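(* Let $\mathcal{E}$ be the $\mathbb{Q}$-algebra of multiple Eisenstein series (the $\mathbb{Q}$-span of $1=G_\varnothing$ and all $G_{k_1,\dots,k_r}$ with $r\ge 1$, $k_1,\dots,k_r\ge 2$, inside the holomorphic functions on $\mathbb{H}$). (i) The assignments, for $r\ge1$ and $k_1,\dots,k_r\ge2$, $$W G_{k_1,\dots,k_r}=(k_1+\cdots+k_r)\,G_{k_1,\dots,k_r},\qquad D G_{k_1,\dots,k_r}=2\pi i\frac{d}{d\tau}G_{k_1,\dots,k_r},$$ $$\delta G_{k_1,\dots,k_r}=\begin{cases}-\frac12 G_{k_2,\dots,k_r}, & k_1=2,\\ 0,& k_1>2,\end{cases}$$ on the generators of $\mathcal{E}$ extend to well-defined derivations $W$, $D$ and $\delta$ on $\mathcal{E}$ (in particular mapping $\mathcal{E}$ to $\mathcal{E}$). (ii) The derivations $W$, $D$ and $\delta$ satisfy $$[W,D]=2D,\qquad [W,\delta]=-2\delta,\qquad [\delta,D]=W .$$ In particular, $\mathcal{E}$ is an $\mathfrak{sl}_2$-algebra. (iii) Put $$\mathcal{E}^{\mathrm{adm}}=\mathbb{Q}\oplus\operatorname{span}_{\mathbb{Q}}\{G_{k_1,\dots,k_r}\mid r\ge1,\ k_1\ge3,\ k_2,\dots,k_r\ge2\}.$$ Then $\mathcal{E}=\mathcal{E}^{\mathrm{adm}}[G_2]$ is a free polynomial algebra over $\mathcal{E}^{\mathrm{adm}}$ (in the variable $G_2$), and $$\delta=-\frac12\frac{\partial}{\partial G_2}.$$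
   Context: $\mathbb{H}$ is the complex upper half-plane. For $r\ge1$ and integers $k_1,\dots,k_r\ge2$ the multiple Eisenstein series is the holomorphic function on $\mathbb{H}$ $$G_{k_1,\dots,k_r}(\tau)=\lim_{M\to\infty}\lim_{N\to\infty}\sum_{\substack{\lambda_1,\dots,\lambda_r\in\mathbb{Z}_M\tau+\mathbb{Z}_N\\ \lambda_1\succ\cdots\succ\lambda_r\succ0}}\frac1{\lambda_1^{k_1}\cdots\lambda_r^{k_r}},$$ where $\mathbb{Z}_M=\{m\in\mathbb{Z}\mid |m|<M\}$ and the total order $\succ$ on $\mathbb{Z}\tau+\mathbb{Z}$ is given by $m_1\tau+n_1\succ m_2\tau+n_2$ iff $m_1>m_2$, or $m_1=m_2$ and $n_1>n_2$. For the empty index, $G_\varnothing=1$. For $k_1\ge3$ the sum converges absolutely. Put $\mathcal{E}=\operatorname{span}_{\mathbb{Q}}\{G_\varnothing, G_{k_1,\dots,k_r}\mid r\ge1,\ k_1,\dots,k_r\ge2\}$; it is a $\mathbb{Q}$-algebra under multiplication of functions, because multiple Eisenstein series multiply by the harmonic (quasi-shuffle) product. An $\mathfrak{sl}_2$-algebra is an algebra with three derivations $W,D,\delta$ satisfying $[W,D]=2D$, $[W,\delta]=-2\delta$, $[\delta,D]=W$. *)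

theory Defs
  imports
    "HOL-Complex_Analysis.Complex_Analysis"
    "HOL-Library.Function_Algebras"
    "HOL-Computational_Algebra.Polynomial"
begin

section \<open>Functions on the upper half-plane\<close>

typedef uhp = "{z :: complex. Im z > 0}"
  morphisms of_uhp Uhp
proof
  show "\<i> \<in> {z :: complex. Im z > 0}" by simp
qed

text \<open>
  The ambient ring is the type \<open>uhp \<Rightarrow> complex\<close> with the pointwise operations, so that its
  unit is the constant function 1 on the upper half-plane.
\<close>

definition holomorphic_uhp :: "(uhp \<Rightarrow> complex) \<Rightarrow> bool" where
  "holomorphic_uhp f \<longleftrightarrow> (f \<circ> Uhp) holomorphic_on {z. Im z > 0}"

text \<open>
  The values of \<open>Uhp\<close> off the upper half-plane do not matter in \<open>ddtau\<close>, because the upper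
  half-plane is open.
\<close>

definition ddtau :: "(uhp \<Rightarrow> complex) \<Rightarrow> uhp \<Rightarrow> complex" where
  "ddtau f = (\<lambda>\<tau>. deriv (f \<circ> Uhp) (of_uhp \<tau>))"

definition scaleQ :: "rat \<Rightarrow> (uhp \<Rightarrow> complex) \<Rightarrow> uhp \<Rightarrow> complex" where
  "scaleQ q f = (\<lambda>\<tau>. of_rat q * f \<tau>)"

global_interpretation Q: vector_space scaleQ
  by unfold_locales (auto simp: scaleQ_def fun_eq_iff algebra_simps of_rat_add of_rat_mult)


section \<open>Multiple Eisenstein series\<close>

text \<open>
  The pair \<open>(m, n)\<close> stands for the lattice point \<open>m \<tau> + n\<close>; for \<open>\<tau>\<close> in the upper half-plane
  this is a bijection onto the lattice, and the order does not depend on \<open>\<tau>\<close>.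
\<close>

fun lat_gt :: "int \<times> int \<Rightarrow> int \<times> int \<Rightarrow> bool" (infix "\<succ>" 50) where
  "(m1, n1) \<succ> (m2, n2) \<longleftrightarrow> m1 > m2 \<or> (m1 = m2 \<and> n1 > n2)"

fun lat_pt :: "uhp \<Rightarrow> int \<times> int \<Rightarrow> complex" where
  "lat_pt \<tau> (m, n) = of_int m * of_uhp \<tau> + of_int n"

definition lat_box :: "nat \<Rightarrow> nat \<Rightarrow> (int \<times> int) set" where
  "lat_box M N = {m. \<bar>m\<bar> < int M} \<times> {n. \<bar>n\<bar> < int N}"

text \<open>Since the order is transitive, the sortedness condition is the chain
  \<open>\<lambda>\<^sub>1 \<succ> \<dots> \<succ> \<lambda>\<^sub>r \<succ> 0\<close>.\<close>

definition lat_chains :: "nat \<Rightarrow> nat \<Rightarrow> nat \<Rightarrow> (int \<times> int) list set" where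
  "lat_chains r M N =
     {ls. length ls = r \<and> set ls \<subseteq> lat_box M N \<and> sorted_wrt (\<succ>) (ls @ [(0, 0)])}"

definition mes_trunc :: "nat list \<Rightarrow> nat \<Rightarrow> nat \<Rightarrow> uhp \<Rightarrow> complex" where
  "mes_trunc ks M N \<tau> =
     (\<Sum>ls \<in> lat_chains (length ks) M N. \<Prod>j<length ks. 1 / lat_pt \<tau> (ls ! j) ^ (ks ! j))"

text \<open>For the empty index the sum has the single term 1, so \<open>G [] = 1\<close>.\<close>

definition G :: "nat list \<Rightarrow> uhp \<Rightarrow> complex" where
  "G ks = (\<lambda>\<tau>. lim (\<lambda>M. lim (\<lambda>N. mes_trunc ks M N \<tau>)))"

definition mes_indices :: "nat list set" where
  "mes_indices = {ks. \<forall>k \<in> set ks. k \<ge> 2}"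

definition adm_indices :: "nat list set" where
  "adm_indices = {ks \<in> mes_indices. ks \<noteq> [] \<and> hd ks \<ge> 3}"

definition MES :: "(uhp \<Rightarrow> complex) set" where
  "MES = Q.span (G ` mes_indices)"

text \<open>The sum in \<open>MES_adm\<close> is meant to be direct, which is a claim and not part of this
  definition.\<close>

definition MES_adm :: "(uhp \<Rightarrow> complex) set" where
  "MES_adm = {c + f | c f. c \<in> Q.span {1} \<and> f \<in> Q.span (G ` adm_indices)}"


section \<open>Subalgebras, derivations and polynomial algebras\<close>

definition rat_subalgebra :: "(uhp \<Rightarrow> complex) set \<Rightarrow> bool" where
  "rat_subalgebra A \<longleftrightarrow> Q.subspace A \<and> 1 \<in> A \<and> (\<forall>f\<in>A. \<forall>g\<in>A. f * g \<in> A)"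

text \<open>Operators are total functions on the ambient ring; only their values on \<open>A\<close> matter.\<close>

type_synonym operator = "(uhp \<Rightarrow> complex) \<Rightarrow> uhp \<Rightarrow> complex"

definition derivation_on :: "(uhp \<Rightarrow> complex) set \<Rightarrow> operator \<Rightarrow> bool" where
  "derivation_on A d \<longleftrightarrow>
     (\<forall>f\<in>A. d f \<in> A) \<and>
     (\<forall>f\<in>A. \<forall>g\<in>A. d (f + g) = d f + d g) \<and>
     (\<forall>q. \<forall>f\<in>A. d (scaleQ q f) = scaleQ q (d f)) \<and>
     (\<forall>f\<in>A. \<forall>g\<in>A. d (f * g) = d f * g + f * d g)"

definition bracket :: "operator \<Rightarrow> operator \<Rightarrow> operator" where
  "bracket X Y = (\<lambda>f. X (Y f) - Y (X f))"

definition sl2_algebra ::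
    "(uhp \<Rightarrow> complex) set \<Rightarrow> operator \<Rightarrow> operator \<Rightarrow> operator \<Rightarrow> bool" where
  "sl2_algebra A W D \<delta> \<longleftrightarrow>
     rat_subalgebra A \<and> derivation_on A W \<and> derivation_on A D \<and> derivation_on A \<delta> \<and>
     (\<forall>f\<in>A. bracket W D f = scaleQ 2 (D f)) \<and>
     (\<forall>f\<in>A. bracket W \<delta> f = scaleQ (-2) (\<delta> f)) \<and>
     (\<forall>f\<in>A. bracket \<delta> D f = W f)"

definition polys_over :: "'a::zero set \<Rightarrow> 'a poly set" where
  "polys_over A = {p. \<forall>i. coeff p i \<in> A}"

text \<open>For a subalgebra \<open>A\<close>, evaluation at \<open>x\<close> is a ring homomorphism from the polynomials over
  \<open>A\<close>; it is injective iff \<open>x\<close> is transcendental over \<open>A\<close>.\<close>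

definition free_poly_algebra ::
    "(uhp \<Rightarrow> complex) set \<Rightarrow> (uhp \<Rightarrow> complex) set \<Rightarrow> (uhp \<Rightarrow> complex) \<Rightarrow> bool" where
  "free_poly_algebra B A x \<longleftrightarrow>
     rat_subalgebra A \<and> bij_betw (\<lambda>p. poly p x) (polys_over A) B"

text \<open>\<open>pderiv\<close> is not available here, because the ring of all functions has zero divisors.\<close>

definition formal_deriv :: "'a::comm_semiring_1 poly \<Rightarrow> 'a poly" where
  "formal_deriv p = (\<Sum>i\<le>degree p. monom (of_nat i * coeff p i) (i - 1))"

end

theory Submission imports Defs "HOL-Real_Asymp.Real_Asymp" begin

text \<open>
The derivative of a truncated sum is rewritten by partial fractions as a rational combination of
truncated sums, up to boundary terms that vanish in the limit; hence the derivative of a multiple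
Eisenstein series is a rational combination of multiple Eisenstein series.

For \<open>x = 2 e + 1 - t\<close> the lattices at \<open>1 / x\<close> and at \<open>t\<close> agree up to the factor \<open>x\<close>, but they are
ordered differently. Comparing the two orders shows, for \<open>G\<close> of weight \<open>k\<close> and \<open>e\<close> tending to infinity,
that \<open>G (1 / x) / x ^ k\<close> tends to \<open>G t\<close> and that \<open>x * (G (1 / x) / x ^ k - G t)\<close> tends to
\<open>- 2 * pi * i * \<delta> G t\<close>. So \<open>\<delta>\<close> is determined by the function, linear relations are homogeneous in the
weight, and differentiating the expansion in \<open>t\<close> gives the commutator of \<open>\<delta>\<close> and \<open>D\<close>.

The harmonic product of \<open>G [2]\<close> with a series whose index starts with \<open>n\<close> twos has leading coefficient
\<open>n + 1\<close>, which makes \<open>G [2]\<close> a generator over the admissible part; applying \<open>\<delta>\<close> to a relation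
lowers its degree, so there is none.
\<close>

section \<open>Chain sums over finite ordered sets\<close>

fun csum :: "('a => 'a => bool) => ('a => complex) => 'a set => nat list => complex" where
 "csum R z F [] = 1"
| "csum R z F (k # ks) = (\<Sum>x\<in>F. csum R z {y \<in> F. R x y} ks / z x ^ k)"

fun qsh :: "nat list => nat list => nat list list" where
 "qsh [] v = [v]"
| "qsh (a # u) [] = [a # u]"
| "qsh (a # u) (b # v) =
  map ((#) a) (qsh u (b # v)) @ map ((#) b) (qsh (a # u) v) @ map ((#) (a + b)) (qsh u v)"

lemma qsh_Nil2 [simp]: "qsh u [] = [u]"
 by (cases u) auto

lemma sum_list_Cons_csum:
 "(\<Sum>w\<leftarrow>ws. csum R z F (a # w)) = (\<Sum>x\<in>F. (\<Sum>w\<leftarrow>ws. csum R z {y\<in>F. R x y} w) / z x ^ a)"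
 by (induction ws) (simp_all add: sum.distrib add_divide_distrib)

locale chain_order =
 fixes R :: "'a => 'a => bool"
 assumes irrefl: "\<not> R x x"
  and trans: "R x y ==> R y w ==> R x w"
  and total: "x \<noteq> y ==> R x y \<or> R y x"
begin

lemma asym: "R x y ==> \<not> R y x"
 using irrefl trans by blast

lemma sum_sum_split:
 fixes f :: "'a => 'a => complex"
 assumes "finite F"
 shows "(\<Sum>x\<in>F. \<Sum>y\<in>F. f x y) =
  (\<Sum>x\<in>F. \<Sum>y\<in>{y\<in>F. R x y}. f x y) + (\<Sum>y\<in>F. \<Sum>x\<in>{x\<in>F. R y x}. f x y) + (\<Sum>x\<in>F. f x x)"
proof -
 have "(\<Sum>y\<in>F. f x y) = (\<Sum>y\<in>{y\<in>F. R x y}. f x y) + (\<Sum>y\<in>{y\<in>F. R y x}. f x y) + f x x"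
  if "x \<in> F" for x
 proof -
  have F: "F = {y\<in>F. R x y} \<union> {y\<in>F. R y x} \<union> {x}"
   using that total by blast
  have "(\<Sum>y\<in>F. f x y) = (\<Sum>y\<in>{y\<in>F. R x y} \<union> {y\<in>F. R y x} \<union> {x}. f x y)"
   using F by simp
  also have "... = (\<Sum>y\<in>{y\<in>F. R x y} \<union> {y\<in>F. R y x}. f x y) + f x x"
   using assms irrefl by (subst sum.union_disjoint) auto
  also have "(\<Sum>y\<in>{y\<in>F. R x y} \<union> {y\<in>F. R y x}. f x y)
    = (\<Sum>y\<in>{y\<in>F. R x y}. f x y) + (\<Sum>y\<in>{y\<in>F. R y x}. f x y)"
   using assms asym by (subst sum.union_disjoint) auto
  finally show ?thesis .
 qed
 then have "(\<Sum>x\<in>F. \<Sum>y\<in>F. f x y) = (\<Sum>x\<in>F. \<Sum>y\<in>{y\<in>F. R x y}. f x y)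
  + (\<Sum>x\<in>F. \<Sum>y\<in>{y\<in>F. R y x}. f x y) + (\<Sum>x\<in>F. f x x)"
  by (simp add: sum.distrib)
 moreover have "(\<Sum>x\<in>F. \<Sum>y\<in>{y\<in>F. R y x}. f x y) = (\<Sum>y\<in>F. \<Sum>x\<in>{x\<in>F. R y x}. f x y)"
  using assms assms by (rule sum.swap_restrict)
 ultimately show ?thesis by simp
qed

lemma below_below: "R x y ==> {w \<in> F. R x w \<and> R y w} = {w \<in> F. R y w}"
 using trans by blast

lemma csum_mult:
 "finite F ==> csum R z F u * csum R z F v = (\<Sum>w\<leftarrow>qsh u v. csum R z F w)"
proof (induction u v arbitrary: F rule: qsh.induct)
 case (3 a u b v)
 let ?L = "%x. {y\<in>F. R x y}"
 have fin: "finite (?L x)" for x using 3 by simp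
 have "csum R z F (a # u) * csum R z F (b # v)
   = (\<Sum>x\<in>F. \<Sum>y\<in>F. (csum R z (?L x) u / z x ^ a) * (csum R z (?L y) v / z y ^ b))"
  by (simp add: sum_product)
 also have "... = (\<Sum>x\<in>F. \<Sum>y\<in>?L x. (csum R z (?L x) u / z x ^ a) * (csum R z (?L y) v / z y ^ b))
  + (\<Sum>y\<in>F. \<Sum>x\<in>?L y. (csum R z (?L x) u / z x ^ a) * (csum R z (?L y) v / z y ^ b))
  + (\<Sum>x\<in>F. (csum R z (?L x) u / z x ^ a) * (csum R z (?L x) v / z x ^ b))"
  by (rule sum_sum_split) fact
 also have "(\<Sum>x\<in>F. \<Sum>y\<in>?L x. (csum R z (?L x) u / z x ^ a) * (csum R z (?L y) v / z y ^ b))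
  = (\<Sum>x\<in>F. (csum R z (?L x) u * csum R z (?L x) (b # v)) / z x ^ a)"
 proof (rule sum.cong[OF refl])
  fix x
  have "csum R z (?L x) (b # v) = (\<Sum>y\<in>?L x. csum R z (?L y) v / z y ^ b)"
   unfolding csum.simps by (intro sum.cong refl) (simp add: below_below)
  then show "(\<Sum>y\<in>?L x. (csum R z (?L x) u / z x ^ a) * (csum R z (?L y) v / z y ^ b))
   = (csum R z (?L x) u * csum R z (?L x) (b # v)) / z x ^ a"
   by (simp add: sum_distrib_left sum_divide_distrib mult_ac del: csum.simps)
 qed
 also have "(\<Sum>y\<in>F. \<Sum>x\<in>?L y. (csum R z (?L x) u / z x ^ a) * (csum R z (?L y) v / z y ^ b))
  = (\<Sum>y\<in>F. (csum R z (?L y) (a # u) * csum R z (?L y) v) / z y ^ b)"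
 proof (rule sum.cong[OF refl])
  fix y
  have e: "csum R z (?L y) (a # u) = (\<Sum>x\<in>?L y. csum R z (?L x) u / z x ^ a)"
   unfolding csum.simps by (intro sum.cong refl) (simp add: below_below)
  show "(\<Sum>x\<in>?L y. (csum R z (?L x) u / z x ^ a) * (csum R z (?L y) v / z y ^ b))
   = (csum R z (?L y) (a # u) * csum R z (?L y) v) / z y ^ b"
   unfolding e by (simp add: sum_distrib_right sum_distrib_left sum_divide_distrib mult_ac del: csum.simps)
 qed
 also have "(\<Sum>x\<in>F. (csum R z (?L x) u / z x ^ a) * (csum R z (?L x) v / z x ^ b))
  = (\<Sum>x\<in>F. (csum R z (?L x) u * csum R z (?L x) v) / z x ^ (a + b))"
  by (simp add: power_add)
 finally show ?case
  by (simp add: comp_def sum_list_Cons_csum 3(1)[OF fin] 3(2)[OF fin] 3(3)[OF fin] add.assoc del: csum.simps)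
qed simp_all

lemma csum_Un:
 assumes "finite F1" "finite F2" "!!x y. x \<in> F1 ==> y \<in> F2 ==> R x y"
 shows "csum R z (F1 \<union> F2) w
  = (\<Sum>i\<le>length w. csum R z F1 (take i w) * csum R z F2 (drop i w))"
 using assms
proof (induction w arbitrary: F1)
 case (Cons k ks)
 have disj: "F1 \<inter> F2 = {}" using Cons.prems(3) irrefl by blast
 have 1: "{y \<in> F1 \<union> F2. R x y} = {y\<in>F1. R x y} \<union> F2" if "x \<in> F1" for x
  using Cons.prems(3) that by blast
 have 2: "{y \<in> F1 \<union> F2. R x y} = {y\<in>F2. R x y}" if "x \<in> F2" for x
  using Cons.prems(3) that asym by blast
 have "csum R z (F1 \<union> F2) (k # ks) = (\<Sum>x\<in>F1. csum R z {y \<in> F1 \<union> F2. R x y} ks / z x ^ k)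
   + (\<Sum>x\<in>F2. csum R z {y \<in> F1 \<union> F2. R x y} ks / z x ^ k)"
  using disj Cons.prems by (simp add: sum.union_disjoint)
 also have "(\<Sum>x\<in>F1. csum R z {y \<in> F1 \<union> F2. R x y} ks / z x ^ k)
   = (\<Sum>x\<in>F1. (\<Sum>i\<le>length ks. csum R z {y\<in>F1. R x y} (take i ks) * csum R z F2 (drop i ks)) / z x ^ k)"
  using Cons.prems by (intro sum.cong refl) (subst 1, assumption, subst Cons.IH, auto)
 also have "... = (\<Sum>i\<le>length ks. csum R z F1 (k # take i ks) * csum R z F2 (drop i ks))"
  by (simp add: sum_divide_distrib sum_distrib_right) (subst sum.swap, simp)
 also have "(\<Sum>x\<in>F2. csum R z {y \<in> F1 \<union> F2. R x y} ks / z x ^ k) = csum R z F2 (k # ks)"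
  unfolding csum.simps by (intro sum.cong refl) (simp only: 2)
 also have "(\<Sum>i\<le>length ks. csum R z F1 (k # take i ks) * csum R z F2 (drop i ks)) + csum R z F2 (k # ks)
  = (\<Sum>i\<le>length (k # ks). csum R z F1 (take i (k # ks)) * csum R z F2 (drop i (k # ks)))"
  unfolding length_Cons by (subst sum.atMost_Suc_shift) simp
 finally show ?case .
qed simp

lemma csum_append_Cons:
 "finite F ==> csum R z F (u @ k # ks)
  = (\<Sum>x\<in>F. csum R z {y\<in>F. R y x} u * csum R z {y\<in>F. R x y} ks / z x ^ k)"
proof (induction u arbitrary: F)
 case (Cons a u)
 let ?A = "%x y. csum R z {w\<in>F. R x w \<and> R w y} u * csum R z {w\<in>F. R y w} ks / (z y ^ k * z x ^ a)"
 have 1: "csum R z {y\<in>F. R x y} (u @ k # ks) / z x ^ a = (\<Sum>y\<in>{y\<in>F. R x y}. ?A x y)" for x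
 proof -
  have e: "{w \<in> {w \<in> F. R x w}. R w y} = {w\<in>F. R x w \<and> R w y}" for y by blast
  show ?thesis
   using Cons.prems
   by (subst Cons.IH) (auto simp: sum_divide_distrib e below_below intro!: sum.cong)
 qed
 have 2: "(\<Sum>x\<in>{x\<in>F. R x y}. ?A x y)
  = csum R z {x\<in>F. R x y} (a # u) * csum R z {w\<in>F. R y w} ks / z y ^ k" for y
 proof -
  have e: "{w \<in> F. R w y \<and> R x w} = {w\<in>F. R x w \<and> R w y}" for x by blast
  show ?thesis by (simp add: sum_divide_distrib sum_distrib_right sum_distrib_left e mult_ac)
 qed
 have "csum R z F ((a # u) @ k # ks) = (\<Sum>x\<in>F. \<Sum>y\<in>{y\<in>F. R x y}. ?A x y)"
  by (simp add: 1)
 also have "... = (\<Sum>y\<in>F. \<Sum>x\<in>{x\<in>F. R x y}. ?A x y)"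
  using Cons.prems Cons.prems by (rule sum.swap_restrict)
 finally show ?case by (simp only: 2)
qed simp

lemma csum_insert_top:
 assumes "finite F" "!!y. y \<in> F ==> R x y"
 shows "csum R z (insert x F) (k # ks) = csum R z F ks / z x ^ k + csum R z F (k # ks)"
proof -
 have x: "x \<notin> F" using assms irrefl by blast
 have 1: "{y. (y = x \<or> y \<in> F) \<and> R x y} = F" using assms irrefl by blast
 have 2: "{y. (y = x \<or> y \<in> F) \<and> R w y} = {y\<in>F. R w y}" if "w \<in> F" for w
  using assms asym that by blast
 show ?thesis using assms x by (simp add: 1 2)
qed

lemma csum_upper:
 assumes "finite F" "x \<in> F"
 shows "csum R z {y\<in>F. R y x} u = csum R z F u
  - (\<Sum>i<length u. csum R z {y\<in>F. R y x} (take i u) *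
    (csum R z {y\<in>F. R x y} (drop (Suc i) u) / z x ^ (u ! i) + csum R z {y\<in>F. R x y} (drop i u)))"
proof -
 let ?U = "{y\<in>F. R y x}" and ?L = "{y\<in>F. R x y}"
 have F: "F = ?U \<union> insert x ?L" using assms total by blast
 have "csum R z F u = csum R z (?U \<union> insert x ?L) u" using F by simp
 also have "... = (\<Sum>i\<le>length u. csum R z ?U (take i u) * csum R z (insert x ?L) (drop i u))"
  using assms trans by (intro csum_Un) auto
 also have "... = csum R z ?U u + (\<Sum>i<length u. csum R z ?U (take i u) * csum R z (insert x ?L) (drop i u))"
  by (simp add: lessThan_Suc_atMost[symmetric])
 also have "(\<Sum>i<length u. csum R z ?U (take i u) * csum R z (insert x ?L) (drop i u))
  = (\<Sum>i<length u. csum R z ?U (take i u) *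
    (csum R z ?L (drop (Suc i) u) / z x ^ (u ! i) + csum R z ?L (drop i u)))"
 proof (rule sum.cong[OF refl])
  fix i assume "i \<in> {..<length u}"
  then have d: "drop i u = u ! i # drop (Suc i) u" by (simp add: Cons_nth_drop_Suc)
  have "csum R z (insert x ?L) (u ! i # drop (Suc i) u)
   = csum R z ?L (drop (Suc i) u) / z x ^ (u ! i) + csum R z ?L (u ! i # drop (Suc i) u)"
   using assms by (intro csum_insert_top) auto
  then show "csum R z ?U (take i u) * csum R z (insert x ?L) (drop i u)
   = csum R z ?U (take i u) * (csum R z ?L (drop (Suc i) u) / z x ^ (u ! i) + csum R z ?L (drop i u))"
   by (simp only: d)
 qed
 finally show ?thesis by simp
qed

end

lemma csum_transport:
 assumes "bij_betw h F F'" "!!x y. x \<in> F ==> y \<in> F ==> R' (h x) (h y) = R x y"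
  "!!x. x \<in> F ==> z' (h x) = z x"
 shows "csum R' z' F' ks = csum R z F ks"
 using assms
proof (induction ks arbitrary: F F')
 case (Cons k ks)
 have "csum R' z' {y\<in>F'. R' (h x) y} ks = csum R z {y\<in>F. R x y} ks" if "x \<in> F" for x
 proof (rule Cons.IH)
  show "bij_betw h {y\<in>F. R x y} {y\<in>F'. R' (h x) y}"
   using Cons.prems(1,2) that unfolding bij_betw_def inj_on_def by (auto simp: image_iff)
 qed (use Cons.prems in auto)
 then show ?case
  using Cons.prems by (simp add: sum.reindex_bij_betw[symmetric])
qed simp

lemma csum_scale: "csum R (%x. c * z x) F ks = csum R z F ks / c ^ sum_list ks"
 by (induction ks arbitrary: F) (simp_all add: power_mult_distrib power_add sum_divide_distrib mult_ac)

lemma csum_bound: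
 fixes b :: "nat => real"
 assumes "finite F" "!!k. k \<in> set ks ==> (\<Sum>x\<in>F. norm (1 / z x ^ k)) \<le> b k"
 shows "norm (csum R z F ks) \<le> (\<Prod>k\<leftarrow>ks. b k)"
 using assms
proof (induction ks arbitrary: F)
 case (Cons k ks)
 have sub: "(\<Sum>x\<in>F'. norm (1 / z x ^ j)) \<le> b j" if "F' \<subseteq> F" "j \<in> set (k # ks)" for F' j
  by (rule order_trans[OF sum_mono2[OF Cons.prems(1) that(1)] Cons.prems(2)[OF that(2)]]) simp
 have IH: "norm (csum R z {y\<in>F. R x y} ks) \<le> (\<Prod>k\<leftarrow>ks. b k)" for x
  by (rule Cons.IH) (use sub Cons.prems in auto)
 have b0: "0 \<le> (\<Prod>k\<leftarrow>ks. b k)"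
  using IH norm_ge_zero order_trans by blast
 have "norm (csum R z F (k # ks)) \<le> (\<Sum>x\<in>F. (\<Prod>k\<leftarrow>ks. b k) * norm (1 / z x ^ k))"
  unfolding csum.simps
 proof (rule sum_norm_le)
  fix x
  have "norm (csum R z {y\<in>F. R x y} ks / z x ^ k) = norm (csum R z {y\<in>F. R x y} ks) * norm (1 / z x ^ k)"
   by (simp add: norm_divide)
  also have "... \<le> (\<Prod>k\<leftarrow>ks. b k) * norm (1 / z x ^ k)"
   by (intro mult_right_mono IH) simp
  finally show "norm (csum R z {y\<in>F. R x y} ks / z x ^ k) \<le> (\<Prod>k\<leftarrow>ks. b k) * norm (1 / z x ^ k)" .
 qed
 also have "... = (\<Prod>k\<leftarrow>ks. b k) * (\<Sum>x\<in>F. norm (1 / z x ^ k))"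
  by (simp add: sum_distrib_left)
 also have "... \<le> (\<Prod>k\<leftarrow>ks. b k) * b k"
  using sub[of F k] b0 by (intro mult_left_mono) auto
 finally show ?case by (simp add: mult.commute)
qed simp

lemma csum_bound_power:
 fixes S :: real
 assumes "finite F" "!!k. k \<in> set ks ==> (\<Sum>x\<in>F. norm (1 / z x ^ k)) \<le> S"
 shows "norm (csum R z F ks) \<le> S ^ length ks"
 using csum_bound[of F ks z "%_. S" R] assms by (simp add: map_replicate_const prod_list_replicate)

lemma csum_diff_bound:
 fixes S \<epsilon> :: real
 assumes "finite F'" "F \<subseteq> F'" "1 \<le> S"
  "!!k. k \<in> set ks ==> (\<Sum>x\<in>F'. norm (1 / z x ^ k)) \<le> S"
  "!!k. k \<in> set ks ==> (\<Sum>x\<in>F'-F. norm (1 / z x ^ k)) \<le> \<epsilon>"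
 shows "norm (csum R z F' ks - csum R z F ks) \<le> length ks * S ^ length ks * \<epsilon>"
 using assms
proof (induction ks arbitrary: F F')
 case (Cons k ks)
 let ?n = "%x j. norm (1 / z x ^ j)"
 have finF: "finite F" using Cons.prems finite_subset by blast
 have sub: "(\<Sum>x\<in>A. ?n x j) \<le> (\<Sum>x\<in>B. ?n x j)" if "A \<subseteq> B" "finite B" for A B j
  by (rule sum_mono2) (use that in auto)
 have "0 \<le> (\<Sum>x\<in>F'-F. ?n x k)" by (rule sum_nonneg) simp
 also have "... \<le> \<epsilon>" by (rule Cons.prems(5)) simp
 finally have e0: "0 \<le> \<epsilon>" .
 have B1: "norm (csum R z {y\<in>F'. R x y} ks) \<le> S ^ length ks" for x
 proof (rule csum_bound_power)
  fix j assume "j \<in> set ks"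
  then show "(\<Sum>x\<in>{y\<in>F'. R x y}. ?n x j) \<le> S"
   using sub[of "{y\<in>F'. R x y}" F' j] Cons.prems(1) Cons.prems(4)[of j] by force
 qed (use Cons.prems in auto)
 have B2: "norm (csum R z {y\<in>F'. R x y} ks - csum R z {y\<in>F. R x y} ks) \<le> length ks * S ^ length ks * \<epsilon>" for x
 proof (rule Cons.IH)
  show "(\<Sum>x\<in>{y\<in>F'. R x y}. ?n x j) \<le> S" if "j \<in> set ks" for j
   using sub[of "{y\<in>F'. R x y}" F' j] Cons.prems(1) Cons.prems(4)[of j] that by force
  show "(\<Sum>x\<in>{y\<in>F'. R x y} - {y\<in>F. R x y}. ?n x j) \<le> \<epsilon>" if "j \<in> set ks" for j
   using sub[of "{y\<in>F'. R x y} - {y\<in>F. R x y}" "F' - F" j] Cons.prems(1) Cons.prems(5)[of j] that by force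
 qed (use Cons.prems in auto)
 have "csum R z F' (k # ks) - csum R z F (k # ks)
  = (\<Sum>x\<in>F'-F. csum R z {y\<in>F'. R x y} ks / z x ^ k)
  + (\<Sum>x\<in>F. (csum R z {y\<in>F'. R x y} ks - csum R z {y\<in>F. R x y} ks) / z x ^ k)"
  using sum.subset_diff[OF Cons.prems(2,1), of "%x. csum R z {y\<in>F'. R x y} ks / z x ^ k"]
  by (simp add: diff_divide_distrib sum_subtractf)
 also have "norm ... \<le> (\<Sum>x\<in>F'-F. S ^ length ks * ?n x k)
  + (\<Sum>x\<in>F. (length ks * S ^ length ks * \<epsilon>) * ?n x k)"
 proof (rule norm_triangle_le, rule add_mono; rule sum_norm_le)
  fix x
  show "norm (csum R z {y\<in>F'. R x y} ks / z x ^ k) \<le> S ^ length ks * ?n x k"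
   using mult_right_mono[OF B1[of x], of "?n x k"] by (simp add: norm_divide)
  show "norm ((csum R z {y\<in>F'. R x y} ks - csum R z {y\<in>F. R x y} ks) / z x ^ k)
   \<le> (length ks * S ^ length ks * \<epsilon>) * ?n x k"
   using mult_right_mono[OF B2[of x], of "?n x k"] by (simp add: norm_divide)
 qed
 also have "... = S ^ length ks * (\<Sum>x\<in>F'-F. ?n x k) + (length ks * S ^ length ks * \<epsilon>) * (\<Sum>x\<in>F. ?n x k)"
  by (simp add: sum_distrib_left)
 also have "... \<le> S ^ length ks * \<epsilon> + (length ks * S ^ length ks * \<epsilon>) * S"
  using Cons.prems(3) Cons.prems(5)[of k] Cons.prems(4)[of k] sub[OF Cons.prems(2,1), of k] e0
  by (intro add_mono mult_left_mono) auto
 also have "... \<le> S ^ Suc (length ks) * \<epsilon> + (length ks * S ^ length ks * \<epsilon>) * S"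
  using Cons.prems(3) e0 by (intro add_right_mono mult_right_mono power_increasing) auto
 also have "... = length (k # ks) * S ^ length (k # ks) * \<epsilon>"
  by (simp add: algebra_simps)
 finally show ?case .
qed simp

lemma csum_eq_sum_lists:
 assumes "finite F"
 shows "csum R z F ks = (\<Sum>ls\<in>{ls. length ls = length ks \<and> set ls \<subseteq> F \<and> sorted_wrt R ls}.
   \<Prod>j<length ks. 1 / z (ls ! j) ^ (ks ! j))"
 using assms
proof (induction ks arbitrary: F)
 case Nil
 have "{ls :: 'a list. length ls = length ([] :: nat list) \<and> set ls \<subseteq> F \<and> sorted_wrt R ls} = {[]}" by auto
 then show ?case by simp
next
 case (Cons k ks)
 let ?C = "%F. {ls. length ls = length ks \<and> set ls \<subseteq> F \<and> sorted_wrt R ls}"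
 have fin: "finite (?C F)" if "finite F" for F :: "'a set"
  by (rule finite_subset[OF _ finite_lists_length_eq[where n = "length ks", OF that]]) auto
 have eq: "{ls. length ls = length (k # ks) \<and> set ls \<subseteq> F \<and> sorted_wrt R ls}
  = (%(x, l). x # l) ` (SIGMA x:F. ?C {y\<in>F. R x y})"
  by (auto simp: length_Suc_conv image_iff)
 have inj: "inj_on (%(x, l). x # l) (SIGMA x:F. ?C {y\<in>F. R x y})"
  by (auto simp: inj_on_def)
 have "(\<Sum>ls\<in>{ls. length ls = length (k # ks) \<and> set ls \<subseteq> F \<and> sorted_wrt R ls}.
   \<Prod>j<length (k # ks). 1 / z (ls ! j) ^ ((k # ks) ! j))
  = (\<Sum>(x, l)\<in>(SIGMA x:F. ?C {y\<in>F. R x y}). (\<Prod>j<length ks. 1 / z (l ! j) ^ (ks ! j)) / z x ^ k)"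
  unfolding eq sum.reindex[OF inj]
  by (intro sum.cong refl)
   (auto simp: prod.lessThan_Suc_shift simp del: prod.lessThan_Suc)
 also have "... = (\<Sum>x\<in>F. \<Sum>l\<in>?C {y\<in>F. R x y}. (\<Prod>j<length ks. 1 / z (l ! j) ^ (ks ! j)) / z x ^ k)"
  using Cons.prems by (intro sum.Sigma[symmetric]) (auto intro!: fin)
 also have "... = csum R z F (k # ks)"
  using Cons.prems by (simp add: Cons.IH sum_divide_distrib)
 finally show ?case by simp
qed

section \<open>Lattice boxes\<close>

interpretation lat: chain_order lat_gt
 by unfold_locales auto

definition posbox :: "nat => nat => (int \<times> int) set" where
 "posbox M N = {p \<in> lat_box M N. p \<succ> (0, 0)}"

definition lval :: "complex => int \<times> int => complex" where
 "lval t p = of_int (fst p) * t + of_int (snd p)"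

definition wrd :: "nat list => nat => nat => complex => complex" where
 "wrd ks M N t = csum (\<succ>) (lval t) (posbox M N) ks"

lemma finite_lat_box [simp]: "finite (lat_box M N)"
proof -
 have "{m::int. \<bar>m\<bar> < int M} = {- int M<..<int M}" for M by auto
 then show ?thesis by (simp add: lat_box_def)
qed

lemma finite_posbox [simp]: "finite (posbox M N)"
 by (simp add: posbox_def)

lemma mes_trunc_eq_wrd: "mes_trunc ks M N \<tau> = wrd ks M N (of_uhp \<tau>)"
proof -
 have 1: "lat_chains (length ks) M N
  = {ls. length ls = length ks \<and> set ls \<subseteq> posbox M N \<and> sorted_wrt (\<succ>) ls}"
  by (auto simp: lat_chains_def posbox_def sorted_wrt_append)
 have 2: "lat_pt \<tau> p = lval (of_uhp \<tau>) p" for p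
  by (cases p) (simp add: lval_def)
 show ?thesis
  unfolding mes_trunc_def wrd_def 1 2 by (rule csum_eq_sum_lists[symmetric]) simp
qed

lemma wrd_mult: "wrd u M N t * wrd v M N t = (\<Sum>w\<leftarrow>qsh u v. wrd w M N t)"
 unfolding wrd_def by (rule lat.csum_mult) simp

section \<open>Convergence of the truncated sums\<close>

definition KA :: "real => complex set" where
 "KA A = {t. norm t < A \<and> 1 / A < Im t}"

definition KK :: "real => real" where "KK A = 1 + A\<^sup>2"

lemma open_KA: "open (KA A)"
 unfolding KA_def by (intro open_Collect_conj open_Collect_less continuous_intros)

lemma KA_pos: "1 \<le> A ==> t \<in> KA A ==> 0 < Im t"
 unfolding KA_def by (auto intro: less_trans[of 0 "1 / A"])

lemma KK_ge1: "1 \<le> KK A" by (simp add: KK_def)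

lemma ex_KA:
 assumes "0 < Im t" shows "\<exists>A\<ge>1. t \<in> KA A"
proof -
 let ?A = "1 + norm t + 1 / Im t"
 have "1 / ?A < Im t"
  using assms by (simp add: field_simps add_pos_nonneg)
 moreover have "norm t < ?A" "1 \<le> ?A" using assms by (auto intro: add_pos_pos)
 ultimately show ?thesis unfolding KA_def by blast
qed

lemma real_lattice_lower:
 assumes "1 \<le> A" "t \<in> KA A"
 shows "max \<bar>a\<bar> \<bar>b\<bar> \<le> KK A * norm (of_real a * t + of_real b :: complex)"
proof -
 let ?w = "of_real a * t + of_real b :: complex"
 have i: "1 / A < Im t" "norm t < A" using assms by (auto simp: KA_def)
 have "Im ?w = a * Im t" by simp
 then have "\<bar>a\<bar> * Im t \<le> norm ?w"
  using abs_Im_le_cmod[of ?w] i KA_pos[OF assms] by (simp add: abs_mult)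
 moreover have "\<bar>a\<bar> * (1 / A) \<le> \<bar>a\<bar> * Im t" using i by (intro mult_left_mono) auto
 ultimately have "\<bar>a\<bar> * (1 / A) \<le> norm ?w" by linarith
 then have a: "\<bar>a\<bar> \<le> A * norm ?w" using assms(1) by (simp add: field_simps)
 have "norm (of_real b :: complex) \<le> norm ?w + norm (of_real a * t)"
  by (metis add_diff_cancel_left' norm_triangle_ineq4)
 also have "norm (of_real a * t) = \<bar>a\<bar> * norm t" by (simp add: norm_mult)
 also have "... \<le> (A * norm ?w) * A" using a i assms by (intro mult_mono) auto
 finally have b: "\<bar>b\<bar> \<le> KK A * norm ?w" by (simp add: KK_def algebra_simps power2_eq_square)
 have "A \<le> KK A" using assms(1) unfolding KK_def
  by (smt (verit) power2_eq_square mult_left_le mult_le_cancel_left1)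
 then have "A * norm ?w \<le> KK A * norm ?w" by (rule mult_right_mono) simp
 then show ?thesis using a b by simp
qed

lemma lval_lower:
 assumes "1 \<le> A" "t \<in> KA A"
 shows "max \<bar>real_of_int m\<bar> \<bar>real_of_int n\<bar> \<le> KK A * norm (lval t (m, n))"
 using real_lattice_lower[OF assms, of "real_of_int m" "real_of_int n"] by (simp add: lval_def)

definition mx :: "int => int => real" where
 "mx m n = max (max 1 (real_of_int m)) \<bar>real_of_int n\<bar>"

lemma mx_ge1: "1 \<le> mx m n" by (simp add: mx_def)

lemma lval_lower_mx:
 assumes "1 \<le> A" "t \<in> KA A" "(m, n) \<noteq> (0, 0)"
 shows "mx m n \<le> KK A * norm (lval t (m, n))"
proof -
 have "mx m n \<le> max \<bar>real_of_int m\<bar> \<bar>real_of_int n\<bar>"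
  using assms(3) unfolding mx_def by (cases "m = 0") auto
 then show ?thesis using lval_lower[OF assms(1,2), of m n] by linarith
qed

lemma lval_nz:
 assumes "0 < Im t" "p \<noteq> (0, 0)" shows "lval t p \<noteq> 0"
proof -
 obtain A where A: "1 \<le> A" "t \<in> KA A" using ex_KA[OF assms(1)] by blast
 obtain m n where "p = (m, n)" by (cases p)
 then show ?thesis using lval_lower_mx[OF A, of m n] mx_ge1[of m n] assms(2) by auto
qed

lemma norm_inv_lval:
 assumes "1 \<le> A" "t \<in> KA A" "(m, n) \<noteq> (0, 0)"
 shows "norm (1 / lval t (m, n) ^ k) \<le> KK A ^ k / mx m n ^ k"
proof -
 have "0 < lval t (m, n) \<or> norm (lval t (m, n)) > 0"
  using lval_nz KA_pos[OF assms(1,2)] assms(3) by (simp add: zero_less_norm_iff)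
 then have p: "0 < norm (lval t (m, n))" using lval_nz KA_pos[OF assms(1,2)] assms(3) by simp
 have "1 / norm (lval t (m, n)) \<le> KK A / mx m n"
  using lval_lower_mx[OF assms] p mx_ge1[of m n] by (simp add: field_simps)
 then have "(1 / norm (lval t (m, n))) ^ k \<le> (KK A / mx m n) ^ k"
  by (intro power_mono) auto
 then show ?thesis by (simp add: norm_divide norm_power power_divide)
qed

lemma inv_sq_telescope:
 assumes "0 < real L" shows "1 / (real (Suc L))\<^sup>2 \<le> 1 / L - 1 / Suc L"
proof -
 have "1 / (real (Suc L))\<^sup>2 \<le> 1 / (real L * real (Suc L))"
  using assms by (intro divide_left_mono) (auto simp: power2_eq_square)
 also have "... = 1 / L - 1 / Suc L" using assms by (simp add: field_simps)
 finally show ?thesis .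
qed

lemma sum_inv_sq_max:
 assumes "(1::real) \<le> m"
 shows "(\<Sum>n=1..L. 1 / (max m (real n))\<^sup>2) \<le> (if real L \<le> m then L / m\<^sup>2 else 2 / m - 1 / L)"
proof (induction L)
 case 0 then show ?case using assms by simp
next
 case (Suc L)
 have m: "0 < m" using assms by simp
 consider "real (Suc L) \<le> m" | "real L \<le> m" "m < real (Suc L)" | "m < real L" by linarith
 then show ?case
 proof cases
  case 1
  then have "max m (1 + real L) = m" by simp
  with 1 Suc show ?thesis using m by (simp add: field_simps)
 next
  case 2
  have L: "max m (real (Suc L)) = real (Suc L)" using 2 by simp
  define n s where "n = real (Suc L)" and "s = n - m"
  have s: "0 < s" "s \<le> 1" and n: "1 \<le> n" using 2 by (auto simp: n_def s_def)
  have "(2 * m - L) * n\<^sup>2 - (real L + 2) * m\<^sup>2 = s * (2 * n - s * (n + 1))"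
  proof -
   have e: "m = n - s" "real L = n - 1" by (auto simp: n_def s_def)
   show ?thesis unfolding e by (simp add: power2_eq_square algebra_simps)
  qed
  moreover have "0 \<le> s * (2 * n - s * (n + 1))"
  proof (rule mult_nonneg_nonneg)
   have "s * (n + 1) \<le> 1 * (n + 1)" using s n by (intro mult_right_mono) auto
   also have "... \<le> 2 * n" using n by simp
   finally show "0 \<le> 2 * n - s * (n + 1)" by simp
  qed (use s in simp)
  ultimately have "(real L + 2) * m\<^sup>2 \<le> (2 * m - L) * n\<^sup>2" by simp
  then have "(real L + 2) / n\<^sup>2 \<le> (2 * m - L) / m\<^sup>2" using m n by (simp add: field_simps)
  moreover have "(2 * m - L) / m\<^sup>2 = 2 / m - L / m\<^sup>2" using m by (simp add: field_simps power2_eq_square)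
  moreover have "real L + 2 = 1 + n" by (simp add: n_def)
  then have "(real L + 2) / n\<^sup>2 = 1 / n\<^sup>2 + 1 / n" by (simp only: add_divide_distrib) (simp add: power2_eq_square)
  ultimately show ?thesis using Suc 2 L by (simp add: n_def)
 next
  case 3
  have L: "max m (real (Suc L)) = real (Suc L)" using 3 by simp
  have "0 < real L" using 3 m by linarith
  then have "1 / (real (Suc L))\<^sup>2 \<le> 1 / L - 1 / Suc L"
   by (rule inv_sq_telescope)
  then show ?thesis using Suc 3 L by (simp add: algebra_simps)
 qed
qed

lemma finite_int_subset_symmetric:
 assumes "finite (F :: int set)" obtains L :: nat where "F \<subseteq> {- int L..int L}"
proof -
 have "F \<subseteq> {- int (nat (Max (insert 0 (abs ` F))))..int (nat (Max (insert 0 (abs ` F))))}"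
 proof
  fix x assume "x \<in> F"
  then have "\<bar>x\<bar> \<le> Max (insert 0 (abs ` F))" using assms by (intro Max_ge) auto
  then show "x \<in> {- int (nat (Max (insert 0 (abs ` F))))..int (nat (Max (insert 0 (abs ` F))))}" by auto
 qed
 then show ?thesis using that by blast
qed

lemma sum_int_symmetric_le:
 fixes f :: "nat => real"
 shows "(\<Sum>n\<in>{- int L..int L}. f (nat \<bar>n\<bar>)) = f 0 + 2 * (\<Sum>n=1..L. f n)"
proof (induction L)
 case (Suc L)
 have "{- int (Suc L)..int (Suc L)} = insert (- int (Suc L)) (insert (int (Suc L)) {- int L..int L})" by auto
 moreover have "nat (1 + int L) = Suc L" by simp
 ultimately show ?case using Suc by (simp add: algebra_simps)
qed simp

lemma sum_mx_sq:
 assumes "finite F" shows "(\<Sum>n\<in>F. 1 / (mx m n)\<^sup>2) \<le> 5 / max 1 (real_of_int m)"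
proof -
 define a where "a = max 1 (real_of_int m)"
 have a: "1 \<le> a" by (simp add: a_def)
 obtain L where L: "F \<subseteq> {- int L..int L}" using finite_int_subset_symmetric[OF assms] .
 let ?f = "%n::nat. 1 / (max a (real n))\<^sup>2"
 have "(\<Sum>n\<in>F. 1 / (mx m n)\<^sup>2) \<le> (\<Sum>n\<in>{- int L..int L}. 1 / (mx m n)\<^sup>2)"
  using L by (intro sum_mono2) auto
 also have "... = (\<Sum>n\<in>{- int L..int L}. ?f (nat \<bar>n\<bar>))"
  by (intro sum.cong) (auto simp: mx_def a_def)
 also have "... = ?f 0 + 2 * (\<Sum>n=1..L. ?f n)" by (rule sum_int_symmetric_le)
 also have "(\<Sum>n=1..L. ?f n) \<le> 2 / a"
 proof -
  have "(if real L \<le> a then L / a\<^sup>2 else 2 / a - 1 / L) \<le> 2 / a"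
   using a by (auto simp: field_simps power2_eq_square)
  then show ?thesis using sum_inv_sq_max[OF a, of L] by linarith
 qed
 also have "?f 0 \<le> 1 / a" using a by (simp add: field_simps power2_eq_square)
 finally show ?thesis by (simp add: a_def)
qed

lemma sum_mx_pow:
 assumes "finite F" "2 \<le> k"
 shows "(\<Sum>n\<in>F. 1 / mx m n ^ k) \<le> 5 / (max 1 (real_of_int m)) ^ (k - 1)"
proof -
 define a where "a = max 1 (real_of_int m)"
 have a: "1 \<le> a" by (simp add: a_def)
 have "1 / mx m n ^ k \<le> 1 / a ^ (k - 2) * (1 / (mx m n)\<^sup>2)" for n
 proof -
  have "a ^ (k - 2) \<le> mx m n ^ (k - 2)" using a by (intro power_mono) (auto simp: mx_def a_def)
  then have "a ^ (k - 2) * (mx m n)\<^sup>2 \<le> mx m n ^ (k - 2) * (mx m n)\<^sup>2" by (intro mult_right_mono) auto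
  also have "... = mx m n ^ k" using assms(2) by (metis le_add_diff_inverse2 power_add)
  finally show ?thesis using a mx_ge1[of m n] by (simp add: frac_le)
 qed
 then have "(\<Sum>n\<in>F. 1 / mx m n ^ k) \<le> (\<Sum>n\<in>F. 1 / a ^ (k - 2) * (1 / (mx m n)\<^sup>2))" by (rule sum_mono)
 also have "... = 1 / a ^ (k - 2) * (\<Sum>n\<in>F. (1 / (mx m n)\<^sup>2))" by (simp add: sum_distrib_left)
 also have "... \<le> 1 / a ^ (k - 2) * (5 / a)"
  using sum_mx_sq[OF assms(1), of m] a by (intro mult_left_mono) (auto simp: a_def)
 also have "... = 5 / a ^ (k - 1)"
 proof -
  have "k - 1 = Suc (k - 2)" using assms(2) by simp
  then show ?thesis by simp
 qed
 finally show ?thesis by (simp add: a_def)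
qed

lemma sum_tail:
 assumes "finite F" "!!n. n \<in> F ==> int N \<le> \<bar>n\<bar>" "1 \<le> N"
 shows "(\<Sum>n\<in>F. 1 / (mx m n)\<^sup>2) \<le> 4 / real N"
proof -
 obtain L where L: "F \<subseteq> {- int L..int L}" using finite_int_subset_symmetric[OF assms(1)] .
 let ?f = "%n::nat. if N \<le> n then 1 / (real n)\<^sup>2 else 0"
 have "(\<Sum>n\<in>F. 1 / (mx m n)\<^sup>2) \<le> (\<Sum>n\<in>F. ?f (nat \<bar>n\<bar>))"
 proof (rule sum_mono)
  fix n assume n: "n \<in> F"
  then have "N \<le> nat \<bar>n\<bar>" "0 < \<bar>n\<bar>" using assms(2)[OF n] assms(3) by auto
  moreover have "\<bar>real_of_int n\<bar>\<^sup>2 \<le> (mx m n)\<^sup>2" by (intro power_mono) (auto simp: mx_def)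
  ultimately show "1 / (mx m n)\<^sup>2 \<le> ?f (nat \<bar>n\<bar>)"
   by (simp add: frac_le)
 qed
 also have "... \<le> (\<Sum>n\<in>{- int L..int L}. ?f (nat \<bar>n\<bar>))"
  using L by (intro sum_mono2) auto
 also have "... = ?f 0 + 2 * (\<Sum>n=1..L. ?f n)" by (rule sum_int_symmetric_le)
 also have "(\<Sum>n=1..L. ?f n) \<le> (if N \<le> L then 2 / N - 1 / L else 0)"
 proof (induction L)
  case 0 then show ?case using assms(3) by simp
 next
  case (Suc L)
  show ?case
  proof (cases "N \<le> L")
   case True
   then have "0 < real L" using assms(3) by simp
   then have "1 / (real (Suc L))\<^sup>2 \<le> 1 / L - 1 / Suc L"
    by (rule inv_sq_telescope)
   then show ?thesis using Suc True by (simp add: algebra_simps)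
  next
   case False
   show ?thesis
   proof (cases "N = Suc L")
    case True
    have "1 / (real N)\<^sup>2 \<le> 1 / real N" using assms(3) by (simp add: field_simps power2_eq_square)
    then show ?thesis using Suc True by simp
   next
    case F: False
    then show ?thesis using Suc False by simp
   qed
  qed
 qed
 also have "(if N \<le> L then 2 / N - 1 / L else 0) \<le> 2 / real N" by simp
 finally show ?thesis using assms(3) by simp
qed

definition pset :: "int set => nat => (int \<times> int) set" where
 "pset I N = {p. fst p \<in> I \<and> \<bar>snd p\<bar> < int N \<and> p \<succ> (0, 0)}"

definition psum :: "int set => nat list => nat => complex => complex" where
 "psum I ks N t = csum (\<succ>) (lval t) (pset I N) ks"

definition plim :: "int set => nat list => complex => complex" where
 "plim I ks t = lim (%N. psum I ks N t)"

lemma pset_Sigma: "pset I N = (SIGMA m:I. {n. \<bar>n\<bar> < int N \<and> (m, n) \<succ> (0, 0)})"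
 by (auto simp: pset_def)

lemma finite_pset_line [simp]: "finite {n. \<bar>n\<bar> < int N \<and> P n}"
 by (rule finite_subset[of _ "{- int N..int N}"]) auto

lemma finite_pset [simp]: "finite I ==> finite (pset I N)"
 unfolding pset_Sigma by (intro finite_SigmaI) auto

lemma posbox_eq_pset: "posbox M N = pset {0..<int M} N"
 by (auto simp: posbox_def pset_def lat_box_def)

lemma wrd_eq_psum: "wrd ks M N t = psum {0..<int M} ks N t"
 by (simp add: wrd_def psum_def posbox_eq_pset)

lemma pset_mono: "N \<le> N' ==> pset I N \<subseteq> pset I N'"
 by (auto simp: pset_def)

lemma sum_line_bound:
 assumes "1 \<le> A" "t \<in> KA A" "finite F" "!!n. n \<in> F ==> (m, n) \<noteq> (0, 0)" "2 \<le> k"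
 shows "(\<Sum>n\<in>F. norm (1 / lval t (m, n) ^ k)) \<le> 5 * KK A ^ k / (max 1 (real_of_int m)) ^ (k - 1)"
proof -
 have "(\<Sum>n\<in>F. norm (1 / lval t (m, n) ^ k)) \<le> (\<Sum>n\<in>F. KK A ^ k * (1 / mx m n ^ k))"
  using norm_inv_lval[OF assms(1,2) assms(4)] by (intro sum_mono) simp
 also have "... = KK A ^ k * (\<Sum>n\<in>F. 1 / mx m n ^ k)" by (simp add: sum_distrib_left)
 also have "... \<le> KK A ^ k * (5 / (max 1 (real_of_int m)) ^ (k - 1))"
  using KK_ge1[of A] by (intro mult_left_mono sum_mx_pow assms) auto
 finally show ?thesis by (simp add: mult.commute)
qed

lemma sum_pset_bound:
 assumes "1 \<le> A" "t \<in> KA A" "finite I" "2 \<le> k"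
 shows "(\<Sum>p\<in>pset I N. norm (1 / lval t p ^ k)) \<le> (\<Sum>m\<in>I. 5 * KK A ^ k / (max 1 (real_of_int m)) ^ (k - 1))"
proof -
 have "(\<Sum>p\<in>pset I N. norm (1 / lval t p ^ k))
  = (\<Sum>m\<in>I. \<Sum>n\<in>{n. \<bar>n\<bar> < int N \<and> (m, n) \<succ> (0, 0)}. norm (1 / lval t (m, n) ^ k))"
  unfolding pset_Sigma using assms(3) by (subst sum.Sigma) (auto simp: case_prod_unfold)
 also have "... \<le> (\<Sum>m\<in>I. 5 * KK A ^ k / (max 1 (real_of_int m)) ^ (k - 1))"
  by (intro sum_mono sum_line_bound assms) auto
 finally show ?thesis .
qed

lemma sum_pset_tail:
 assumes "1 \<le> A" "t \<in> KA A" "finite I" "2 \<le> k" "1 \<le> N"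
 shows "(\<Sum>p\<in>pset I N' - pset I N. norm (1 / lval t p ^ k)) \<le> card I * (KK A ^ k * 4 / N)"
proof -
 let ?F = "%m. {n. \<bar>n\<bar> < int N' \<and> (int N \<le> \<bar>n\<bar> \<and> (m, n) \<succ> (0, 0))}"
 have eq: "pset I N' - pset I N = (SIGMA m:I. ?F m)"
  by (auto simp: pset_def)
 have "(\<Sum>p\<in>pset I N' - pset I N. norm (1 / lval t p ^ k)) = (\<Sum>m\<in>I. \<Sum>n\<in>?F m. norm (1 / lval t (m, n) ^ k))"
  unfolding eq using assms(3) by (subst sum.Sigma) (auto simp: case_prod_unfold)
 also have "... \<le> (\<Sum>m\<in>I. KK A ^ k * 4 / N)"
 proof (rule sum_mono)
  fix m
  have "(\<Sum>n\<in>?F m. norm (1 / lval t (m, n) ^ k)) \<le> (\<Sum>n\<in>?F m. KK A ^ k * (1 / (mx m n)\<^sup>2))"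
  proof (rule sum_mono)
   fix n assume "n \<in> ?F m"
   then have "(m, n) \<noteq> (0, 0)" by auto
   then have "norm (1 / lval t (m, n) ^ k) \<le> KK A ^ k / mx m n ^ k" by (rule norm_inv_lval[OF assms(1,2)])
   also have "... \<le> KK A ^ k / (mx m n)\<^sup>2"
    using mx_ge1[of m n] KK_ge1[of A] assms(4) by (intro divide_left_mono power_increasing) auto
   finally show "norm (1 / lval t (m, n) ^ k) \<le> KK A ^ k * (1 / (mx m n)\<^sup>2)" by simp
  qed
  also have "... = KK A ^ k * (\<Sum>n\<in>?F m. 1 / (mx m n)\<^sup>2)" by (simp add: sum_distrib_left)
  also have "... \<le> KK A ^ k * (4 / N)"
   using KK_ge1[of A] assms(5) by (intro mult_left_mono sum_tail) auto
  finally show "(\<Sum>n\<in>?F m. norm (1 / lval t (m, n) ^ k)) \<le> KK A ^ k * 4 / N" by simp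
 qed
 finally show ?thesis by simp
qed

lemma KK_pow_le: "k \<le> s ==> KK A ^ k \<le> KK A ^ s"
 using KK_ge1 by (intro power_increasing) auto

lemma mes_indices_Cons [simp]: "k # ks \<in> mes_indices \<longleftrightarrow> 2 \<le> k \<and> ks \<in> mes_indices"
 by (simp add: mes_indices_def)

lemma mes_indices_Nil [simp]: "[] \<in> mes_indices"
 by (simp add: mes_indices_def)

lemma mes_indices_append [simp]: "u @ v \<in> mes_indices \<longleftrightarrow> u \<in> mes_indices \<and> v \<in> mes_indices"
 by (auto simp: mes_indices_def)

lemma mes_indices_take: "w \<in> mes_indices ==> take i w \<in> mes_indices"
 by (auto simp: mes_indices_def dest: in_set_takeD)

lemma mes_indices_drop: "w \<in> mes_indices ==> drop i w \<in> mes_indices"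
 by (auto simp: mes_indices_def dest: in_set_dropD)

lemma mem_mes_indices: "ks \<in> mes_indices ==> k \<in> set ks ==> 2 \<le> k"
 by (simp add: mes_indices_def)

definition SS :: "real => int set => nat list => real" where
 "SS A I ks = 1 + card I * (5 * KK A ^ sum_list ks)"

lemma SS_ge1: "1 \<le> SS A I ks"
 using KK_ge1[of A] by (simp add: SS_def)

lemma sum_pset_le_SS:
 assumes "1 \<le> A" "t \<in> KA A" "finite I" "ks \<in> mes_indices" "k \<in> set ks"
 shows "(\<Sum>p\<in>pset I N. norm (1 / lval t p ^ k)) \<le> SS A I ks"
proof -
 have k: "2 \<le> k" "k \<le> sum_list ks" using assms member_le_sum_list by (auto dest: mem_mes_indices)
 have "(\<Sum>p\<in>pset I N. norm (1 / lval t p ^ k)) \<le> (\<Sum>m\<in>I. 5 * KK A ^ k / (max 1 (real_of_int m)) ^ (k - 1))"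
  by (rule sum_pset_bound) (use assms k in auto)
 also have "... \<le> (\<Sum>m\<in>I. 5 * KK A ^ sum_list ks)"
 proof (rule sum_mono)
  fix m
  have "5 * KK A ^ k / (max 1 (real_of_int m)) ^ (k - 1) \<le> 5 * KK A ^ k / 1"
   using KK_ge1[of A] by (intro divide_left_mono one_le_power) auto
  then show "5 * KK A ^ k / (max 1 (real_of_int m)) ^ (k - 1) \<le> 5 * KK A ^ sum_list ks"
   using KK_pow_le[OF k(2), of A] by simp
 qed
 finally show ?thesis by (simp add: SS_def)
qed

definition CC :: "real => int set => nat list => real" where
 "CC A I ks = length ks * SS A I ks ^ length ks * (card I * (KK A ^ sum_list ks * 4))"

lemma psum_cauchy:
 assumes "1 \<le> A" "t \<in> KA A" "finite I" "ks \<in> mes_indices" "1 \<le> N" "N \<le> N'"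
 shows "norm (psum I ks N' t - psum I ks N t) \<le> CC A I ks / N"
proof -
 have "norm (psum I ks N' t - psum I ks N t)
  \<le> length ks * SS A I ks ^ length ks * (card I * (KK A ^ sum_list ks * 4 / N))"
  unfolding psum_def
 proof (rule csum_diff_bound)
  show "(\<Sum>x\<in>pset I N' - pset I N. norm (1 / lval t x ^ k)) \<le> card I * (KK A ^ sum_list ks * 4 / N)"
   if "k \<in> set ks" for k
  proof -
   have "2 \<le> k" "k \<le> sum_list ks" using that assms member_le_sum_list by (auto dest: mem_mes_indices)
   then have "(\<Sum>x\<in>pset I N' - pset I N. norm (1 / lval t x ^ k)) \<le> card I * (KK A ^ k * 4 / N)"
    by (intro sum_pset_tail assms)
   also have "... \<le> card I * (KK A ^ sum_list ks * 4 / N)"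
    using KK_pow_le[OF \<open>k \<le> sum_list ks\<close>, of A] by (intro mult_left_mono divide_right_mono mult_right_mono) auto
   finally show ?thesis .
  qed
 qed (use assms sum_pset_le_SS SS_ge1 pset_mono in auto)
 then show ?thesis by (simp add: CC_def)
qed

lemma cauchy_lim:
 fixes f :: "nat => complex"
 assumes "!!N N'. 1 \<le> N ==> N \<le> N' ==> norm (f N' - f N) \<le> e N" "e \<longlonglongrightarrow> 0"
 shows "f \<longlonglongrightarrow> lim f" "!!N. 1 \<le> N ==> norm (lim f - f N) \<le> e N"
proof -
 have "Cauchy f"
 proof (rule CauchyI)
  fix \<epsilon> :: real assume "0 < \<epsilon>"
  then have "\<forall>\<^sub>F N in sequentially. e N < \<epsilon> / 2"
   using assms(2) by (intro order_tendstoD) auto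
  then obtain N0 where N0: "!!N. N \<ge> N0 ==> e N < \<epsilon> / 2" by (auto simp: eventually_sequentially)
  show "\<exists>M. \<forall>m\<ge>M. \<forall>n\<ge>M. norm (f m - f n) < \<epsilon>"
  proof (intro exI[of _ "max 1 N0"] allI impI)
   fix m n assume mn: "max 1 N0 \<le> m" "max 1 N0 \<le> n"
   have "norm (f m - f (max 1 N0)) < \<epsilon> / 2" "norm (f n - f (max 1 N0)) < \<epsilon> / 2"
    using assms(1)[of "max 1 N0" m] assms(1)[of "max 1 N0" n] N0[of "max 1 N0"] mn by auto
   then show "norm (f m - f n) < \<epsilon>"
    using norm_triangle_lt[of "f m - f (max 1 N0)" "f (max 1 N0) - f n" \<epsilon>]
    by (simp add: norm_minus_commute)
  qed
 qed
 then show L: "f \<longlonglongrightarrow> lim f" by (simp add: Cauchy_convergent_iff convergent_LIMSEQ_iff)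
 fix N :: nat assume N: "1 \<le> N"
 have "(%n. norm (f n - f N)) \<longlonglongrightarrow> norm (lim f - f N)" by (intro tendsto_intros L)
 then show "norm (lim f - f N) \<le> e N"
  by (rule tendsto_upperbound) (use assms(1)[OF N] in \<open>auto simp: eventually_sequentially\<close>)
qed

lemma psum_plim:
 assumes "1 \<le> A" "t \<in> KA A" "finite I" "ks \<in> mes_indices"
 shows "(%N. psum I ks N t) \<longlonglongrightarrow> plim I ks t"
  and "1 \<le> N ==> norm (plim I ks t - psum I ks N t) \<le> CC A I ks / N"
proof -
 have e: "(%N. CC A I ks / real N) \<longlonglongrightarrow> 0" by real_asymp
 note c = cauchy_lim[of "%N. psum I ks N t" "%N. CC A I ks / real N", OF _ e]
 show "(%N. psum I ks N t) \<longlonglongrightarrow> plim I ks t"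
  unfolding plim_def by (rule c) (rule psum_cauchy[OF assms])
 show "norm (plim I ks t - psum I ks N t) \<le> CC A I ks / N" if "1 \<le> N"
  unfolding plim_def by (rule c(2)) (use psum_cauchy[OF assms] that in auto)
qed

lemma psum_plim':
 assumes "0 < Im t" "finite I" "ks \<in> mes_indices"
 shows "(%N. psum I ks N t) \<longlonglongrightarrow> plim I ks t"
 using ex_KA[OF assms(1)] psum_plim(1) assms by blast

lemma plim_bound:
 assumes "0 < Im t" "finite I" "ks \<in> mes_indices" "\<forall>\<^sub>F N in sequentially. norm (psum I ks N t) \<le> B"
 shows "norm (plim I ks t) \<le> B"
 by (rule tendsto_upperbound[OF tendsto_norm[OF psum_plim'[OF assms(1-3)]] assms(4)]) simp

definition PK :: "real => nat list => real" where
 "PK A ks = (\<Prod>k\<leftarrow>ks. 5 * KK A ^ k)"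

lemma PK_nonneg: "0 \<le> PK A ks"
 using KK_ge1[of A] unfolding PK_def by (induction ks) auto

lemma PK_Cons [simp]: "PK A (k # ks) = 5 * KK A ^ k * PK A ks" "PK A [] = 1"
 by (simp_all add: PK_def)

lemma prod_line_bound:
 "(\<Prod>k\<leftarrow>ks. 5 * KK A ^ k / a ^ (k - 1)) = PK A ks / a ^ (\<Sum>k\<leftarrow>ks. k - 1)"
 by (induction ks) (auto simp: power_add)

lemma psum_line_bound:
 assumes "1 \<le> A" "t \<in> KA A" "ks \<in> mes_indices"
 shows "norm (psum {m} ks N t) \<le> PK A ks / (max 1 (real_of_int m)) ^ (\<Sum>k\<leftarrow>ks. k - 1)"
 unfolding psum_def prod_line_bound[symmetric]
proof (rule csum_bound)
 show "(\<Sum>x\<in>pset {m} N. norm (1 / lval t x ^ k)) \<le> 5 * KK A ^ k / max 1 (real_of_int m) ^ (k - 1)"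
  if "k \<in> set ks" for k
  using sum_pset_bound[OF assms(1,2), of "{m}" k N] that assms(3) mem_mes_indices by auto
qed simp

lemma pset_line_full: "0 < m ==> pset {m} N = Pair m ` {n. \<bar>n\<bar> < int N}"
 by (auto simp: pset_def)

lemma sum_telescope_int:
 fixes f :: "int => 'a::ab_group_add"
 shows "(\<Sum>n\<in>{n. \<bar>n\<bar> < int (Suc N)}. f n - f (n + 1)) = f (- int N) - f (int (Suc N))"
proof (induction N)
 case 0
 have "{n. \<bar>n\<bar> < int (Suc 0)} = {0}" by auto
 then show ?case by simp
next
 case (Suc N)
 have fin: "finite {n. \<bar>n\<bar> < int (Suc N)}" by (rule finite_subset[of _ "{- int (Suc N)..int (Suc N)}"]) auto
 have e: "{n. \<bar>n\<bar> < int (Suc (Suc N))} = insert (- int (Suc N)) (insert (int (Suc N)) {n. \<bar>n\<bar> < int (Suc N)})"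
  by auto
 have "(\<Sum>n\<in>{n. \<bar>n\<bar> < int (Suc (Suc N))}. f n - f (n + 1))
  = (f (- int (Suc N)) - f (- int (Suc N) + 1)) + ((f (int (Suc N)) - f (int (Suc N) + 1)) + (f (- int N) - f (int (Suc N))))"
  unfolding e using fin by (subst sum.insert, simp, force, subst sum.insert) (auto simp: Suc.IH simp del: of_nat_Suc)
 moreover have "- int (Suc N) + 1 = - int N" "int (Suc N) + 1 = int (Suc (Suc N))" by auto
 ultimately show ?case by (simp only:) (simp add: algebra_simps)
qed

lemma psum_line_two:
 assumes "1 \<le> A" "t \<in> KA A" "0 < m" "1 \<le> N"
 shows "norm (psum {m} [2] (Suc N) t) \<le> 5 * KK A ^ 3 / (real_of_int m)\<^sup>2 + 2 * KK A / N"
proof -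
 define z where "z n = lval t (m, n)" for n
 have z: "z n \<noteq> 0" for n
  unfolding z_def using assms KA_pos by (intro lval_nz) auto
 have zs: "z (n + 1) = z n + 1" for n by (simp add: z_def lval_def)
 have inv: "norm (1 / z n) \<le> KK A / mx m n" for n
  using norm_inv_lval[OF assms(1,2), of m n 1] assms(3) by (simp add: z_def)
 let ?F = "{n. \<bar>n\<bar> < int (Suc N)}"
 have fin: "finite ?F" by (rule finite_subset[of _ "{- int (Suc N)..int (Suc N)}"]) auto
 have "psum {m} [2] (Suc N) t = (\<Sum>n\<in>?F. 1 / z n ^ 2)"
  unfolding psum_def pset_line_full[OF assms(3)] by (simp add: sum.reindex inj_on_def z_def)
 also have "... = (\<Sum>n\<in>?F. 1 / ((z n)\<^sup>2 * z (n + 1))) + (\<Sum>n\<in>?F. 1 / z n - 1 / z (n + 1))"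
 proof -
  have "1 / (z n)\<^sup>2 = 1 / ((z n)\<^sup>2 * z (n + 1)) + (1 / z n - 1 / z (n + 1))" for n :: int
  proof -
   have "1 / (a\<^sup>2 * b) + (1 / a - 1 / b) = 1 / a\<^sup>2" if "a \<noteq> 0" "b \<noteq> 0" "b = a + 1" for a b :: complex
   proof -
    have "1 / (a\<^sup>2 * b) + (1 / a - 1 / b) = (1 + a * b - a * a) / (a\<^sup>2 * b)"
     using that(1,2) by (simp add: field_simps power2_eq_square)
    also have "1 + a * b - a * a = b" using that(3) by (simp add: algebra_simps)
    finally show ?thesis using that(2) by simp
   qed
   then show ?thesis using z zs by metis
  qed
  then show ?thesis by (simp only: sum.distrib)
 qed
 also have "norm ... \<le> 5 * KK A ^ 3 / (real_of_int m)\<^sup>2 + 2 * KK A / N"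
 proof (rule norm_triangle_le, rule add_mono)
  have "norm (1 / ((z n)\<^sup>2 * z (n + 1))) \<le> KK A ^ 3 / real_of_int m * (1 / (mx m n)\<^sup>2)" for n
  proof -
   have "KK A / mx m (n + 1) \<le> KK A / real_of_int m"
    using KK_ge1[of A] assms(3) by (intro divide_left_mono) (auto simp: mx_def)
   then have 1: "norm (1 / z (n + 1)) \<le> KK A / real_of_int m" using inv[of "n + 1"] by linarith
   have 2: "norm (1 / z n) ^ 2 \<le> (KK A / mx m n) ^ 2" by (intro power_mono inv) auto
   have "norm (1 / ((z n)\<^sup>2 * z (n + 1))) = norm (1 / z n) ^ 2 * norm (1 / z (n + 1))"
    by (simp add: norm_divide norm_mult norm_power power_divide)
   also have "... \<le> (KK A / mx m n) ^ 2 * (KK A / real_of_int m)"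
    by (intro mult_mono 1 2) auto
   finally show ?thesis by (simp add: power_divide power3_eq_cube power2_eq_square mult_ac)
  qed
  then have "norm (\<Sum>n\<in>?F. 1 / ((z n)\<^sup>2 * z (n + 1))) \<le> (\<Sum>n\<in>?F. KK A ^ 3 / real_of_int m * (1 / (mx m n)\<^sup>2))"
   by (intro sum_norm_le) auto
  also have "... = KK A ^ 3 / real_of_int m * (\<Sum>n\<in>?F. 1 / (mx m n)\<^sup>2)" by (simp add: sum_distrib_left)
  also have "... \<le> KK A ^ 3 / real_of_int m * (5 / real_of_int m)"
   using sum_mx_sq[OF fin, of m] assms(3) KK_ge1[of A] by (intro mult_left_mono) auto
  finally show "norm (\<Sum>n\<in>?F. 1 / ((z n)\<^sup>2 * z (n + 1))) \<le> 5 * KK A ^ 3 / (real_of_int m)\<^sup>2"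
   by (simp add: power2_eq_square mult_ac)
  have b: "norm (1 / z n) \<le> KK A / N" if "int N \<le> \<bar>n\<bar>" for n
  proof -
   have "real N \<le> mx m n" using that by (auto simp: mx_def)
   then have "KK A / mx m n \<le> KK A / N" using KK_ge1[of A] assms(4) by (intro divide_left_mono) auto
   then show ?thesis using inv[of n] by linarith
  qed
  have "(\<Sum>n\<in>?F. 1 / z n - 1 / z (n + 1)) = 1 / z (- int N) - 1 / z (int (Suc N))"
   by (rule sum_telescope_int)
  also have "norm ... \<le> KK A / N + KK A / N"
   by (rule order_trans[OF norm_triangle_ineq4]) (intro add_mono b, auto)
  finally show "norm (\<Sum>n\<in>?F. 1 / z n - 1 / z (n + 1)) \<le> 2 * KK A / N" by simp
 qed
 finally show ?thesis .
qed

definition LB :: "real => nat list => real" where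
 "LB A ks = 4 * (PK A ks + 6 * KK A ^ 3)"

lemma LB_nonneg: "0 \<le> LB A ks"
 using PK_nonneg[of A ks] KK_ge1[of A] by (simp add: LB_def)

lemma sum_pred_ge:
 assumes "ks \<in> mes_indices" shows "length ks \<le> (\<Sum>k\<leftarrow>ks. k - 1)"
 using assms by (induction ks) auto

lemma plim_line_bound:
 assumes "1 \<le> A" "t \<in> KA A" "ks \<in> mes_indices" "ks \<noteq> []"
 shows "norm (plim {int m} ks t) \<le> LB A ks / (real m + 1)\<^sup>2"
proof -
 have pos: "0 < Im t" using KA_pos assms by blast
 define a where "a = max 1 (real m)"
 have a: "1 \<le> a" "real m + 1 \<le> 2 * a" by (auto simp: a_def)
 have "norm (plim {int m} ks t) \<le> (PK A ks + 6 * KK A ^ 3) / a\<^sup>2"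
 proof (cases "ks = [2] \<and> 0 < m")
  case True
  have "\<forall>\<^sub>F N in sequentially. 2 * KK A / real N < KK A ^ 3 / a\<^sup>2"
  proof (rule order_tendstoD)
   show "(%N. 2 * KK A / real N) \<longlonglongrightarrow> 0" by real_asymp
   show "0 < KK A ^ 3 / a\<^sup>2" using KK_ge1[of A] a by simp
  qed
  then have "\<forall>\<^sub>F N in sequentially. norm (psum {int m} ks (Suc N) t) \<le> 6 * KK A ^ 3 / a\<^sup>2"
   using eventually_ge_at_top[of 1]
  proof eventually_elim
   case (elim N)
   have "real m = a" using True by (simp add: a_def)
   then have "5 * KK A ^ 3 / (real_of_int (int m))\<^sup>2 = 5 * (KK A ^ 3 / a\<^sup>2)"
    "6 * KK A ^ 3 / a\<^sup>2 = 6 * (KK A ^ 3 / a\<^sup>2)" by simp_all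
   then show ?case using elim psum_line_two[OF assms(1,2), of "int m" N] True by auto
  qed
  then have "\<forall>\<^sub>F N in sequentially. norm (psum {int m} ks N t) \<le> 6 * KK A ^ 3 / a\<^sup>2"
   using eventually_sequentially_Suc[of "%N. norm (psum {int m} ks N t) \<le> 6 * KK A ^ 3 / a\<^sup>2"] by blast
  then have "norm (plim {int m} ks t) \<le> 6 * KK A ^ 3 / a\<^sup>2"
   by (intro plim_bound pos assms) auto
  also have "... \<le> (PK A ks + 6 * KK A ^ 3) / a\<^sup>2"
   using PK_nonneg[of A ks] by (intro divide_right_mono) auto
  finally show ?thesis .
 next
  case False
  have "PK A ks / a ^ (\<Sum>k\<leftarrow>ks. k - 1) \<le> PK A ks / a\<^sup>2"
  proof (cases "m = 0")
   case True then show ?thesis by (simp add: a_def)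
  next
   case m: False
   have "2 \<le> (\<Sum>k\<leftarrow>ks. k - 1)"
   proof (cases ks)
    case (Cons k ks')
    show ?thesis
    proof (cases ks')
     case Nil
     then show ?thesis using Cons False m assms(3) by auto
    next
     case (Cons k' ks'')
     then show ?thesis using sum_pred_ge[OF assms(3)] \<open>ks = k # ks'\<close> by simp
    qed
   qed (use assms in auto)
   then show ?thesis using a PK_nonneg[of A ks] by (intro divide_left_mono power_increasing) auto
  qed
  moreover have "norm (plim {int m} ks t) \<le> PK A ks / a ^ (\<Sum>k\<leftarrow>ks. k - 1)"
   using psum_line_bound[OF assms(1-3), of "int m"]
   by (intro plim_bound pos assms) (auto simp: a_def)
  moreover have "PK A ks / a\<^sup>2 \<le> (PK A ks + 6 * KK A ^ 3) / a\<^sup>2"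
   using KK_ge1[of A] by (intro divide_right_mono) auto
  ultimately show ?thesis by linarith
 qed
 also have "... \<le> LB A ks / (real m + 1)\<^sup>2"
 proof -
  have "(real m + 1)\<^sup>2 \<le> (2 * a)\<^sup>2" using a by (intro power_mono) auto
  then have "LB A ks / (2 * a)\<^sup>2 \<le> LB A ks / (real m + 1)\<^sup>2"
   using LB_nonneg[of A ks] a by (intro divide_left_mono) auto
  moreover have "4 * x / (2 * a)\<^sup>2 = x / a\<^sup>2" for x by (simp add: power_mult_distrib)
  then have "LB A ks / (2 * a)\<^sup>2 = (PK A ks + 6 * KK A ^ 3) / a\<^sup>2"
   unfolding LB_def by blast
  ultimately show ?thesis by simp
 qed
 finally show ?thesis .
qed

lemma pset_Suc: "pset {0..<int (Suc M)} N = pset {int M} N \<union> pset {0..<int M} N"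
 by (auto simp: pset_def)

lemma psum_Suc:
 "psum {0..<int (Suc M)} w N t
  = (\<Sum>i\<le>length w. psum {int M} (take i w) N t * psum {0..<int M} (drop i w) N t)"
 unfolding psum_def pset_Suc
proof (rule lat.csum_Un)
 show "x \<succ> y" if "x \<in> pset {int M} N" "y \<in> pset {0..<int M} N" for x y
  using that by (cases x; cases y) (auto simp: pset_def)
qed simp_all

lemma plim_Suc:
 assumes "0 < Im t" "w \<in> mes_indices"
 shows "plim {0..<int (Suc M)} w t
  = (\<Sum>i\<le>length w. plim {int M} (take i w) t * plim {0..<int M} (drop i w) t)"
proof (rule LIMSEQ_unique)
 show "(%N. psum {0..<int (Suc M)} w N t) \<longlonglongrightarrow> plim {0..<int (Suc M)} w t"
  by (rule psum_plim') (use assms in auto)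
 show "(%N. psum {0..<int (Suc M)} w N t) \<longlonglongrightarrow>
  (\<Sum>i\<le>length w. plim {int M} (take i w) t * plim {0..<int M} (drop i w) t)"
  unfolding psum_Suc
  by (intro tendsto_intros psum_plim') (use assms mes_indices_take mes_indices_drop in auto)
qed

lemma plim_Nil [simp]: "plim I [] t = 1"
 by (simp add: plim_def psum_def)

lemma sum_inv_sq_tail:
 assumes "1 \<le> M" "M \<le> M'"
 shows "(\<Sum>m\<in>{M..<M'}. 1 / (real m + 1)\<^sup>2) \<le> 1 / real M - 1 / real M'"
 using assms(2)
proof (induction M' rule: dec_induct)
 case (step n)
 have "{M..<Suc n} = insert n {M..<n}" using step.hyps by auto
 then have "(\<Sum>m\<in>{M..<Suc n}. 1 / (real m + 1)\<^sup>2) = 1 / (real (Suc n))\<^sup>2 + (\<Sum>m\<in>{M..<n}. 1 / (real m + 1)\<^sup>2)"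
  by (simp add: add.commute)
 moreover have "1 / (real (Suc n))\<^sup>2 \<le> 1 / n - 1 / Suc n"
  by (rule inv_sq_telescope) (use step.hyps assms(1) in simp)
 ultimately show ?case using step.IH by linarith
qed simp

lemma sum_inv_sq_le: "(\<Sum>m<M. 1 / (real m + 1)\<^sup>2) \<le> 2"
proof (cases "M = 0")
 case False
 then have "{..<M} = insert 0 {1..<M}" by auto
 then have "(\<Sum>m<M. 1 / (real m + 1)\<^sup>2) = 1 + (\<Sum>m\<in>{1..<M}. 1 / (real m + 1)\<^sup>2)" by simp
 moreover have "0 \<le> 1 / real M" by simp
 moreover have "(\<Sum>m\<in>{1..<M}. 1 / (real m + 1)\<^sup>2) \<le> 1 / real 1 - 1 / real M"
  by (rule sum_inv_sq_tail) (use False in auto)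
 ultimately show ?thesis by linarith
qed simp

lemma psum_empty: "ks \<noteq> [] ==> psum {} ks N t = 0"
 by (cases ks) (auto simp: psum_def pset_def)

lemma plim_empty: "ks \<noteq> [] ==> plim {} ks t = 0"
 by (simp add: plim_def psum_empty)

lemma plim_increments:
 assumes "1 \<le> A" "w \<in> mes_indices"
 shows "\<exists>C\<ge>0. \<forall>t\<in>KA A. \<forall>M.
   norm (plim {0..<int (Suc M)} w t - plim {0..<int M} w t) \<le> C / (real M + 1)\<^sup>2 \<and>
   norm (plim {0..<int M} w t) \<le> 1 + 2 * C"
 using assms(2)
proof (induction w rule: length_induct)
 case (1 w)
 show ?case
 proof (cases "w = []")
  case True then show ?thesis by (intro exI[of _ 0]) simp
 next
  case False
  have "\<forall>i\<in>{1..length w}. \<exists>C\<ge>0. \<forall>t\<in>KA A. \<forall>M. norm (plim {0..<int M} (drop i w) t) \<le> 1 + 2 * C"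
  proof
   fix i assume i: "i \<in> {1..length w}"
   have "length (drop i w) < length w" using i False by auto
   then show "\<exists>C\<ge>0. \<forall>t\<in>KA A. \<forall>M. norm (plim {0..<int M} (drop i w) t) \<le> 1 + 2 * C"
    using 1(1) mes_indices_drop[OF 1(2)] by blast
  qed
  then obtain C where C: "!!i. i \<in> {1..length w} ==> 0 \<le> C i"
   "!!i t M. i \<in> {1..length w} ==> t \<in> KA A ==> norm (plim {0..<int M} (drop i w) t) \<le> 1 + 2 * C i"
   by metis
  define D where "D = (\<Sum>i\<in>{1..length w}. LB A (take i w) * (1 + 2 * C i))"
  have D0: "0 \<le> D" unfolding D_def using C(1) LB_nonneg by (intro sum_nonneg mult_nonneg_nonneg) auto
  have inc: "norm (plim {0..<int (Suc M)} w t - plim {0..<int M} w t) \<le> D / (real M + 1)\<^sup>2"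
   if t: "t \<in> KA A" for t M
  proof -
   have e: "{..length w} = insert 0 {1..length w}" by auto
   have "plim {0..<int (Suc M)} w t - plim {0..<int M} w t
    = (\<Sum>i\<in>{1..length w}. plim {int M} (take i w) t * plim {0..<int M} (drop i w) t)"
    unfolding plim_Suc[OF KA_pos[OF assms(1) t] 1(2)] e by simp
   also have "norm ... \<le> (\<Sum>i\<in>{1..length w}. LB A (take i w) / (real M + 1)\<^sup>2 * (1 + 2 * C i))"
   proof (rule sum_norm_le)
    fix i assume i: "i \<in> {1..length w}"
    then have "norm (plim {int M} (take i w) t) \<le> LB A (take i w) / (real M + 1)\<^sup>2"
     using False by (intro plim_line_bound assms t mes_indices_take 1(2)) auto
    then show "norm (plim {int M} (take i w) t * plim {0..<int M} (drop i w) t)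
      \<le> LB A (take i w) / (real M + 1)\<^sup>2 * (1 + 2 * C i)"
     unfolding norm_mult using C(2)[OF i t] LB_nonneg by (intro mult_mono) auto
   qed
   finally show ?thesis by (simp add: D_def sum_divide_distrib)
  qed
  have bd: "norm (plim {0..<int M} w t) \<le> D * (\<Sum>m<M. 1 / (real m + 1)\<^sup>2)" if t: "t \<in> KA A" for t M
  proof (induction M)
   case 0 then show ?case using False by (simp add: plim_empty)
  next
   case (Suc M)
   have "norm (plim {0..<int (Suc M)} w t) \<le> norm (plim {0..<int M} w t)
     + norm (plim {0..<int (Suc M)} w t - plim {0..<int M} w t)"
    by (rule norm_triangle_sub)
   then show ?case using Suc inc[OF t, of M] by (simp add: algebra_simps)
  qed
  show ?thesis
  proof (intro exI[of _ D] conjI ballI allI)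
   fix t M assume t: "t \<in> KA A"
   have "D * (\<Sum>m<M. 1 / (real m + 1)\<^sup>2) \<le> D * 2"
    by (intro mult_left_mono sum_inv_sq_le D0)
   then show "norm (plim {0..<int M} w t) \<le> 1 + 2 * D" using bd[OF t, of M] by linarith
  qed (use D0 inc in auto)
 qed
qed

definition GG :: "nat list => complex => complex" where
 "GG w t = lim (%M. plim {0..<int M} w t)"

lemma plim_GG:
 assumes "1 \<le> A" "w \<in> mes_indices"
 shows "\<exists>C\<ge>0. \<forall>t\<in>KA A. (%M. plim {0..<int M} w t) \<longlonglongrightarrow> GG w t \<and>
  (\<forall>M\<ge>1. norm (GG w t - plim {0..<int M} w t) \<le> C / M)"
proof -
 obtain C where C: "0 \<le> C" "!!t M. t \<in> KA A ==>
   norm (plim {0..<int (Suc M)} w t - plim {0..<int M} w t) \<le> C / (real M + 1)\<^sup>2"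
  using plim_increments[OF assms] by blast
 have c: "norm (plim {0..<int M'} w t - plim {0..<int M} w t) \<le> C / M"
  if "1 \<le> M" "M \<le> M'" "t \<in> KA A" for M M' t
 proof -
  have "norm (plim {0..<int M'} w t - plim {0..<int M} w t) \<le> (\<Sum>m\<in>{M..<M'}. C / (real m + 1)\<^sup>2)"
   using that(2)
  proof (induction M' rule: dec_induct)
   case (step n)
   have "{M..<Suc n} = insert n {M..<n}" using step.hyps by auto
   then have s: "(\<Sum>m\<in>{M..<Suc n}. C / (real m + 1)\<^sup>2) = C / (real n + 1)\<^sup>2 + (\<Sum>m\<in>{M..<n}. C / (real m + 1)\<^sup>2)" by simp
   have "norm (plim {0..<int (Suc n)} w t - plim {0..<int M} w t)
    \<le> norm (plim {0..<int (Suc n)} w t - plim {0..<int n} w t) + norm (plim {0..<int n} w t - plim {0..<int M} w t)"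
    using norm_triangle_ineq[of "plim {0..<int (Suc n)} w t - plim {0..<int n} w t" "plim {0..<int n} w t - plim {0..<int M} w t"] by simp
   then show ?case using step.IH C(2)[OF that(3), of n] s by linarith
  qed simp
  also have "... = C * (\<Sum>m\<in>{M..<M'}. 1 / (real m + 1)\<^sup>2)" by (simp add: sum_distrib_left)
  also have "... \<le> C * (1 / M)"
  proof (rule mult_left_mono[OF _ C(1)])
   have "0 \<le> 1 / real M'" by simp
   then show "(\<Sum>m\<in>{M..<M'}. 1 / (real m + 1)\<^sup>2) \<le> 1 / real M"
    using sum_inv_sq_tail[OF that(1,2)] by linarith
  qed
  finally show ?thesis by simp
 qed
 have e: "(%M. C / real M) \<longlonglongrightarrow> 0" by real_asymp
 show ?thesis
 proof (intro exI[of _ C] conjI ballI allI impI C(1))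
  fix t assume t: "t \<in> KA A"
  note cl = cauchy_lim[of "%M. plim {0..<int M} w t" "%M. C / real M", OF _ e]
  show "(%M. plim {0..<int M} w t) \<longlonglongrightarrow> GG w t"
   unfolding GG_def by (rule cl) (use c t in auto)
  fix M :: nat assume "1 \<le> M"
  then show "norm (GG w t - plim {0..<int M} w t) \<le> C / real M"
   unfolding GG_def by (intro cl(2)) (use c t in auto)
 qed
qed

lemma uniform_limit_inverse_bound:
 fixes f :: "nat => complex => complex"
 assumes "!!n t. t \<in> S ==> 1 \<le> n ==> norm (g t - f n t) \<le> C / n"
 shows "uniform_limit S f g sequentially"
proof (rule uniform_limitI)
 fix e :: real assume "0 < e"
 have "(%n. C / real n) \<longlonglongrightarrow> 0" by real_asymp
 then have "\<forall>\<^sub>F n in sequentially. C / real n < e" using \<open>0 < e\<close> by (rule order_tendstoD)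
 then show "\<forall>\<^sub>F n in sequentially. \<forall>t\<in>S. dist (f n t) (g t) < e"
  using eventually_ge_at_top[of 1]
 proof eventually_elim
  case (elim n)
  show ?case
  proof
   fix t assume "t \<in> S"
   then show "dist (f n t) (g t) < e" using assms[of t n] elim by (simp add: dist_norm norm_minus_commute)
  qed
 qed
qed

lemma uniform_plim:
 assumes "1 \<le> A" "finite I" "w \<in> mes_indices"
 shows "uniform_limit (KA A) (%N. psum I w N) (plim I w) sequentially"
 by (rule uniform_limit_inverse_bound[where C = "CC A I w"]) (use psum_plim(2)[OF assms(1) _ assms(2,3)] in auto)

lemma uniform_GG:
 assumes "1 \<le> A" "w \<in> mes_indices"
 shows "uniform_limit (KA A) (%M. plim {0..<int M} w) (GG w) sequentially"
proof -
 obtain C where "\<forall>t\<in>KA A. \<forall>M\<ge>1. norm (GG w t - plim {0..<int M} w t) \<le> C / M"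
  using plim_GG[OF assms] by blast
 then show ?thesis by (intro uniform_limit_inverse_bound[where C = C]) auto
qed

lemma plim_GG_tendsto:
 assumes "0 < Im t" "w \<in> mes_indices"
 shows "(%M. plim {0..<int M} w t) \<longlonglongrightarrow> GG w t"
 using ex_KA[OF assms(1)] plim_GG[OF _ assms(2)] by blast

lemma holomorphic_csum:
 assumes "finite F" "(0, 0) \<notin> F"
 shows "(%t. csum (\<succ>) (lval t) F ks) holomorphic_on {t. 0 < Im t}"
 using assms
proof (induction ks arbitrary: F)
 case (Cons k ks)
 have "lval t p ^ k \<noteq> 0" if "p \<in> F" "0 < Im t" for t p
  using lval_nz[OF that(2), of p] that(1) Cons.prems(2) by (cases "p = (0, 0)") auto
 moreover have "(%t. lval t p) holomorphic_on {t. 0 < Im t}" for p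
  unfolding lval_def by (intro holomorphic_intros)
 ultimately show ?case
  unfolding csum.simps using Cons.prems by (intro holomorphic_intros Cons.IH) auto
qed simp

lemma holomorphic_psum: "finite I ==> psum I ks N holomorphic_on {t. 0 < Im t}"
proof -
 assume "finite I"
 then have "(%t. psum I ks N t) holomorphic_on {t. 0 < Im t}"
  unfolding psum_def by (intro holomorphic_csum finite_pset) (auto simp: pset_def)
 then show ?thesis by simp
qed

lemma holomorphic_on_upper_limit:
 assumes "!!n. f n holomorphic_on {t. 0 < Im t}"
  and "!!A. 1 \<le> A ==> uniform_limit (KA A) f g sequentially"
 shows "g holomorphic_on {t. 0 < Im t}"
proof (rule holomorphic_uniform_sequence[of _ f])
 show "open {t. 0 < Im t}" by (rule open_halfspace_Im_gt)
 fix x :: complex assume "x \<in> {t. 0 < Im t}"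
 then obtain A where A: "1 \<le> A" "x \<in> KA A" using ex_KA by blast
 then obtain d where d: "0 < d" "cball x d \<subseteq> KA A" using open_KA open_contains_cball by blast
 show "\<exists>d>0. cball x d \<subseteq> {t. 0 < Im t} \<and> uniform_limit (cball x d) f g sequentially"
 proof (intro exI conjI)
  show "cball x d \<subseteq> {t. 0 < Im t}" using d KA_pos[OF A(1)] by blast
  show "uniform_limit (cball x d) f g sequentially"
   by (rule uniform_limit_on_subset[OF assms(2)[OF A(1)] d(2)])
 qed (rule d)
qed (rule assms(1))

lemma holomorphic_plim:
 assumes "finite I" "w \<in> mes_indices" shows "plim I w holomorphic_on {t. 0 < Im t}"
 by (rule holomorphic_on_upper_limit[of "%N. psum I w N"]) (use assms holomorphic_psum uniform_plim in auto)

lemma holomorphic_GG: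
 assumes "w \<in> mes_indices" shows "GG w holomorphic_on {t. 0 < Im t}"
 by (rule holomorphic_on_upper_limit[of "%M. plim {0..<int M} w"]) (use assms holomorphic_plim uniform_GG in auto)

lemma deriv_upper_limit:
 assumes "!!n. f n holomorphic_on {t. 0 < Im t}" "0 < Im t"
  and "!!A. 1 \<le> A ==> uniform_limit (KA A) f g sequentially"
 shows "(%n. deriv (f n) t) \<longlonglongrightarrow> deriv g t"
proof -
 obtain A where A: "1 \<le> A" "t \<in> KA A" using ex_KA[OF assms(2)] by blast
 have "f n holomorphic_on KA A" for n
  by (rule holomorphic_on_subset[OF assms(1)]) (use KA_pos[OF A(1)] in blast)
 then show ?thesis
  by (intro deriv_complex_uniform_limit[OF assms(3)[OF A(1)] _ _ open_KA A(2)]) auto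
qed

lemma deriv_plim:
 assumes "0 < Im t" "finite I" "w \<in> mes_indices"
 shows "(%N. deriv (psum I w N) t) \<longlonglongrightarrow> deriv (plim I w) t"
 by (rule deriv_upper_limit) (use assms holomorphic_psum uniform_plim in auto)

lemma deriv_GG:
 assumes "0 < Im t" "w \<in> mes_indices"
 shows "(%M. deriv (plim {0..<int M} w) t) \<longlonglongrightarrow> deriv (GG w) t"
 by (rule deriv_upper_limit) (use assms holomorphic_plim uniform_GG in auto)

lemma of_uhp_pos: "0 < Im (of_uhp \<tau>)"
 using of_uhp[of \<tau>] by simp

lemma G_eq_GG:
 assumes "w \<in> mes_indices" shows "G w \<tau> = GG w (of_uhp \<tau>)"
 unfolding G_def GG_def mes_trunc_eq_wrd wrd_eq_psum plim_def ..

lemma mes_indices_qsh: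
 "w \<in> set (qsh u v) ==> u \<in> mes_indices ==> v \<in> mes_indices ==> w \<in> mes_indices"
 by (induction u v arbitrary: w rule: qsh.induct) auto

lemma sum_list_qsh: "w \<in> set (qsh u v) ==> sum_list w = sum_list u + sum_list v"
 by (induction u v arbitrary: w rule: qsh.induct) auto

lemma psum_mult:
 "finite I ==> psum I u N t * psum I v N t = (\<Sum>w\<leftarrow>qsh u v. psum I w N t)"
 unfolding psum_def by (rule lat.csum_mult) simp

lemma tendsto_sum_list:
 fixes f :: "'a => nat => complex"
 assumes "!!w. w \<in> set ws ==> f w \<longlonglongrightarrow> g w"
 shows "(%n. \<Sum>w\<leftarrow>ws. f w n) \<longlonglongrightarrow> (\<Sum>w\<leftarrow>ws. g w)"
 using assms by (induction ws) (auto intro!: tendsto_add)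

lemma plim_mult:
 assumes "0 < Im t" "finite I" "u \<in> mes_indices" "v \<in> mes_indices"
 shows "plim I u t * plim I v t = (\<Sum>w\<leftarrow>qsh u v. plim I w t)"
proof (rule LIMSEQ_unique)
 show "(%N. psum I u N t * psum I v N t) \<longlonglongrightarrow> plim I u t * plim I v t"
  by (intro tendsto_mult psum_plim' assms)
 show "(%N. psum I u N t * psum I v N t) \<longlonglongrightarrow> (\<Sum>w\<leftarrow>qsh u v. plim I w t)"
  unfolding psum_mult[OF assms(2)]
  by (intro tendsto_sum_list psum_plim' assms(1,2)) (use mes_indices_qsh assms in blast)
qed

lemma GG_mult:
 assumes "0 < Im t" "u \<in> mes_indices" "v \<in> mes_indices"
 shows "GG u t * GG v t = (\<Sum>w\<leftarrow>qsh u v. GG w t)"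
proof (rule LIMSEQ_unique)
 show "(%M. plim {0..<int M} u t * plim {0..<int M} v t) \<longlonglongrightarrow> GG u t * GG v t"
  by (intro tendsto_mult plim_GG_tendsto assms)
 show "(%M. plim {0..<int M} u t * plim {0..<int M} v t) \<longlonglongrightarrow> (\<Sum>w\<leftarrow>qsh u v. GG w t)"
  unfolding plim_mult[OF assms(1) finite_atLeastLessThan_int assms(2,3)]
  by (intro tendsto_sum_list plim_GG_tendsto assms(1)) (use mes_indices_qsh assms in blast)
qed

lemma GG_Nil [simp]: "GG [] t = 1"
 by (simp add: GG_def)

section \<open>The summation identity behind the derivative\<close>

lemma partial_fraction:
 fixes s l :: complex
 assumes "s \<noteq> 0" "l \<noteq> 0" "s \<noteq> l" "2 \<le> k"
 shows "(1 / (s - l) - 1 / s) / l ^ k - (1 / (s - l) + 1 / l) / s ^ k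
  = (\<Sum>a\<in>{2..<k}. 1 / (s ^ a * l ^ (k + 1 - a)))"
 using assms(4)
proof (induction k rule: dec_induct)
 case base
 have "(1 / (s - l) - 1 / s) / l\<^sup>2 = (1 / (s - l) + 1 / l) / s\<^sup>2"
  using assms(1-3) by (simp add: divide_simps) (simp add: power2_eq_square algebra_simps)
 then show ?case by simp
next
 case (step k)
 have d: "s - l \<noteq> 0" using assms by simp
 have c: "(1 / (s - l) + 1 / l) * (1 / l - 1 / s) = 1 / l\<^sup>2"
  using assms(1-3) d by (simp add: divide_simps) (simp add: power2_eq_square algebra_simps)
 have "(\<Sum>a\<in>{2..<Suc k}. 1 / (s ^ a * l ^ (Suc k + 1 - a)))
   = (\<Sum>a\<in>{2..<k}. 1 / (s ^ a * l ^ (k + 1 - a)) / l) + 1 / s ^ k / l\<^sup>2"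
 proof -
  have "(\<Sum>a\<in>{2..<k}. 1 / (s ^ a * l ^ (Suc k + 1 - a))) = (\<Sum>a\<in>{2..<k}. 1 / (s ^ a * l ^ (k + 1 - a)) / l)"
   by (intro sum.cong) (auto simp: Suc_diff_le)
  moreover have "{2..<Suc k} = insert k {2..<k}" using step.hyps by auto
  ultimately show ?thesis by (simp add: power2_eq_square add.commute)
 qed
 also have "... = ((1 / (s - l) - 1 / s) / l ^ k - (1 / (s - l) + 1 / l) / s ^ k) / l
   + 1 / s ^ k * ((1 / (s - l) + 1 / l) * (1 / l - 1 / s))"
  unfolding c step.IH by (simp add: sum_divide_distrib)
 also have "... = (1 / (s - l) - 1 / s) / l ^ Suc k - (1 / (s - l) + 1 / l) / s ^ Suc k"
  by (simp add: algebra_simps diff_divide_distrib add_divide_distrib)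
 finally show ?case by simp
qed

lemma partial_fraction_deriv:
 fixes s l :: complex
 assumes "s \<noteq> 0" "l \<noteq> 0" "s \<noteq> l" "2 \<le> k"
 shows "(1 / s\<^sup>2 - 1 / (s - l)\<^sup>2) / l ^ k + of_nat k * (1 / (s - l) + 1 / l) / s ^ (k + 1) + 1 / (s ^ k * (s - l)\<^sup>2)
  = - (\<Sum>a\<in>{2..<k}. of_nat a / (s ^ (a + 1) * l ^ (k + 1 - a)))"
 using assms(4)
proof (induction k rule: dec_induct)
 case base
 have "(1 / s\<^sup>2 - 1 / (s - l)\<^sup>2) / l\<^sup>2 + 2 * (1 / (s - l) + 1 / l) / s ^ 3 + 1 / (s\<^sup>2 * (s - l)\<^sup>2) = 0"
  using assms(1-3) by (simp add: divide_simps) (simp add: power2_eq_square power3_eq_cube algebra_simps)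
 then show ?case by simp
next
 case (step k)
 have d: "s - l \<noteq> 0" using assms by simp
 let ?c = "1 / (s - l) + 1 / l"
 have c: "?c / s * (1 / s - 1 / l) = - (1 / (s * l\<^sup>2))"
  using assms(1-3) d by (simp add: divide_simps) (simp add: power2_eq_square algebra_simps)
 have c2: "?c / s\<^sup>2 + 1 / (s - l)\<^sup>2 * (1 / s - 1 / l) = 0"
  using assms(1-3) d by (simp add: divide_simps) (simp add: power2_eq_square algebra_simps)
 have "- (\<Sum>a\<in>{2..<Suc k}. of_nat a / (s ^ (a + 1) * l ^ (Suc k + 1 - a)))
   = - (\<Sum>a\<in>{2..<k}. of_nat a / (s ^ (a + 1) * l ^ (k + 1 - a)) / l) + 1 / s ^ k * (of_nat k * (- (1 / (s * l\<^sup>2))))"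
 proof -
  have "(\<Sum>a\<in>{2..<k}. of_nat a / (s ^ (a + 1) * l ^ (Suc k + 1 - a)))
   = (\<Sum>a\<in>{2..<k}. of_nat a / (s ^ (a + 1) * l ^ (k + 1 - a)) / l)"
   by (intro sum.cong) (auto simp: Suc_diff_le)
  moreover have "{2..<Suc k} = insert k {2..<k}" using step.hyps by auto
  ultimately show ?thesis by (simp add: power2_eq_square mult_ac)
 qed
 also have "... = - (\<Sum>a\<in>{2..<k}. of_nat a / (s ^ (a + 1) * l ^ (k + 1 - a))) / l
   + 1 / s ^ k * (of_nat k * (?c / s * (1 / s - 1 / l)) + (?c / s\<^sup>2 + 1 / (s - l)\<^sup>2 * (1 / s - 1 / l)))"
  unfolding c c2 by (simp add: sum_divide_distrib)
 also have "... = (1 / s\<^sup>2 - 1 / (s - l)\<^sup>2) / l ^ Suc k + of_nat (Suc k) * ?c / s ^ (Suc k + 1) + 1 / (s ^ Suc k * (s - l)\<^sup>2)"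
  unfolding step.IH[symmetric]
  by (simp add: algebra_simps diff_divide_distrib add_divide_distrib power2_eq_square)
 finally show ?case by simp
qed

context chain_order
begin

lemma sum_triple_swap:
 fixes f :: "'a => 'a => 'a => complex"
 assumes "finite F"
 shows "(\<Sum>x\<in>F. \<Sum>y\<in>{y\<in>F. R x y}. \<Sum>w\<in>{w\<in>F. R y w}. f x y w)
   = (\<Sum>x\<in>F. \<Sum>w\<in>{w\<in>F. R x w}. \<Sum>y\<in>{y\<in>F. R x y \<and> R y w}. f x y w)"
proof (rule sum.cong[OF refl])
 fix x
 have "(\<Sum>y\<in>{y\<in>F. R x y}. \<Sum>w\<in>{w\<in>F. R y w}. f x y w)
   = (\<Sum>w\<in>F. \<Sum>y\<in>{y \<in> {y\<in>F. R x y}. R y w}. f x y w)"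
  using assms by (intro sum.swap_restrict) auto
 also have "... = (\<Sum>w\<in>{w\<in>F. R x w}. \<Sum>y\<in>{y \<in> {y\<in>F. R x y}. R y w}. f x y w)"
  using assms trans by (intro sum.mono_neutral_right) (auto intro!: sum.neutral)
 finally show "(\<Sum>y\<in>{y\<in>F. R x y}. \<Sum>w\<in>{w\<in>F. R y w}. f x y w)
   = (\<Sum>w\<in>{w\<in>F. R x w}. \<Sum>y\<in>{y\<in>F. R x y \<and> R y w}. f x y w)"
  by (simp add: conj_assoc)
qed

lemma sum_upper_lower:
 fixes f :: "'a => 'a => complex"
 assumes "finite F"
 shows "(\<Sum>x\<in>F. \<Sum>y\<in>{y\<in>F. R x y}. f x y) = (\<Sum>y\<in>F. \<Sum>x\<in>{x\<in>F. R x y}. f x y)"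
 using assms assms by (rule sum.swap_restrict)

end

definition Xs :: "('a => 'a => bool) => ('a => complex) => 'a set => ('a => complex) => ('a => complex) => nat => ('a => complex) => complex" where
 "Xs R z F g g1 k v = (\<Sum>s\<in>F. \<Sum>l\<in>{l\<in>F. R s l}.
  (g1 s * (1 / (z s - z l) - 1 / z s) + g s * (1 / (z s)\<^sup>2 - 1 / (z s - z l)\<^sup>2)) * (v l / z l ^ k))"

definition Ys :: "('a => 'a => bool) => ('a => complex) => 'a set => ('a => complex) => ('a => complex) => ('a => complex) => complex" where
 "Ys R z F h h1 v = (\<Sum>s\<in>F. \<Sum>l\<in>{l\<in>F. R s l}.
  (h1 s * (1 / (z s - z l) + 1 / z l) - h s / (z s - z l)\<^sup>2) * v l)"

definition Cs :: "('a => 'a => bool) => ('a => complex) => 'a set => ('a => complex) => ('a => complex) => nat => ('a => complex) => complex" where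
 "Cs R z F g g1 k v = (\<Sum>a\<in>{2..<k}. (\<Sum>s\<in>F. \<Sum>l\<in>{l\<in>F. R s l}. g1 s / z s ^ a * (v l / z l ^ (k + 1 - a)))
  - of_nat a * (\<Sum>s\<in>F. \<Sum>l\<in>{l\<in>F. R s l}. g s / z s ^ (a + 1) * (v l / z l ^ (k + 1 - a))))"

lemma Xs_eq_Ys_plus_Cs:
 assumes "!!x. x \<in> F ==> z x \<noteq> 0" "!!x y. x \<in> F ==> y \<in> F ==> R x y ==> z x \<noteq> z y" "2 \<le> k"
 shows "Xs R z F g g1 k v
  = Ys R z F (%s. g s / z s ^ k) (%s. g1 s / z s ^ k - of_nat k * g s / z s ^ (k + 1)) v + Cs R z F g g1 k v"
proof -
 have pt: "(g1 s * (1 / (z s - z l) - 1 / z s) + g s * (1 / (z s)\<^sup>2 - 1 / (z s - z l)\<^sup>2)) * (v l / z l ^ k)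
  = ((g1 s / z s ^ k - of_nat k * g s / z s ^ (k + 1)) * (1 / (z s - z l) + 1 / z l) - g s / z s ^ k / (z s - z l)\<^sup>2) * v l
  + (\<Sum>a\<in>{2..<k}. g1 s / z s ^ a * (v l / z l ^ (k + 1 - a)) - of_nat a * (g s / z s ^ (a + 1) * (v l / z l ^ (k + 1 - a))))"
  if "s \<in> F" "l \<in> {l\<in>F. R s l}" for s l
 proof -
  have nz: "z s \<noteq> 0" "z l \<noteq> 0" "z s \<noteq> z l" using assms that by auto
  have "(\<Sum>a\<in>{2..<k}. g1 s / z s ^ a * (v l / z l ^ (k + 1 - a)) - of_nat a * (g s / z s ^ (a + 1) * (v l / z l ^ (k + 1 - a))))
   = g1 s * v l * (\<Sum>a\<in>{2..<k}. 1 / (z s ^ a * z l ^ (k + 1 - a)))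
   + g s * v l * (- (\<Sum>a\<in>{2..<k}. of_nat a / (z s ^ (a + 1) * z l ^ (k + 1 - a))))"
   by (simp add: sum_subtractf sum_distrib_left mult_ac)
  also have "... = g1 s * v l * ((1 / (z s - z l) - 1 / z s) / z l ^ k - (1 / (z s - z l) + 1 / z l) / z s ^ k)
   + g s * v l * ((1 / (z s)\<^sup>2 - 1 / (z s - z l)\<^sup>2) / z l ^ k + of_nat k * (1 / (z s - z l) + 1 / z l) / z s ^ (k + 1) + 1 / (z s ^ k * (z s - z l)\<^sup>2))"
   unfolding partial_fraction[OF nz assms(3)] partial_fraction_deriv[OF nz assms(3)] ..
  finally have e: "(\<Sum>a\<in>{2..<k}. g1 s / z s ^ a * (v l / z l ^ (k + 1 - a)) - of_nat a * (g s / z s ^ (a + 1) * (v l / z l ^ (k + 1 - a)))) = ..." .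
  define A B C D where "A = 1 / (z s - z l) - 1 / z s" and "B = 1 / (z s - z l) + 1 / z l"
   and "C = 1 / (z s)\<^sup>2 - 1 / (z s - z l)\<^sup>2" and "D = (z s - z l)\<^sup>2"
  show ?thesis unfolding e A_def[symmetric] B_def[symmetric] C_def[symmetric] D_def[symmetric]
   by (simp add: algebra_simps diff_divide_distrib add_divide_distrib)
 qed
 have C: "Cs R z F g g1 k v = (\<Sum>s\<in>F. \<Sum>l\<in>{l\<in>F. R s l}. \<Sum>a\<in>{2..<k}.
  g1 s / z s ^ a * (v l / z l ^ (k + 1 - a)) - of_nat a * (g s / z s ^ (a + 1) * (v l / z l ^ (k + 1 - a))))"
  unfolding Cs_def by (simp add: sum_subtractf sum_distrib_left sum.swap[of _ "{2..<k}"])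
 show ?thesis
  unfolding Xs_def Ys_def C sum.distrib[symmetric] by (intro sum.cong refl pt)
qed

lemma (in chain_order) Xs_minus_Ys:
 assumes "finite F"
 shows "Xs R z F (%r. \<Sum>s\<in>{s\<in>F. R s r}. h s) (%r. \<Sum>s\<in>{s\<in>F. R s r}. h1 s) k v
   - Ys R z F h h1 (%r. \<Sum>n\<in>{n\<in>F. R r n}. v n / z n ^ k)
  = (\<Sum>s\<in>F. \<Sum>n\<in>{n\<in>F. R s n}.
    (h1 s * ((\<Sum>r\<in>{r\<in>F. R s r \<and> R r n}. 1 / (z r - z n) - 1 / (z s - z r)) - 2 * (\<Sum>r\<in>{r\<in>F. R s r \<and> R r n}. 1 / z r))
    + h s * ((\<Sum>r\<in>{r\<in>F. R s r \<and> R r n}. 1 / (z r)\<^sup>2) - (\<Sum>r\<in>{r\<in>F. R s r \<and> R r n}. 1 / (z r - z n)\<^sup>2 - 1 / (z s - z r)\<^sup>2)))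
    * (v n / z n ^ k))"
proof -
 let ?w = "%n. v n / z n ^ k"
 have "Xs R z F (%r. \<Sum>s\<in>{s\<in>F. R s r}. h s) (%r. \<Sum>s\<in>{s\<in>F. R s r}. h1 s) k v
  = (\<Sum>r\<in>F. \<Sum>n\<in>{n\<in>F. R r n}. \<Sum>s\<in>{s\<in>F. R s r}.
    (h1 s * (1 / (z r - z n) - 1 / z r) + h s * (1 / (z r)\<^sup>2 - 1 / (z r - z n)\<^sup>2)) * ?w n)"
  unfolding Xs_def sum_distrib_right sum.distrib[symmetric] distrib_right ..
 also have "... = (\<Sum>r\<in>F. \<Sum>s\<in>{s\<in>F. R s r}. \<Sum>n\<in>{n\<in>F. R r n}.
    (h1 s * (1 / (z r - z n) - 1 / z r) + h s * (1 / (z r)\<^sup>2 - 1 / (z r - z n)\<^sup>2)) * ?w n)"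
  by (intro sum.cong refl sum.swap)
 also have "... = (\<Sum>s\<in>F. \<Sum>r\<in>{r\<in>F. R s r}. \<Sum>n\<in>{n\<in>F. R r n}.
    (h1 s * (1 / (z r - z n) - 1 / z r) + h s * (1 / (z r)\<^sup>2 - 1 / (z r - z n)\<^sup>2)) * ?w n)"
  by (rule sum_upper_lower[symmetric]) fact
 finally have X: "Xs R z F (%r. \<Sum>s\<in>{s\<in>F. R s r}. h s) (%r. \<Sum>s\<in>{s\<in>F. R s r}. h1 s) k v = ..." .
 have Y: "Ys R z F h h1 (%r. \<Sum>n\<in>{n\<in>F. R r n}. ?w n)
  = (\<Sum>s\<in>F. \<Sum>r\<in>{r\<in>F. R s r}. \<Sum>n\<in>{n\<in>F. R r n}.
    (h1 s * (1 / (z s - z r) + 1 / z r) - h s / (z s - z r)\<^sup>2) * ?w n)"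
  unfolding Ys_def by (simp add: sum_distrib_left)
 have "(\<Sum>s\<in>F. \<Sum>r\<in>{r\<in>F. R s r}. \<Sum>n\<in>{n\<in>F. R r n}.
    (h1 s * (1 / (z r - z n) - 1 / z r) + h s * (1 / (z r)\<^sup>2 - 1 / (z r - z n)\<^sup>2)) * ?w n)
  - (\<Sum>s\<in>F. \<Sum>r\<in>{r\<in>F. R s r}. \<Sum>n\<in>{n\<in>F. R r n}.
    (h1 s * (1 / (z s - z r) + 1 / z r) - h s / (z s - z r)\<^sup>2) * ?w n)
  = (\<Sum>s\<in>F. \<Sum>n\<in>{n\<in>F. R s n}. \<Sum>r\<in>{r\<in>F. R s r \<and> R r n}.
   (h1 s * (1 / (z r - z n) - 1 / z r) + h s * (1 / (z r)\<^sup>2 - 1 / (z r - z n)\<^sup>2)) * ?w n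
   - (h1 s * (1 / (z s - z r) + 1 / z r) - h s / (z s - z r)\<^sup>2) * ?w n)"
  unfolding sum_triple_swap[OF assms] by (simp only: sum_subtractf)
 also have "... = (\<Sum>s\<in>F. \<Sum>n\<in>{n\<in>F. R s n}.
    (h1 s * ((\<Sum>r\<in>{r\<in>F. R s r \<and> R r n}. 1 / (z r - z n) - 1 / (z s - z r)) - 2 * (\<Sum>r\<in>{r\<in>F. R s r \<and> R r n}. 1 / z r))
    + h s * ((\<Sum>r\<in>{r\<in>F. R s r \<and> R r n}. 1 / (z r)\<^sup>2) - (\<Sum>r\<in>{r\<in>F. R s r \<and> R r n}. 1 / (z r - z n)\<^sup>2 - 1 / (z s - z r)\<^sup>2)))
    * ?w n)"
 proof (intro sum.cong refl)
  fix s n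
  have e: "(h1 s * (1 / (z r - z n) - 1 / z r) + h s * (1 / (z r)\<^sup>2 - 1 / (z r - z n)\<^sup>2)) * ?w n
   - (h1 s * (1 / (z s - z r) + 1 / z r) - h s / (z s - z r)\<^sup>2) * ?w n
   = (h1 s * ((1 / (z r - z n) - 1 / (z s - z r)) - 2 * (1 / z r))
    + h s * (1 / (z r)\<^sup>2 - (1 / (z r - z n)\<^sup>2 - 1 / (z s - z r)\<^sup>2))) * ?w n" for r
   by (simp add: algebra_simps)
  show "(\<Sum>r\<in>{r\<in>F. R s r \<and> R r n}.
   (h1 s * (1 / (z r - z n) - 1 / z r) + h s * (1 / (z r)\<^sup>2 - 1 / (z r - z n)\<^sup>2)) * ?w n
   - (h1 s * (1 / (z s - z r) + 1 / z r) - h s / (z s - z r)\<^sup>2) * ?w n)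
   = (h1 s * ((\<Sum>r\<in>{r\<in>F. R s r \<and> R r n}. 1 / (z r - z n) - 1 / (z s - z r)) - 2 * (\<Sum>r\<in>{r\<in>F. R s r \<and> R r n}. 1 / z r))
    + h s * ((\<Sum>r\<in>{r\<in>F. R s r \<and> R r n}. 1 / (z r)\<^sup>2) - (\<Sum>r\<in>{r\<in>F. R s r \<and> R r n}. 1 / (z r - z n)\<^sup>2 - 1 / (z s - z r)\<^sup>2)))
    * ?w n"
   unfolding e sum_distrib_right[symmetric]
   by (simp only: sum_distrib_left sum_subtractf sum.distrib right_diff_distrib)
 qed
 finally show ?thesis unfolding X Y .
qed

lemma Ys_bottom:
 "Ys R z F h h1 (%_. 1)
  = (\<Sum>s\<in>F. h1 s * (2 * (\<Sum>l\<in>{l\<in>F. R s l}. 1 / z l) - (\<Sum>l\<in>{l\<in>F. R s l}. 1 / z l - 1 / (z s - z l)))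
   - h s * ((\<Sum>l\<in>{l\<in>F. R s l}. 1 / (z l)\<^sup>2) + (\<Sum>l\<in>{l\<in>F. R s l}. 1 / (z s - z l)\<^sup>2 - 1 / (z l)\<^sup>2)))"
 unfolding Ys_def
proof (rule sum.cong[OF refl])
 fix s
 have e: "(h1 s * (1 / (z s - z l) + 1 / z l) - h s / (z s - z l)\<^sup>2) * 1
  = h1 s * (2 * (1 / z l) - (1 / z l - 1 / (z s - z l))) - h s * (1 / (z l)\<^sup>2 + (1 / (z s - z l)\<^sup>2 - 1 / (z l)\<^sup>2))" for l
  by (simp add: algebra_simps)
 show "(\<Sum>l\<in>{l\<in>F. R s l}. (h1 s * (1 / (z s - z l) + 1 / z l) - h s / (z s - z l)\<^sup>2) * 1)
  = h1 s * (2 * (\<Sum>l\<in>{l\<in>F. R s l}. 1 / z l) - (\<Sum>l\<in>{l\<in>F. R s l}. 1 / z l - 1 / (z s - z l)))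
   - h s * ((\<Sum>l\<in>{l\<in>F. R s l}. 1 / (z l)\<^sup>2) + (\<Sum>l\<in>{l\<in>F. R s l}. 1 / (z s - z l)\<^sup>2 - 1 / (z l)\<^sup>2))"
  unfolding e by (simp only: sum_distrib_left sum_subtractf sum.distrib right_diff_distrib distrib_left)
qed

section \<open>Families of truncated sums and null families\<close>

type_synonym fam = "nat => nat => complex => complex"

inductive_set EE :: "fam set" where
 EE_wrd: "ks \<in> mes_indices ==> wrd ks \<in> EE"
| EE_zero: "(%M N t. 0) \<in> EE"
| EE_add: "f \<in> EE ==> g \<in> EE ==> (%M N t. f M N t + g M N t) \<in> EE"
| EE_scale: "f \<in> EE ==> (%M N t. of_rat q * f M N t) \<in> EE"

lemma EE_minus: "f \<in> EE ==> (%M N t. - f M N t) \<in> EE"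
 using EE_scale[of f "-1"] by simp

lemma EE_diff: "f \<in> EE ==> g \<in> EE ==> (%M N t. f M N t - g M N t) \<in> EE"
 using EE_add[OF _ EE_minus, of f g] by simp

lemma EE_of_nat: "f \<in> EE ==> (%M N t. of_nat n * f M N t) \<in> EE"
 using EE_scale[of f "of_nat n"] by simp

lemma EE_sum: "finite I ==> (!!i. i \<in> I ==> f i \<in> EE) ==> (%M N t. \<Sum>i\<in>I. f i M N t) \<in> EE"
 by (induction I rule: finite_induct) (auto intro: EE.intros)

lemma EE_sum_list: "(!!w. w \<in> set ws ==> f w \<in> EE) ==> (%M N t. \<Sum>w\<leftarrow>ws. f w M N t) \<in> EE"
 by (induction ws) (auto intro: EE.intros)

lemma EE_mult:
 assumes "f \<in> EE" "g \<in> EE" shows "(%M N t. f M N t * g M N t) \<in> EE"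
 using assms(1)
proof (induction rule: EE.induct)
 case (EE_wrd u)
 show ?case
  using assms(2)
 proof (induction rule: EE.induct)
  case (EE_wrd v)
  show ?case unfolding wrd_mult
   by (rule EE_sum_list) (use mes_indices_qsh[OF _ \<open>u \<in> mes_indices\<close> \<open>v \<in> mes_indices\<close>] EE.EE_wrd in blast)
 next
  case (EE_scale f q)
  then show ?case using EE.EE_scale[of _ q] by (simp add: mult.left_commute)
 qed (auto simp: distrib_left intro: EE.intros)
next
 case (EE_scale f q)
 then show ?case using EE.EE_scale[of _ q] by (simp add: mult.assoc)
qed (auto simp: distrib_right intro: EE.intros)

lemma EE_limit:
 assumes "f \<in> EE" "0 < Im t"
 shows "\<exists>L. (\<forall>M. (%N. f M N t) \<longlonglongrightarrow> L M) \<and> convergent L"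
 using assms(1)
proof (induction rule: EE.induct)
 case (EE_wrd ks)
 have "convergent (%M. plim {0..<int M} ks t)"
  using plim_GG_tendsto[OF assms(2) EE_wrd] by (rule convergentI)
 moreover have "(%N. wrd ks M N t) \<longlonglongrightarrow> plim {0..<int M} ks t" for M
  unfolding wrd_eq_psum by (rule psum_plim') (use assms EE_wrd in auto)
 ultimately show ?case by (intro exI[of _ "%M. plim {0..<int M} ks t"]) auto
next
 case EE_zero
 show ?case by (intro exI[of _ "%_. 0"]) (auto intro: convergent_const)
next
 case (EE_add f g)
 then obtain L L' where "\<forall>M. (%N. f M N t) \<longlonglongrightarrow> L M" "convergent L" "\<forall>M. (%N. g M N t) \<longlonglongrightarrow> L' M" "convergent L'"
  by blast
 then show ?case by (intro exI[of _ "%M. L M + L' M"]) (auto intro: tendsto_add convergent_add)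
next
 case (EE_scale f q)
 then obtain L where "\<forall>M. (%N. f M N t) \<longlonglongrightarrow> L M" "convergent L" by blast
 then show ?case
  by (intro exI[of _ "%M. of_rat q * L M"]) (auto intro: tendsto_mult_left convergent_mult convergent_const)
qed

definition nullf :: "fam => bool" where
 "nullf h \<longleftrightarrow> (\<forall>t. 0 < Im t \<longrightarrow> (\<exists>b. b \<longlonglongrightarrow> 0 \<and> (\<forall>M. \<forall>\<^sub>F N in sequentially. norm (h M N t) \<le> b M)))"

lemma nullfI:
 assumes "!!t. 0 < Im t ==> \<exists>b. b \<longlonglongrightarrow> 0 \<and> (\<forall>M. \<forall>\<^sub>F N in sequentially. norm (h M N t) \<le> b M)"
 shows "nullf h"
 using assms unfolding nullf_def by blast

lemma nullf_pointwise:
 assumes "!!t M. 0 < Im t ==> (%N. h M N t) \<longlonglongrightarrow> 0" shows "nullf h"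
proof (rule nullfI)
 fix t :: complex assume t: "0 < Im t"
 show "\<exists>b. b \<longlonglongrightarrow> 0 \<and> (\<forall>M. \<forall>\<^sub>F N in sequentially. norm (h M N t) \<le> b M)"
 proof (intro exI[of _ "%M. 1 / (real M + 1)"] conjI allI)
  show "(%M. 1 / (real M + 1)) \<longlonglongrightarrow> 0" by real_asymp
  fix M :: nat
  have "\<forall>\<^sub>F N in sequentially. norm (h M N t) < 1 / (real M + 1)"
   using tendsto_norm_zero[OF assms[OF t]] by (rule order_tendstoD) simp
  then show "\<forall>\<^sub>F N in sequentially. norm (h M N t) \<le> 1 / (real M + 1)"
   by eventually_elim simp
 qed
qed

lemma nullf_add: "nullf f ==> nullf g ==> nullf (%M N t. f M N t + g M N t)"
proof (rule nullfI)
 fix t :: complex assume t: "0 < Im t" "nullf f" "nullf g"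
 then obtain b c where "b \<longlonglongrightarrow> 0" "!!M. \<forall>\<^sub>F N in sequentially. norm (f M N t) \<le> b M"
  "c \<longlonglongrightarrow> 0" "!!M. \<forall>\<^sub>F N in sequentially. norm (g M N t) \<le> c M"
  unfolding nullf_def by meson
 moreover have "\<forall>\<^sub>F N in sequentially. norm (f M N t + g M N t) \<le> b M + c M" for M
  using calculation(2,4)[of M] by eventually_elim (rule norm_triangle_mono)
 moreover have "(%M. b M + c M) \<longlonglongrightarrow> 0" using tendsto_add[OF calculation(1,3)] by simp
 ultimately show "\<exists>b. b \<longlonglongrightarrow> 0 \<and> (\<forall>M. \<forall>\<^sub>F N in sequentially. norm (f M N t + g M N t) \<le> b M)"
  by (intro exI[of _ "%M. b M + c M"]) blast
qed

lemma nullf_const_mult: "nullf f ==> nullf (%M N t. c * f M N t)"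
proof (rule nullfI)
 fix t :: complex assume t: "0 < Im t" "nullf f"
 then obtain b where b: "b \<longlonglongrightarrow> 0" "!!M. \<forall>\<^sub>F N in sequentially. norm (f M N t) \<le> b M"
  unfolding nullf_def by meson
 have "\<forall>\<^sub>F N in sequentially. norm (c * f M N t) \<le> norm c * b M" for M
  using b(2)[of M] by eventually_elim (simp add: norm_mult mult_left_mono)
 moreover have "(%M. norm c * b M) \<longlonglongrightarrow> 0" using tendsto_mult_left[OF b(1), of "norm c"] by simp
 ultimately show "\<exists>b. b \<longlonglongrightarrow> 0 \<and> (\<forall>M. \<forall>\<^sub>F N in sequentially. norm (c * f M N t) \<le> b M)"
  by (intro exI[of _ "%M. norm c * b M"]) blast
qed

lemma nullf_EE_mult:
 assumes "e \<in> EE" "nullf f" shows "nullf (%M N t. e M N t * f M N t)"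
proof (rule nullfI)
 fix t :: complex assume t: "0 < Im t"
 obtain b where b: "b \<longlonglongrightarrow> 0" "!!M. \<forall>\<^sub>F N in sequentially. norm (f M N t) \<le> b M"
  using assms(2) t unfolding nullf_def by meson
 obtain L where L: "!!M. (%N. e M N t) \<longlonglongrightarrow> L M" "convergent L" using EE_limit[OF assms(1) t] by blast
 from L(2) have "Bseq L" by (rule convergent_imp_Bseq)
 then obtain K where K: "!!M. norm (L M) \<le> K" unfolding Bseq_def by blast
 have K0: "0 \<le> K" using order_trans[OF norm_ge_zero K] .
 have "\<forall>\<^sub>F N in sequentially. norm (e M N t * f M N t) \<le> (K + 1) * b M" for M
 proof -
  have "\<forall>\<^sub>F N in sequentially. norm (e M N t) < K + 1"
   using tendsto_norm[OF L(1)[of M]] by (rule order_tendstoD) (use K[of M] in simp)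
  then show ?thesis using b(2)[of M]
   by eventually_elim (use K0 in \<open>auto simp: norm_mult intro!: mult_mono\<close>)
 qed
 moreover have "(%M. (K + 1) * b M) \<longlonglongrightarrow> 0" using tendsto_mult_left[OF b(1), of "K + 1"] by simp
 ultimately show "\<exists>b. b \<longlonglongrightarrow> 0 \<and> (\<forall>M. \<forall>\<^sub>F N in sequentially. norm (e M N t * f M N t) \<le> b M)"
  by (intro exI[of _ "%M. (K + 1) * b M"]) blast
qed

definition LL :: "fam set" where
 "LL = {f. \<exists>e\<in>EE. nullf (%M N t. f M N t - e M N t)}"

lemma EE_LL: "e \<in> EE ==> e \<in> LL"
 unfolding LL_def by (auto intro!: bexI[of _ e] nullf_pointwise)

lemma nullf_LL: "nullf f ==> f \<in> LL"
 unfolding LL_def by (auto intro!: bexI[of _ "%M N t. 0"] EE_zero)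

lemma LL_add:
 assumes "f \<in> LL" "g \<in> LL" shows "(%M N t. f M N t + g M N t) \<in> LL"
proof -
 obtain e e' where "e \<in> EE" "nullf (%M N t. f M N t - e M N t)" "e' \<in> EE" "nullf (%M N t. g M N t - e' M N t)"
  using assms unfolding LL_def by blast
 then show ?thesis unfolding LL_def
  using nullf_add[of "%M N t. f M N t - e M N t" "%M N t. g M N t - e' M N t"]
  by (auto intro!: bexI[of _ "%M N t. e M N t + e' M N t"] EE_add simp: algebra_simps)
qed

lemma LL_scale:
 assumes "f \<in> LL" shows "(%M N t. of_rat q * f M N t) \<in> LL"
proof -
 obtain e where "e \<in> EE" "nullf (%M N t. f M N t - e M N t)"
  using assms unfolding LL_def by blast
 then show ?thesis unfolding LL_def
  using nullf_const_mult[of "%M N t. f M N t - e M N t" "of_rat q"]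
  by (auto intro!: bexI[of _ "%M N t. of_rat q * e M N t"] EE_scale simp: algebra_simps)
qed

lemma LL_EE_mult:
 assumes "e \<in> EE" "f \<in> LL" shows "(%M N t. e M N t * f M N t) \<in> LL"
proof -
 obtain e' where "e' \<in> EE" "nullf (%M N t. f M N t - e' M N t)"
  using assms unfolding LL_def by blast
 then show ?thesis unfolding LL_def
  using nullf_EE_mult[OF assms(1), of "%M N t. f M N t - e' M N t"]
  by (auto intro!: bexI[of _ "%M N t. e M N t * e' M N t"] EE_mult assms(1) simp: algebra_simps)
qed

lemma LL_minus: "f \<in> LL ==> (%M N t. - f M N t) \<in> LL"
 using LL_scale[of f "-1"] by simp

lemma LL_diff: "f \<in> LL ==> g \<in> LL ==> (%M N t. f M N t - g M N t) \<in> LL"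
 using LL_add[OF _ LL_minus, of f g] by simp

lemma LL_of_nat: "f \<in> LL ==> (%M N t. of_nat n * f M N t) \<in> LL"
 using LL_scale[of f "of_nat n"] by simp

lemma LL_sum: "finite I ==> (!!i. i \<in> I ==> f i \<in> LL) ==> (%M N t. \<Sum>i\<in>I. f i M N t) \<in> LL"
 by (induction I rule: finite_induct) (auto intro: LL_add EE_LL EE_zero)

lemma LL_sum_list: "(!!w. w \<in> set ws ==> f w \<in> LL) ==> (%M N t. \<Sum>w\<leftarrow>ws. f w M N t) \<in> LL"
 by (induction ws) (auto intro: LL_add EE_LL EE_zero)

lemma LL_cong_null:
 assumes "f \<in> LL" "nullf (%M N t. g M N t - f M N t)" shows "g \<in> LL"
 using LL_add[OF assms(1) nullf_LL[OF assms(2)]] by simp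

abbreviation low :: "nat => nat => int \<times> int => (int \<times> int) set" where
 "low M N p \<equiv> {q \<in> posbox M N. p \<succ> q}"

abbreviation upp :: "nat => nat => int \<times> int => (int \<times> int) set" where
 "upp M N p \<equiv> {q \<in> posbox M N. q \<succ> p}"

definition vl :: "nat list => nat => nat => complex => int \<times> int => complex" where
 "vl ks M N t p = csum (\<succ>) (lval t) (low M N p) ks"

definition tu :: "nat list => nat => nat => complex => int \<times> int => complex" where
 "tu ks M N t p = csum (\<succ>) (lval t) (upp M N p) ks"

lemma vl_Nil [simp]: "vl [] M N t = (%_. 1)" by (simp add: vl_def fun_eq_iff)

lemma tu_Nil [simp]: "tu [] M N t = (%_. 1)" by (simp add: tu_def fun_eq_iff)

lemma vl_Cons: "vl (k # ks) M N t p = (\<Sum>q\<in>low M N p. vl ks M N t q / lval t q ^ k)"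
 unfolding vl_def csum.simps
 by (intro sum.cong refl) (simp add: lat.below_below)

lemma tu_snoc: "tu (u @ [k]) M N t p = (\<Sum>q\<in>upp M N p. tu u M N t q / lval t q ^ k)"
proof -
 have e: "{y \<in> upp M N p. y \<succ> q} = upp M N q" if "q \<in> upp M N p" for q
  using that lat.trans by blast
 have "csum (\<succ>) (lval t) (upp M N p) (u @ [k])
  = (\<Sum>q\<in>upp M N p. csum (\<succ>) (lval t) {y \<in> upp M N p. y \<succ> q} u / lval t q ^ k)"
  by (subst lat.csum_append_Cons) simp_all
 also have "... = (\<Sum>q\<in>upp M N p. csum (\<succ>) (lval t) (upp M N q) u / lval t q ^ k)"
  by (intro sum.cong refl) (simp only: e)
 finally show ?thesis unfolding tu_def .
qed

lemma wrd_split: "wrd (u @ k # ks) M N t = (\<Sum>p\<in>posbox M N. tu u M N t p / lval t p ^ k * vl ks M N t p)"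
 unfolding wrd_def vl_def tu_def by (subst lat.csum_append_Cons) auto

inductive_set UU :: "(nat => nat => complex => int \<times> int => complex) set" where
 UU_tu: "ks \<in> mes_indices ==> tu ks \<in> UU"
| UU_zero: "(%M N t p. 0) \<in> UU"
| UU_add: "f \<in> UU ==> g \<in> UU ==> (%M N t p. f M N t p + g M N t p) \<in> UU"
| UU_scale: "f \<in> UU ==> (%M N t p. of_rat q * f M N t p) \<in> UU"

lemma UU_one: "(%M N t p. 1) \<in> UU"
proof -
 have "tu [] = (%M N t p. 1)" by (simp add: fun_eq_iff)
 then show ?thesis using UU_tu[of "[]"] by simp
qed

lemma UU_of_nat: "f \<in> UU ==> (%M N t p. of_nat n * f M N t p) \<in> UU"
 using UU_scale[of f "of_nat n"] by simp

lemma UU_diff: "f \<in> UU ==> g \<in> UU ==> (%M N t p. f M N t p - g M N t p) \<in> UU"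
 using UU_add[OF _ UU_scale, of f g "-1"] by simp

lemma UU_up:
 assumes "g \<in> UU" "2 \<le> k"
 shows "(%M N t p. \<Sum>q\<in>upp M N p. g M N t q / lval t q ^ k) \<in> UU"
 using assms(1)
proof (induction rule: UU.induct)
 case (UU_tu ks)
 have "tu (ks @ [k]) \<in> UU" using UU_tu assms(2) by (intro UU.UU_tu) simp
 moreover have "tu (ks @ [k]) = (%M N t p. \<Sum>q\<in>upp M N p. tu ks M N t q / lval t q ^ k)"
  by (simp add: fun_eq_iff tu_snoc)
 ultimately show ?case by simp
next
 case (UU_scale f q)
 show ?case using UU.UU_scale[OF UU_scale.IH, of q] by (simp add: sum_distrib_left)
qed (auto simp: sum.distrib add_divide_distrib intro: UU.intros)

lemma UU_sum:
 assumes "g \<in> UU" "2 \<le> k" "ks \<in> mes_indices"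
 shows "(%M N t. \<Sum>p\<in>posbox M N. g M N t p / lval t p ^ k * vl ks M N t p) \<in> EE"
 using assms(1)
proof (induction rule: UU.induct)
 case (UU_tu u)
 have "wrd (u @ k # ks) \<in> EE" using UU_tu assms by (intro EE_wrd) simp
 moreover have "wrd (u @ k # ks) = (%M N t. \<Sum>p\<in>posbox M N. tu u M N t p / lval t p ^ k * vl ks M N t p)"
  by (simp add: fun_eq_iff wrd_split)
 ultimately show ?case by simp
next
 case (UU_scale f q)
 show ?case using EE_scale[OF UU_scale.IH, of q] by (simp add: sum_distrib_left mult.assoc)
qed (auto simp: sum.distrib add_divide_distrib distrib_right intro: EE.intros)

lemma sum_low_upp:
 fixes f :: "int \<times> int => int \<times> int => complex"
 shows "(\<Sum>s\<in>posbox M N. \<Sum>l\<in>low M N s. f s l) = (\<Sum>l\<in>posbox M N. \<Sum>s\<in>upp M N l. f s l)"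
 by (rule lat.sum_upper_lower) simp

lemma UU_sum2:
 assumes "g \<in> UU" "2 \<le> a" "2 \<le> b" "ks \<in> mes_indices"
 shows "(%M N t. \<Sum>s\<in>posbox M N. \<Sum>l\<in>low M N s. g M N t s / lval t s ^ a * (vl ks M N t l / lval t l ^ b)) \<in> EE"
proof -
 have "(%M N t. \<Sum>p\<in>posbox M N. (\<Sum>q\<in>upp M N p. g M N t q / lval t q ^ a) / lval t p ^ b * vl ks M N t p) \<in> EE"
  by (rule UU_sum[OF UU_up[OF assms(1,2)] assms(3,4)])
 moreover have "(\<Sum>p\<in>posbox M N. (\<Sum>q\<in>upp M N p. g M N t q / lval t q ^ a) / lval t p ^ b * vl ks M N t p)
  = (\<Sum>s\<in>posbox M N. \<Sum>l\<in>low M N s. g M N t s / lval t s ^ a * (vl ks M N t l / lval t l ^ b))" for M N t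
  unfolding sum_low_upp by (intro sum.cong refl) (simp add: sum_distrib_right sum_divide_distrib)
 ultimately show ?thesis by simp
qed

lemma UU_sum3:
 assumes "g \<in> UU" "2 \<le> a" "2 \<le> b" "ks \<in> mes_indices"
 shows "(%M N t. \<Sum>s\<in>posbox M N. \<Sum>l\<in>low M N s. g M N t s / lval t s ^ a
  * (\<Sum>r\<in>{r\<in>posbox M N. s \<succ> r \<and> r \<succ> l}. 1 / (lval t r)\<^sup>2) * (vl ks M N t l / lval t l ^ b)) \<in> EE"
proof -
 let ?g = "%M N t p. \<Sum>q\<in>upp M N p. g M N t q / lval t q ^ a"
 have "(%M N t. \<Sum>s\<in>posbox M N. \<Sum>l\<in>low M N s. ?g M N t s / lval t s ^ 2 * (vl ks M N t l / lval t l ^ b)) \<in> EE"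
  by (rule UU_sum2[OF UU_up[OF assms(1,2)] _ assms(3,4)]) simp
 moreover have "(\<Sum>s\<in>posbox M N. \<Sum>l\<in>low M N s. ?g M N t s / lval t s ^ 2 * (vl ks M N t l / lval t l ^ b))
  = (\<Sum>s\<in>posbox M N. \<Sum>l\<in>low M N s. g M N t s / lval t s ^ a
  * (\<Sum>r\<in>{r\<in>posbox M N. s \<succ> r \<and> r \<succ> l}. 1 / (lval t r)\<^sup>2) * (vl ks M N t l / lval t l ^ b))" for M N t
 proof -
  let ?f = "%q s l. g M N t q / lval t q ^ a / lval t s ^ 2 * (vl ks M N t l / lval t l ^ b)"
  have "(\<Sum>s\<in>posbox M N. \<Sum>l\<in>low M N s. ?g M N t s / lval t s ^ 2 * (vl ks M N t l / lval t l ^ b))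
   = (\<Sum>s\<in>posbox M N. \<Sum>q\<in>upp M N s. \<Sum>l\<in>low M N s. ?f q s l)"
   by (rule sum.cong[OF refl], simp add: sum_distrib_right sum_divide_distrib, rule sum.swap)
  also have "... = (\<Sum>q\<in>posbox M N. \<Sum>s\<in>low M N q. \<Sum>l\<in>low M N s. ?f q s l)"
   by (rule sum_low_upp[symmetric])
  also have "... = (\<Sum>q\<in>posbox M N. \<Sum>l\<in>low M N q. \<Sum>s\<in>{r\<in>posbox M N. q \<succ> r \<and> r \<succ> l}. ?f q s l)"
   by (rule lat.sum_triple_swap) simp
  finally show ?thesis by (simp add: sum_distrib_left sum_distrib_right mult_ac)
 qed
 ultimately show ?thesis by simp
qed

section \<open>Boundary errors of the truncation\<close>

definition ell :: "nat => real" where "ell N = 1 + ln (real N)"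

lemma ell_ge1: "1 \<le> N ==> 1 \<le> ell N"
 by (simp add: ell_def)

lemma sum_inv_le_ell:
 assumes "1 \<le> N" shows "(\<Sum>n=1..N. 1 / real n) \<le> ell N"
proof -
 obtain m where m: "N = Suc m" using assms by (cases N) auto
 have "harm (Suc m) - ln (Suc m) \<le> harm (Suc 0) - ln (Suc 0)"
  using decseqD[OF decseq_harm_diff_ln, of 0 m] by simp
 then show ?thesis
  unfolding m ell_def by (simp add: harm_def inverse_eq_divide)
qed

lemma sum_inv_abs:
 assumes "finite F" "!!n. n \<in> F ==> \<bar>n\<bar> \<le> int L" "1 \<le> L"
 shows "(\<Sum>n\<in>F. 1 / max 1 \<bar>real_of_int n\<bar>) \<le> 3 * ell L"
proof -
 let ?f = "%n::nat. 1 / max 1 (real n)"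
 have "(\<Sum>n\<in>F. 1 / max 1 \<bar>real_of_int n\<bar>) \<le> (\<Sum>n\<in>{- int L..int L}. 1 / max 1 \<bar>real_of_int n\<bar>)"
  using assms(2) by (intro sum_mono2) (force simp: abs_le_iff)+
 also have "... = (\<Sum>n\<in>{- int L..int L}. ?f (nat \<bar>n\<bar>))"
  by (intro sum.cong) auto
 also have "... = ?f 0 + 2 * (\<Sum>n=1..L. ?f n)" by (rule sum_int_symmetric_le)
 also have "(\<Sum>n=1..L. ?f n) = (\<Sum>n=1..L. 1 / real n)" by (intro sum.cong) auto
 also have "?f 0 + 2 * (\<Sum>n=1..L. 1 / real n) \<le> 3 * ell L"
  using sum_inv_le_ell[OF assms(3)] ell_ge1[OF assms(3)] by simp
 finally show ?thesis by simp
qed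

lemma sum_inv_window:
 assumes "finite F" "!!n. n \<in> F ==> int N - int S \<le> \<bar>n\<bar> \<and> \<bar>n\<bar> \<le> int N + int S" "S \<le> 2 * N" "1 \<le> N"
 shows "(\<Sum>n\<in>F. 1 / max 1 \<bar>real_of_int n\<bar>) \<le> 18 * (ell N / N) * (1 + real S)"
proof (cases "2 * S \<le> N")
 case True
 have "F \<subseteq> {int N - int S..int N + int S} \<union> {- int N - int S..- int N + int S}"
  using assms(2) by force
 then have "card F \<le> card ({int N - int S..int N + int S} \<union> {- int N - int S..- int N + int S})"
  by (intro card_mono) auto
 also have "... \<le> card {int N - int S..int N + int S} + card {- int N - int S..- int N + int S}"
  by (rule card_Un_le)
 also have "... = 4 * S + 2" by (simp add: nat_add_distrib)
 finally have card: "card F \<le> 4 * S + 2" .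
 have "(\<Sum>n\<in>F. 1 / max 1 \<bar>real_of_int n\<bar>) \<le> (\<Sum>n\<in>F. 2 / N)"
 proof (rule sum_mono)
  fix n assume "n \<in> F"
  then have "int N \<le> 2 * \<bar>n\<bar>" using assms(2)[of n] True by linarith
  then have "real N \<le> 2 * max 1 \<bar>real_of_int n\<bar>" by linarith
  then show "1 / max 1 \<bar>real_of_int n\<bar> \<le> 2 / N" using assms(4) by (simp add: field_simps)
 qed
 also have "... = card F * (2 / N)" by simp
 also have "... \<le> (4 * real S + 2) * (2 / N)"
  using card by (intro mult_right_mono) auto
 also have "... \<le> 18 * (1 + real S) * (1 / N)" by (simp add: divide_right_mono)
 also have "... \<le> 18 * (1 + real S) * (ell N / N)"
  using ell_ge1[OF assms(4)] by (intro mult_left_mono divide_right_mono) auto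
 finally show ?thesis by (simp add: mult_ac)
next
 case False
 have "(\<Sum>n\<in>F. 1 / max 1 \<bar>real_of_int n\<bar>) \<le> 3 * ell (3 * N)"
  by (rule sum_inv_abs) (use assms in \<open>force+\<close>)
 also have "ell (3 * N) = ell N + ln 3" using assms(4) by (simp add: ell_def ln_mult)
 also have "ln 3 \<le> (2::real)" using ln_add_one_self_le_self[of 2] by simp
 finally have "(\<Sum>n\<in>F. 1 / max 1 \<bar>real_of_int n\<bar>) \<le> 9 * ell N" using ell_ge1[OF assms(4)] by simp
 also have "9 * ell N = 18 * (ell N / N) * (N / 2)" using assms(4) by simp
 also have "... \<le> 18 * (ell N / N) * (1 + real S)"
  using ell_ge1[OF assms(4)] False by (intro mult_left_mono) auto
 finally show ?thesis .
qed

lemma lattice_sym_diff: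
 assumes A: "1 \<le> A" "t \<in> KA A" and fin: "finite T1" "finite T2" and S: "S \<le> 2 * N" "1 \<le> N" and j: "1 \<le> j"
  and D: "!!p. p \<in> (T1 - T2) \<union> (T2 - T1) ==> 0 \<le> fst p \<and> fst p < int M \<and> p \<noteq> (0, 0)
   \<and> int N - int S \<le> \<bar>snd p\<bar> \<and> \<bar>snd p\<bar> \<le> int N + int S"
 shows "norm ((\<Sum>p\<in>T1. 1 / lval t p ^ j) - (\<Sum>p\<in>T2. 1 / lval t p ^ j))
  \<le> (M * KK A ^ j * 18) * (ell N / N) * (1 + real S)"
proof -
 define D where "D = (T1 - T2) \<union> (T2 - T1)"
 have finD: "finite D" using fin by (simp add: D_def)
 have "(\<Sum>p\<in>T1. 1 / lval t p ^ j) - (\<Sum>p\<in>T2. 1 / lval t p ^ j)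
   = (\<Sum>p\<in>T1 - T2. 1 / lval t p ^ j) - (\<Sum>p\<in>T2 - T1. 1 / lval t p ^ j)"
  using sum.Int_Diff[OF fin(1), of "%p. 1 / lval t p ^ j" T2] sum.Int_Diff[OF fin(2), of "%p. 1 / lval t p ^ j" T1]
  by (simp add: Int_commute)
 also have "norm ... \<le> (\<Sum>p\<in>T1 - T2. norm (1 / lval t p ^ j)) + (\<Sum>p\<in>T2 - T1. norm (1 / lval t p ^ j))"
  by (intro order_trans[OF norm_triangle_ineq4] add_mono sum_norm_le) auto
 also have "... = (\<Sum>p\<in>D. norm (1 / lval t p ^ j))"
  unfolding D_def using fin by (intro sum.union_disjoint[symmetric]) auto
 also have "... \<le> (\<Sum>p\<in>D. KK A ^ j * (1 / max 1 \<bar>real_of_int (snd p)\<bar>))"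
 proof (rule sum_mono)
  fix p assume "p \<in> D"
  then have "p \<noteq> (0, 0)" using D unfolding D_def by blast
  then obtain m n where p: "p = (m, n)" "(m, n) \<noteq> (0, 0)" by (cases p) auto
  have "norm (1 / lval t p ^ j) \<le> KK A ^ j / mx m n ^ j" unfolding p(1) by (rule norm_inv_lval[OF A p(2)])
  also have "... \<le> KK A ^ j / max 1 \<bar>real_of_int n\<bar>"
  proof (intro divide_left_mono)
   have "max 1 \<bar>real_of_int n\<bar> \<le> mx m n ^ 1" by (simp add: mx_def)
   also have "... \<le> mx m n ^ j" using mx_ge1[of m n] j by (intro power_increasing) auto
   finally show "max 1 \<bar>real_of_int n\<bar> \<le> mx m n ^ j" .
  qed (use KK_ge1[of A] mx_ge1[of m n] in auto)
  finally show "norm (1 / lval t p ^ j) \<le> KK A ^ j * (1 / max 1 \<bar>real_of_int (snd p)\<bar>)" by (simp add: p)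
 qed
 also have "... \<le> (\<Sum>p\<in>(SIGMA m:{0..<int M}. {n. (m, n) \<in> D}). KK A ^ j * (1 / max 1 \<bar>real_of_int (snd p)\<bar>))"
 proof (rule sum_mono2)
  have "finite {n. (m, n) \<in> D}" for m
   by (rule finite_subset[of _ "snd ` D"]) (use finD in force)+
  then show "finite (SIGMA m:{0..<int M}. {n. (m, n) \<in> D})" by auto
  show "D \<subseteq> (SIGMA m:{0..<int M}. {n. (m, n) \<in> D})"
  proof
   fix x assume "x \<in> D"
   then show "x \<in> (SIGMA m:{0..<int M}. {n. (m, n) \<in> D})" using D[of x] unfolding D_def[symmetric] by (cases x) auto
  qed
 qed (use KK_ge1[of A] in auto)
 also have "... = (\<Sum>m\<in>{0..<int M}. \<Sum>n\<in>{n. (m, n) \<in> D}. KK A ^ j * (1 / max 1 \<bar>real_of_int n\<bar>))"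
 proof -
  have "finite {n. (m, n) \<in> D}" for m
   by (rule finite_subset[of _ "snd ` D"]) (use finD in force)+
  then show ?thesis by (subst sum.Sigma) (auto simp: case_prod_unfold)
 qed
 also have "... \<le> (\<Sum>m\<in>{0..<int M}. KK A ^ j * (18 * (ell N / N) * (1 + real S)))"
 proof (rule sum_mono)
  fix m
  have "finite {n. (m, n) \<in> D}"
   by (rule finite_subset[of _ "snd ` D"]) (use finD in force)+
  moreover have "int N - int S \<le> \<bar>n\<bar> \<and> \<bar>n\<bar> \<le> int N + int S" if "n \<in> {n. (m, n) \<in> D}" for n
   using D[of "(m, n)"] that unfolding D_def by auto
  ultimately have "(\<Sum>n\<in>{n. (m, n) \<in> D}. 1 / max 1 \<bar>real_of_int n\<bar>) \<le> 18 * (ell N / N) * (1 + real S)"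
   by (rule sum_inv_window[OF _ _ S])
  then show "(\<Sum>n\<in>{n. (m, n) \<in> D}. KK A ^ j * (1 / max 1 \<bar>real_of_int n\<bar>)) \<le> KK A ^ j * (18 * (ell N / N) * (1 + real S))"
   unfolding sum_distrib_left[symmetric] using KK_ge1[of A] by (intro mult_left_mono) auto
 qed
 also have "... = (M * KK A ^ j * 18) * (ell N / N) * (1 + real S)"
  by (simp only: sum_constant card_atLeastLessThan_int) simp
 finally show ?thesis .
qed

lemma lval_diff: "lval t (p - q) = lval t p - lval t q"
 by (simp add: lval_def algebra_simps)

lemma lval_0 [simp]: "lval t (0, 0) = 0"
 by (simp add: lval_def)

lemma mem_posbox: "(a, b) \<in> posbox M N \<longleftrightarrow> 0 \<le> a \<and> a < int M \<and> \<bar>b\<bar> < int N \<and> (0 < a \<or> 0 < b)"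
 by (auto simp: posbox_def lat_box_def)

definition dlt :: "nat => nat => nat => complex => int \<times> int => int \<times> int => complex" where
 "dlt j M N t s n = (\<Sum>r\<in>{r\<in>posbox M N. s \<succ> r \<and> r \<succ> n}. 1 / (lval t r - lval t n) ^ j - 1 / (lval t s - lval t r) ^ j)"

lemma dlt_bound:
 assumes A: "1 \<le> A" "t \<in> KA A" and s: "s \<in> posbox M N" and n: "n \<in> posbox M N \<or> n = (0, 0)" and j: "1 \<le> j"
 shows "norm (dlt j M N t s n) \<le> (M * KK A ^ j * 18) * (ell N / N) * ((1 + \<bar>real_of_int (snd s)\<bar>) * (1 + \<bar>real_of_int (snd n)\<bar>))"
proof -
 obtain s1 s2 n1 n2 where e: "s = (s1, s2)" "n = (n1, n2)" by (cases s, cases n)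
 let ?B = "{r\<in>posbox M N. s \<succ> r \<and> r \<succ> n}"
 let ?S = "nat \<bar>s2\<bar> + nat \<bar>n2\<bar>"
 have N: "1 \<le> N" "\<bar>s2\<bar> < int N" "\<bar>n2\<bar> < int N" "0 \<le> n1" "0 \<le> s1" "s1 < int M" "0 < n1 \<or> 0 \<le> n2"
  using s n by (auto simp: e mem_posbox)
 have "dlt j M N t s n = (\<Sum>p\<in>(%r. r - n) ` ?B. 1 / lval t p ^ j) - (\<Sum>p\<in>(%r. s - r) ` ?B. 1 / lval t p ^ j)"
  unfolding dlt_def by (subst (1 2) sum.reindex) (auto simp: inj_on_def lval_diff sum_subtractf)
 also have "norm ... \<le> (M * KK A ^ j * 18) * (ell N / N) * (1 + real ?S)"
 proof (rule lattice_sym_diff[OF A _ _ _ N(1) j])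
  have 1: "(%r. r - n) ` ?B = {p. p \<succ> (0, 0) \<and> s - n \<succ> p \<and> \<bar>snd p + n2\<bar> < int N}"
  proof (intro equalityI subsetI)
   fix p assume p: "p \<in> {p. p \<succ> (0, 0) \<and> s - n \<succ> p \<and> \<bar>snd p + n2\<bar> < int N}"
   obtain a b where ab: "p = (a, b)" by (cases p)
   have "(a + n1, b + n2) \<in> ?B" using p N by (auto simp: ab e mem_posbox)
   then show "p \<in> (%r. r - n) ` ?B" by (intro image_eqI[of _ _ "(a + n1, b + n2)"]) (auto simp: ab e)
  qed (auto simp: e mem_posbox)
  have 2: "(%r. s - r) ` ?B = {p. p \<succ> (0, 0) \<and> s - n \<succ> p \<and> \<bar>s2 - snd p\<bar> < int N}"
  proof (intro equalityI subsetI)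
   fix p assume p: "p \<in> {p. p \<succ> (0, 0) \<and> s - n \<succ> p \<and> \<bar>s2 - snd p\<bar> < int N}"
   obtain a b where ab: "p = (a, b)" by (cases p)
   have "(s1 - a, s2 - b) \<in> ?B" using p N by (auto simp: ab e mem_posbox)
   then show "p \<in> (%r. s - r) ` ?B" by (intro image_eqI[of _ _ "(s1 - a, s2 - b)"]) (auto simp: ab e)
  qed (auto simp: e mem_posbox)
  fix p assume "p \<in> (%r. r - n) ` ?B - (%r. s - r) ` ?B \<union> ((%r. s - r) ` ?B - (%r. r - n) ` ?B)"
  then show "0 \<le> fst p \<and> fst p < int M \<and> p \<noteq> (0, 0) \<and> int N - int ?S \<le> \<bar>snd p\<bar> \<and> \<bar>snd p\<bar> \<le> int N + int ?S"
   unfolding 1 2 using N by (cases p) (auto simp: e)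
 qed (use N in auto)
 also have "... \<le> (M * KK A ^ j * 18) * (ell N / N) * ((1 + \<bar>real_of_int (snd s)\<bar>) * (1 + \<bar>real_of_int (snd n)\<bar>))"
  using KK_ge1[of A] ell_ge1[OF N(1)] by (intro mult_left_mono) (auto simp: e algebra_simps)
 finally show ?thesis .
qed

definition topd :: "nat => nat => nat => complex => int \<times> int => complex" where
 "topd j M N t l = (\<Sum>s\<in>upp M N l. 1 / (lval t s - lval t l) ^ j)
  - (\<Sum>p\<in>{p\<in>posbox M N. fst p < int M - fst l}. 1 / lval t p ^ j)"

lemma topd_bound:
 assumes A: "1 \<le> A" "t \<in> KA A" and l: "l \<in> posbox M N" and j: "1 \<le> j"
 shows "norm (topd j M N t l) \<le> (M * KK A ^ j * 18) * (ell N / N) * (1 + \<bar>real_of_int (snd l)\<bar>)"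
proof -
 obtain l1 l2 where e: "l = (l1, l2)" by (cases l)
 have N: "1 \<le> N" "\<bar>l2\<bar> < int N" "0 \<le> l1" "l1 < int M" "0 < l1 \<or> 0 \<le> l2"
  using l by (auto simp: e mem_posbox)
 let ?T = "{p\<in>posbox M N. fst p < int M - fst l}"
 have "topd j M N t l = (\<Sum>p\<in>(%r. r - l) ` upp M N l. 1 / lval t p ^ j) - (\<Sum>p\<in>?T. 1 / lval t p ^ j)"
  unfolding topd_def by (subst (1) sum.reindex) (auto simp: inj_on_def lval_diff)
 also have "norm ... \<le> (M * KK A ^ j * 18) * (ell N / N) * (1 + real (nat \<bar>l2\<bar>))"
 proof (rule lattice_sym_diff[OF A _ _ _ N(1) j])
  have 1: "(%r. r - l) ` upp M N l = {p. p \<succ> (0, 0) \<and> fst p < int M - l1 \<and> \<bar>snd p + l2\<bar> < int N}"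
  proof (intro equalityI subsetI)
   fix p assume p: "p \<in> {p. p \<succ> (0, 0) \<and> fst p < int M - l1 \<and> \<bar>snd p + l2\<bar> < int N}"
   obtain a b where ab: "p = (a, b)" by (cases p)
   have "(a + l1, b + l2) \<in> upp M N l" using p N by (auto simp: ab e mem_posbox)
   then show "p \<in> (%r. r - l) ` upp M N l" by (intro image_eqI[of _ _ "(a + l1, b + l2)"]) (auto simp: ab e)
  qed (auto simp: e mem_posbox)
  fix p assume "p \<in> (%r. r - l) ` upp M N l - ?T \<union> (?T - (%r. r - l) ` upp M N l)"
  then show "0 \<le> fst p \<and> fst p < int M \<and> p \<noteq> (0, 0) \<and> int N - int (nat \<bar>l2\<bar>) \<le> \<bar>snd p\<bar> \<and> \<bar>snd p\<bar> \<le> int N + int (nat \<bar>l2\<bar>)"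
   unfolding 1 using N by (cases p) (auto simp: e mem_posbox)
 qed (use N in auto)
 finally show ?thesis by (simp add: e)
qed

definition wt :: "int \<times> int => real" where
 "wt p = 1 / (mx (fst p) (snd p))\<^sup>2"

definition wt1 :: "int \<times> int => real" where
 "wt1 p = (1 + \<bar>real_of_int (snd p)\<bar>) / (mx (fst p) (snd p))\<^sup>2"

lemma sum_posbox_levels:
 fixes f :: "int \<times> int => 'a::comm_monoid_add"
 shows "(\<Sum>p\<in>posbox M N. f p) = (\<Sum>m\<in>{0..<int M}. \<Sum>n\<in>{n. \<bar>n\<bar> < int N \<and> (m, n) \<succ> (0, 0)}. f (m, n))"
 unfolding posbox_eq_pset pset_Sigma by (subst sum.Sigma) (auto simp: case_prod_unfold)

lemma wt_nonneg: "0 \<le> wt p" "0 \<le> wt1 p"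
 by (simp_all add: wt_def wt1_def)

lemma sum_wt1: assumes "1 \<le> N" shows "(\<Sum>p\<in>posbox M N. wt1 p) \<le> 6 * real M * ell N"
proof -
 have 1: "(\<Sum>p\<in>posbox M N. wt1 p) \<le> (\<Sum>m\<in>{0..<int M}. 6 * ell N)"
  unfolding sum_posbox_levels
 proof (rule sum_mono)
  fix m
  let ?F = "{n. \<bar>n\<bar> < int N \<and> (m, n) \<succ> (0, 0)}"
  have "(\<Sum>n\<in>?F. wt1 (m, n)) \<le> (\<Sum>n\<in>?F. 2 * (1 / max 1 \<bar>real_of_int n\<bar>))"
  proof (rule sum_mono)
   fix n
   let ?x = "max 1 \<bar>real_of_int n\<bar>"
   have "wt1 (m, n) \<le> 2 * ?x / ?x\<^sup>2"
    unfolding wt1_def by (intro frac_le power_mono) (auto simp: mx_def)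
   also have "... = 2 * (1 / ?x)" by (simp add: power2_eq_square)
   finally show "wt1 (m, n) \<le> 2 * (1 / ?x)" .
  qed
  also have "... = 2 * (\<Sum>n\<in>?F. 1 / max 1 \<bar>real_of_int n\<bar>)" by (simp add: sum_distrib_left)
  also have "... \<le> 2 * (3 * ell N)"
   using assms by (intro mult_left_mono sum_inv_abs) auto
  finally show "(\<Sum>n\<in>?F. wt1 (m, n)) \<le> 6 * ell N" by simp
 qed
 also have "... = 6 * real M * ell N" by simp
 finally show ?thesis by simp
qed

lemma ell_tendsto: "(%N. C * (ell N ^ 3 / N)) \<longlonglongrightarrow> 0"
 unfolding ell_def by real_asymp

lemma nullf_double:
 assumes "!!t M. 0 < Im t ==> \<exists>C. \<forall>N\<ge>1. \<forall>s\<in>posbox M N. \<forall>n\<in>posbox M N.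
  norm (f M N t s n) \<le> C * (ell N / N) * (wt1 s * wt1 n)"
 shows "nullf (%M N t. \<Sum>s\<in>posbox M N. \<Sum>n\<in>low M N s. f M N t s n)"
proof (rule nullf_pointwise)
 fix t :: complex and M assume "0 < Im t"
 then obtain C where C: "!!N s n. 1 \<le> N ==> s \<in> posbox M N ==> n \<in> posbox M N ==>
  norm (f M N t s n) \<le> C * (ell N / N) * (wt1 s * wt1 n)" using assms by blast
 have "norm (\<Sum>s\<in>posbox M N. \<Sum>n\<in>low M N s. f M N t s n) \<le> (\<bar>C\<bar> * (6 * real M)\<^sup>2) * (ell N ^ 3 / N)" if N: "1 \<le> N" for N
 proof -
  let ?c = "\<bar>C\<bar> * (ell N / N)"
  have e0: "0 \<le> ell N / N" using ell_ge1[OF N] by simp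
  have "norm (\<Sum>s\<in>posbox M N. \<Sum>n\<in>low M N s. f M N t s n) \<le> (\<Sum>s\<in>posbox M N. \<Sum>n\<in>low M N s. ?c * (wt1 s * wt1 n))"
  proof (intro sum_norm_le)
   fix s n assume "s \<in> posbox M N" "n \<in> low M N s"
   then have "norm (f M N t s n) \<le> C * (ell N / N) * (wt1 s * wt1 n)" using C[OF N] by simp
   also have "... \<le> ?c * (wt1 s * wt1 n)" using wt_nonneg e0 by (intro mult_right_mono) auto
   finally show "norm (f M N t s n) \<le> ?c * (wt1 s * wt1 n)" .
  qed
  also have "... \<le> (\<Sum>s\<in>posbox M N. \<Sum>n\<in>posbox M N. ?c * (wt1 s * wt1 n))"
   using e0 wt_nonneg by (intro sum_mono sum_mono2 mult_nonneg_nonneg) auto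
  also have "... = ?c * ((\<Sum>s\<in>posbox M N. wt1 s) * (\<Sum>n\<in>posbox M N. wt1 n))"
   by (simp only: sum_product) (simp only: sum_distrib_left)
  also have "... \<le> ?c * ((6 * real M * ell N) * (6 * real M * ell N))"
   using e0 ell_ge1[OF N] by (intro mult_left_mono mult_mono sum_wt1 N sum_nonneg wt_nonneg) auto
  also have "... = (\<bar>C\<bar> * (6 * real M)\<^sup>2) * (ell N ^ 3 / N)" by (simp add: power2_eq_square power3_eq_cube)
  finally show ?thesis .
 qed
 then have "\<forall>\<^sub>F N in sequentially. norm (\<Sum>s\<in>posbox M N. \<Sum>n\<in>low M N s. f M N t s n) \<le> (\<bar>C\<bar> * (6 * real M)\<^sup>2) * (ell N ^ 3 / N)"
  using eventually_sequentially by blast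
 then show "(%N. \<Sum>s\<in>posbox M N. \<Sum>n\<in>low M N s. f M N t s n) \<longlonglongrightarrow> 0"
  by (rule Lim_null_comparison) (rule ell_tendsto)
qed

lemma nullf_single:
 assumes "!!t M. 0 < Im t ==> \<exists>C. \<forall>N\<ge>1. \<forall>s\<in>posbox M N.
  norm (f M N t s) \<le> C * (ell N / N) * wt1 s"
 shows "nullf (%M N t. \<Sum>s\<in>posbox M N. f M N t s)"
proof (rule nullf_pointwise)
 fix t :: complex and M assume "0 < Im t"
 then obtain C where C: "!!N s. 1 \<le> N ==> s \<in> posbox M N ==>
  norm (f M N t s) \<le> C * (ell N / N) * wt1 s" using assms by blast
 have "norm (\<Sum>s\<in>posbox M N. f M N t s) \<le> (\<bar>C\<bar> * (6 * real M)) * (ell N ^ 3 / N)" if N: "1 \<le> N" for N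
 proof -
  let ?c = "\<bar>C\<bar> * (ell N / N)"
  have e0: "0 \<le> ell N / N" using ell_ge1[OF N] by simp
  have "norm (\<Sum>s\<in>posbox M N. f M N t s) \<le> (\<Sum>s\<in>posbox M N. ?c * wt1 s)"
  proof (intro sum_norm_le)
   fix s n assume "s \<in> posbox M N"
   then have "norm (f M N t s) \<le> C * (ell N / N) * wt1 s" using C[OF N] by simp
   also have "... \<le> ?c * wt1 s" using wt_nonneg e0 by (intro mult_right_mono) auto
   finally show "norm (f M N t s) \<le> ?c * wt1 s" .
  qed
  also have "... = ?c * (\<Sum>s\<in>posbox M N. wt1 s)"
   by (simp add: sum_distrib_left)
  also have "... \<le> ?c * (6 * real M * ell N)"
   using e0 ell_ge1[OF N] by (intro mult_left_mono sum_wt1 N) auto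
  also have "... = (\<bar>C\<bar> * (6 * real M)) * (ell N ^ 2 / N)" by (simp add: power2_eq_square)
  also have "... \<le> (\<bar>C\<bar> * (6 * real M)) * (ell N ^ 3 / N)"
   using ell_ge1[OF N] by (intro mult_left_mono divide_right_mono power_increasing) auto
  finally show ?thesis .
 qed
 then have "\<forall>\<^sub>F N in sequentially. norm (\<Sum>s\<in>posbox M N. f M N t s) \<le> (\<bar>C\<bar> * (6 * real M)) * (ell N ^ 3 / N)"
  using eventually_sequentially by blast
 then show "(%N. \<Sum>s\<in>posbox M N. f M N t s) \<longlonglongrightarrow> 0"
  by (rule Lim_null_comparison) (rule ell_tendsto)
qed

type_synonym pfam = "nat => nat => complex => int \<times> int => complex"

definition bnd :: "pfam => bool" where
 "bnd f \<longleftrightarrow> (\<forall>t M. 0 < Im t \<longrightarrow> (\<exists>C. \<forall>N. \<forall>p. norm (f M N t p) \<le> C))"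

definition bnd2 :: "pfam => bool" where
 "bnd2 f \<longleftrightarrow> (\<forall>t M. 0 < Im t \<longrightarrow> (\<exists>C. \<forall>N. \<forall>p\<in>posbox M N. norm (f M N t p) \<le> C * wt p))"

lemma csum_subset_bound:
 assumes "1 \<le> A" "t \<in> KA A" "ks \<in> mes_indices" "F \<subseteq> posbox M N"
 shows "norm (csum R (lval t) F ks) \<le> SS A {0..<int M} ks ^ length ks"
proof (rule csum_bound_power)
 show "finite F" using assms(4) finite_posbox finite_subset by blast
 fix k assume "k \<in> set ks"
 have "(\<Sum>x\<in>F. norm (1 / lval t x ^ k)) \<le> (\<Sum>x\<in>posbox M N. norm (1 / lval t x ^ k))"
  using assms(4) by (intro sum_mono2) auto
 also have "... \<le> SS A {0..<int M} ks"
  unfolding posbox_eq_pset by (rule sum_pset_le_SS) (use assms \<open>k \<in> set ks\<close> in auto)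
 finally show "(\<Sum>x\<in>F. norm (1 / lval t x ^ k)) \<le> SS A {0..<int M} ks" .
qed

lemma bnd_csum:
 assumes "ks \<in> mes_indices" "!!M N p. F M N p \<subseteq> posbox M N"
 shows "bnd (%M N t p. csum (\<succ>) (lval t) (F M N p) ks)"
 unfolding bnd_def
proof (intro allI impI)
 fix t M assume t: "0 < Im (t::complex)"
 then obtain A where A: "1 \<le> A" "t \<in> KA A" using ex_KA[OF t] by blast
 show "\<exists>C. \<forall>N p. cmod (csum (\<succ>) (lval t) (F M N p) ks) \<le> C"
  using csum_subset_bound[OF A assms] by blast
qed

lemma bnd_vl: "ks \<in> mes_indices ==> bnd (vl ks)"
 using bnd_csum[of ks low] by (simp add: vl_def[abs_def])

lemma bnd_tu: "ks \<in> mes_indices ==> bnd (tu ks)"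
 using bnd_csum[of ks upp] by (simp add: tu_def[abs_def])

lemma bnd_const: "bnd (%M N t p. c)"
 unfolding bnd_def by auto

lemma bnd_add:
 assumes "bnd f" "bnd g" shows "bnd (%M N t p. f M N t p + g M N t p)"
 unfolding bnd_def
proof (intro allI impI)
 fix t M assume "0 < Im (t::complex)"
 then obtain C C' where C: "!!N p. norm (f M N t p) \<le> C" "!!N p. norm (g M N t p) \<le> C'"
  using assms unfolding bnd_def by meson
 then show "\<exists>C. \<forall>N p. norm (f M N t p + g M N t p) \<le> C"
  by (intro exI[of _ "C + C'"] allI norm_triangle_mono)
qed

lemma bnd_mult:
 assumes "bnd f" "bnd g" shows "bnd (%M N t p. f M N t p * g M N t p)"
 unfolding bnd_def
proof (intro allI impI)
 fix t M assume "0 < Im (t::complex)"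
 then obtain C C' where C: "!!N p. norm (f M N t p) \<le> C" "!!N p. norm (g M N t p) \<le> C'"
  using assms unfolding bnd_def by meson
 have "0 \<le> C" using order_trans[OF norm_ge_zero C(1)] .
 with C show "\<exists>C. \<forall>N p. norm (f M N t p * g M N t p) \<le> C"
  by (intro exI[of _ "C * C'"] allI) (simp add: norm_mult mult_mono)
qed

lemma bnd_UU: "g \<in> UU ==> bnd g"
 by (induction rule: UU.induct) (auto intro: bnd_tu bnd_const bnd_add bnd_mult)

lemma bnd2_div:
 assumes "bnd f" "2 \<le> k" shows "bnd2 (%M N t p. f M N t p / lval t p ^ k)"
 unfolding bnd2_def
proof (intro allI impI)
 fix t M assume t: "0 < Im (t::complex)"
 then obtain C where C: "!!N p. norm (f M N t p) \<le> C"
  using assms unfolding bnd_def by meson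
 obtain A where A: "1 \<le> A" "t \<in> KA A" using ex_KA[OF t] by blast
 have "norm (f M N t p / lval t p ^ k) \<le> (C * KK A ^ k) * wt p" if "p \<in> posbox M N" for N p
 proof -
  obtain m n where p: "p = (m, n)" by (cases p)
  have "(m, n) \<noteq> (0, 0)" using that by (auto simp: p mem_posbox)
  then have "norm (1 / lval t p ^ k) \<le> KK A ^ k / mx m n ^ k" unfolding p by (rule norm_inv_lval[OF A])
  also have "... \<le> KK A ^ k / mx m n ^ 2"
   using mx_ge1[of m n] assms(2) KK_ge1[of A] by (intro divide_left_mono power_increasing) auto
  finally have "norm (f M N t p) * norm (1 / lval t p ^ k) \<le> C * (KK A ^ k / mx m n ^ 2)"
   by (intro mult_mono C order_trans[OF norm_ge_zero C]) auto
  then show ?thesis by (simp add: wt_def p norm_divide)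
 qed
 then show "\<exists>C. \<forall>N. \<forall>p\<in>posbox M N. norm (f M N t p / lval t p ^ k) \<le> C * wt p" by blast
qed

lemma bnd2_diff:
 assumes "bnd2 f" "bnd2 g" shows "bnd2 (%M N t p. f M N t p - g M N t p)"
 unfolding bnd2_def
proof (intro allI impI)
 fix t M assume "0 < Im (t::complex)"
 then obtain C C' where C: "!!N p. p \<in> posbox M N ==> norm (f M N t p) \<le> C * wt p" "!!N p. p \<in> posbox M N ==> norm (g M N t p) \<le> C' * wt p"
  using assms unfolding bnd2_def by meson
 have "norm (f M N t p - g M N t p) \<le> (C + C') * wt p" if "p \<in> posbox M N" for N p
  using norm_triangle_ineq4[of "f M N t p" "g M N t p"] C[OF that] by (simp add: distrib_right)
 then show "\<exists>C. \<forall>N. \<forall>p\<in>posbox M N. norm (f M N t p - g M N t p) \<le> C * wt p"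
  by blast
qed

lemma nullf_dlt:
 assumes "bnd2 h" "bnd2 w" "1 \<le> j"
 shows "nullf (%M N t. \<Sum>s\<in>posbox M N. \<Sum>n\<in>low M N s. h M N t s * dlt j M N t s n * w M N t n)"
proof (rule nullf_double)
 fix t M assume t: "0 < Im (t::complex)"
 then obtain C C' where C: "!!N p. p \<in> posbox M N ==> norm (h M N t p) \<le> C * wt p" "!!N p. p \<in> posbox M N ==> norm (w M N t p) \<le> C' * wt p"
  using assms unfolding bnd2_def by meson
 obtain A where A: "1 \<le> A" "t \<in> KA A" using ex_KA[OF t] by blast
 have "norm (h M N t s * dlt j M N t s n * w M N t n) \<le> (C * C' * (M * KK A ^ j * 18)) * (ell N / N) * (wt1 s * wt1 n)"
  if "1 \<le> N" and s: "s \<in> posbox M N" and n: "n \<in> posbox M N" for N s n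
 proof -
  have "norm (h M N t s * dlt j M N t s n * w M N t n) = norm (h M N t s) * norm (dlt j M N t s n) * norm (w M N t n)"
   by (simp add: norm_mult)
  also have "... \<le> (C * wt s) * ((M * KK A ^ j * 18) * (ell N / N) * ((1 + \<bar>real_of_int (snd s)\<bar>) * (1 + \<bar>real_of_int (snd n)\<bar>))) * (C' * wt n)"
   using dlt_bound[OF A s disjI1[OF n] assms(3)] C(1)[OF s] C(2)[OF n]
   by (intro mult_mono mult_nonneg_nonneg[OF order_trans[OF norm_ge_zero C(1)[OF s]]] order_trans[OF norm_ge_zero C(1)[OF s]]
     order_trans[OF norm_ge_zero dlt_bound[OF A s disjI1[OF n] assms(3)]]) auto
  also have "... = (C * C' * (M * KK A ^ j * 18)) * (ell N / N) * (wt1 s * wt1 n)"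
   by (simp only: wt_def wt1_def times_divide_eq_left times_divide_eq_right divide_divide_eq_left) (simp only: mult_ac mult_1)
  finally show ?thesis .
 qed
 then show "\<exists>C. \<forall>N\<ge>1. \<forall>s\<in>posbox M N. \<forall>n\<in>posbox M N. norm (h M N t s * dlt j M N t s n * w M N t n) \<le> C * (ell N / N) * (wt1 s * wt1 n)"
  by blast
qed

lemma nullf_weighted:
 assumes "bnd2 h" "!!t M. 0 < Im t ==> \<exists>C. \<forall>N\<ge>1. \<forall>s\<in>posbox M N. norm (e M N t s) \<le> C * (ell N / N) * (1 + \<bar>real_of_int (snd s)\<bar>)"
 shows "nullf (%M N t. \<Sum>s\<in>posbox M N. e M N t s * h M N t s)"
proof (rule nullf_single)
 fix t M assume t: "0 < Im (t::complex)"
 then obtain C where C: "!!N p. p \<in> posbox M N ==> norm (h M N t p) \<le> C * wt p"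
  using assms(1) unfolding bnd2_def by meson
 obtain C' where C': "!!N s. 1 \<le> N ==> s \<in> posbox M N ==> norm (e M N t s) \<le> C' * (ell N / N) * (1 + \<bar>real_of_int (snd s)\<bar>)"
  using assms(2)[OF t] by blast
 have "norm (e M N t s * h M N t s) \<le> (C' * C) * (ell N / N) * wt1 s" if "1 \<le> N" "s \<in> posbox M N" for N s
 proof -
  have "norm (e M N t s * h M N t s) \<le> (C' * (ell N / N) * (1 + \<bar>real_of_int (snd s)\<bar>)) * (C * wt s)"
   unfolding norm_mult using C'[OF that] C[OF that(2)]
   by (intro mult_mono order_trans[OF norm_ge_zero C'[OF that]]) auto
  also have "... = (C' * C) * (ell N / N) * wt1 s" by (simp add: wt_def wt1_def)
  finally show ?thesis .
 qed
 then show "\<exists>C. \<forall>N\<ge>1. \<forall>s\<in>posbox M N. norm (e M N t s * h M N t s) \<le> C * (ell N / N) * wt1 s" by blast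
qed

lemma nullf_dlt0:
 assumes "bnd2 h" "1 \<le> j"
 shows "nullf (%M N t. \<Sum>s\<in>posbox M N. dlt j M N t s (0, 0) * h M N t s)"
proof (rule nullf_weighted[OF assms(1)])
 fix t M assume t: "0 < Im (t::complex)"
 then obtain A where A: "1 \<le> A" "t \<in> KA A" using ex_KA[OF t] by blast
 show "\<exists>C. \<forall>N\<ge>1. \<forall>s\<in>posbox M N. norm (dlt j M N t s (0, 0)) \<le> C * (ell N / N) * (1 + \<bar>real_of_int (snd s)\<bar>)"
  using dlt_bound[OF A _ disjI2[OF refl] assms(2), of _ M]
  by (intro exI[of _ "M * KK A ^ j * 18"]) simp
qed

lemma nullf_topd:
 assumes "bnd2 h" "1 \<le> j"
 shows "nullf (%M N t. \<Sum>s\<in>posbox M N. topd j M N t s * h M N t s)"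
proof (rule nullf_weighted[OF assms(1)])
 fix t M assume t: "0 < Im (t::complex)"
 then obtain A where A: "1 \<le> A" "t \<in> KA A" using ex_KA[OF t] by blast
 show "\<exists>C. \<forall>N\<ge>1. \<forall>s\<in>posbox M N. norm (topd j M N t s) \<le> C * (ell N / N) * (1 + \<bar>real_of_int (snd s)\<bar>)"
  using topd_bound[OF A _ assms(2), of _ M]
  by (intro exI[of _ "M * KK A ^ j * 18"]) simp
qed

section \<open>The derivative of a truncated word\<close>

definition hh :: pfam where
 "hh M N t p = (\<Sum>q\<in>low M N p. 1 / lval t q)"

text \<open>The weights \<open>\<omega>\<close> mark one letter of the word; for \<open>\<omega> (m, n) = - m\<close> this is the derivative in \<open>t\<close>.\<close>

fun DM :: "pfam => nat => nat => complex => (int \<times> int => complex) => nat list => complex" where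
 "DM \<omega> M N t g [] = 0"
| "DM \<omega> M N t g (k # ks) = (\<Sum>p\<in>posbox M N. \<omega> M N t p * (of_nat k * g p / lval t p ^ (k + 1) * vl ks M N t p))
  + DM \<omega> M N t (%p. \<Sum>q\<in>upp M N p. g q / lval t q ^ k) ks"

lemma LL_cong: "f \<in> LL ==> (!!M N t. 0 < Im t ==> g M N t = f M N t) ==> g \<in> LL"
 by (rule LL_cong_null) (auto intro!: nullf_pointwise)

lemma posbox_nz: "p \<in> posbox M N ==> p \<noteq> (0, 0)"
 by (cases p) (auto simp: mem_posbox)

lemma lval_posbox_nz: "0 < Im t ==> p \<in> posbox M N ==> lval t p \<noteq> 0"
 using lval_nz posbox_nz by blast

lemma lval_inj: "0 < Im t ==> p \<noteq> q ==> lval t p \<noteq> lval t q"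
 using lval_nz[of t "p - q"] by (auto simp: lval_diff prod_eq_iff zero_prod_def)

lemma lval_gt: "0 < Im t ==> p \<succ> q ==> lval t p \<noteq> lval t q"
 using lval_inj lat.irrefl by metis

lemma low_between_0: "{r \<in> posbox M N. s \<succ> r \<and> r \<succ> (0, 0)} = low M N s"
 by (auto simp: posbox_def)

lemma low_split:
 assumes "n \<in> low M N s"
 shows "low M N s = {r \<in> posbox M N. s \<succ> r \<and> r \<succ> n} \<union> insert n (low M N n)"
proof
 show "low M N s \<subseteq> {r \<in> posbox M N. s \<succ> r \<and> r \<succ> n} \<union> insert n (low M N n)"
  using lat.total by blast
 show "{r \<in> posbox M N. s \<succ> r \<and> r \<succ> n} \<union> insert n (low M N n) \<subseteq> low M N s"
  using assms lat.trans by blast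
qed

lemma hh_between:
 assumes "n \<in> low M N s"
 shows "(\<Sum>r\<in>{r\<in>posbox M N. s \<succ> r \<and> r \<succ> n}. 1 / lval t r) = hh M N t s - hh M N t n - 1 / lval t n"
proof -
 have "hh M N t s = (\<Sum>r\<in>{r\<in>posbox M N. s \<succ> r \<and> r \<succ> n}. 1 / lval t r) + (\<Sum>r\<in>insert n (low M N n). 1 / lval t r)"
  unfolding hh_def by (subst low_split[OF assms], rule sum.union_disjoint) (auto simp del: lat_gt.simps simp: lat.irrefl dest: lat.asym)
 also have "(\<Sum>r\<in>insert n (low M N n). 1 / lval t r) = 1 / lval t n + hh M N t n"
  unfolding hh_def using lat.irrefl by (subst sum.insert) (auto simp del: lat_gt.simps)
 finally show ?thesis by simp
qed

lemma Cs_EE: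
 assumes "g \<in> UU" "g1 \<in> UU" "ks \<in> mes_indices"
 shows "(%M N t. Cs (\<succ>) (lval t) (posbox M N) (g M N t) (g1 M N t) k (vl ks M N t)) \<in> EE"
 unfolding Cs_def
 by (intro EE_sum EE_diff EE_of_nat UU_sum2 assms) auto

lemma LL_comb:
 assumes "c \<in> LL" "i \<in> LL" "e1 \<in> LL" "e2 \<in> LL" "r1 \<in> LL" "r2 \<in> LL" "s \<in> LL"
 shows "(%M N t. i M N t + c M N t - e1 M N t - of_nat 2 * (r1 M N t - of_nat k * r2 M N t) - s M N t + e2 M N t) \<in> LL"
 by (intro LL_add LL_diff LL_of_nat assms)

lemma master_algebra:
 fixes X' :: complex
 assumes "X' - Y = E1 - 2 * P + 2 * Q + 2 * R + S - E2" "P = P1 - P3"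
 shows "Y + C - 2 * P1 + 2 * (P3 + D) = X' - 2 * Q + 2 * D + C - E1 - of_nat 2 * R - S + E2"
proof -
 have "Y = X' - (E1 - 2 * P + 2 * Q + 2 * R + S - E2)" using assms(1) by (metis diff_diff_eq2 diff_add_cancel add_diff_cancel_left')
 then show ?thesis unfolding assms(2) by (simp add: algebra_simps)
qed

lemma master:
 assumes "ks \<in> mes_indices" "2 \<le> k" "g \<in> UU" "g1 \<in> UU"
 shows "(%M N t. Xs (\<succ>) (lval t) (posbox M N) (g M N t) (g1 M N t) k (vl ks M N t)
  - 2 * (\<Sum>p\<in>posbox M N. hh M N t p * (g1 M N t p / lval t p ^ k * vl ks M N t p))
  + 2 * DM hh M N t (g M N t) (k # ks)) \<in> LL"
 using assms
proof (induction ks arbitrary: k g g1)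
 case Nil
 define h where "h = (%M N t p. g M N t p / lval t p ^ k)"
 define h1 where "h1 = (%M N t p. g1 M N t p / lval t p ^ k - of_nat k * g M N t p / lval t p ^ (k + 1))"
 let ?C = "%M N t. Cs (\<succ>) (lval t) (posbox M N) (g M N t) (g1 M N t) k (vl [] M N t)"
 let ?S = "%M N t. \<Sum>s\<in>posbox M N. \<Sum>l\<in>low M N s. g M N t s / lval t s ^ k * (vl [] M N t l / lval t l ^ 2)"
 let ?E1 = "%M N t. \<Sum>s\<in>posbox M N. dlt 1 M N t s (0, 0) * h1 M N t s"
 let ?E2 = "%M N t. \<Sum>s\<in>posbox M N. dlt 2 M N t s (0, 0) * h M N t s"
 have bh: "bnd2 h" unfolding h_def by (rule bnd2_div) (use Nil bnd_UU in auto)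
 have "bnd2 (%M N t p. g1 M N t p / lval t p ^ k)"
  by (rule bnd2_div) (use Nil bnd_UU in auto)
 moreover have "bnd2 (%M N t p. (of_nat k * g M N t p) / lval t p ^ (k + 1))"
  by (rule bnd2_div) (use Nil bnd_UU UU_of_nat in auto)
 ultimately have bh1: "bnd2 h1" unfolding h1_def by (rule bnd2_diff)
 have "?C \<in> LL" by (rule EE_LL, rule Cs_EE) (use Nil in auto)
 moreover have "?S \<in> LL" by (rule EE_LL, rule UU_sum2) (use Nil in auto)
 moreover have "?E1 \<in> LL" "?E2 \<in> LL" by (intro nullf_LL nullf_dlt0 bh bh1; simp)+
 ultimately have "(%M N t. ?C M N t - ?S M N t - ?E1 M N t + ?E2 M N t) \<in> LL"
  by (intro LL_add LL_diff)
 then show ?case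
 proof (rule LL_cong)
  fix M N and t :: complex assume t: "0 < Im t"
  have "Xs (\<succ>) (lval t) (posbox M N) (g M N t) (g1 M N t) k (vl [] M N t)
   = Ys (\<succ>) (lval t) (posbox M N) (h M N t) (h1 M N t) (%_. 1) + ?C M N t"
   unfolding h_def h1_def using Nil(2) t
   by (subst Xs_eq_Ys_plus_Cs) (auto simp: lval_posbox_nz lval_gt simp del: lat_gt.simps)
  also have "Ys (\<succ>) (lval t) (posbox M N) (h M N t) (h1 M N t) (%_. 1)
   = (\<Sum>s\<in>posbox M N. h1 M N t s * (2 * hh M N t s - dlt 1 M N t s (0, 0))
    - h M N t s * ((\<Sum>l\<in>low M N s. 1 / (lval t l)\<^sup>2) - dlt 2 M N t s (0, 0)))"
  proof -
   have d: "dlt j M N t s (0, 0) = (\<Sum>l\<in>low M N s. 1 / lval t l ^ j - 1 / (lval t s - lval t l) ^ j)" for j s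
    unfolding dlt_def low_between_0 by simp
   have d1: "(\<Sum>l\<in>low M N s. 1 / lval t l - 1 / (lval t s - lval t l)) = dlt 1 M N t s (0, 0)" for s
    unfolding d by simp
   have d2: "(\<Sum>l\<in>low M N s. 1 / (lval t s - lval t l)\<^sup>2 - 1 / (lval t l)\<^sup>2) = - dlt 2 M N t s (0, 0)" for s
    unfolding d by (simp add: sum_negf[symmetric])
   show ?thesis unfolding Ys_bottom d1 d2 hh_def by simp
  qed
  also have "... = 2 * (\<Sum>s\<in>posbox M N. h1 M N t s * hh M N t s) - ?E1 M N t - ?S M N t + ?E2 M N t"
   by (simp add: h_def sum.distrib sum_subtractf sum_distrib_left algebra_simps)
  finally have 1: "Xs (\<succ>) (lval t) (posbox M N) (g M N t) (g1 M N t) k (vl [] M N t)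
   = 2 * (\<Sum>s\<in>posbox M N. h1 M N t s * hh M N t s) - ?E1 M N t - ?S M N t + ?E2 M N t + ?C M N t" .
  have 2: "(\<Sum>s\<in>posbox M N. h1 M N t s * hh M N t s)
   = (\<Sum>p\<in>posbox M N. hh M N t p * (g1 M N t p / lval t p ^ k * vl [] M N t p)) - DM hh M N t (g M N t) [k]"
   by (simp add: h1_def sum_subtractf algebra_simps)
  show "Xs (\<succ>) (lval t) (posbox M N) (g M N t) (g1 M N t) k (vl [] M N t)
  - 2 * (\<Sum>p\<in>posbox M N. hh M N t p * (g1 M N t p / lval t p ^ k * vl [] M N t p))
  + 2 * DM hh M N t (g M N t) [k] = ?C M N t - ?S M N t - ?E1 M N t + ?E2 M N t"
   unfolding 1 2 by (simp add: algebra_simps del: DM.simps)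
 qed
next
 case (Cons k' ks)
 define h where "h = (%M N t p. g M N t p / lval t p ^ k)"
 define h1 where "h1 = (%M N t p. g1 M N t p / lval t p ^ k - of_nat k * g M N t p / lval t p ^ (k + 1))"
 define g' where "g' = (%M N t r. \<Sum>s\<in>upp M N r. h M N t s)"
 define g1' where "g1' = (%M N t r. \<Sum>s\<in>upp M N r. h1 M N t s)"
 define w where "w = (%M N t p. vl ks M N t p / lval t p ^ k')"
 have k': "2 \<le> k'" "ks \<in> mes_indices" and k: "2 \<le> k" using Cons.prems by auto
 have bh: "bnd2 h" unfolding h_def by (rule bnd2_div) (use Cons bnd_UU in auto)
 have "bnd2 (%M N t p. g1 M N t p / lval t p ^ k)"
  by (rule bnd2_div) (use Cons bnd_UU in auto)
 moreover have "bnd2 (%M N t p. (of_nat k * g M N t p) / lval t p ^ (k + 1))"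
  by (rule bnd2_div) (use Cons bnd_UU UU_of_nat in auto)
 ultimately have bh1: "bnd2 h1" unfolding h1_def by (rule bnd2_diff)
 have bw: "bnd2 w" unfolding w_def by (intro bnd2_div bnd_vl k')
 have g': "g' \<in> UU" unfolding g'_def h_def by (intro UU_up Cons.prems)
 have "(%M N t r. (\<Sum>s\<in>upp M N r. g1 M N t s / lval t s ^ k) - of_nat k * (\<Sum>s\<in>upp M N r. g M N t s / lval t s ^ (k + 1))) \<in> UU"
  by (intro UU_diff UU_of_nat UU_up Cons.prems) (use k in auto)
 then have g1': "g1' \<in> UU" by (simp add: g1'_def h1_def sum_subtractf sum_distrib_left)
 let ?C = "%M N t. Cs (\<succ>) (lval t) (posbox M N) (g M N t) (g1 M N t) k (vl (k' # ks) M N t)"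
 let ?I = "%M N t. Xs (\<succ>) (lval t) (posbox M N) (g' M N t) (g1' M N t) k' (vl ks M N t)
  - 2 * (\<Sum>p\<in>posbox M N. hh M N t p * (g1' M N t p / lval t p ^ k' * vl ks M N t p))
  + 2 * DM hh M N t (g' M N t) (k' # ks)"
 let ?E1 = "%M N t. \<Sum>s\<in>posbox M N. \<Sum>n\<in>low M N s. h1 M N t s * dlt 1 M N t s n * w M N t n"
 let ?E2 = "%M N t. \<Sum>s\<in>posbox M N. \<Sum>n\<in>low M N s. h M N t s * dlt 2 M N t s n * w M N t n"
 let ?R = "%M N t. \<Sum>s\<in>posbox M N. \<Sum>n\<in>low M N s. h1 M N t s * (w M N t n / lval t n)"
 let ?R1 = "%M N t. \<Sum>s\<in>posbox M N. \<Sum>n\<in>low M N s. g1 M N t s / lval t s ^ k * (vl ks M N t n / lval t n ^ (k' + 1))"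
 let ?R2 = "%M N t. \<Sum>s\<in>posbox M N. \<Sum>n\<in>low M N s. g M N t s / lval t s ^ (k + 1) * (vl ks M N t n / lval t n ^ (k' + 1))"
 let ?S = "%M N t. \<Sum>s\<in>posbox M N. \<Sum>n\<in>low M N s. g M N t s / lval t s ^ k
  * (\<Sum>r\<in>{r\<in>posbox M N. s \<succ> r \<and> r \<succ> n}. 1 / (lval t r)\<^sup>2) * (vl ks M N t n / lval t n ^ k')"
 have "?C \<in> LL" by (rule EE_LL, rule Cs_EE) (use Cons in auto)
 moreover have "?I \<in> LL" by (rule Cons.IH[OF k'(2,1) g' g1'])
 moreover have "?E1 \<in> LL" "?E2 \<in> LL" by (intro nullf_LL nullf_dlt bh bh1 bw; simp)+
 moreover have "?R1 \<in> LL" by (rule EE_LL, rule UU_sum2) (use Cons.prems k' k in auto)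
 moreover have "?R2 \<in> LL" by (rule EE_LL, rule UU_sum2) (use Cons.prems k' k in auto)
 moreover have "?S \<in> LL" by (rule EE_LL, rule UU_sum3) (use Cons.prems k' k in auto)
 ultimately have "(%M N t. ?I M N t + ?C M N t - ?E1 M N t - of_nat 2 * (?R1 M N t - of_nat k * ?R2 M N t) - ?S M N t + ?E2 M N t) \<in> LL"
  by (rule LL_comb)
 then show ?case
 proof (rule LL_cong)
  fix M N and t :: complex assume t: "0 < Im t"
  have R: "?R M N t = ?R1 M N t - of_nat k * ?R2 M N t"
   unfolding sum_distrib_left sum_subtractf[symmetric]
   by (intro sum.cong refl) (simp add: h1_def w_def algebra_simps diff_divide_distrib)
  have v: "vl (k' # ks) M N t = (%r. \<Sum>n\<in>low M N r. vl ks M N t n / lval t n ^ k')"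
   by (simp add: fun_eq_iff vl_Cons)
  have X: "Xs (\<succ>) (lval t) (posbox M N) (g M N t) (g1 M N t) k (vl (k' # ks) M N t)
   = Ys (\<succ>) (lval t) (posbox M N) (h M N t) (h1 M N t) (vl (k' # ks) M N t) + ?C M N t"
   unfolding h_def h1_def using k t
   by (subst Xs_eq_Ys_plus_Cs) (auto simp: lval_posbox_nz lval_gt simp del: lat_gt.simps)
  let ?P = "\<Sum>s\<in>posbox M N. h1 M N t s * hh M N t s * vl (k' # ks) M N t s"
  let ?Q = "\<Sum>p\<in>posbox M N. hh M N t p * (g1' M N t p / lval t p ^ k' * vl ks M N t p)"
  have Q: "(\<Sum>s\<in>posbox M N. \<Sum>n\<in>low M N s. h1 M N t s * hh M N t n * w M N t n) = ?Q"
   unfolding sum_low_upp by (simp add: g1'_def w_def sum_distrib_left sum_distrib_right sum_divide_distrib mult_ac)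
  have P: "(\<Sum>s\<in>posbox M N. \<Sum>n\<in>low M N s. h1 M N t s * hh M N t s * w M N t n) = ?P"
   by (simp add: vl_Cons w_def sum_distrib_left)
  have "Xs (\<succ>) (lval t) (posbox M N) (g' M N t) (g1' M N t) k' (vl ks M N t)
   - Ys (\<succ>) (lval t) (posbox M N) (h M N t) (h1 M N t) (vl (k' # ks) M N t)
   = (\<Sum>s\<in>posbox M N. \<Sum>n\<in>low M N s.
    (h1 M N t s * (dlt 1 M N t s n - 2 * (\<Sum>r\<in>{r\<in>posbox M N. s \<succ> r \<and> r \<succ> n}. 1 / lval t r))
    + h M N t s * ((\<Sum>r\<in>{r\<in>posbox M N. s \<succ> r \<and> r \<succ> n}. 1 / (lval t r)\<^sup>2) - dlt 2 M N t s n)) * w M N t n)"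
   unfolding g'_def g1'_def v w_def dlt_def by (subst lat.Xs_minus_Ys) (simp_all add: power_one_right)
  also have "... = (\<Sum>s\<in>posbox M N. \<Sum>n\<in>low M N s.
    h1 M N t s * dlt 1 M N t s n * w M N t n - 2 * (h1 M N t s * hh M N t s * w M N t n)
    + 2 * (h1 M N t s * hh M N t n * w M N t n) + 2 * (h1 M N t s * (w M N t n / lval t n))
    + g M N t s / lval t s ^ k * (\<Sum>r\<in>{r\<in>posbox M N. s \<succ> r \<and> r \<succ> n}. 1 / (lval t r)\<^sup>2) * (vl ks M N t n / lval t n ^ k')
    - h M N t s * dlt 2 M N t s n * w M N t n)"
   by (intro sum.cong refl, subst hh_between) (auto simp: h_def w_def algebra_simps simp del: lat_gt.simps)
  also have "... = ?E1 M N t - 2 * ?P + 2 * ?Q + 2 * ?R M N t + ?S M N t - ?E2 M N t"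
   unfolding P[symmetric] Q[symmetric] by (simp only: sum.distrib sum_subtractf sum_distrib_left)
  finally have Y: "Xs (\<succ>) (lval t) (posbox M N) (g' M N t) (g1' M N t) k' (vl ks M N t)
   - Ys (\<succ>) (lval t) (posbox M N) (h M N t) (h1 M N t) (vl (k' # ks) M N t)
   = ?E1 M N t - 2 * ?P + 2 * ?Q + 2 * ?R M N t + ?S M N t - ?E2 M N t" .
  have P2: "?P = (\<Sum>p\<in>posbox M N. hh M N t p * (g1 M N t p / lval t p ^ k * vl (k' # ks) M N t p))
   - (\<Sum>p\<in>posbox M N. hh M N t p * (of_nat k * g M N t p / lval t p ^ (k + 1) * vl (k' # ks) M N t p))"
   by (simp add: h1_def sum_subtractf[symmetric]) (simp add: algebra_simps)
  have D: "DM hh M N t (g M N t) (k # k' # ks) = (\<Sum>p\<in>posbox M N. hh M N t p * (of_nat k * g M N t p / lval t p ^ (k + 1) * vl (k' # ks) M N t p))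
   + DM hh M N t (g' M N t) (k' # ks)"
   unfolding DM.simps(2)[of hh M N t _ k] g'_def h_def ..
  show "Xs (\<succ>) (lval t) (posbox M N) (g M N t) (g1 M N t) k (vl (k' # ks) M N t)
  - 2 * (\<Sum>p\<in>posbox M N. hh M N t p * (g1 M N t p / lval t p ^ k * vl (k' # ks) M N t p))
  + 2 * DM hh M N t (g M N t) (k # k' # ks)
  = ?I M N t + ?C M N t - ?E1 M N t - of_nat 2 * (?R1 M N t - of_nat k * ?R2 M N t) - ?S M N t + ?E2 M N t"
   unfolding X D R[symmetric] by (rule master_algebra[OF Y P2])
 qed
qed

definition win :: "nat => pfam" where
 "win j M N t l = (\<Sum>p\<in>{p\<in>posbox M N. int M - fst l \<le> fst p}. 1 / lval t p ^ j)"

definition om :: pfam where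
 "om M N t l = - hh M N t l - win 1 M N t l"

lemma sum_posbox_split:
 fixes f :: "int \<times> int => complex"
 assumes "l \<in> posbox M N"
 shows "(\<Sum>p\<in>upp M N l. f p) = (\<Sum>p\<in>posbox M N. f p) - f l - (\<Sum>p\<in>low M N l. f p)"
proof -
 have "posbox M N = upp M N l \<union> insert l (low M N l)" using assms lat.total by blast
 then have "(\<Sum>p\<in>posbox M N. f p) = (\<Sum>p\<in>upp M N l \<union> insert l (low M N l). f p)" by simp
 also have "... = (\<Sum>p\<in>upp M N l. f p) + (\<Sum>p\<in>insert l (low M N l). f p)"
  by (rule sum.union_disjoint) (auto simp del: lat_gt.simps simp: lat.irrefl dest: lat.asym)
 also have "(\<Sum>p\<in>insert l (low M N l). f p) = f l + (\<Sum>p\<in>low M N l. f p)"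
  by (subst sum.insert) (auto simp del: lat_gt.simps simp: lat.irrefl)
 finally show ?thesis by simp
qed

lemma sum_below_win:
 "(\<Sum>p\<in>{p\<in>posbox M N. fst p < int M - fst l}. 1 / lval t p ^ j) = (\<Sum>p\<in>posbox M N. 1 / lval t p ^ j) - win j M N t l"
proof -
 have "posbox M N = {p\<in>posbox M N. fst p < int M - fst l} \<union> {p\<in>posbox M N. int M - fst l \<le> fst p}" by auto
 then have "(\<Sum>p\<in>posbox M N. 1 / lval t p ^ j) = (\<Sum>p\<in>{p\<in>posbox M N. fst p < int M - fst l} \<union> {p\<in>posbox M N. int M - fst l \<le> fst p}. 1 / lval t p ^ j)" by simp
 also have "... = (\<Sum>p\<in>{p\<in>posbox M N. fst p < int M - fst l}. 1 / lval t p ^ j) + win j M N t l"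
  unfolding win_def by (rule sum.union_disjoint) auto
 finally show ?thesis by simp
qed

lemma sum_upp_shift:
 assumes "l \<in> posbox M N"
 shows "(\<Sum>s\<in>upp M N l. 1 / (lval t s - lval t l) ^ j - 1 / lval t s ^ j)
  = topd j M N t l - win j M N t l + 1 / lval t l ^ j + (\<Sum>p\<in>low M N l. 1 / lval t p ^ j)"
proof -
 have "(\<Sum>s\<in>upp M N l. 1 / (lval t s - lval t l) ^ j) = topd j M N t l + ((\<Sum>p\<in>posbox M N. 1 / lval t p ^ j) - win j M N t l)"
  unfolding topd_def sum_below_win by simp
 then show ?thesis using sum_posbox_split[OF assms, of "%p. 1 / lval t p ^ j"] by (simp add: sum_subtractf)
qed

lemma wrd_Cons: "wrd (k # ks) M N t = (\<Sum>p\<in>posbox M N. vl ks M N t p / lval t p ^ k)"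
 using wrd_split[of "[]" k ks M N t] by simp

lemma bnd2_vl: "ks \<in> mes_indices ==> 2 \<le> k ==> bnd2 (%M N t p. vl ks M N t p / lval t p ^ k)"
 by (intro bnd2_div bnd_vl)

lemma DM_zero [simp]: "DM \<omega> M N t (%_. 0) ks = 0"
 by (induction ks) auto

lemma om_LL:
 assumes "ks \<in> mes_indices" "2 \<le> k"
 shows "(%M N t. \<Sum>l\<in>posbox M N. om M N t l * (vl ks M N t l / lval t l ^ k)) \<in> LL"
proof -
 let ?m = "%M N t. Xs (\<succ>) (lval t) (posbox M N) (%_. 0) (%_. 1) k (vl ks M N t)
  - 2 * (\<Sum>p\<in>posbox M N. hh M N t p * (1 / lval t p ^ k * vl ks M N t p))
  + 2 * DM hh M N t (%_. 0) (k # ks)"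
 let ?T = "%M N t. \<Sum>l\<in>posbox M N. topd 1 M N t l * (vl ks M N t l / lval t l ^ k)"
 have 1: "?m \<in> LL" using master[OF assms UU_zero UU_one] .
 have 2: "wrd ((k + 1) # ks) \<in> LL" using assms by (intro EE_LL EE_wrd) auto
 have 3: "?T \<in> LL" by (intro nullf_LL nullf_topd bnd2_vl assms) simp
 have eq: "(\<Sum>l\<in>posbox M N. om M N t l * (vl ks M N t l / lval t l ^ k)) = ?m M N t - wrd ((k + 1) # ks) M N t - ?T M N t" for M N t
 proof -
  have "Xs (\<succ>) (lval t) (posbox M N) (%_. 0) (%_. 1) k (vl ks M N t)
   = (\<Sum>l\<in>posbox M N. (\<Sum>s\<in>upp M N l. 1 / (lval t s - lval t l) ^ 1 - 1 / lval t s ^ 1) * (vl ks M N t l / lval t l ^ k))"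
   unfolding Xs_def sum_low_upp by (simp add: sum_distrib_right sum_divide_distrib)
  also have "... = (\<Sum>l\<in>posbox M N. (topd 1 M N t l - win 1 M N t l + 1 / lval t l ^ 1 + hh M N t l) * (vl ks M N t l / lval t l ^ k))"
   by (intro sum.cong refl, subst sum_upp_shift) (simp_all add: hh_def)
  finally show ?thesis
   unfolding DM_zero wrd_Cons om_def
   by (simp add: sum_distrib_left sum_subtractf[symmetric]) (intro sum.cong refl, simp add: algebra_simps add_divide_distrib diff_divide_distrib)
 qed
 show ?thesis unfolding eq by (intro LL_diff 1 2 3)
qed

lemma sum_list_sum_swap: "(\<Sum>w\<leftarrow>ws. \<Sum>p\<in>F. f w p) = (\<Sum>p\<in>F. \<Sum>w\<leftarrow>ws. (f w p :: complex))"
 by (induction ws) (auto simp: sum.distrib)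

lemma vl_mult: "vl u M N t p * vl v M N t p = (\<Sum>w\<leftarrow>qsh u v. vl w M N t p)"
 unfolding vl_def by (rule lat.csum_mult) simp

lemma DM_hh_win2_LL:
 assumes "ks \<in> mes_indices" "2 \<le> k"
 shows "(%M N t. 2 * DM hh M N t (%_. 1) (k # ks) + (\<Sum>l\<in>posbox M N. win 2 M N t l * (vl ks M N t l / lval t l ^ k))) \<in> LL"
proof -
 let ?m = "%M N t. Xs (\<succ>) (lval t) (posbox M N) (%_. 1) (%_. 0) k (vl ks M N t)
  - 2 * (\<Sum>p\<in>posbox M N. hh M N t p * (0 / lval t p ^ k * vl ks M N t p))
  + 2 * DM hh M N t (%_. 1) (k # ks)"
 let ?T = "%M N t. \<Sum>l\<in>posbox M N. topd 2 M N t l * (vl ks M N t l / lval t l ^ k)"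
 let ?H = "%M N t. \<Sum>w\<leftarrow>qsh [2] ks. wrd (k # w) M N t"
 have 1: "?m \<in> LL" using master[OF assms UU_one UU_zero] .
 have 2: "wrd ((k + 2) # ks) \<in> LL" using assms by (intro EE_LL EE_wrd) auto
 have 3: "?T \<in> LL" by (intro nullf_LL nullf_topd bnd2_vl assms) simp
 have 4: "?H \<in> LL" using mes_indices_qsh[of _ "[2]" ks] assms by (intro EE_LL EE_sum_list EE_wrd) auto
 have eq: "2 * DM hh M N t (%_. 1) (k # ks) + (\<Sum>l\<in>posbox M N. win 2 M N t l * (vl ks M N t l / lval t l ^ k))
  = ?m M N t + wrd ((k + 2) # ks) M N t + ?T M N t + ?H M N t" for M N t
 proof -
  have "Xs (\<succ>) (lval t) (posbox M N) (%_. 1) (%_. 0) k (vl ks M N t)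
   = (\<Sum>l\<in>posbox M N. - (\<Sum>s\<in>upp M N l. 1 / (lval t s - lval t l) ^ 2 - 1 / lval t s ^ 2) * (vl ks M N t l / lval t l ^ k))"
   unfolding Xs_def sum_low_upp by (simp add: sum_distrib_right sum_divide_distrib sum_negf[symmetric])
  also have "... = (\<Sum>l\<in>posbox M N. - (topd 2 M N t l - win 2 M N t l + 1 / lval t l ^ 2 + vl [2] M N t l) * (vl ks M N t l / lval t l ^ k))"
   by (intro sum.cong refl, subst sum_upp_shift) (simp_all add: vl_Cons)
  finally have X: "Xs (\<succ>) (lval t) (posbox M N) (%_. 1) (%_. 0) k (vl ks M N t) = ..." .
  have "?H M N t = (\<Sum>l\<in>posbox M N. \<Sum>w\<leftarrow>qsh [2] ks. vl w M N t l / lval t l ^ k)"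
   unfolding wrd_Cons by (rule sum_list_sum_swap)
  also have "... = (\<Sum>l\<in>posbox M N. vl [2] M N t l * (vl ks M N t l / lval t l ^ k))"
  proof (rule sum.cong[OF refl])
   fix l
   have "vl [2] M N t l * (vl ks M N t l / lval t l ^ k) = (\<Sum>w\<leftarrow>qsh [2] ks. vl w M N t l) * inverse (lval t l ^ k)"
    unfolding vl_mult[symmetric] by (simp add: divide_inverse)
   then show "(\<Sum>w\<leftarrow>qsh [2] ks. vl w M N t l / lval t l ^ k) = vl [2] M N t l * (vl ks M N t l / lval t l ^ k)"
    by (auto simp: divide_inverse sum_list_mult_const)
  qed
  finally have H: "?H M N t = ..." .
  have "0 = (\<Sum>l\<in>posbox M N. - (topd 2 M N t l - win 2 M N t l + 1 / lval t l ^ 2 + vl [2] M N t l) * (vl ks M N t l / lval t l ^ k))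
   + (\<Sum>p\<in>posbox M N. vl ks M N t p / lval t p ^ (k + 2)) + ?T M N t + (\<Sum>l\<in>posbox M N. vl [2] M N t l * (vl ks M N t l / lval t l ^ k))
   - (\<Sum>l\<in>posbox M N. win 2 M N t l * (vl ks M N t l / lval t l ^ k))"
   unfolding sum.distrib[symmetric] sum_subtractf[symmetric]
   by (rule sum.neutral[symmetric], rule ballI) (simp add: algebra_simps power2_eq_square)
  then have W: "(\<Sum>l\<in>posbox M N. win 2 M N t l * (vl ks M N t l / lval t l ^ k))
   = (\<Sum>l\<in>posbox M N. - (topd 2 M N t l - win 2 M N t l + 1 / lval t l ^ 2 + vl [2] M N t l) * (vl ks M N t l / lval t l ^ k))
   + (\<Sum>p\<in>posbox M N. vl ks M N t p / lval t p ^ (k + 2)) + ?T M N t + (\<Sum>l\<in>posbox M N. vl [2] M N t l * (vl ks M N t l / lval t l ^ k))"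
   by (simp only: eq_diff_eq add_0)
  show ?thesis unfolding X H wrd_Cons[of "k + 2"] by (subst W) (simp del: DM.simps)
 qed
 show ?thesis unfolding eq by (intro LL_add 1 2 3 4)
qed

lemma tu_expand:
 assumes "p \<in> posbox M N"
 shows "tu u M N t p = wrd u M N t - (\<Sum>i<length u. tu (take i u) M N t p *
  (vl (drop (Suc i) u) M N t p / lval t p ^ (u ! i) + vl (drop i u) M N t p))"
 unfolding tu_def vl_def wrd_def by (rule lat.csum_upper) (use assms in auto)

lemma om_tu_LL:
 assumes "u \<in> mes_indices" "ks \<in> mes_indices" "2 \<le> k"
 shows "(%M N t. \<Sum>p\<in>posbox M N. tu u M N t p * (om M N t p * (vl ks M N t p / lval t p ^ k))) \<in> LL"
 using assms
proof (induction "length u" arbitrary: u ks k rule: less_induct)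
 case less
 let ?b = "%M N t p. om M N t p * (vl ks M N t p / lval t p ^ k)"
 let ?A = "%i w M N t. \<Sum>p\<in>posbox M N. tu (take i u) M N t p * (om M N t p * (vl w M N t p / lval t p ^ (k + u ! i)))"
 let ?B = "%i w M N t. \<Sum>p\<in>posbox M N. tu (take i u) M N t p * (om M N t p * (vl w M N t p / lval t p ^ k))"
 have A: "?A i w \<in> LL" if "i < length u" "w \<in> set (qsh (drop (Suc i) u) ks)" for i w
  by (rule less.hyps) (use that less.prems mes_indices_qsh[OF that(2)] in \<open>auto intro: mes_indices_take mes_indices_drop\<close>)
 have B: "?B i w \<in> LL" if "i < length u" "w \<in> set (qsh (drop i u) ks)" for i w
  by (rule less.hyps) (use that less.prems mes_indices_qsh[OF that(2)] in \<open>auto intro: mes_indices_take mes_indices_drop\<close>)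
 have "(%M N t. wrd u M N t * (\<Sum>p\<in>posbox M N. ?b M N t p)
  - (\<Sum>i<length u. (\<Sum>w\<leftarrow>qsh (drop (Suc i) u) ks. ?A i w M N t) + (\<Sum>w\<leftarrow>qsh (drop i u) ks. ?B i w M N t))) \<in> LL"
  using A B less.prems by (intro LL_diff LL_EE_mult EE_wrd om_LL LL_sum LL_add LL_sum_list) auto
 moreover have "(\<Sum>p\<in>posbox M N. tu u M N t p * ?b M N t p) = wrd u M N t * (\<Sum>p\<in>posbox M N. ?b M N t p)
  - (\<Sum>i<length u. (\<Sum>w\<leftarrow>qsh (drop (Suc i) u) ks. ?A i w M N t) + (\<Sum>w\<leftarrow>qsh (drop i u) ks. ?B i w M N t))" for M N t
 proof -
  have sl: "(\<Sum>w\<leftarrow>ws. \<Sum>p\<in>posbox M N. a p * (b p * (vl w M N t p / c p))) = (\<Sum>p\<in>posbox M N. a p * (b p * ((\<Sum>w\<leftarrow>ws. vl w M N t p) / c p)))"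
   for ws a b c by (induction ws) (auto simp: sum.distrib add_divide_distrib distrib_left)
  have "(\<Sum>p\<in>posbox M N. tu u M N t p * ?b M N t p)
   = (\<Sum>p\<in>posbox M N. wrd u M N t * ?b M N t p - (\<Sum>i<length u. tu (take i u) M N t p *
    (vl (drop (Suc i) u) M N t p / lval t p ^ (u ! i) + vl (drop i u) M N t p) * ?b M N t p))"
   by (rule sum.cong[OF refl], subst tu_expand, assumption, simp only: left_diff_distrib sum_distrib_right)
  also have "... = wrd u M N t * (\<Sum>p\<in>posbox M N. ?b M N t p) - (\<Sum>i<length u. \<Sum>p\<in>posbox M N. tu (take i u) M N t p *
    (vl (drop (Suc i) u) M N t p / lval t p ^ (u ! i) + vl (drop i u) M N t p) * ?b M N t p)"
   unfolding sum_subtractf sum_distrib_left by (subst sum.swap) simp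
  also have "(\<Sum>i<length u. \<Sum>p\<in>posbox M N. tu (take i u) M N t p *
    (vl (drop (Suc i) u) M N t p / lval t p ^ (u ! i) + vl (drop i u) M N t p) * ?b M N t p)
   = (\<Sum>i<length u. (\<Sum>w\<leftarrow>qsh (drop (Suc i) u) ks. ?A i w M N t) + (\<Sum>w\<leftarrow>qsh (drop i u) ks. ?B i w M N t))"
   unfolding sl vl_mult[symmetric] sum.distrib[symmetric]
   by (intro sum.cong refl) (simp add: power_add algebra_simps)
  finally show ?thesis .
 qed
 ultimately show ?case by simp
qed

lemma DM_LL:
 assumes "!!u k ks. u \<in> mes_indices ==> ks \<in> mes_indices ==> 2 \<le> k ==>
   (%M N t. \<Sum>p\<in>posbox M N. tu u M N t p * (\<omega> M N t p * (vl ks M N t p / lval t p ^ k))) \<in> LL"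
  and "u \<in> mes_indices" "ks \<in> mes_indices"
 shows "(%M N t. DM \<omega> M N t (tu u M N t) ks) \<in> LL"
 using assms(2,3)
proof (induction ks arbitrary: u)
 case Nil
 then show ?case using EE_LL[OF EE_zero] by simp
next
 case (Cons k ks)
 have "(%M N t. of_nat k * (\<Sum>p\<in>posbox M N. tu u M N t p * (\<omega> M N t p * (vl ks M N t p / lval t p ^ (k + 1)))) + DM \<omega> M N t (tu (u @ [k]) M N t) ks) \<in> LL"
  by (intro LL_add LL_of_nat assms(1) Cons.IH) (use Cons.prems in auto)
 moreover have "of_nat k * (\<Sum>p\<in>posbox M N. tu u M N t p * (\<omega> M N t p * (vl ks M N t p / lval t p ^ (k + 1)))) + DM \<omega> M N t (tu (u @ [k]) M N t) ks
  = DM \<omega> M N t (tu u M N t) (k # ks)" for M N t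
 proof -
  have "tu (u @ [k]) M N t = (%p. \<Sum>q\<in>upp M N p. tu u M N t q / lval t q ^ k)"
   by (simp add: fun_eq_iff tu_snoc)
  then show ?thesis by (simp add: sum_distrib_left mult_ac)
 qed
 ultimately show ?case by simp
qed

lemma DM_lin:
 assumes "!!p. p \<in> posbox M N ==> \<omega> M N t p = a * \<omega>1 M N t p + b * \<omega>2 M N t p"
 shows "DM \<omega> M N t g ks = a * DM \<omega>1 M N t g ks + b * DM \<omega>2 M N t g ks"
proof (induction ks arbitrary: g)
 case (Cons k ks)
 have "(\<Sum>p\<in>posbox M N. \<omega> M N t p * (of_nat k * g p / lval t p ^ (k + 1) * vl ks M N t p))
  = a * (\<Sum>p\<in>posbox M N. \<omega>1 M N t p * (of_nat k * g p / lval t p ^ (k + 1) * vl ks M N t p))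
  + b * (\<Sum>p\<in>posbox M N. \<omega>2 M N t p * (of_nat k * g p / lval t p ^ (k + 1) * vl ks M N t p))"
  unfolding sum_distrib_left sum.distrib[symmetric] using assms by (intro sum.cong refl) (simp add: algebra_simps add_divide_distrib)
 then show ?case using Cons.IH by (simp add: algebra_simps)
qed simp

lemma has_derivative_div_lval:
 assumes "0 < Im t" "p \<in> posbox M N" "(g has_field_derivative g') (at t)"
 shows "((%t. g t / lval t p ^ k) has_field_derivative g' / lval t p ^ k - of_nat k * of_int (fst p) * g t / lval t p ^ (k + 1)) (at t)"
proof -
 have nz: "lval t p \<noteq> 0" using lval_posbox_nz assms by blast
 have "((%t. lval t p) has_field_derivative of_int (fst p)) (at t)"
  unfolding lval_def by (auto intro!: derivative_eq_intros)
 from DERIV_divide[OF assms(3) DERIV_power[OF this, of k]]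
 have "((%t. g t / lval t p ^ k) has_field_derivative
  (g' * lval t p ^ k - g t * (of_nat k * (of_int (fst p) * lval t p ^ (k - Suc 0)))) / (lval t p ^ k * lval t p ^ k)) (at t)"
  using nz by simp
 also have "(g' * lval t p ^ k - g t * (of_nat k * (of_int (fst p) * lval t p ^ (k - Suc 0)))) / (lval t p ^ k * lval t p ^ k)
  = g' / lval t p ^ k - of_nat k * of_int (fst p) * g t / lval t p ^ (k + 1)"
  using nz by (cases k) (simp_all add: field_simps)
 finally show ?thesis .
qed

lemma has_derivative_DM:
 fixes g :: "complex => int \<times> int => complex"
 assumes t: "0 < Im t" and "!!p. ((%t. g t p) has_field_derivative g' p) (at t)"
 shows "((%t. \<Sum>p\<in>posbox M N. g t p / lval t p ^ k * vl ks M N t p) has_field_derivative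
  DM (%M N t p. - of_int (fst p)) M N t (g t) (k # ks) + (\<Sum>p\<in>posbox M N. g' p / lval t p ^ k * vl ks M N t p)) (at t)"
 using assms(2)
proof (induction ks arbitrary: g g' k)
 case Nil
 have d: "((%t. g t p / lval t p ^ k) has_field_derivative g' p / lval t p ^ k - of_nat k * of_int (fst p) * g t p / lval t p ^ (k + 1)) (at t)"
  if "p \<in> posbox M N" for p
  by (rule has_derivative_div_lval[OF t that Nil])
 have "((%t. \<Sum>p\<in>posbox M N. g t p / lval t p ^ k) has_field_derivative
  (\<Sum>p\<in>posbox M N. g' p / lval t p ^ k - of_nat k * of_int (fst p) * g t p / lval t p ^ (k + 1))) (at t)"
  by (intro DERIV_sum d)
 then show ?case by (simp add: sum_subtractf sum_negf mult_ac)
next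
 case (Cons k' ks)
 have d: "((%t. g t p / lval t p ^ k) has_field_derivative g' p / lval t p ^ k - of_nat k * of_int (fst p) * g t p / lval t p ^ (k + 1)) (at t)"
  if "p \<in> posbox M N" for p
  by (rule has_derivative_div_lval[OF t that Cons.prems])
 let ?G = "%t p. \<Sum>q\<in>upp M N p. g t q / lval t q ^ k"
 let ?G' = "%p. \<Sum>q\<in>upp M N p. g' q / lval t q ^ k - of_nat k * of_int (fst q) * g t q / lval t q ^ (k + 1)"
 have sw: "(\<Sum>p\<in>posbox M N. f p * vl (k' # ks) M N t p)
  = (\<Sum>p\<in>posbox M N. (\<Sum>q\<in>upp M N p. f q) / lval t p ^ k' * vl ks M N t p)" for f t
 proof -
  have "(\<Sum>p\<in>posbox M N. f p * vl (k' # ks) M N t p) = (\<Sum>s\<in>posbox M N. \<Sum>l\<in>low M N s. f s * (vl ks M N t l / lval t l ^ k'))"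
   by (simp add: vl_Cons sum_distrib_left)
  then show ?thesis unfolding sum_low_upp by (simp add: sum_distrib_right sum_divide_distrib)
 qed
 have "((%t. \<Sum>p\<in>posbox M N. ?G t p / lval t p ^ k' * vl ks M N t p) has_field_derivative
  DM (%M N t p. - of_int (fst p)) M N t (?G t) (k' # ks) + (\<Sum>p\<in>posbox M N. ?G' p / lval t p ^ k' * vl ks M N t p)) (at t)"
  by (rule Cons.IH, rule DERIV_sum, rule d) auto
 moreover have "DM (%M N t p. - of_int (fst p)) M N t (?G t) (k' # ks) + (\<Sum>p\<in>posbox M N. ?G' p / lval t p ^ k' * vl ks M N t p)
  = DM (%M N t p. - of_int (fst p)) M N t (g t) (k # k' # ks) + (\<Sum>p\<in>posbox M N. g' p / lval t p ^ k * vl (k' # ks) M N t p)"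
 proof -
  have e: "(\<Sum>p\<in>posbox M N. (a p - b p) * v p) = (\<Sum>p\<in>posbox M N. a p * v p) - (\<Sum>p\<in>posbox M N. b p * v p)" for a b v :: "_ => complex"
   by (simp add: left_diff_distrib sum_subtractf)
  show ?thesis
   unfolding sw[symmetric] DM.simps(2)[of _ M N t "g t" k] e
   by (simp add: sum_negf mult_ac del: DM.simps)
 qed
 ultimately show ?case by (simp only: sw)
qed

lemma deriv_wrd:
 assumes "0 < Im t"
 shows "deriv (wrd ks M N) t = DM (%M N t p. - of_int (fst p)) M N t (%_. 1) ks"
proof (cases ks)
 case Nil
 then have "wrd ks M N = (%_. 1)" by (simp add: wrd_def fun_eq_iff)
 then show ?thesis using Nil by simp
next
 case (Cons k ks')
 have "((%t. \<Sum>p\<in>posbox M N. 1 / lval t p ^ k * vl ks' M N t p) has_field_derivative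
  DM (%M N t p. - of_int (fst p)) M N t (%_. 1) (k # ks') + (\<Sum>p\<in>posbox M N. 0 / lval t p ^ k * vl ks' M N t p)) (at t)"
  by (rule has_derivative_DM[OF assms]) simp
 moreover have "wrd ks M N = (%t. \<Sum>p\<in>posbox M N. 1 / lval t p ^ k * vl ks' M N t p)"
  unfolding Cons fun_eq_iff wrd_Cons by simp
 ultimately show ?thesis using Cons by (simp add: DERIV_imp_deriv del: DM.simps)
qed

section \<open>The sums of 1/z over a full horizontal line\<close>

definition lsum :: "nat => complex => int => complex" where
 "lsum N t j = (\<Sum>n\<in>{n. \<bar>n\<bar> < int N}. 1 / lval t (j, n))"

lemma trapezoid_Ln:
 assumes "0 < Im z" "!!s. 0 \<le> s ==> s \<le> 1 ==> b \<le> norm (z + of_real s)" "0 < b"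
 shows "norm ((1 / z + 1 / (z + 1)) / 2 - (Ln (z + 1) - Ln z)) \<le> 1 / b ^ 3"
proof -
 define \<phi> where "\<phi> w = w / 2 * (1 / z + 1 / (z + w)) - (Ln (z + w) - Ln z)" for w :: complex
 let ?\<phi>' = "%w. w\<^sup>2 / (2 * z * (z + w)\<^sup>2)"
 let ?S = "closed_segment 0 1 :: complex set"
 have S: "\<exists>s. 0 \<le> s \<and> s \<le> 1 \<and> w = of_real s" if "w \<in> ?S" for w
  using that by (auto simp: in_segment scaleR_conv_of_real)
 have d: "(\<phi> has_field_derivative ?\<phi>' w) (at w within ?S)" if "w \<in> ?S" for w
 proof -
  have nz: "z + w \<noteq> 0" "z + w \<notin> \<real>\<^sub>\<le>\<^sub>0" "z \<noteq> 0"
   using assms(1) S[OF that] by (auto simp: complex_eq_iff complex_nonpos_Reals_iff)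
  have 1: "((%w. w / 2) has_field_derivative 1 / 2) (at w)" by (auto intro!: derivative_eq_intros)
  have 2: "((%w. 1 / (z + w)) has_field_derivative - 1 / (z + w)\<^sup>2) (at w)"
   using nz by (auto intro!: derivative_eq_intros simp: power2_eq_square)
  have 3: "((%w. Ln (z + w) - Ln z) has_field_derivative 1 / (z + w)) (at w)"
   using nz by (auto intro!: derivative_eq_intros simp: inverse_eq_divide)
  have "(\<phi> has_field_derivative
   1 / 2 * (1 / z + 1 / (z + w)) + (0 + - 1 / (z + w)\<^sup>2) * (w / 2) - 1 / (z + w)) (at w)"
   unfolding \<phi>_def by (rule DERIV_diff[OF DERIV_mult[OF 1 DERIV_add[OF DERIV_const 2]] 3])
  also have "1 / 2 * (1 / z + 1 / (z + w)) + (0 + - 1 / (z + w)\<^sup>2) * (w / 2) - 1 / (z + w) = ?\<phi>' w"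
   using nz by (simp add: divide_simps) (simp add: power2_eq_square algebra_simps)
  finally show ?thesis by (rule DERIV_subset) simp
 qed
 have b: "norm (?\<phi>' w) \<le> 1 / b ^ 3" if "w \<in> ?S" for w
 proof -
  obtain s where s: "0 \<le> s" "s \<le> 1" "w = of_real s" using S[OF \<open>w \<in> ?S\<close>] by blast
  have 1: "b \<le> norm z" "b \<le> norm (z + w)" using assms(2)[of 0] assms(2)[of s] s by auto
  have "norm (?\<phi>' w) = s\<^sup>2 / (2 * norm z * norm (z + w) ^ 2)"
   by (simp add: norm_divide norm_mult norm_power s(3))
  also have "... \<le> 1 / (b * b ^ 2)"
  proof (rule frac_le)
   have "s\<^sup>2 \<le> 1\<^sup>2" using s by (intro power_mono) auto
   then show "s\<^sup>2 \<le> 1" by simp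
   have "b * b\<^sup>2 \<le> norm z * norm (z + w) ^ 2"
    using 1 assms(3) by (intro mult_mono power_mono) auto
   also have "... \<le> 2 * norm z * norm (z + w) ^ 2" by simp
   finally show "b * b\<^sup>2 \<le> 2 * norm z * norm (z + w) ^ 2" .
  qed (use assms(3) in auto)
  finally show ?thesis by (simp add: power3_eq_cube power2_eq_square mult.assoc)
 qed
 have "norm (\<phi> 1 - \<phi> 0) \<le> 1 / b ^ 3 * norm (1 - 0 :: complex)"
  by (rule field_differentiable_bound[of ?S \<phi> ?\<phi>']) (use d b in auto)
 then show ?thesis by (simp add: \<phi>_def)
qed

lemma Ln_shift_tendsto: "(%N. Ln (x + of_nat N + 1) - Ln (of_nat N - x)) \<longlonglongrightarrow> 0"
proof -
 have l: "(%N. y / of_nat N) \<longlonglongrightarrow> 0" for y :: complex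
  by (rule tendsto_divide_0[OF tendsto_const tendsto_of_nat])
 have L: "(%N. Ln (1 + y / of_nat N)) \<longlonglongrightarrow> 0" for y :: complex
 proof -
  have "(%N. Ln (1 + y / of_nat N)) \<longlonglongrightarrow> Ln (1 + 0)"
   by (intro tendsto_intros l) auto
  then show ?thesis by simp
 qed
 have nz: "\<forall>\<^sub>F N in sequentially. 1 + y / of_nat N \<noteq> 0" for y :: complex
 proof -
  have "(%N. 1 + y / of_nat N) \<longlonglongrightarrow> 1 + 0" by (intro tendsto_intros l)
  from tendsto_imp_eventually_ne[OF this, of 0] show ?thesis by simp
 qed
 have "(%N. Ln (1 + (x + 1) / of_nat N) - Ln (1 + (- x) / of_nat N)) \<longlonglongrightarrow> 0 - 0"
  by (intro tendsto_diff L)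
 moreover have "\<forall>\<^sub>F N in sequentially. Ln (1 + (x + 1) / of_nat N) - Ln (1 + (- x) / of_nat N) = Ln (x + of_nat N + 1) - Ln (of_nat N - x)"
  using nz[of "x + 1"] nz[of "- x"] eventually_gt_at_top[of 0]
 proof eventually_elim
  case (elim N)
  have e: "Ln (of_nat N + y) = ln (real N) + Ln (1 + y / of_nat N)" if "1 + y / of_nat N \<noteq> 0" for y
  proof -
   have "of_nat N + y = of_real (real N) * (1 + y / of_nat N)" using elim(3) by (simp add: field_simps)
   then show ?thesis using Ln_times_of_real[of "real N" "1 + y / of_nat N"] that elim(3) by simp
  qed
  show ?case using e[OF elim(1)] e[OF elim(2)] by (simp add: add_ac)
 qed
 ultimately show ?thesis by (simp add: tendsto_cong)
qed

lemma lsum_bound: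
 assumes A: "1 \<le> A" "t \<in> KA A" and j: "1 \<le> j" and \<epsilon>: "0 < \<epsilon>"
 shows "\<forall>\<^sub>F N in sequentially. norm (lsum N t j + of_real pi * \<i>) \<le> 40 * KK A ^ 3 / (real_of_int j)\<^sup>2 + \<epsilon>"
proof -
 define z where "z n = lval t (j, n)" for n
 have pos: "0 < Im t" using KA_pos A by blast
 have im: "0 < Im (z n)" for n using pos j by (simp add: z_def lval_def)
 have zS: "z (n + 1) = z n + 1" for n by (simp add: z_def lval_def)
 define er where "er n = (1 / z n + 1 / z (n + 1)) / 2 - (Ln (z (n + 1)) - Ln (z n))" for n
 have er: "norm (er n) \<le> (2 * KK A) ^ 3 * (1 / mx j n ^ 3)" for n
 proof -
  have "norm (er n) \<le> 1 / (mx j n / (2 * KK A)) ^ 3"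
   unfolding er_def zS
  proof (rule trapezoid_Ln[OF im])
   fix s :: real assume s: "0 \<le> s" "s \<le> 1"
   have "mx j n / 2 \<le> max \<bar>real_of_int j\<bar> \<bar>real_of_int n + s\<bar>"
   proof -
    have "\<bar>real_of_int n\<bar> \<le> 1 \<or> 2 \<le> \<bar>real_of_int n\<bar>" by (cases "\<bar>n\<bar> \<le> 1") linarith+
    moreover have "1 \<le> real_of_int j" using j by simp
    ultimately have "\<bar>real_of_int n\<bar> \<le> 2 * real_of_int j \<or> \<bar>real_of_int n\<bar> \<le> 2 * \<bar>real_of_int n + s\<bar>"
     using s by (auto simp: abs_if split: if_splits)
    then show ?thesis using j by (auto simp: mx_def max_def)
   qed
   also have "... \<le> KK A * norm (z n + of_real s)"
    using real_lattice_lower[OF A, of "real_of_int j" "real_of_int n + s"] by (simp add: z_def lval_def add.assoc)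
   finally show "mx j n / (2 * KK A) \<le> norm (z n + of_real s)"
    using KK_ge1[of A] by (simp add: field_simps)
  qed (use mx_ge1[of j n] KK_ge1[of A] in auto)
  then show ?thesis by (simp add: power_divide)
 qed
 have erS: "norm (\<Sum>n\<in>{n. \<bar>n\<bar> < int (Suc N)}. er n) \<le> 40 * KK A ^ 3 / (real_of_int j)\<^sup>2" for N
 proof -
  have "norm (\<Sum>n\<in>{n. \<bar>n\<bar> < int (Suc N)}. er n) \<le> (\<Sum>n\<in>{n. \<bar>n\<bar> < int (Suc N)}. (2 * KK A) ^ 3 * (1 / mx j n ^ 3))"
   by (intro sum_norm_le er)
  also have "... = (2 * KK A) ^ 3 * (\<Sum>n\<in>{n. \<bar>n\<bar> < int (Suc N)}. 1 / mx j n ^ 3)"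
   by (simp add: sum_distrib_left)
  also have "... \<le> (2 * KK A) ^ 3 * (5 / (max 1 (real_of_int j)) ^ (3 - 1))"
   using KK_ge1[of A] finite_pset_line[of "Suc N" "%_. True"] by (intro mult_left_mono sum_mx_pow) auto
  finally show ?thesis using j by (simp add: power_mult_distrib max_def)
 qed
 have eq: "lsum (Suc N) t j + of_real pi * \<i> = (\<Sum>n\<in>{n. \<bar>n\<bar> < int (Suc N)}. er n)
  + ((Ln (of_int j * t + of_nat N + 1) - Ln (of_nat N - of_int j * t)) + 1 / 2 * (1 / (of_int j * t - of_nat N) - 1 / (of_int j * t + of_nat N + 1)))" for N
 proof -
  have "(\<Sum>n\<in>{n. \<bar>n\<bar> < int (Suc N)}. er n) = (\<Sum>n\<in>{n. \<bar>n\<bar> < int (Suc N)}. 1 / z n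
   + ((Ln (z n) - 1 / 2 * (1 / z n)) - (Ln (z (n + 1)) - 1 / 2 * (1 / z (n + 1)))))"
   by (intro sum.cong refl) (simp add: er_def field_simps)
  also have "... = lsum (Suc N) t j + ((Ln (z (- int N)) - 1 / 2 * (1 / z (- int N))) - (Ln (z (int (Suc N))) - 1 / 2 * (1 / z (int (Suc N)))))"
   unfolding sum.distrib sum_telescope_int[of "%n. Ln (z n) - 1 / 2 * (1 / z n)" N] by (simp add: lsum_def z_def)
  finally have 1: "(\<Sum>n\<in>{n. \<bar>n\<bar> < int (Suc N)}. er n) = ..." .
  have 2: "z (- int N) = of_int j * t - of_nat N" "z (int (Suc N)) = of_int j * t + of_nat N + 1"
   by (simp_all add: z_def lval_def)
  have "Ln (of_int j * t - of_nat N) = Ln (- (of_nat N - of_int j * t))" by simp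
  also have "... = Ln (of_nat N - of_int j * t) + \<i> * of_real pi"
   using im[of 0] pos j by (subst Ln_minus) (auto simp: z_def lval_def complex_eq_iff)
  finally have 3: "Ln (of_int j * t - of_nat N) = Ln (of_nat N - of_int j * t) + \<i> * of_real pi" .
  show ?thesis unfolding 1 2 3 by (simp add: algebra_simps)
 qed
 have "(%N. (Ln (of_int j * t + of_nat N + 1) - Ln (of_nat N - of_int j * t)) + 1 / 2 * (1 / (of_int j * t - of_nat N) - 1 / (of_int j * t + of_nat N + 1))) \<longlonglongrightarrow> 0 + 1 / 2 * (0 - 0)"
 proof (intro tendsto_add Ln_shift_tendsto tendsto_mult_left tendsto_diff)
  have a: "filterlim (%N. (of_nat N :: complex)) at_infinity sequentially" by (rule tendsto_of_nat)
  have "filterlim (%N. - of_int j * t + (of_nat N :: complex)) at_infinity sequentially"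
   by (rule tendsto_add_filterlim_at_infinity[OF tendsto_const a])
  from tendsto_divide_0[OF tendsto_const this, of "-1"]
  show "(%N. 1 / (of_int j * t - of_nat N)) \<longlonglongrightarrow> 0"
   by (simp add: minus_divide_left[symmetric] minus_divide_right)
  have "filterlim (%N. (of_int j * t + 1) + (of_nat N :: complex)) at_infinity sequentially"
   by (rule tendsto_add_filterlim_at_infinity[OF tendsto_const a])
  from tendsto_divide_0[OF tendsto_const this, of "1"]
  show "(%N. 1 / (of_int j * t + of_nat N + 1)) \<longlonglongrightarrow> 0" by (simp add: add_ac)
 qed
 then have "(%N. norm ((Ln (of_int j * t + of_nat N + 1) - Ln (of_nat N - of_int j * t)) + 1 / 2 * (1 / (of_int j * t - of_nat N) - 1 / (of_int j * t + of_nat N + 1)))) \<longlonglongrightarrow> 0"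
  by (intro tendsto_norm_zero) simp
 then have "\<forall>\<^sub>F N in sequentially. norm ((Ln (of_int j * t + of_nat N + 1) - Ln (of_nat N - of_int j * t)) + 1 / 2 * (1 / (of_int j * t - of_nat N) - 1 / (of_int j * t + of_nat N + 1))) < \<epsilon>"
  by (rule order_tendstoD) fact
 then have "\<forall>\<^sub>F N in sequentially. norm (lsum (Suc N) t j + of_real pi * \<i>) \<le> 40 * KK A ^ 3 / (real_of_int j)\<^sup>2 + \<epsilon>"
 proof eventually_elim
  case (elim N)
  show ?case unfolding eq by (intro norm_triangle_mono erS less_imp_le[OF elim])
 qed
 then show ?thesis by (simp add: eventually_sequentially_Suc[of "%N. norm (lsum N t j + of_real pi * \<i>) \<le> 40 * KK A ^ 3 / (real_of_int j)\<^sup>2 + \<epsilon>"])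
qed

section \<open>Window sums are negligible\<close>

lemma sum_window_sq:
 assumes "m < M"
 shows "(\<Sum>j\<in>{int M - int m..<int M}. 1 / (real_of_int j)\<^sup>2) \<le> 2 * (1 / (real M - real m) - 1 / real M)"
 using assms
proof (induction m)
 case (Suc m)
 define a where "a = real M - real m"
 have a: "2 \<le> a" using Suc.prems by (simp add: a_def)
 have "{int M - int (Suc m)..<int M} = insert (int M - int (Suc m)) {int M - int m..<int M}" using Suc.prems by auto
 then have "(\<Sum>j\<in>{int M - int (Suc m)..<int M}. 1 / (real_of_int j)\<^sup>2) = 1 / (a - 1)\<^sup>2 + (\<Sum>j\<in>{int M - int m..<int M}. 1 / (real_of_int j)\<^sup>2)"
  by (simp add: a_def algebra_simps)
 also have "... \<le> 1 / (a - 1)\<^sup>2 + 2 * (1 / a - 1 / real M)"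
  using Suc by (simp add: a_def)
 also have "1 / (a - 1)\<^sup>2 \<le> 2 * (1 / (a - 1) - 1 / a)"
 proof -
  have "1 / b\<^sup>2 = 2 / (b * (2 * b))" for b :: real by (simp add: power2_eq_square)
  then have "1 / (a - 1)\<^sup>2 = 2 / ((a - 1) * (2 * (a - 1)))" .
  also have "... \<le> 2 / ((a - 1) * a)" using a by (intro divide_left_mono mult_left_mono mult_pos_pos) auto
  also have "... = 2 * (1 / (a - 1) - 1 / a)" using a by (simp add: field_simps)
  finally show ?thesis .
 qed
 finally show ?case by (simp add: a_def algebra_simps)
qed simp

lemma ell_power_tendsto:
 assumes "0 < (s::real)" shows "(%M. ell M ^ e / real M powr s) \<longlonglongrightarrow> 0"
 using assms
proof (induction e arbitrary: s)
 case 0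
 then show ?case by (simp, real_asymp)
next
 case (Suc e)
 have "(%M. ell M / real M powr (s / 2)) \<longlonglongrightarrow> 0"
  unfolding ell_def using Suc.prems by real_asymp
 from tendsto_mult[OF this Suc.IH[of "s / 2"]]
 have "(%M. ell M / real M powr (s / 2) * (ell M ^ e / real M powr (s / 2))) \<longlonglongrightarrow> 0"
  using Suc.prems by simp
 moreover have "ell M / real M powr (s / 2) * (ell M ^ e / real M powr (s / 2)) = ell M ^ Suc e / real M powr s" for M
  using powr_add[of "real M" "s / 2" "s / 2"] by simp
 ultimately show ?case by (simp only:)
qed

lemma sum_norm_inv_posbox:
 assumes A: "1 \<le> A" "t \<in> KA A" and k: "2 \<le> k" "k \<le> s" and M: "1 \<le> M" and F: "F \<subseteq> posbox M N"
 shows "(\<Sum>p\<in>F. norm (1 / lval t p ^ k)) \<le> 15 * KK A ^ s * ell M"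
proof -
 have "(\<Sum>p\<in>F. norm (1 / lval t p ^ k)) \<le> (\<Sum>p\<in>posbox M N. norm (1 / lval t p ^ k))"
  using F by (intro sum_mono2) auto
 also have "... \<le> (\<Sum>m\<in>{0..<int M}. 5 * KK A ^ k / (max 1 (real_of_int m)) ^ (k - 1))"
  unfolding posbox_eq_pset by (rule sum_pset_bound) (use A k in auto)
 also have "... \<le> (\<Sum>m\<in>{0..<int M}. 5 * KK A ^ s * (1 / max 1 \<bar>real_of_int m\<bar>))"
 proof (rule sum_mono)
  fix m :: int assume "m \<in> {0..<int M}"
  then have m: "max 1 \<bar>real_of_int m\<bar> = max 1 (real_of_int m)" by simp
  have "max 1 (real_of_int m) ^ 1 \<le> max 1 (real_of_int m) ^ (k - 1)" using k by (intro power_increasing) auto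
  then have "5 * KK A ^ k / (max 1 (real_of_int m)) ^ (k - 1) \<le> 5 * KK A ^ s / max 1 (real_of_int m)"
   using KK_ge1[of A] KK_pow_le[OF k(2), of A] by (intro frac_le) auto
  then show "5 * KK A ^ k / (max 1 (real_of_int m)) ^ (k - 1) \<le> 5 * KK A ^ s * (1 / max 1 \<bar>real_of_int m\<bar>)"
   unfolding m by simp
 qed
 also have "... = 5 * KK A ^ s * (\<Sum>m\<in>{0..<int M}. 1 / max 1 \<bar>real_of_int m\<bar>)" by (simp add: sum_distrib_left)
 also have "... \<le> 5 * KK A ^ s * (3 * ell M)"
  using KK_ge1[of A] M by (intro mult_left_mono sum_inv_abs) auto
 finally show ?thesis by simp
qed

lemma csum_ell_bound:
 assumes "1 \<le> A" "t \<in> KA A" "ks \<in> mes_indices" "sum_list ks \<le> s" "1 \<le> M" "F \<subseteq> posbox M N"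
 shows "norm (csum R (lval t) F ks) \<le> (15 * KK A ^ s * ell M) ^ length ks"
proof (rule csum_bound_power)
 show "finite F" using assms finite_posbox finite_subset by blast
 fix k assume k: "k \<in> set ks"
 then have "k \<le> s" using member_le_sum_list[OF k] assms(4) by simp
 then show "(\<Sum>x\<in>F. norm (1 / lval t x ^ k)) \<le> 15 * KK A ^ s * ell M"
  using sum_norm_inv_posbox assms mem_mes_indices k by blast
qed

lemma sum_inv_reflect: assumes "1 \<le> M" shows "(\<Sum>m\<in>{0..<int M}. 1 / (real M - real_of_int m)) \<le> ell M"
proof -
 have "(\<Sum>m\<in>{0..<int M}. 1 / (real M - real_of_int m)) = (\<Sum>n=1..M. 1 / real n)"
  by (rule sum.reindex_bij_witness[of _ "%n. int M - int n" "%m. nat (int M - m)"]) auto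
 then show ?thesis using sum_inv_le_ell[OF assms] by simp
qed

lemma nullf_window:
 assumes d: "!!t. 0 < Im t ==> \<exists>C\<ge>0. \<forall>j\<ge>1. \<forall>\<epsilon>>0. \<forall>\<^sub>F N in sequentially. norm (d N t j) \<le> C / (real_of_int j)\<^sup>2 + \<epsilon>"
  and \<omega>: "!!M N t p. 0 < Im t ==> p \<in> posbox M N ==> \<omega> M N t p = (\<Sum>j\<in>{int M - fst p..<int M}. d N t j)"
  and w: "u \<in> mes_indices" "ks \<in> mes_indices" "2 \<le> k"
 shows "nullf (%M N t. \<Sum>p\<in>posbox M N. tu u M N t p * (\<omega> M N t p * (vl ks M N t p / lval t p ^ k)))"
proof (rule nullfI)
 fix t :: complex assume t: "0 < Im t"
 obtain A where A: "1 \<le> A" "t \<in> KA A" using ex_KA[OF t] by blast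
 obtain C where C: "0 \<le> C" "!!j \<epsilon>. 1 \<le> j ==> 0 < \<epsilon> ==> \<forall>\<^sub>F N in sequentially. norm (d N t j) \<le> C / (real_of_int j)\<^sup>2 + \<epsilon>"
  using d[OF t] by blast
 define s where "s = sum_list u + sum_list ks"
 define E where "E = length u + length ks"
 define V where "V M = 15 * KK A ^ s * ell M" for M
 define b where "b M = (15 * KK A ^ s) ^ E * (5 * KK A ^ k) * (2 * C + 1) * (ell M ^ Suc E / real M)" for M
 have "(%M. ell M ^ Suc E / real M powr 1) \<longlonglongrightarrow> 0" by (rule ell_power_tendsto) simp
 then have "(%M. ell M ^ Suc E / real M) \<longlonglongrightarrow> 0" by simp
 then have b0: "b \<longlonglongrightarrow> 0" unfolding b_def by (rule tendsto_mult_right_zero)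
 moreover have "\<forall>\<^sub>F N in sequentially. norm (\<Sum>p\<in>posbox M N. tu u M N t p * (\<omega> M N t p * (vl ks M N t p / lval t p ^ k))) \<le> b M" for M
 proof (cases "M = 0")
  case True
  then have "posbox M N = {}" for N by (auto simp: posbox_def lat_box_def)
  then show ?thesis using True by (simp add: b_def)
 next
  case False
  then have M: "1 \<le> M" by simp
  have "\<forall>\<^sub>F N in sequentially. \<forall>j\<in>{1..<int M}. norm (d N t j) \<le> C / (real_of_int j)\<^sup>2 + 1 / (real M)\<^sup>2"
   using M by (intro eventually_ball_finite ballI C(2)) auto
  then show ?thesis
  proof eventually_elim
   case (elim N)
   let ?W = "%m. 2 * C * (real_of_int m / ((real M - real_of_int m) * real M)) + real_of_int m / (real M)\<^sup>2"
   have W: "norm (\<omega> M N t p) \<le> ?W (fst p)" if p: "p \<in> posbox M N" for p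
   proof -
    obtain m where m: "fst p = int m" "m < M" using p by (cases p) (auto simp: mem_posbox dest: zero_le_imp_eq_int)
    have "norm (\<omega> M N t p) \<le> (\<Sum>j\<in>{int M - int m..<int M}. C * (1 / (real_of_int j)\<^sup>2) + 1 / (real M)\<^sup>2)"
     unfolding \<omega>[OF t p] m(1) by (rule sum_norm_le) (use elim m(2) in auto)
    also have "... = C * (\<Sum>j\<in>{int M - int m..<int M}. 1 / (real_of_int j)\<^sup>2) + m / (real M)\<^sup>2"
     by (simp add: sum.distrib sum_distrib_left)
    also have "... \<le> C * (2 * (1 / (real M - real m) - 1 / real M)) + m / (real M)\<^sup>2"
     using C(1) sum_window_sq[OF m(2)] by (intro add_right_mono mult_left_mono) auto
    also have "1 / (real M - real m) - 1 / real M = m / ((real M - real m) * real M)"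
     using m(2) by (simp add: field_simps)
    finally show ?thesis by (simp add: m(1) mult_ac)
   qed
   have V0: "0 \<le> V M" unfolding V_def using KK_ge1[of A] ell_ge1[OF M] by simp
   have "norm (\<Sum>p\<in>posbox M N. tu u M N t p * (\<omega> M N t p * (vl ks M N t p / lval t p ^ k)))
    \<le> (\<Sum>p\<in>posbox M N. V M ^ E * (?W (fst p) * norm (1 / lval t p ^ k)))"
   proof (rule sum_norm_le)
    fix p assume p: "p \<in> posbox M N"
    have 1: "norm (tu u M N t p) \<le> V M ^ length u" "norm (vl ks M N t p) \<le> V M ^ length ks"
     unfolding tu_def vl_def V_def by (intro csum_ell_bound A w M; force simp: s_def)+
    have W0: "0 \<le> ?W (fst p)" using order_trans[OF norm_ge_zero W[OF p]] .
    have "norm (tu u M N t p * (\<omega> M N t p * (vl ks M N t p / lval t p ^ k)))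
     = norm (tu u M N t p) * norm (vl ks M N t p) * (norm (\<omega> M N t p) * norm (1 / lval t p ^ k))"
     by (simp add: norm_mult norm_divide)
    also have "... \<le> V M ^ length u * V M ^ length ks * (?W (fst p) * norm (1 / lval t p ^ k))"
     using 1 V0 W0 by (intro mult_mono mult_right_mono W[OF p] mult_nonneg_nonneg) auto
    finally show "norm (tu u M N t p * (\<omega> M N t p * (vl ks M N t p / lval t p ^ k))) \<le> V M ^ E * (?W (fst p) * norm (1 / lval t p ^ k))"
     by (simp add: E_def power_add)
   qed
   also have "... = V M ^ E * (\<Sum>m\<in>{0..<int M}. ?W m * (\<Sum>n\<in>{n. \<bar>n\<bar> < int N \<and> (m, n) \<succ> (0, 0)}. norm (1 / lval t (m, n) ^ k)))"
    unfolding sum_distrib_left[symmetric] sum_posbox_levels by (simp add: sum_distrib_left)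
   also have "... \<le> V M ^ E * (\<Sum>m\<in>{0..<int M}. 5 * KK A ^ k * (2 * C / M * (1 / (real M - real_of_int m)) + 1 / (real M)\<^sup>2))"
   proof (intro mult_left_mono sum_mono)
    fix m :: int assume m: "m \<in> {0..<int M}"
    then have mM: "0 < real M - real_of_int m" "0 \<le> m" by auto
    have W0: "0 \<le> ?W m" using mM C(1) M by (intro add_nonneg_nonneg mult_nonneg_nonneg divide_nonneg_nonneg) auto
    let ?a = "max 1 (real_of_int m)"
    have "(\<Sum>n\<in>{n. \<bar>n\<bar> < int N \<and> (m, n) \<succ> (0, 0)}. norm (1 / lval t (m, n) ^ k)) \<le> 5 * KK A ^ k / ?a ^ (k - 1)"
     by (rule sum_line_bound) (use A w in auto)
    also have "... \<le> 5 * KK A ^ k / ?a ^ 1"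
     using w(3) KK_ge1[of A] by (intro divide_left_mono power_increasing) auto
    finally have "?W m * (\<Sum>n\<in>{n. \<bar>n\<bar> < int N \<and> (m, n) \<succ> (0, 0)}. norm (1 / lval t (m, n) ^ k)) \<le> ?W m * (5 * KK A ^ k / ?a)"
     using W0 by (intro mult_left_mono) auto
    also have "... = 5 * KK A ^ k * (?W m / ?a)" by simp
    also have "?W m / ?a \<le> 2 * C / M * (1 / (real M - real_of_int m)) + 1 / (real M)\<^sup>2"
    proof -
     have r: "real_of_int m / ?a \<le> 1" by simp
     have "?W m / ?a = (2 * C / M * (1 / (real M - real_of_int m)) + 1 / (real M)\<^sup>2) * (real_of_int m / ?a)"
      by (simp add: algebra_simps add_divide_distrib)
     also have "... \<le> (2 * C / M * (1 / (real M - real_of_int m)) + 1 / (real M)\<^sup>2) * 1"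
      using r mM C(1) M by (intro mult_left_mono add_nonneg_nonneg mult_nonneg_nonneg) auto
     finally show ?thesis by simp
    qed
    finally show "?W m * (\<Sum>n\<in>{n. \<bar>n\<bar> < int N \<and> (m, n) \<succ> (0, 0)}. norm (1 / lval t (m, n) ^ k))
     \<le> 5 * KK A ^ k * (2 * C / M * (1 / (real M - real_of_int m)) + 1 / (real M)\<^sup>2)"
     using KK_ge1[of A] by (simp add: mult_left_mono)
   qed (use V0 in auto)
   also have "... = V M ^ E * (5 * KK A ^ k) * (2 * C / M * (\<Sum>m\<in>{0..<int M}. 1 / (real M - real_of_int m)) + M * (1 / (real M)\<^sup>2))"
    unfolding sum_distrib_left[symmetric] sum.distrib by (simp add: mult.assoc)
   also have "... \<le> V M ^ E * (5 * KK A ^ k) * (2 * C / M * ell M + 1 / M * ell M)"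
   proof (intro mult_left_mono add_mono sum_inv_reflect M)
    show "M * (1 / (real M)\<^sup>2) \<le> 1 / M * ell M" using M ell_ge1[OF M] by (simp add: power2_eq_square divide_right_mono)
   qed (use V0 KK_ge1[of A] C(1) in auto)
   also have "... = b M" unfolding b_def V_def by (simp add: field_simps power_mult_distrib add_divide_distrib)
   finally show ?case .
  qed
 qed
 ultimately show "\<exists>b. b \<longlonglongrightarrow> 0 \<and> (\<forall>M. \<forall>\<^sub>F N in sequentially. norm (\<Sum>p\<in>posbox M N. tu u M N t p * (\<omega> M N t p * (vl ks M N t p / lval t p ^ k))) \<le> b M)"
  by blast
qed

lemma win_levels:
 assumes "p \<in> posbox M N"
 shows "win j M N t p = (\<Sum>i\<in>{int M - fst p..<int M}. \<Sum>n\<in>{n. \<bar>n\<bar> < int N}. 1 / lval t (i, n) ^ j)"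
proof -
 have "fst p < int M" using assms by (cases p) (auto simp: mem_posbox)
 then have "{q\<in>posbox M N. int M - fst p \<le> fst q} = {int M - fst p..<int M} \<times> {n. \<bar>n\<bar> < int N}"
  by (auto simp: mem_posbox)
 then show ?thesis unfolding win_def
  using finite_pset_line[of N "%_. True"] by (subst sum.cartesian_product) (simp add: case_prod_unfold)
qed

definition werr :: pfam where
 "werr M N t p = (\<Sum>i\<in>{int M - fst p..<int M}. lsum N t i + of_real pi * \<i>)"

lemma win1_eq:
 assumes "p \<in> posbox M N"
 shows "win 1 M N t p = (of_real pi * \<i>) * (- of_int (fst p)) + 1 * werr M N t p"
proof -
 have "0 \<le> fst p" using assms by (cases p) (auto simp: mem_posbox)
 then show ?thesis
  unfolding win_levels[OF assms] werr_def by (simp add: sum.distrib lsum_def)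
qed

lemma werr_LL:
 assumes "u \<in> mes_indices" "ks \<in> mes_indices" "2 \<le> k"
 shows "(%M N t. \<Sum>p\<in>posbox M N. tu u M N t p * (werr M N t p * (vl ks M N t p / lval t p ^ k))) \<in> LL"
proof (rule nullf_LL, rule nullf_window[where d = "%N t j. lsum N t j + of_real pi * \<i>"])
 fix t :: complex assume t: "0 < Im t"
 obtain A where A: "1 \<le> A" "t \<in> KA A" using ex_KA[OF t] by blast
 show "\<exists>C\<ge>0. \<forall>j\<ge>1. \<forall>\<epsilon>>0. \<forall>\<^sub>F N in sequentially. norm (lsum N t j + of_real pi * \<i>) \<le> C / (real_of_int j)\<^sup>2 + \<epsilon>"
  using lsum_bound[OF A] KK_ge1[of A] by (intro exI[of _ "40 * KK A ^ 3"]) auto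
qed (use assms in \<open>auto simp: werr_def\<close>)

lemma win2_null:
 assumes "ks \<in> mes_indices" "2 \<le> k"
 shows "nullf (%M N t. \<Sum>p\<in>posbox M N. win 2 M N t p * (vl ks M N t p / lval t p ^ k))"
proof -
 have "nullf (%M N t. \<Sum>p\<in>posbox M N. tu [] M N t p * (win 2 M N t p * (vl ks M N t p / lval t p ^ k)))"
 proof (rule nullf_window[where d = "%N t j. \<Sum>n\<in>{n. \<bar>n\<bar> < int N}. 1 / lval t (j, n) ^ 2"])
  fix t :: complex assume t: "0 < Im t"
  obtain A where A: "1 \<le> A" "t \<in> KA A" using ex_KA[OF t] by blast
  have "\<forall>\<^sub>F N in sequentially. norm (\<Sum>n\<in>{n. \<bar>n\<bar> < int N}. 1 / lval t (j, n) ^ 2) \<le> LB A [2] / (real_of_int j)\<^sup>2 + \<epsilon>"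
   if j: "1 \<le> j" and e: "0 < \<epsilon>" for j \<epsilon>
  proof -
   have ps: "psum {j} [2] N t = (\<Sum>n\<in>{n. \<bar>n\<bar> < int N}. 1 / lval t (j, n) ^ 2)" for N
    unfolding psum_def csum.simps using j by (subst pset_line_full) (auto simp: sum.reindex inj_on_def)
   have "norm (plim {j} [2] t) \<le> LB A [2] / (real (nat j) + 1)\<^sup>2"
    using plim_line_bound[OF A, of "[2]" "nat j"] j by simp
   also have "... \<le> LB A [2] / (real_of_int j)\<^sup>2"
    using j LB_nonneg by (intro divide_left_mono power_mono mult_pos_pos) auto
   finally have "norm (plim {j} [2] t) < LB A [2] / (real_of_int j)\<^sup>2 + \<epsilon>" using e by simp
   moreover have "(%N. norm (psum {j} [2] N t)) \<longlonglongrightarrow> norm (plim {j} [2] t)"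
    by (intro tendsto_norm psum_plim' t) auto
   ultimately have "\<forall>\<^sub>F N in sequentially. norm (psum {j} [2] N t) < LB A [2] / (real_of_int j)\<^sup>2 + \<epsilon>"
    by (intro order_tendstoD)
   then show ?thesis unfolding ps by eventually_elim simp
  qed
  then show "\<exists>C\<ge>0. \<forall>j\<ge>1. \<forall>\<epsilon>>0. \<forall>\<^sub>F N in sequentially. norm (\<Sum>n\<in>{n. \<bar>n\<bar> < int N}. 1 / lval t (j, n) ^ 2) \<le> C / (real_of_int j)\<^sup>2 + \<epsilon>"
   using LB_nonneg by blast
 qed (use assms win_levels in auto)
 then show ?thesis by simp
qed

lemma LL_half: "(%M N t. 2 * f M N t) \<in> LL ==> f \<in> LL"
 using LL_scale[of "%M N t. 2 * f M N t" "1 / 2"] by (simp add: of_rat_divide)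

lemma split_algebra:
 assumes "(X::complex) = P + 1 * W" "X = (- 1) * Q + (- 1) * H" shows "P = - Q - H - W"
proof -
 have "P = X - W" using assms(1) by simp
 then show ?thesis using assms(2) by simp
qed

lemma deriv_wrd_LL:
 assumes "w \<in> mes_indices"
 shows "(%M N t. 2 * of_real pi * \<i> * deriv (wrd w M N) t) \<in> LL"
proof (cases w)
 case Nil
 have "wrd [] M N = (%_. 1)" for M N by (simp add: wrd_def fun_eq_iff)
 then show ?thesis using Nil EE_LL[OF EE_zero] by simp
next
 case (Cons k ks)
 then have k: "2 \<le> k" "ks \<in> mes_indices" using assms by auto
 let ?D = "%\<omega> M N t. DM \<omega> M N t (%_. 1) w"
 have om: "?D om \<in> LL" using DM_LL[OF om_tu_LL mes_indices_Nil assms] by simp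
 have we: "?D werr \<in> LL" using DM_LL[OF werr_LL mes_indices_Nil assms] by simp
 have "(%M N t. 2 * DM hh M N t (%_. 1) (k # ks)) \<in> LL"
  using LL_diff[OF DM_hh_win2_LL[OF k(2,1)] nullf_LL[OF win2_null[OF k(2,1)]]] by (simp del: DM.simps)
 then have hh: "?D hh \<in> LL" unfolding Cons by (rule LL_half)
 have eq: "2 * of_real pi * \<i> * deriv (wrd w M N) t = of_nat 2 * (- ?D om M N t - ?D hh M N t - ?D werr M N t)"
  if t: "0 < Im t" for M N t
 proof -
  have 1: "?D (win 1) M N t = (of_real pi * \<i>) * ?D (%M N t p. - of_int (fst p)) M N t + 1 * ?D werr M N t"
   by (rule DM_lin) (rule win1_eq)
  have 2: "?D (win 1) M N t = (- 1) * ?D om M N t + (- 1) * ?D hh M N t"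
   by (rule DM_lin) (simp add: om_def)
  have "(of_real pi * \<i>) * ?D (%M N t p. - of_int (fst p)) M N t = - ?D om M N t - ?D hh M N t - ?D werr M N t"
   by (rule split_algebra[OF 1 2])
  then show ?thesis unfolding deriv_wrd[OF t] by (simp add: mult.assoc del: DM.simps)
 qed
 have "(%M N t. of_nat 2 * (- ?D om M N t - ?D hh M N t - ?D werr M N t)) \<in> LL"
  by (intro LL_of_nat LL_diff LL_minus om hh we)
 then show ?thesis by (rule LL_cong) (rule eq)
qed

definition lcw :: "(nat list => complex) => (rat \<times> nat list) list => complex" where
 "lcw f ps = (\<Sum>p\<leftarrow>ps. of_rat (fst p) * f (snd p))"

lemma lcw_Nil [simp]: "lcw f [] = 0" and lcw_append [simp]: "lcw f (ps @ qs) = lcw f ps + lcw f qs"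
 and lcw_Cons [simp]: "lcw f ((q, w) # ps) = of_rat q * f w + lcw f ps"
 by (simp_all add: lcw_def)

lemma lcw_scale: "lcw f (map (%(q, w). (c * q, w)) ps) = of_rat c * lcw f ps"
 by (induction ps) (auto simp: of_rat_mult algebra_simps)

lemma lcw_tendsto:
 assumes "!!w. w \<in> snd ` set ps ==> (%n. f n w) \<longlonglongrightarrow> g w"
 shows "(%n. lcw (f n) ps) \<longlonglongrightarrow> lcw g ps"
 unfolding lcw_def by (intro tendsto_sum_list tendsto_mult_left assms) auto

lemma EE_lcw:
 assumes "e \<in> EE"
 shows "\<exists>ps. snd ` set ps \<subseteq> mes_indices \<and> (\<forall>M N t. e M N t = lcw (%w. wrd w M N t) ps)"
 using assms
proof (induction rule: EE.induct)
 case (EE_wrd ks)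
 then show ?case by (intro exI[of _ "[(1, ks)]"]) simp
next
 case EE_zero
 show ?case by (intro exI[of _ "[]"]) simp
next
 case (EE_add f g)
 obtain ps where "snd ` set ps \<subseteq> mes_indices" "\<forall>M N t. f M N t = lcw (%w. wrd w M N t) ps"
  using EE_add.IH(1) by (elim exE conjE)
 moreover obtain qs where "snd ` set qs \<subseteq> mes_indices" "\<forall>M N t. g M N t = lcw (%w. wrd w M N t) qs"
  using EE_add.IH(2) by (elim exE conjE)
 ultimately show ?case by (intro exI[of _ "ps @ qs"]) auto
next
 case (EE_scale f q)
 obtain ps where ps: "snd ` set ps \<subseteq> mes_indices" "\<forall>M N t. f M N t = lcw (%w. wrd w M N t) ps"
  using EE_scale.IH by (elim exE conjE)
 have "snd ` set (map (%(c, w). (q * c, w)) ps) = snd ` set ps" by force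
 with ps show ?case by (intro exI[of _ "map (%(c, w). (q * c, w)) ps"]) (simp add: lcw_scale)
qed

theorem deriv_GG_span:
 assumes "w \<in> mes_indices"
 shows "\<exists>ps. snd ` set ps \<subseteq> mes_indices \<and>
  (\<forall>t. 0 < Im t \<longrightarrow> 2 * of_real pi * \<i> * deriv (GG w) t = lcw (%v. GG v t) ps)"
proof -
 obtain e where e: "e \<in> EE" "nullf (%M N t. 2 * of_real pi * \<i> * deriv (wrd w M N) t - e M N t)"
  using deriv_wrd_LL[OF assms] unfolding LL_def by blast
 obtain ps where ps: "snd ` set ps \<subseteq> mes_indices" "!!M N t. e M N t = lcw (%v. wrd v M N t) ps"
  using EE_lcw[OF e(1)] by (elim exE conjE) metis
 have "2 * of_real pi * \<i> * deriv (GG w) t = lcw (%v. GG v t) ps" if t: "0 < Im t" for t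
 proof -
  obtain b where b: "b \<longlonglongrightarrow> 0" "!!M. \<forall>\<^sub>F N in sequentially. norm (2 * of_real pi * \<i> * deriv (wrd w M N) t - e M N t) \<le> b M"
   using e(2) t unfolding nullf_def by meson
  have wp: "wrd w M N = psum {0..<int M} w N" for M N by (simp add: fun_eq_iff wrd_eq_psum)
  have "norm (2 * of_real pi * \<i> * deriv (plim {0..<int M} w) t - lcw (%v. plim {0..<int M} v t) ps) \<le> b M" for M
  proof (rule tendsto_upperbound[OF _ b(2)])
   show "(%N. norm (2 * of_real pi * \<i> * deriv (wrd w M N) t - e M N t))
    \<longlonglongrightarrow> norm (2 * of_real pi * \<i> * deriv (plim {0..<int M} w) t - lcw (%v. plim {0..<int M} v t) ps)"
    unfolding ps(2) wp wrd_eq_psum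
    by (intro tendsto_norm tendsto_diff tendsto_mult_left deriv_plim lcw_tendsto psum_plim' t assms) (use ps(1) in auto)
  qed simp
  then have "(%M. 2 * of_real pi * \<i> * deriv (plim {0..<int M} w) t - lcw (%v. plim {0..<int M} v t) ps) \<longlonglongrightarrow> 0"
   by (intro Lim_null_comparison[OF _ b(1)] always_eventually allI)
  moreover have "(%M. 2 * of_real pi * \<i> * deriv (plim {0..<int M} w) t - lcw (%v. plim {0..<int M} v t) ps)
   \<longlonglongrightarrow> 2 * of_real pi * \<i> * deriv (GG w) t - lcw (%v. GG v t) ps"
   by (intro tendsto_diff tendsto_mult_left deriv_GG lcw_tendsto plim_GG_tendsto t assms) (use ps(1) in auto)
  ultimately have "2 * of_real pi * \<i> * deriv (GG w) t - lcw (%v. GG v t) ps = 0"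
   using LIMSEQ_unique by blast
  then show ?thesis by simp
 qed
 with ps(1) show ?thesis by blast
qed

section \<open>Comparing chain sums\<close>

lemma csum_value_diff:
 fixes S \<eta> :: real
 assumes "finite F" "0 \<le> S" "!!k. k \<in> set u ==> (\<Sum>x\<in>F. norm (1 / z x ^ k)) \<le> S"
  "!!k. k \<in> set u ==> (\<Sum>x\<in>F. norm (1 / z' x ^ k)) \<le> S"
  "!!k. k \<in> set u ==> (\<Sum>x\<in>F. norm (1 / z' x ^ k - 1 / z x ^ k)) \<le> \<eta>"
 shows "norm (csum R z' F u - csum R z F u) \<le> length u * S ^ (length u - 1) * \<eta>"
 using assms
proof (induction u arbitrary: F)
 case (Cons k ks)
 have sub: "(\<Sum>x\<in>G. norm (f x)) \<le> c" if "G \<subseteq> F" "(\<Sum>x\<in>F. norm (f x)) \<le> c" for G c and f :: "'a => complex"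
  by (rule order_trans[OF sum_mono2[OF Cons.prems(1) that(1)] that(2)]) simp
 have "0 \<le> (\<Sum>x\<in>F. norm (1 / z' x ^ k - 1 / z x ^ k))" by (rule sum_nonneg) simp
 then have \<eta>: "0 \<le> \<eta>" using Cons.prems(5)[of k] by simp
 let ?L = "%x. {y \<in> F. R x y}"
 have 1: "norm (csum R z' (?L x) ks) \<le> S ^ length ks" for x
 proof (rule csum_bound_power)
  fix j assume j: "j \<in> set ks"
  show "(\<Sum>x\<in>?L x. norm (1 / z' x ^ j)) \<le> S" by (rule sub) (use Cons.prems(4)[of j] j in auto)
 qed (use Cons.prems(1) in auto)
 have 2: "norm (csum R z' (?L x) ks - csum R z (?L x) ks) \<le> length ks * S ^ (length ks - 1) * \<eta>" for x
 proof (rule Cons.IH)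
  fix j assume j: "j \<in> set ks"
  show "(\<Sum>x\<in>?L x. norm (1 / z x ^ j)) \<le> S" by (rule sub) (use Cons.prems(3)[of j] j in auto)
  show "(\<Sum>x\<in>?L x. norm (1 / z' x ^ j)) \<le> S" by (rule sub) (use Cons.prems(4)[of j] j in auto)
  show "(\<Sum>x\<in>?L x. norm (1 / z' x ^ j - 1 / z x ^ j)) \<le> \<eta>" by (rule sub) (use Cons.prems(5)[of j] j in auto)
 qed (use Cons.prems(1,2) in auto)
 have eq: "csum R z' F (k # ks) - csum R z F (k # ks)
  = (\<Sum>x\<in>F. csum R z' (?L x) ks * (1 / z' x ^ k - 1 / z x ^ k)) + (\<Sum>x\<in>F. (csum R z' (?L x) ks - csum R z (?L x) ks) * (1 / z x ^ k))"
  unfolding csum.simps sum.distrib[symmetric] sum_subtractf[symmetric]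
  by (rule sum.cong[OF refl]) (simp add: algebra_simps diff_divide_distrib)
 have "norm (csum R z' F (k # ks) - csum R z F (k # ks)) \<le> (\<Sum>x\<in>F. S ^ length ks * norm (1 / z' x ^ k - 1 / z x ^ k)) + (\<Sum>x\<in>F. length ks * S ^ (length ks - 1) * \<eta> * norm (1 / z x ^ k))"
  unfolding eq
 proof (rule norm_triangle_mono; rule sum_norm_le)
  fix x
  show "norm (csum R z' (?L x) ks * (1 / z' x ^ k - 1 / z x ^ k)) \<le> S ^ length ks * norm (1 / z' x ^ k - 1 / z x ^ k)"
   unfolding norm_mult by (rule mult_right_mono[OF 1]) simp
  show "norm ((csum R z' (?L x) ks - csum R z (?L x) ks) * (1 / z x ^ k)) \<le> length ks * S ^ (length ks - 1) * \<eta> * norm (1 / z x ^ k)"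
   unfolding norm_mult[of "_ - _"] by (rule mult_right_mono[OF 2]) simp
 qed
 also have "... = S ^ length ks * (\<Sum>x\<in>F. norm (1 / z' x ^ k - 1 / z x ^ k)) + length ks * S ^ (length ks - 1) * \<eta> * (\<Sum>x\<in>F. norm (1 / z x ^ k))"
  by (simp only: sum_distrib_left)
 also have "... \<le> S ^ length ks * \<eta> + length ks * S ^ (length ks - 1) * \<eta> * S"
  using Cons.prems(2) Cons.prems(3)[of k] Cons.prems(5)[of k] \<eta> by (intro add_mono mult_left_mono) auto
 also have "... = length (k # ks) * S ^ (length (k # ks) - 1) * \<eta>"
  by (cases ks) (simp_all add: algebra_simps)
 finally show ?case .
qed simp

lemma csum_order_diff:
 fixes S \<omega> :: real
 assumes "finite F" "1 \<le> S" "!!x k. x \<in> F ==> k \<in> set u ==> norm (1 / z x ^ k) \<le> b x" "!!x. 0 \<le> b x" "(\<Sum>x\<in>F. b x) \<le> S"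
  "(\<Sum>x\<in>F. b x * (\<Sum>y\<in>{y\<in>F. R x y \<noteq> R' x y}. b y)) \<le> \<omega>"
 shows "norm (csum R' z F u - csum R z F u) \<le> 2 * (length u)\<^sup>2 * S ^ length u * \<omega>"
 using assms
proof (induction u arbitrary: F)
 case (Cons k ks)
 let ?T = "%x. {y\<in>F. R x y \<noteq> R' x y}"
 let ?n = "length ks"
 have nS: "(\<Sum>x\<in>G. norm (1 / z x ^ j)) \<le> (\<Sum>x\<in>G. b x)" if "G \<subseteq> F" "j \<in> set (k # ks)" for G j
  by (rule sum_mono) (use that Cons.prems(3) in auto)
 have bs: "(\<Sum>x\<in>G. b x) \<le> (\<Sum>x\<in>H. b x)" if "G \<subseteq> H" "H \<subseteq> F" for G H
  by (rule sum_mono2) (use that Cons.prems(1,4) finite_subset in auto)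
 have w0: "0 \<le> \<omega>"
  by (rule order_trans[OF _ Cons.prems(6)]) (intro sum_nonneg mult_nonneg_nonneg Cons.prems(4))
 have 1: "norm (csum R' z {y\<in>F. R' x y} ks - csum R z {y\<in>F. R' x y} ks) \<le> 2 * ?n\<^sup>2 * S ^ ?n * \<omega>" for x
 proof (rule Cons.IH)
  show "(\<Sum>x\<in>{y\<in>F. R' x y}. b x) \<le> S" using bs[of "{y\<in>F. R' x y}" F] Cons.prems(5) by auto
  have "(\<Sum>v\<in>{y\<in>F. R' x y}. b v * (\<Sum>y\<in>{y\<in>{y\<in>F. R' x y}. R v y \<noteq> R' v y}. b y)) \<le> (\<Sum>v\<in>{y\<in>F. R' x y}. b v * (\<Sum>y\<in>?T v. b y))"
   by (intro sum_mono mult_left_mono bs Cons.prems(4)) auto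
  also have "... \<le> (\<Sum>v\<in>F. b v * (\<Sum>y\<in>?T v. b y))"
   by (rule sum_mono2) (use Cons.prems(1,4) in \<open>auto intro!: mult_nonneg_nonneg sum_nonneg\<close>)
  also have "... \<le> \<omega>" by (rule Cons.prems(6))
  finally show "(\<Sum>v\<in>{y\<in>F. R' x y}. b v * (\<Sum>y\<in>{y\<in>{y\<in>F. R' x y}. R v y \<noteq> R' v y}. b y)) \<le> \<omega>" .
 qed (use Cons.prems in auto)
 have d: "norm (csum R z G ks - csum R z {y\<in>F. R x y \<and> R' x y} ks) \<le> ?n * S ^ ?n * (\<Sum>y\<in>?T x. b y)"
  if "{y\<in>F. R x y \<and> R' x y} \<subseteq> G" "G \<subseteq> F" "G - {y\<in>F. R x y \<and> R' x y} \<subseteq> ?T x" for G x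
 proof (rule csum_diff_bound)
  show "(\<Sum>x\<in>G. norm (1 / z x ^ j)) \<le> S" if "j \<in> set ks" for j
   using nS[of G j] bs[of G F] Cons.prems(5) that \<open>G \<subseteq> F\<close> by auto
  show "(\<Sum>y\<in>G - {y\<in>F. R x y \<and> R' x y}. norm (1 / z y ^ j)) \<le> (\<Sum>y\<in>?T x. b y)" if "j \<in> set ks" for j
   using nS[of "G - {y\<in>F. R x y \<and> R' x y}" j] bs[of "G - {y\<in>F. R x y \<and> R' x y}" "?T x"] that \<open>G \<subseteq> F\<close>
    \<open>G - {y\<in>F. R x y \<and> R' x y} \<subseteq> ?T x\<close> by force
 qed (use that Cons.prems(1,2) finite_subset in auto)
 have 2: "norm (csum R z {y\<in>F. R' x y} ks - csum R z {y\<in>F. R x y} ks) \<le> 2 * ?n * S ^ ?n * (\<Sum>y\<in>?T x. b y)" for x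
 proof -
  have eq: "csum R z {y\<in>F. R' x y} ks - csum R z {y\<in>F. R x y} ks
   = (csum R z {y\<in>F. R' x y} ks - csum R z {y\<in>F. R x y \<and> R' x y} ks) - (csum R z {y\<in>F. R x y} ks - csum R z {y\<in>F. R x y \<and> R' x y} ks)"
   by simp
  have "norm (csum R z {y\<in>F. R' x y} ks - csum R z {y\<in>F. R x y} ks) \<le> ?n * S ^ ?n * (\<Sum>y\<in>?T x. b y) + ?n * S ^ ?n * (\<Sum>y\<in>?T x. b y)"
   unfolding eq by (rule order_trans[OF norm_triangle_ineq4 add_mono]; rule d; auto)
  then show ?thesis by simp
 qed
 have lin: "(\<Sum>x\<in>F. (a + c * T x) * b x) = a * (\<Sum>x\<in>F. b x) + c * (\<Sum>x\<in>F. b x * T x)" for a c :: real and T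
  unfolding sum_distrib_left sum.distrib[symmetric] by (rule sum.cong) (simp_all add: algebra_simps)
 have eq: "csum R' z F (k # ks) - csum R z F (k # ks)
  = (\<Sum>x\<in>F. ((csum R' z {y\<in>F. R' x y} ks - csum R z {y\<in>F. R' x y} ks) + (csum R z {y\<in>F. R' x y} ks - csum R z {y\<in>F. R x y} ks)) * (1 / z x ^ k))"
  unfolding csum.simps sum_subtractf[symmetric]
  by (rule sum.cong[OF refl]) (simp add: diff_divide_distrib)
 have "norm (csum R' z F (k # ks) - csum R z F (k # ks)) \<le> (\<Sum>x\<in>F. (2 * ?n\<^sup>2 * S ^ ?n * \<omega> + 2 * ?n * S ^ ?n * (\<Sum>y\<in>?T x. b y)) * b x)"
  unfolding eq
 proof (rule sum_norm_le)
  fix x assume x: "x \<in> F"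
  show "norm (((csum R' z {y\<in>F. R' x y} ks - csum R z {y\<in>F. R' x y} ks) + (csum R z {y\<in>F. R' x y} ks - csum R z {y\<in>F. R x y} ks)) * (1 / z x ^ k))
   \<le> (2 * ?n\<^sup>2 * S ^ ?n * \<omega> + 2 * ?n * S ^ ?n * (\<Sum>y\<in>?T x. b y)) * b x"
   unfolding norm_mult
   by (intro mult_mono norm_triangle_mono 1 2 Cons.prems(3) x add_nonneg_nonneg mult_nonneg_nonneg sum_nonneg)
    (use Cons.prems(2,4) w0 in auto)
 qed
 also have "... = 2 * ?n\<^sup>2 * S ^ ?n * \<omega> * (\<Sum>x\<in>F. b x) + 2 * ?n * S ^ ?n * (\<Sum>x\<in>F. b x * (\<Sum>y\<in>?T x. b y))"
  by (rule lin)
 also have "... \<le> 2 * ?n\<^sup>2 * S ^ ?n * \<omega> * S + 2 * ?n * S ^ ?n * \<omega>"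
  using Cons.prems(2,5,6) w0 by (intro add_mono mult_left_mono) auto
 also have "... \<le> 2 * ?n\<^sup>2 * S ^ ?n * \<omega> * S + 2 * ?n * S ^ ?n * \<omega> * S"
  using Cons.prems(2) w0 mult_left_mono[of 1 S "2 * ?n * S ^ ?n * \<omega>"] by simp
 also have "... \<le> 2 * (length (k # ks))\<^sup>2 * S ^ length (k # ks) * \<omega>"
 proof -
  have "2 * ?n\<^sup>2 + 2 * ?n \<le> 2 * (real (Suc ?n))\<^sup>2" by (simp add: power2_eq_square algebra_simps)
  then have "(2 * ?n\<^sup>2 + 2 * ?n) * (S ^ Suc ?n * \<omega>) \<le> 2 * (real (Suc ?n))\<^sup>2 * (S ^ Suc ?n * \<omega>)"
   using Cons.prems(2) w0 by (intro mult_right_mono) auto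
  then show ?thesis by (simp add: algebra_simps)
 qed
 finally show ?case .
qed simp

section \<open>The shear of a horizontal line\<close>

text \<open>For \<open>d = 2 * e + 1\<close>, write \<open>n = d * qd n + rd n\<close> with \<open>\<bar>rd n\<bar> \<le> e\<close>.\<close>

definition qd :: "nat => int => int" where
 "qd e n = (n + int e) div (2 * int e + 1)"

definition rd :: "nat => int => int" where
 "rd e n = (n + int e) mod (2 * int e + 1) - int e"

lemma qr_eq: "n = qd e n * (2 * int e + 1) + rd e n"
 unfolding qd_def rd_def using div_mult_mod_eq[of "n + int e" "2 * int e + 1"] by simp

lemma rd_le: "\<bar>rd e n\<bar> \<le> int e"
 unfolding rd_def using pos_mod_bound[of "2 * int e + 1" "n + int e"] pos_mod_sign[of "2 * int e + 1" "n + int e"] by linarith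

lemma qr_unique:
 assumes "n = q * (2 * int e + 1) + r" "\<bar>r\<bar> \<le> int e"
 shows "qd e n = q" "rd e n = r"
proof -
 have e: "n + int e = (r + int e) + q * (2 * int e + 1)" using assms by simp
 show "qd e n = q" unfolding qd_def e using assms(2) by (subst div_mult_self1) auto
 then show "rd e n = r" using qr_eq[of n e] assms(1) by simp
qed

lemma qr_minus: "qd e (- n) = - qd e n" "rd e (- n) = - rd e n"
proof -
 have "- n = (- qd e n) * (2 * int e + 1) + (- rd e n)" using qr_eq[of n e] by (simp add: algebra_simps)
 from qr_unique[OF this] rd_le[of e n] show "qd e (- n) = - qd e n" "rd e (- n) = - rd e n" by auto
qed

lemma qr_small: "\<bar>n\<bar> \<le> int e ==> qd e n = 0" "\<bar>n\<bar> \<le> int e ==> rd e n = n"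
 using qr_unique[of n 0 e n] by auto

lemma qr_0 [simp]: "qd e 0 = 0" "rd e 0 = 0"
 using qr_small[of 0 e] by auto

lemma qd_le: "\<bar>qd e n\<bar> \<le> \<bar>n\<bar>" "\<bar>qd e n\<bar> * (2 * int e + 1) \<le> 2 * \<bar>n\<bar>"
proof -
 have "n - rd e n = qd e n * (2 * int e + 1)" using qr_eq[of n e] by simp
 then have "\<bar>n - rd e n\<bar> = \<bar>qd e n\<bar> * (2 * int e + 1)" by (simp add: abs_mult)
 then have 1: "\<bar>qd e n\<bar> * (2 * int e + 1) \<le> \<bar>n\<bar> + int e" using rd_le[of e n] by linarith
 have "\<bar>qd e n\<bar> \<le> \<bar>n\<bar> \<and> \<bar>qd e n\<bar> * (2 * int e + 1) \<le> 2 * \<bar>n\<bar>"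
 proof (cases "\<bar>n\<bar> \<le> int e")
  case False
  then have 2: "\<bar>qd e n\<bar> * (2 * int e + 1) \<le> 2 * \<bar>n\<bar>" using 1 by linarith
  have "e \<noteq> 0 \<or> \<bar>qd e n\<bar> \<le> \<bar>n\<bar>" using 1 by (cases "e = 0") auto
  moreover have "\<bar>qd e n\<bar> \<le> \<bar>n\<bar>" if "e \<noteq> 0"
  proof -
   have "\<bar>qd e n\<bar> * 2 \<le> \<bar>qd e n\<bar> * (2 * int e + 1)" using that by (intro mult_left_mono) auto
   then show ?thesis using 2 by linarith
  qed
  ultimately show ?thesis using 2 by blast
 qed (simp add: qr_small)
 then show "\<bar>qd e n\<bar> \<le> \<bar>n\<bar>" "\<bar>qd e n\<bar> * (2 * int e + 1) \<le> 2 * \<bar>n\<bar>" by auto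
qed

definition lx :: "nat => int => int => bool" where
 "lx e a b \<longleftrightarrow> rd e b < rd e a \<or> (rd e b = rd e a \<and> qd e b < qd e a)"

text \<open>The relabelling \<open>sg\<close> makes the sign of the remainder agree with the sign of the label, so that
 \<open>lx\<close> and the natural order disagree only on few pairs of labels.\<close>

definition sg :: "nat => int => int" where
 "sg e n = (if rd e n = 0 \<or> (0 < rd e n \<longleftrightarrow> 0 < n) then n else - n)"

lemma sg_cases: "sg e n = n \<or> sg e n = - n"
 by (simp add: sg_def)

lemma abs_sg [simp]: "\<bar>sg e n\<bar> = \<bar>n\<bar>"
 using sg_cases[of e n] by auto

lemma sg_sg [simp]: "sg e (sg e n) = n"
proof (cases "n = 0")
 case False
 then show ?thesis by (auto simp: sg_def qr_minus)
qed (simp add: sg_def)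

lemma sg_small: "\<bar>n\<bar> \<le> int e ==> sg e n = n"
 by (simp add: sg_def qr_small)

lemma sg_pos: "lx e (sg e n) 0 \<longleftrightarrow> 0 < n"
proof (cases "rd e n = 0")
 case True
 then have "n = qd e n * (2 * int e + 1)" using qr_eq[of n e] by simp
 then have "0 < n \<longleftrightarrow> 0 < qd e n * (2 * int e + 1)" by (rule arg_cong)
 also have "... \<longleftrightarrow> 0 < qd e n" by (simp add: zero_less_mult_iff)
 finally have "0 < qd e n \<longleftrightarrow> 0 < n" ..
 then show ?thesis using True by (simp add: sg_def lx_def)
next
 case False
 then have "n \<noteq> 0" by auto
 then show ?thesis using False by (auto simp: sg_def lx_def qr_minus)
qed

lemma rd_sg: "\<bar>rd e (sg e n)\<bar> = \<bar>rd e n\<bar>"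
 using sg_cases[of e n] by (auto simp: qr_minus)

lemma rd_sg_pos: "rd e n \<noteq> 0 ==> 0 < rd e (sg e n) \<longleftrightarrow> 0 < n"
 using sg_pos[of e n] rd_sg[of e n] by (auto simp: lx_def)

lemma sg_disagree:
 assumes "lx e (sg e a) (sg e b) \<noteq> (b < a)"
 shows "(int e < \<bar>a\<bar> \<and> \<bar>rd e a\<bar> \<le> \<bar>b\<bar>) \<or> (int e < \<bar>b\<bar> \<and> \<bar>rd e b\<bar> \<le> \<bar>a\<bar>)"
proof (rule ccontr)
 assume n: "\<not> ?thesis"
 consider "\<bar>a\<bar> \<le> int e" "\<bar>b\<bar> \<le> int e" | "int e < \<bar>a\<bar>" | "int e < \<bar>b\<bar>" by linarith
 then show False
 proof cases
  case 1
  then show False using assms by (simp add: sg_small lx_def qr_small)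
 next
  case 2
  then have "\<bar>b\<bar> < \<bar>rd e a\<bar>" using n by auto
  moreover from this have "\<bar>b\<bar> \<le> int e" using rd_le[of e a] by linarith
  moreover from this have "rd e (sg e b) = b" "qd e (sg e b) = 0" by (simp_all add: sg_small qr_small)
  ultimately show False using assms rd_sg_pos[of e a] rd_sg[of e a] 2
   unfolding lx_def by (smt (verit))
 next
  case 3
  then have "\<bar>a\<bar> < \<bar>rd e b\<bar>" using n by auto
  moreover from this have "\<bar>a\<bar> \<le> int e" using rd_le[of e b] by linarith
  moreover from this have "rd e (sg e a) = a" "qd e (sg e a) = 0" by (simp_all add: sg_small qr_small)
  ultimately show False using assms rd_sg_pos[of e b] rd_sg[of e b] 3
   unfolding lx_def by (smt (verit))
 qed
qed

definition zs :: "nat => nat => complex => int => complex" where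
 "zs e m t n = lval t (int m - qd e n, n)"

definition xx :: "nat => complex => complex" where
 "xx e t = of_nat (2 * e + 1) - t"

text \<open>The levels of the lattice at \<open>1 / xx e t\<close> are grouped into the clusters \<open>JJ e m\<close>; the cluster \<open>m\<close>
 is a sheared copy of the line \<open>m\<close> of the lattice at \<open>t\<close>.\<close>

definition JJ :: "nat => nat => int set" where
 "JJ e m = (if m = 0 then {0..int e} else {int m * (2 * int e + 1) - int e..int m * (2 * int e + 1) + int e})"

definition lab :: "nat => nat => nat => int set" where
 "lab e m N = {n. (m = 0 \<longrightarrow> lx e n 0) \<and> \<bar>qd e n - int m\<bar> < int N}"

definition HH :: "nat => nat => int => int \<times> int" where
 "HH e m n = (int m * (2 * int e + 1) + rd e n, qd e n - int m)"

lemma xx_nz: "0 < Im t ==> xx e t \<noteq> 0" "0 < Im t ==> 0 < Im (1 / xx e t)"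
 by (auto simp: xx_def complex_eq_iff Im_divide intro!: divide_pos_pos add_nonneg_pos)

lemma lval_HH:
 assumes "xx e t \<noteq> 0" shows "lval (1 / xx e t) (HH e m n) = (1 / xx e t) * zs e m t n"
proof -
 define x where "x = xx e t"
 have t: "t = (2 * of_nat e + 1) - x" by (simp add: x_def xx_def)
 have n: "(of_int n :: complex) = of_int (qd e n) * (2 * of_nat e + 1) + of_int (rd e n)"
  by (subst qr_eq[of n e]) simp
 have z: "zs e m t n = of_int (int m * (2 * int e + 1) + rd e n) + of_int (qd e n - int m) * x"
  unfolding zs_def lval_def fst_conv snd_conv n by (simp add: t algebra_simps)
 have "x \<noteq> 0" using assms by (simp add: x_def)
 then show ?thesis unfolding z x_def[symmetric] unfolding lval_def HH_def fst_conv snd_conv by (simp add: field_simps)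
qed

lemma bij_HH: "bij_betw (HH e m) (lab e m N) (pset (JJ e m) N)"
proof (rule bij_betwI')
 show "HH e m n = HH e m n' \<longleftrightarrow> n = n'" for n n'
  using qr_eq[of n e] qr_eq[of n' e] by (auto simp: HH_def)
next
 fix n assume n: "n \<in> lab e m N"
 show "HH e m n \<in> pset (JJ e m) N"
 proof (cases "m = 0")
  case False
  then have "1 * (2 * int e + 1) \<le> int m * (2 * int e + 1)" by (intro mult_right_mono) auto
  moreover have "0 \<le> int e" by simp
  ultimately have "0 < int m * (2 * int e + 1) + rd e n" using rd_le[of e n] by (smt (verit))
  moreover have "int m * (2 * int e + 1) + rd e n \<in> JJ e m" using False rd_le[of e n] by (auto simp: JJ_def)
  ultimately show ?thesis using n by (simp add: pset_def HH_def lab_def)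
 qed (use n rd_le[of e n] in \<open>auto simp: lab_def pset_def HH_def JJ_def lx_def\<close>)
next
 fix p assume p: "p \<in> pset (JJ e m) N"
 obtain a b where ab: "p = (a, b)" by (cases p)
 define n where "n = (b + int m) * (2 * int e + 1) + (a - int m * (2 * int e + 1))"
 have "\<bar>a - int m * (2 * int e + 1)\<bar> \<le> int e" using p by (auto simp: ab pset_def JJ_def split: if_splits)
 from qr_unique[OF n_def this] have q: "qd e n = b + int m" "rd e n = a - int m * (2 * int e + 1)" .
 have "n \<in> lab e m N" using p by (auto simp: ab pset_def lab_def lx_def q)
 moreover have "p = HH e m n" by (simp add: ab HH_def q)
 ultimately show "\<exists>n\<in>lab e m N. p = HH e m n" by blast
qed

lemma finite_JJ [simp]: "finite (JJ e m)"
 by (simp add: JJ_def)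

lemma finite_lab [simp]: "finite (lab e m N)"
 using bij_betw_finite[OF bij_HH] finite_pset[OF finite_JJ] by blast

lemma psum_JJ:
 assumes "0 < Im t"
 shows "psum (JJ e m) u N (1 / xx e t) / xx e t ^ sum_list u = csum (lx e) (zs e m t) (lab e m N) u"
proof -
 have nz: "xx e t \<noteq> 0" using xx_nz[OF assms] by simp
 have "psum (JJ e m) u N (1 / xx e t) = csum (lx e) (%n. (1 / xx e t) * zs e m t n) (lab e m N) u"
  unfolding psum_def
  by (rule csum_transport[OF bij_HH]) (use lval_HH[OF nz] in \<open>auto simp: HH_def lx_def\<close>)
 also have "... = csum (lx e) (zs e m t) (lab e m N) u / (1 / xx e t) ^ sum_list u" by (rule csum_scale)
 finally show ?thesis using nz by (simp add: power_divide)
qed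

lemma csum_lab_sg:
 "csum (lx e) (zs e m t) (lab e m N) u
  = csum (%a b. lx e (sg e a) (sg e b)) (%n. zs e m t (sg e n)) (sg e ` lab e m N) u"
proof (rule csum_transport)
 show "bij_betw (sg e) (sg e ` lab e m N) (lab e m N)"
  by (rule bij_betw_byWitness[of _ "sg e"]) auto
qed simp_all

lemma sg_lab_pos: "n \<in> sg e ` lab e m N ==> m = 0 ==> 0 < n"
 using sg_pos[of e n] by (auto simp: lab_def)

lemma lab_nz: "n \<in> lab e m N ==> m = 0 ==> n \<noteq> 0"
 by (auto simp: lab_def lx_def)

lemma mx_minus: "mx m (- n) = mx m n" by (simp add: mx_def)

lemma mx_sg: "mx m (sg e n) = mx m n"
 using sg_cases[of e n] by (auto simp: mx_minus)

lemma zs_lower: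
 assumes A: "1 \<le> A" "t \<in> KA A" and "m = 0 \<longrightarrow> n \<noteq> 0"
 shows "mx (int m) n \<le> 2 * KK A * norm (zs e m t n)"
proof -
 have "mx (int m) n \<le> 2 * max \<bar>real_of_int (int m - qd e n)\<bar> \<bar>real_of_int n\<bar>"
  using qd_le(1)[of e n] assms(3) by (cases "m = 0") (auto simp: mx_def max_def)
 also have "... \<le> 2 * (KK A * norm (zs e m t n))"
  unfolding zs_def by (intro mult_left_mono lval_lower A) auto
 finally show ?thesis by simp
qed

lemma line_lower:
 assumes A: "1 \<le> A" "t \<in> KA A" and "m = 0 \<longrightarrow> n \<noteq> 0"
 shows "mx (int m) n \<le> 2 * KK A * norm (lval t (int m, n))"
proof -
 have "mx (int m) n \<le> KK A * norm (lval t (int m, n))"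
  by (rule lval_lower_mx[OF A]) (use assms(3) in auto)
 also have "... \<le> 2 * KK A * norm (lval t (int m, n))" using KK_ge1[of A] by simp
 finally show ?thesis .
qed

lemma inv_power_le:
 fixes z :: complex
 assumes "1 \<le> y" "y \<le> c * norm z"
 shows "norm (1 / z ^ k) \<le> c ^ k / y ^ k"
proof -
 have z: "0 < norm z" using assms by (cases "z = 0") auto
 then have "1 / norm z \<le> c / y" using assms by (simp add: field_simps)
 then have "(1 / norm z) ^ k \<le> (c / y) ^ k" by (intro power_mono) auto
 then show ?thesis by (simp add: norm_divide norm_power power_divide)
qed

lemma inv_power_le2:
 fixes z :: complex
 assumes "1 \<le> y" "y \<le> c * norm z" "1 \<le> c" "j \<le> k" "k \<le> s"
 shows "norm (1 / z ^ k) \<le> c ^ s / y ^ j"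
proof -
 have "norm (1 / z ^ k) \<le> c ^ k / y ^ k" using assms by (intro inv_power_le)
 also have "... \<le> c ^ s / y ^ j"
  using assms by (intro frac_le power_increasing) auto
 finally show ?thesis .
qed

lemma norm_power_diff_le:
 fixes a b :: complex
 assumes "norm a \<le> B" "norm b \<le> B"
 shows "norm (a ^ k - b ^ k) \<le> k * norm (a - b) * B ^ (k - 1)"
proof (induction k)
 case (Suc k)
 have B: "0 \<le> B" using assms(1) norm_ge_zero order_trans by blast
 have eq: "a ^ Suc k - b ^ Suc k = a * (a ^ k - b ^ k) + (a - b) * b ^ k" by (simp add: algebra_simps)
 have "norm (a ^ Suc k - b ^ Suc k) \<le> B * (k * norm (a - b) * B ^ (k - 1)) + norm (a - b) * B ^ k"
  unfolding eq
  by (rule norm_triangle_mono; unfold norm_mult norm_power; intro mult_mono power_mono assms Suc.IH mult_left_mono) (use B in auto)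
 also have "... = Suc k * norm (a - b) * B ^ (Suc k - 1)" by (cases k) (auto simp: algebra_simps)
 finally show ?case .
qed simp

lemma inv_power_diff:
 fixes z z' :: complex
 assumes "1 \<le> y" "y \<le> c * norm z" "y \<le> c * norm z'" "1 \<le> k"
 shows "norm (1 / z' ^ k - 1 / z ^ k) \<le> k * norm (z - z') * (c / y) ^ (k + 1)"
proof -
 have nz: "z \<noteq> 0" "z' \<noteq> 0" using assms by auto
 have b: "norm (1 / z) \<le> c / y" "norm (1 / z') \<le> c / y"
  using inv_power_le[of y c z 1] inv_power_le[of y c z' 1] assms by auto
 have c0: "0 \<le> c / y" using b(1) norm_ge_zero order_trans by blast
 have "norm ((1 / z') ^ k - (1 / z) ^ k) \<le> k * norm (1 / z' - 1 / z) * (c / y) ^ (k - 1)"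
  by (rule norm_power_diff_le[OF b(2,1)])
 also have "1 / z' - 1 / z = (z - z') * ((1 / z) * (1 / z'))" using nz by (simp add: field_simps)
 also have "k * norm ((z - z') * ((1 / z) * (1 / z'))) * (c / y) ^ (k - 1) \<le> k * (norm (z - z') * ((c / y) * (c / y))) * (c / y) ^ (k - 1)"
  unfolding norm_mult by (intro mult_right_mono mult_left_mono mult_mono b c0) (use c0 in auto)
 also have "... = k * norm (z - z') * (c / y) ^ (k + 1)"
  using assms(4) by (cases k) (auto simp: mult_ac)
 finally show ?thesis by (simp add: power_divide)
qed

lemma zs_diff: "lval t (int m, n) - zs e m t n = of_int (qd e n) * t"
 by (simp add: zs_def lval_def algebra_simps)

lemma qd_mx: "\<bar>real_of_int (qd e n)\<bar> / mx m n \<le> 2 / real (2 * e + 1)"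
proof -
 have "real_of_int (\<bar>qd e n\<bar> * (2 * int e + 1)) \<le> real_of_int (2 * \<bar>n\<bar>)"
  using qd_le(2)[of e n] by (simp only: of_int_le_iff)
 then have "\<bar>real_of_int (qd e n)\<bar> * real (2 * e + 1) \<le> 2 * \<bar>real_of_int n\<bar>" by (simp add: add.commute)
 also have "... \<le> 2 * mx m n" by (simp add: mx_def)
 finally show ?thesis using mx_ge1[of m n] by (simp add: field_simps)
qed

lemma sum_far:
 assumes "finite F" shows "(\<Sum>n\<in>{n\<in>F. int e < \<bar>n\<bar>}. 1 / (mx m n)\<^sup>2) \<le> 8 / real (2 * e + 1)"
proof -
 have "(\<Sum>n\<in>{n\<in>F. int e < \<bar>n\<bar>}. 1 / (mx m n)\<^sup>2) \<le> 4 / real (e + 1)"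
  by (rule sum_tail) (use assms in auto)
 also have "... \<le> 8 / real (2 * e + 1)" by (simp add: field_simps)
 finally show ?thesis .
qed

lemma sum_far_eq:
 fixes f :: "int => real"
 assumes "finite F" "!!n. n \<in> F ==> \<bar>n\<bar> \<le> int e ==> f n = 0"
 shows "(\<Sum>n\<in>F. f n) = (\<Sum>n\<in>{n\<in>F. int e < \<bar>n\<bar>}. f n)"
proof (rule sum.mono_neutral_right)
 show "\<forall>n\<in>F - {n\<in>F. int e < \<bar>n\<bar>}. f n = 0" using assms(2) by force
qed (use assms in auto)

lemma shear_value:
 assumes A: "1 \<le> A" "t \<in> KA A" and m: "1 \<le> m" and k: "2 \<le> k" and F: "finite F"
 defines "c \<equiv> 2 * KK A"
 shows "(\<Sum>n\<in>F. norm (1 / zs e m t n ^ k - 1 / lval t (int m, n) ^ k)) \<le> 2 * real k * A * c ^ (k + 1) / real (2 * e + 1) * (8 / real (2 * e + 1))"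
  and "3 \<le> k ==> (\<Sum>n\<in>F. norm (1 / zs e m t n ^ k - 1 / lval t (int m, n) ^ k)) \<le> 2 * real k * A * c ^ (k + 1) / real (2 * e + 1) * (5 / (real m)\<^sup>2)"
proof -
 let ?f = "%n. norm (1 / zs e m t n ^ k - 1 / lval t (int m, n) ^ k)"
 let ?D = "real (2 * e + 1)"
 let ?C = "2 * real k * A * c ^ (k + 1) / ?D"
 have c: "1 \<le> c" using KK_ge1[of A] by (simp add: c_def)
 have t: "norm t \<le> A" using A by (simp add: KA_def)
 have C0: "0 \<le> ?C" using c A(1) by simp
 have pt: "?f n \<le> ?C * (1 / mx (int m) n ^ k)" for n
 proof -
  let ?y = "mx (int m) n"
  have y: "1 \<le> ?y" by (rule mx_ge1)
  have "?f n \<le> k * norm (lval t (int m, n) - zs e m t n) * (c / ?y) ^ (k + 1)"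
   by (rule inv_power_diff) (use y k m line_lower[OF A] zs_lower[OF A] in \<open>auto simp: c_def\<close>)
  also have "... \<le> k * (\<bar>real_of_int (qd e n)\<bar> * A) * (c / ?y) ^ (k + 1)"
   unfolding zs_diff norm_mult using t c y by (intro mult_right_mono mult_left_mono) (auto intro!: mult_mono)
  also have "... = k * A * c ^ (k + 1) * (\<bar>real_of_int (qd e n)\<bar> / ?y) * (1 / ?y ^ k)"
   by (simp add: power_divide)
  also have "... \<le> k * A * c ^ (k + 1) * (2 / ?D) * (1 / ?y ^ k)"
   using c A(1) y by (intro mult_right_mono mult_left_mono qd_mx) auto
  finally show ?thesis by (simp add: mult_ac)
 qed
 have z: "?f n = 0" if "\<bar>n\<bar> \<le> int e" for n using that by (simp add: zs_def qr_small)
 have "(\<Sum>n\<in>F. ?f n) = (\<Sum>n\<in>{n\<in>F. int e < \<bar>n\<bar>}. ?f n)" by (rule sum_far_eq) (use F z in auto)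
 also have "... \<le> (\<Sum>n\<in>{n\<in>F. int e < \<bar>n\<bar>}. ?C * (1 / (mx (int m) n)\<^sup>2))"
 proof (rule sum_mono)
  fix n
  have "1 / mx (int m) n ^ k \<le> 1 / (mx (int m) n)\<^sup>2"
   using mx_ge1[of "int m" n] k by (intro divide_left_mono power_increasing) auto
  then show "?f n \<le> ?C * (1 / (mx (int m) n)\<^sup>2)" using pt[of n] mult_left_mono[OF _ C0] by (meson order_trans)
 qed
 also have "... = ?C * (\<Sum>n\<in>{n\<in>F. int e < \<bar>n\<bar>}. 1 / (mx (int m) n)\<^sup>2)" by (simp only: sum_distrib_left)
 also have "... \<le> ?C * (8 / ?D)" by (intro mult_left_mono sum_far F C0)
 finally show "(\<Sum>n\<in>F. ?f n) \<le> 2 * real k * A * c ^ (k + 1) / real (2 * e + 1) * (8 / real (2 * e + 1))" by simp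
 assume k3: "3 \<le> k"
 have "(\<Sum>n\<in>F. ?f n) \<le> (\<Sum>n\<in>F. ?C * (1 / mx (int m) n ^ k))" by (intro sum_mono pt)
 also have "... = ?C * (\<Sum>n\<in>F. 1 / mx (int m) n ^ k)" by (simp only: sum_distrib_left)
 also have "... \<le> ?C * (5 / (max 1 (real_of_int (int m))) ^ (k - 1))"
  by (intro mult_left_mono sum_mx_pow F k C0)
 also have "... \<le> ?C * (5 / (real m)\<^sup>2)"
  using m k3 C0 by (intro mult_left_mono divide_left_mono) (auto simp: max_def intro!: power_increasing)
 finally show "(\<Sum>n\<in>F. ?f n) \<le> 2 * real k * A * c ^ (k + 1) / real (2 * e + 1) * (5 / (real m)\<^sup>2)" by simp
qed

lemma relabel_value:
 assumes A: "1 \<le> A" "t \<in> KA A" and F: "finite F" "!!n. n \<in> F ==> m = 0 ==> 0 < n" and k: "2 \<le> k" "k \<le> s"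
 defines "c \<equiv> 2 * KK A"
 shows "(\<Sum>n\<in>F. norm (1 / zs e m t (sg e n) ^ k - 1 / lval t (int m, n) ^ k)) \<le> 96 * A * c ^ (s + 1) * (real m + 1) / (real (2 * e + 1))\<^sup>2"
proof -
 let ?f = "%n. norm (1 / zs e m t (sg e n) ^ k - 1 / lval t (int m, n) ^ k)"
 let ?D = "real (2 * e + 1)"
 let ?C = "12 * A * c ^ (s + 1) * (real m + 1) / ?D"
 have c: "1 \<le> c" using KK_ge1[of A] by (simp add: c_def)
 have t: "norm t \<le> A" using A by (simp add: KA_def)
 have C0: "0 \<le> ?C" using c A(1) by simp
 have pt: "?f n \<le> ?C * (1 / (mx (int m) n)\<^sup>2)" if n: "n \<in> F" "int e < \<bar>n\<bar>" for n
 proof -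
  let ?y = "mx (int m) n"
  let ?z = "lval t (int m, n)" and ?z' = "zs e m t (sg e n)"
  have y: "1 \<le> ?y" by (rule mx_ge1)
  have n0: "n \<noteq> 0" using n by auto
  then have s0: "sg e n \<noteq> 0" using sg_cases[of e n] by auto
  have lo: "?y \<le> c * norm ?z" "?y \<le> c * norm ?z'"
   unfolding c_def using line_lower[OF A, of m n] zs_lower[OF A, of m "sg e n" e] n0 s0 by (auto simp: mx_sg)
  have "int e + 1 \<le> \<bar>n\<bar>" using n(2) by simp
  then have "real e + 1 \<le> \<bar>real_of_int n\<bar>" by linarith
  then have "?D \<le> 2 * ?y" by (simp add: mx_def)
  then have yD: "1 / ?y \<le> 2 / ?D" using y by (simp add: field_simps)
  have "?f n \<le> 2 * A * c ^ (s + 1) * (2 * real m + 2 + \<bar>real_of_int (qd e n)\<bar>) / ?y ^ 3"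
  proof (cases "k = 2")
   case True
   have ev: "?f n = norm (1 / w ^ k - 1 / ?z ^ k)" if "w = ?z' \<or> w = - ?z'" for w
    using that True by auto
   define w where "w = (if sg e n = n then ?z' else - ?z')"
   have w: "w = ?z' \<or> w = - ?z'" by (simp add: w_def)
   have "norm (?z - w) \<le> (2 * real m + \<bar>real_of_int (qd e n)\<bar>) * A"
   proof (cases "sg e n = n")
    case True
    then have "?z - w = of_int (qd e n) * t" by (simp add: w_def zs_diff)
    then have "norm (?z - w) \<le> \<bar>real_of_int (qd e n)\<bar> * A" using t by (simp add: norm_mult mult_left_mono)
    also have "... \<le> (2 * real m + \<bar>real_of_int (qd e n)\<bar>) * A" using A(1) by (intro mult_right_mono) auto
    finally show ?thesis .
   next
    case False
    then have "sg e n = - n" using sg_cases[of e n] by auto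
    then have "?z - w = of_int (2 * int m + qd e n) * t" using False
     by (simp add: w_def zs_def lval_def qr_minus algebra_simps)
    then have "norm (?z - w) = \<bar>real_of_int (2 * int m + qd e n)\<bar> * norm t" by (simp only: norm_mult norm_of_int)
    also have "... \<le> (2 * real m + \<bar>real_of_int (qd e n)\<bar>) * A" using t by (intro mult_mono) auto
    finally show ?thesis .
   qed
   then have "norm (?z - w) \<le> (2 * real m + 2 + \<bar>real_of_int (qd e n)\<bar>) * A"
    using A(1) by (simp add: algebra_simps)
   moreover have "?f n \<le> 2 * norm (?z - w) * (c / ?y) ^ (2 + 1)"
    unfolding ev[OF w] using inv_power_diff[of ?y c ?z w 2] y lo w True by auto
   ultimately have "?f n \<le> 2 * ((2 * real m + 2 + \<bar>real_of_int (qd e n)\<bar>) * A) * (c / ?y) ^ (2 + 1)"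
    using y c by (smt (verit) mult_right_mono mult_left_mono zero_le_power divide_nonneg_nonneg)
   also have "... = 2 * A * c ^ (2 + 1) * (2 * real m + 2 + \<bar>real_of_int (qd e n)\<bar>) / ?y ^ 3"
    by (simp add: power_divide)
   also have "... \<le> 2 * A * c ^ (s + 1) * (2 * real m + 2 + \<bar>real_of_int (qd e n)\<bar>) / ?y ^ 3"
    using c k y A(1) by (intro divide_right_mono mult_right_mono mult_left_mono power_increasing) auto
   finally show ?thesis .
  next
   case False
   then have k3: "3 \<le> k" using k by simp
   have "?f n \<le> norm (1 / ?z' ^ k) + norm (1 / ?z ^ k)" by (rule norm_triangle_ineq4)
   also have "... \<le> c ^ (s + 1) / ?y ^ 3 + c ^ (s + 1) / ?y ^ 3"
    by (intro add_mono inv_power_le2 y lo c k3) (use k in auto)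
   also have "... = (2 * 1 * c ^ (s + 1) * 1) / ?y ^ 3" by simp
   also have "... \<le> 2 * A * c ^ (s + 1) * (2 * real m + 2 + \<bar>real_of_int (qd e n)\<bar>) / ?y ^ 3"
    using c y A(1) by (intro divide_right_mono mult_mono mult_nonneg_nonneg) auto
   finally show ?thesis .
  qed
  also have "... = 2 * A * c ^ (s + 1) * ((2 * real m + 2) * (1 / ?y) + \<bar>real_of_int (qd e n)\<bar> / ?y) * (1 / ?y\<^sup>2)"
   using y by (simp add: field_simps power2_eq_square power3_eq_cube)
  also have "... \<le> 2 * A * c ^ (s + 1) * ((2 * real m + 2) * (2 / ?D) + 2 / ?D) * (1 / ?y\<^sup>2)"
   using c A(1) yD by (intro mult_right_mono mult_left_mono add_mono qd_mx) auto
  also have "... \<le> 2 * A * c ^ (s + 1) * (6 * (real m + 1) / ?D) * (1 / ?y\<^sup>2)"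
  proof -
   have "(2 * real m + 2) * (2 / D) + 2 / D \<le> 6 * (real m + 1) / D" if "0 < D" for D
    using that by (simp add: field_simps)
   from this[of ?D] show ?thesis using c A(1) by (intro mult_right_mono mult_left_mono) auto
  qed
  also have "... = ?C * (1 / ?y\<^sup>2)" by simp
  finally show ?thesis .
 qed
 have z: "?f n = 0" if "\<bar>n\<bar> \<le> int e" for n using that by (simp add: zs_def qr_small sg_small)
 have "(\<Sum>n\<in>F. ?f n) = (\<Sum>n\<in>{n\<in>F. int e < \<bar>n\<bar>}. ?f n)" by (rule sum_far_eq) (use F z in auto)
 also have "... \<le> (\<Sum>n\<in>{n\<in>F. int e < \<bar>n\<bar>}. ?C * (1 / (mx (int m) n)\<^sup>2))"
  by (intro sum_mono pt) auto
 also have "... = ?C * (\<Sum>n\<in>{n\<in>F. int e < \<bar>n\<bar>}. 1 / (mx (int m) n)\<^sup>2)" by (simp only: sum_distrib_left)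
 also have "... \<le> ?C * (8 / ?D)" by (intro mult_left_mono sum_far F C0)
 also have "... = 96 * A * c ^ (s + 1) * (real m + 1) / (real (2 * e + 1))\<^sup>2" by (simp add: power2_eq_square)
 finally show ?thesis .
qed

lemma sum_inv_sq_int:
 assumes "finite Q" shows "(\<Sum>q\<in>Q. 1 / (max 1 \<bar>real_of_int q\<bar>)\<^sup>2) \<le> 5"
proof -
 have "(\<Sum>q\<in>Q. 1 / (max 1 \<bar>real_of_int q\<bar>)\<^sup>2) = (\<Sum>q\<in>Q. 1 / (mx 0 q)\<^sup>2)"
  by (intro sum.cong) (auto simp: mx_def)
 then show ?thesis using sum_mx_sq[OF assms, of 0] by simp
qed

lemma sum_far_rd:
 assumes "finite F" "1 \<le> e"
 shows "(\<Sum>n\<in>{n\<in>F. int e < \<bar>n\<bar>}. 1 / (mx m n)\<^sup>2 * (1 / max 1 \<bar>real_of_int (rd e n)\<bar>)) \<le> 60 * ell e / (real (2 * e + 1))\<^sup>2"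
proof -
 let ?D = "real (2 * e + 1)"
 let ?F = "{n\<in>F. int e < \<bar>n\<bar>}"
 let ?h = "%n. (qd e n, rd e n)"
 let ?a = "%q::int. 1 / (max 1 \<bar>real_of_int q\<bar>)\<^sup>2"
 let ?b = "%r::int. 1 / max 1 \<bar>real_of_int r\<bar>"
 have inj: "inj_on ?h ?F" using qr_eq by (metis (no_types, lifting) inj_onI prod.inject)
 have "(\<Sum>n\<in>?F. 1 / (mx m n)\<^sup>2 * ?b (rd e n)) \<le> (\<Sum>n\<in>?F. 4 / ?D\<^sup>2 * (?a (qd e n) * ?b (rd e n)))"
 proof (rule sum_mono)
  fix n assume n: "n \<in> ?F"
  have "qd e n \<noteq> 0"
   using n qr_eq[of n e] rd_le[of e n] by auto
  then have "1 \<le> \<bar>qd e n\<bar>" by simp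
  then have q1: "1 \<le> \<bar>real_of_int (qd e n)\<bar>" by linarith
  have "n - rd e n = qd e n * (2 * int e + 1)" using qr_eq[of n e] by simp
  then have "\<bar>n - rd e n\<bar> = \<bar>qd e n\<bar> * (2 * int e + 1)" by (simp add: abs_mult)
  then have "\<bar>qd e n\<bar> * (2 * int e + 1) \<le> 2 * \<bar>n\<bar>" using n rd_le[of e n] by auto
  then have "real_of_int (\<bar>qd e n\<bar> * (2 * int e + 1)) \<le> real_of_int (2 * \<bar>n\<bar>)" by (simp only: of_int_le_iff)
  then have "\<bar>real_of_int (qd e n)\<bar> * ?D / 2 \<le> mx m n" by (simp add: mx_def add.commute)
  then have "(\<bar>real_of_int (qd e n)\<bar> * ?D / 2)\<^sup>2 \<le> (mx m n)\<^sup>2" by (intro power_mono) auto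
  then have "1 / (mx m n)\<^sup>2 \<le> 1 / (\<bar>real_of_int (qd e n)\<bar> * ?D / 2)\<^sup>2"
   using q1 mx_ge1[of m n] by (intro divide_left_mono mult_pos_pos zero_less_power) auto
  also have "... = 4 / ?D\<^sup>2 * ?a (qd e n)" using q1 by (simp add: power_divide power_mult_distrib max_def)
  finally have "1 / (mx m n)\<^sup>2 * ?b (rd e n) \<le> (4 / ?D\<^sup>2 * ?a (qd e n)) * ?b (rd e n)" by (intro mult_right_mono) auto
  then show "1 / (mx m n)\<^sup>2 * ?b (rd e n) \<le> 4 / ?D\<^sup>2 * (?a (qd e n) * ?b (rd e n))" by (simp only: mult.assoc)
 qed
 also have "... = 4 / ?D\<^sup>2 * (\<Sum>n\<in>?F. ?a (qd e n) * ?b (rd e n))" by (simp only: sum_distrib_left)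
 also have "(\<Sum>n\<in>?F. ?a (qd e n) * ?b (rd e n)) = (\<Sum>p\<in>?h ` ?F. ?a (fst p) * ?b (snd p))"
  by (subst sum.reindex[OF inj]) simp
 also have "... \<le> (\<Sum>p\<in>(qd e ` ?F) \<times> {- int e..int e}. ?a (fst p) * ?b (snd p))"
  using assms(1) rd_le[of e] by (intro sum_mono2) (auto simp: abs_le_iff minus_le_iff)
 also have "... = (\<Sum>q\<in>qd e ` ?F. ?a q) * (\<Sum>r\<in>{- int e..int e}. ?b r)"
  by (simp only: sum_product sum.cartesian_product case_prod_unfold)
 also have "... \<le> 5 * (3 * ell e)"
  using assms by (intro mult_mono sum_inv_sq_int sum_inv_abs sum_nonneg) (auto simp: abs_le_iff)
 finally have "(\<Sum>n\<in>?F. 1 / (mx m n)\<^sup>2 * ?b (rd e n)) \<le> 4 / ?D\<^sup>2 * (5 * (3 * ell e))"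
  by (simp add: mult_left_mono divide_right_mono)
 then show ?thesis by simp
qed

lemma sum_tail_any:
 assumes "finite F" shows "(\<Sum>y\<in>{y\<in>F. \<bar>r\<bar> \<le> \<bar>y\<bar>}. 1 / (mx m y)\<^sup>2) \<le> 5 * (1 / max 1 \<bar>real_of_int r\<bar>)"
proof (cases "r = 0")
 case True
 have "(\<Sum>y\<in>{y\<in>F. \<bar>r\<bar> \<le> \<bar>y\<bar>}. 1 / (mx m y)\<^sup>2) \<le> 5 / max 1 (real_of_int m)" by (rule sum_mx_sq) (use assms in auto)
 also have "... \<le> 5" by (simp add: field_simps)
 finally show ?thesis using True by simp
next
 case False
 have "(\<Sum>y\<in>{y\<in>F. \<bar>r\<bar> \<le> \<bar>y\<bar>}. 1 / (mx m y)\<^sup>2) \<le> 4 / real (nat \<bar>r\<bar>)"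
  by (rule sum_tail) (use assms False in auto)
 also have "... \<le> 5 * (1 / max 1 \<bar>real_of_int r\<bar>)"
 proof -
  have "1 \<le> \<bar>r\<bar>" using False by simp
  then have "1 \<le> \<bar>real_of_int r\<bar>" by linarith
  then show ?thesis by (simp add: field_simps max_def)
 qed
 finally show ?thesis .
qed

lemma order_error:
 assumes "finite F" "1 \<le> e"
 shows "(\<Sum>x\<in>F. 1 / (mx m x)\<^sup>2 * (\<Sum>y\<in>{y\<in>F. (y < x) \<noteq> lx e (sg e x) (sg e y)}. 1 / (mx m y)\<^sup>2)) \<le> 600 * ell e / (real (2 * e + 1))\<^sup>2"
proof -
 let ?w = "%n. 1 / (mx m n)\<^sup>2"
 let ?P = "%x y. int e < \<bar>x\<bar> \<and> \<bar>rd e x\<bar> \<le> \<bar>y\<bar>"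
 let ?S = "\<Sum>x\<in>F. \<Sum>y\<in>F. if ?P x y then ?w x * ?w y else 0"
 have S: "?S \<le> 300 * ell e / (real (2 * e + 1))\<^sup>2"
 proof -
  have "?S = (\<Sum>x\<in>{x\<in>F. int e < \<bar>x\<bar>}. ?w x * (\<Sum>y\<in>{y\<in>F. \<bar>rd e x\<bar> \<le> \<bar>y\<bar>}. ?w y))"
  proof -
   have "(\<Sum>y\<in>F. if ?P x y then ?w x * ?w y else 0) = (if int e < \<bar>x\<bar> then ?w x * (\<Sum>y\<in>{y\<in>F. \<bar>rd e x\<bar> \<le> \<bar>y\<bar>}. ?w y) else 0)" for x
    using assms(1) by (auto simp: sum.inter_filter sum_distrib_left intro!: sum.cong)
   then show ?thesis by (simp only: sum.inter_filter[OF assms(1)])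
  qed
  also have "... \<le> (\<Sum>x\<in>{x\<in>F. int e < \<bar>x\<bar>}. ?w x * (5 * (1 / max 1 \<bar>real_of_int (rd e x)\<bar>)))"
   by (intro sum_mono mult_left_mono sum_tail_any assms) auto
  also have "... = 5 * (\<Sum>x\<in>{x\<in>F. int e < \<bar>x\<bar>}. ?w x * (1 / max 1 \<bar>real_of_int (rd e x)\<bar>))"
   unfolding sum_distrib_left by (intro sum.cong) auto
  also have "... \<le> 5 * (60 * ell e / (real (2 * e + 1))\<^sup>2)"
   by (intro mult_left_mono sum_far_rd assms) auto
  finally show ?thesis by simp
 qed
 have "(\<Sum>x\<in>F. ?w x * (\<Sum>y\<in>{y\<in>F. (y < x) \<noteq> lx e (sg e x) (sg e y)}. ?w y))
  = (\<Sum>x\<in>F. \<Sum>y\<in>F. if (y < x) \<noteq> lx e (sg e x) (sg e y) then ?w x * ?w y else 0)"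
  using assms(1) by (intro sum.cong refl) (auto simp: sum.inter_filter sum_distrib_left intro!: sum.cong)
 also have "... \<le> (\<Sum>x\<in>F. \<Sum>y\<in>F. (if ?P x y then ?w x * ?w y else 0) + (if ?P y x then ?w y * ?w x else 0))"
 proof (intro sum_mono)
  fix x y
  have "?P x y \<or> ?P y x" if "(y < x) \<noteq> lx e (sg e x) (sg e y)"
   by (rule sg_disagree) (use that in auto)
  moreover have "0 \<le> ?w x * ?w y" by simp
  ultimately show "(if (y < x) \<noteq> lx e (sg e x) (sg e y) then ?w x * ?w y else 0) \<le> (if ?P x y then ?w x * ?w y else 0) + (if ?P y x then ?w y * ?w x else 0)"
   by (simp only: mult.commute split: if_split) linarith
 qed
 also have "... = ?S + (\<Sum>x\<in>F. \<Sum>y\<in>F. if ?P y x then ?w y * ?w x else 0)"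
  by (simp only: sum.distrib)
 also have "(\<Sum>x\<in>F. \<Sum>y\<in>F. if ?P y x then ?w y * ?w x else 0) = ?S" by (rule sum.swap)
 finally show ?thesis using S by simp
qed

definition Dd :: "nat => real" where "Dd e = real (2 * e + 1)"

lemma Dd_ge1: "1 \<le> Dd e" by (simp add: Dd_def)

lemma ell_Dd: assumes "1 \<le> e" shows "ell e / (real (2 * e + 1))\<^sup>2 \<le> 5 * Dd e powr (- 7 / 4)"
proof -
 have d: "1 \<le> Dd e" by (rule Dd_ge1)
 have "ln (real e) \<le> ln (Dd e)" using assms by (simp add: Dd_def)
 also have "... \<le> Dd e powr (1 / 4) / (1 / 4)" by (rule ln_powr_bound) (use d in auto)
 finally have "ell e \<le> 1 + 4 * Dd e powr (1 / 4)" by (simp add: ell_def)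
 moreover have "1 \<le> Dd e powr (1 / 4)" using d by (simp add: ge_one_powr_ge_zero)
 ultimately have "ell e \<le> 5 * Dd e powr (1 / 4)" by simp
 then have "ell e / (Dd e)\<^sup>2 \<le> 5 * Dd e powr (1 / 4) / (Dd e)\<^sup>2" by (rule divide_right_mono) simp
 also have "(Dd e)\<^sup>2 = Dd e powr 2" using d by (simp add: powr_realpow)
 also have "5 * Dd e powr (1 / 4) / Dd e powr 2 = 5 * (Dd e powr (1 / 4 - 2))"
  by (simp only: powr_diff times_divide_eq_right)
 finally show ?thesis using d by (simp add: Dd_def powr_realpow)
qed

lemma inv_sq_Dd: "1 / (real (2 * e + 1))\<^sup>2 \<le> Dd e powr (- 7 / 4)"
proof -
 have d: "1 \<le> Dd e" by (rule Dd_ge1)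
 have "1 / (Dd e)\<^sup>2 = Dd e powr (- 2)" using d by (simp add: powr_minus powr_realpow inverse_eq_divide)
 also have "... \<le> Dd e powr (- 7 / 4)" using d by (intro powr_mono) auto
 finally show ?thesis by (simp add: Dd_def)
qed

lemma line_exhaust:
 assumes A: "1 \<le> A" "t \<in> KA A" and F: "finite F" "!!n. n \<in> F ==> m = 0 ==> 0 < n"
  "!!n. \<bar>n\<bar> < int N' ==> (m = 0 \<longrightarrow> 0 < n) ==> n \<in> F" and N': "1 \<le> N'" and u: "u \<in> mes_indices"
 shows "norm (csum (%a b. b < a) (%n. lval t (int m, n)) F u - psum {int m} u N' t)
  \<le> length u * (6 * KK A ^ sum_list u) ^ length u * (KK A ^ sum_list u * (4 / N'))"
proof -
 let ?G = "{n. \<bar>n\<bar> < int N' \<and> (m = 0 \<longrightarrow> 0 < n)}"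
 have ps: "psum {int m} u N' t = csum (%a b. b < a) (%n. lval t (int m, n)) ?G u"
  unfolding psum_def
  by (rule csum_transport[where h = "Pair (int m)"]) (auto simp: bij_betw_def inj_on_def pset_def)
 have nz: "(int m, n) \<noteq> (0, 0)" if "n \<in> F" for n using F(2)[OF that] by auto
 show ?thesis unfolding ps
 proof (rule csum_diff_bound)
  fix k assume k: "k \<in> set u"
  then have k2: "2 \<le> k" "k \<le> sum_list u" using u mem_mes_indices member_le_sum_list by auto
  have "(\<Sum>n\<in>F. norm (1 / lval t (int m, n) ^ k)) \<le> 5 * KK A ^ k / (max 1 (real_of_int (int m))) ^ (k - 1)"
   by (rule sum_line_bound[OF A F(1) nz k2(1)])
  also have "... \<le> 5 * KK A ^ sum_list u / 1"
   using KK_ge1[of A] KK_pow_le[OF k2(2), of A] by (intro frac_le) auto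
  also have "... \<le> 6 * KK A ^ sum_list u" using KK_ge1[of A] by simp
  finally show "(\<Sum>n\<in>F. norm (1 / lval t (int m, n) ^ k)) \<le> 6 * KK A ^ sum_list u" .
  have "(\<Sum>n\<in>F - ?G. norm (1 / lval t (int m, n) ^ k)) \<le> (\<Sum>n\<in>F - ?G. KK A ^ sum_list u * (1 / (mx (int m) n)\<^sup>2))"
  proof (rule sum_mono)
   fix n assume "n \<in> F - ?G"
   then have "norm (1 / lval t (int m, n) ^ k) \<le> KK A ^ k / mx (int m) n ^ k" using norm_inv_lval[OF A nz] by blast
   also have "... \<le> KK A ^ sum_list u / (mx (int m) n)\<^sup>2"
    using mx_ge1[of "int m" n] KK_ge1[of A] k2 by (intro frac_le power_increasing) auto
   finally show "norm (1 / lval t (int m, n) ^ k) \<le> KK A ^ sum_list u * (1 / (mx (int m) n)\<^sup>2)" by simp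
  qed
  also have "... = KK A ^ sum_list u * (\<Sum>n\<in>F - ?G. 1 / (mx (int m) n)\<^sup>2)" by (simp only: sum_distrib_left)
  also have "... \<le> KK A ^ sum_list u * (4 / N')"
   using KK_ge1[of A] F(1,2) N' by (intro mult_left_mono sum_tail) force+
  finally show "(\<Sum>n\<in>F - ?G. norm (1 / lval t (int m, n) ^ k)) \<le> KK A ^ sum_list u * (4 / N')" .
 next
  have "6 * 1 \<le> 6 * KK A ^ sum_list u" using KK_ge1[of A] by (intro mult_left_mono) auto
  then show "1 \<le> 6 * KK A ^ sum_list u" by simp
 qed (use F in auto)
qed

lemma lab_contains:
 assumes "\<bar>n\<bar> < int N"
 shows "m \<noteq> 0 ==> n \<in> lab e m (N + m)" and "(m = 0 \<longrightarrow> 0 < n) ==> n \<in> sg e ` lab e m (N + m)"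
proof -
 have q: "\<bar>qd e k - int m\<bar> < int (N + m)" if "\<bar>k\<bar> = \<bar>n\<bar>" for k
  using qd_le(1)[of e k] assms that by linarith
 show "m \<noteq> 0 ==> n \<in> lab e m (N + m)" using q[of n] by (simp add: lab_def)
 assume "m = 0 \<longrightarrow> 0 < n"
 then have "sg e n \<in> lab e m (N + m)" using q[of "sg e n"] by (simp add: lab_def sg_pos)
 then show "n \<in> sg e ` lab e m (N + m)" by (intro image_eqI[of _ _ "sg e n"]) auto
qed

lemma cluster_limit:
 assumes A: "1 \<le> A" "t \<in> KA A" and u: "u \<in> mes_indices"
  and B: "!!N. 1 \<le> N ==> norm (csum (lx e) (zs e m t) (lab e m (N + m)) u - psum {int m} u N t) \<le> B + C / N"
 shows "norm (plim (JJ e m) u (1 / xx e t) / xx e t ^ sum_list u - plim {int m} u t) \<le> B"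
proof -
 have pos: "0 < Im t" using KA_pos A by blast
 have 1: "(%N. psum (JJ e m) u (N + m) (1 / xx e t)) \<longlonglongrightarrow> plim (JJ e m) u (1 / xx e t)"
  by (rule LIMSEQ_ignore_initial_segment[OF psum_plim'[OF xx_nz(2)[OF pos] finite_JJ u]])
 have 2: "(%N. norm (psum (JJ e m) u (N + m) (1 / xx e t) / xx e t ^ sum_list u - psum {int m} u N t))
  \<longlonglongrightarrow> norm (plim (JJ e m) u (1 / xx e t) / xx e t ^ sum_list u - plim {int m} u t)"
  by (intro tendsto_norm tendsto_diff tendsto_divide tendsto_const 1 psum_plim' pos u) (use xx_nz(1)[OF pos] in auto)
 have "(%N. B + C / real N) \<longlonglongrightarrow> B + 0" by (intro tendsto_add tendsto_const) real_asymp
 then have 3: "(%N. B + C / real N) \<longlonglongrightarrow> B" by simp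
 show ?thesis
  by (rule tendsto_le[OF sequentially_bot 3 2])
   (use B psum_JJ[OF pos] in \<open>auto simp: eventually_sequentially\<close>)
qed

definition cl :: "nat => complex => nat => nat list => complex" where
 "cl e t m u = plim (JJ e m) u (1 / xx e t) / xx e t ^ sum_list u"

lemma sum_zs_le:
 fixes z :: "int => complex"
 assumes A: "1 \<le> A" "t \<in> KA A" and F: "finite F" "!!n. n \<in> F ==> m = 0 ==> n \<noteq> 0" and k: "2 \<le> k" "k \<le> s"
  and z: "!!n. n \<in> F ==> mx (int m) n \<le> 2 * KK A * norm (z n)"
 shows "(\<Sum>n\<in>F. norm (1 / z n ^ k)) \<le> 5 * (2 * KK A) ^ s / (max 1 (real m)) ^ (k - 1)"
proof -
 have "(\<Sum>n\<in>F. norm (1 / z n ^ k)) \<le> (\<Sum>n\<in>F. (2 * KK A) ^ s * (1 / mx (int m) n ^ k))"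
 proof (rule sum_mono)
  fix n assume n: "n \<in> F"
  have "norm (1 / z n ^ k) \<le> (2 * KK A) ^ s / mx (int m) n ^ k"
   by (rule inv_power_le2[OF mx_ge1 z[OF n] _ order_refl k(2)]) (use KK_ge1[of A] in auto)
  then show "norm (1 / z n ^ k) \<le> (2 * KK A) ^ s * (1 / mx (int m) n ^ k)" by simp
 qed
 also have "... = (2 * KK A) ^ s * (\<Sum>n\<in>F. 1 / mx (int m) n ^ k)" by (simp only: sum_distrib_left)
 also have "... \<le> (2 * KK A) ^ s * (5 / (max 1 (real_of_int (int m))) ^ (k - 1))"
  using KK_ge1[of A] by (intro mult_left_mono sum_mx_pow F k) auto
 finally show ?thesis by (simp add: mult_ac)
qed

lemma prod_div_power: "(\<Prod>k\<leftarrow>ks. B / a ^ (k - 1)) = (B::real) ^ length ks / a ^ (\<Sum>k\<leftarrow>ks. k - 1)"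
 by (induction ks) (auto simp: power_add)

lemma cluster_trivial:
 assumes A: "1 \<le> A" "t \<in> KA A" and u: "u \<in> mes_indices"
 shows "norm (cl e t m u) \<le> (5 * (2 * KK A) ^ sum_list u) ^ length u / (max 1 (real m)) ^ (\<Sum>k\<leftarrow>u. k - 1)"
proof -
 have pos: "0 < Im t" using KA_pos A by blast
 have "norm (csum (lx e) (zs e m t) (lab e m N) u) \<le> (\<Prod>k\<leftarrow>u. 5 * (2 * KK A) ^ sum_list u / (max 1 (real m)) ^ (k - 1))" for N
 proof (rule csum_bound[OF finite_lab])
  fix k assume k: "k \<in> set u"
  show "(\<Sum>n\<in>lab e m N. norm (1 / zs e m t n ^ k)) \<le> 5 * (2 * KK A) ^ sum_list u / (max 1 (real m)) ^ (k - 1)"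
  proof (rule sum_zs_le[OF A finite_lab lab_nz])
   show "2 \<le> k" "k \<le> sum_list u" using k u mem_mes_indices member_le_sum_list by auto
   show "mx (int m) n \<le> 2 * KK A * norm (zs e m t n)" if "n \<in> lab e m N" for n
    by (rule zs_lower[OF A]) (use lab_nz[OF that] in auto)
  qed
 qed
 then have b: "norm (psum (JJ e m) u N (1 / xx e t) / xx e t ^ sum_list u) \<le> (5 * (2 * KK A) ^ sum_list u) ^ length u / (max 1 (real m)) ^ (\<Sum>k\<leftarrow>u. k - 1)" for N
  unfolding psum_JJ[OF pos] prod_div_power by blast
 have "(%N. norm (psum (JJ e m) u N (1 / xx e t) / xx e t ^ sum_list u)) \<longlonglongrightarrow> norm (cl e t m u)"
  unfolding cl_def by (intro tendsto_norm tendsto_divide tendsto_const psum_plim' xx_nz pos finite_JJ u) (use xx_nz(1)[OF pos] in auto)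
 then show ?thesis by (rule tendsto_upperbound) (use b in auto)
qed

lemma cluster_shear:
 assumes A: "1 \<le> A" "t \<in> KA A" and m: "1 \<le> m" and k: "2 \<le> k"
 shows "norm (cl e t m [k] - plim {int m} [k] t) \<le> 2 * real k * A * (2 * KK A) ^ (k + 1) / real (2 * e + 1) * (8 / real (2 * e + 1))"
  and "3 \<le> k ==> norm (cl e t m [k] - plim {int m} [k] t) \<le> 2 * real k * A * (2 * KK A) ^ (k + 1) / real (2 * e + 1) * (5 / (real m)\<^sup>2)"
proof -
 have g: "norm (cl e t m [k] - plim {int m} [k] t) \<le> B"
  if B: "!!F. finite F ==> (\<Sum>n\<in>F. norm (1 / zs e m t n ^ k - 1 / lval t (int m, n) ^ k)) \<le> B" for B
  unfolding cl_def
 proof (rule cluster_limit[OF A, where C = "length [k] * (6 * KK A ^ sum_list [k]) ^ length [k] * (KK A ^ sum_list [k] * 4)"])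
  fix N :: nat assume N: "1 \<le> N"
  let ?F = "lab e m (N + m)"
  have 1: "norm (csum (%a b. b < a) (%n. lval t (int m, n)) ?F [k] - psum {int m} [k] N t)
   \<le> length [k] * (6 * KK A ^ sum_list [k]) ^ length [k] * (KK A ^ sum_list [k] * (4 / N))"
   by (rule line_exhaust[OF A]) (use m N k lab_contains(1)[of _ N m e] in auto)
  have eq: "csum (lx e) (zs e m t) ?F [k] - csum (%a b. b < a) (%n. lval t (int m, n)) ?F [k]
   = (\<Sum>n\<in>?F. 1 / zs e m t n ^ k - 1 / lval t (int m, n) ^ k)"
   by (simp add: sum_subtractf)
  have 2: "norm (csum (lx e) (zs e m t) ?F [k] - csum (%a b. b < a) (%n. lval t (int m, n)) ?F [k]) \<le> B"
   unfolding eq by (rule order_trans[OF norm_sum B[OF finite_lab]])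
  show "norm (csum (lx e) (zs e m t) ?F [k] - psum {int m} [k] N t) \<le> B + length [k] * (6 * KK A ^ sum_list [k]) ^ length [k] * (KK A ^ sum_list [k] * 4) / N"
   using norm_triangle_mono[OF 2 1] by simp
 qed (use k in auto)
 show "norm (cl e t m [k] - plim {int m} [k] t) \<le> 2 * real k * A * (2 * KK A) ^ (k + 1) / real (2 * e + 1) * (8 / real (2 * e + 1))"
  by (rule g) (rule shear_value(1)[OF A m k])
 show "norm (cl e t m [k] - plim {int m} [k] t) \<le> 2 * real k * A * (2 * KK A) ^ (k + 1) / real (2 * e + 1) * (5 / (real m)\<^sup>2)" if "3 \<le> k"
  by (rule g) (rule shear_value(2)[OF A m k _ that])
qed

definition RC :: "real => nat list => real" where
 "RC A u = length u * (2 * (5 * (2 * KK A) ^ sum_list u) ^ length u) * (96 * A * (2 * KK A) ^ (sum_list u + 1))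
  + 2 * (length u)\<^sup>2 * (5 * (2 * KK A) ^ sum_list u) ^ length u * ((2 * KK A) ^ sum_list u * (2 * KK A) ^ sum_list u * 3000)"

lemma relabel_compare:
 assumes A: "1 \<le> A" "t \<in> KA A" and u: "u \<in> mes_indices" and e: "1 \<le> e" and c: "2 \<le> length u \<or> (m = 0 \<and> u \<noteq> [])"
  and F: "finite F" "!!n. n \<in> F ==> m = 0 ==> 0 < n"
 shows "norm (csum (%a b. lx e (sg e a) (sg e b)) (%n. zs e m t (sg e n)) F u - csum (%a b. b < a) (%n. lval t (int m, n)) F u)
  \<le> RC A u * Dd e powr (- 7 / 4)"
proof -
 define s where "s = sum_list u"
 define B where "B = (2 * KK A) ^ s"
 have B1: "1 \<le> B" unfolding B_def using KK_ge1[of A] by (intro one_le_power) auto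
 let ?R = "%a b. lx e (sg e a) (sg e b)"
 let ?z = "%n. lval t (int m, n)" and ?z' = "%n. zs e m t (sg e n)"
 have k: "2 \<le> k" "k \<le> s" if "k \<in> set u" for k
  using that u mem_mes_indices member_le_sum_list by (auto simp: s_def)
 have n0: "n \<noteq> 0" if "n \<in> F" "m = 0" for n using F(2)[OF that] by simp
 have lo: "mx (int m) n \<le> 2 * KK A * norm (?z n)" "mx (int m) n \<le> 2 * KK A * norm (?z' n)" if "n \<in> F" for n
  using line_lower[OF A, of m n] zs_lower[OF A, of m "sg e n" e] n0[OF that] sg_cases[of e n] by (auto simp: mx_sg)
 let ?a = "max 1 (real m)"
 let ?n = "length u"
 have S: "(\<Sum>n\<in>F. norm (1 / z n ^ k)) \<le> 5 * B / ?a" if "k \<in> set u" "!!n. n \<in> F ==> mx (int m) n \<le> 2 * KK A * norm (z n)" for k and z :: "int => complex"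
 proof -
  have "(\<Sum>n\<in>F. norm (1 / z n ^ k)) \<le> 5 * B / ?a ^ (k - 1)"
   unfolding B_def by (rule sum_zs_le[OF A F(1) n0 k[OF that(1)] that(2)])
  also have "... \<le> 5 * B / ?a ^ 1"
   using k[OF that(1)] B1 by (intro divide_left_mono power_increasing) auto
  finally show ?thesis by simp
 qed
 let ?\<eta> = "96 * A * (2 * KK A) ^ (s + 1) * (real m + 1) / (real (2 * e + 1))\<^sup>2"
 have 1: "norm (csum ?R ?z' F u - csum ?R ?z F u) \<le> ?n * (5 * B / ?a) ^ (?n - 1) * ?\<eta>"
 proof (rule csum_value_diff[OF F(1)])
  show "0 \<le> 5 * B / ?a" using B1 by simp
  show "(\<Sum>n\<in>F. norm (1 / ?z n ^ k)) \<le> 5 * B / ?a" if "k \<in> set u" for k by (rule S[OF that lo(1)])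
  show "(\<Sum>n\<in>F. norm (1 / ?z' n ^ k)) \<le> 5 * B / ?a" if "k \<in> set u" for k by (rule S[OF that lo(2)])
  show "(\<Sum>n\<in>F. norm (1 / ?z' n ^ k - 1 / ?z n ^ k)) \<le> ?\<eta>" if "k \<in> set u" for k
   by (rule relabel_value[OF A F k[OF that]])
 qed
 have 11: "(5 * B / ?a) ^ (?n - 1) * (real m + 1) \<le> 2 * (5 * B) ^ ?n"
 proof (cases "m = 0")
  case True
  have "(5 * B) ^ (?n - 1) \<le> (5 * B) ^ ?n" using B1 by (intro power_increasing) auto
  moreover have "0 \<le> (5 * B) ^ ?n" using B1 by simp
  ultimately show ?thesis using True by simp
 next
  case False
  then have n2: "2 \<le> ?n" using c by auto
  have "(5 * B / ?a) ^ (?n - 1) * (real m + 1) = (5 * B) ^ (?n - 1) * ((real m + 1) / ?a ^ (?n - 1))"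
   by (simp add: power_divide)
  also have "... \<le> (5 * B) ^ ?n * ((real m + 1) / ?a ^ 1)"
   using n2 B1 by (intro mult_mono power_increasing divide_left_mono) auto
  also have "... \<le> (5 * B) ^ ?n * 2"
   using False B1 by (intro mult_left_mono) (auto simp: max_def field_simps)
  finally show ?thesis by simp
 qed
 have "?n * (5 * B / ?a) ^ (?n - 1) * ?\<eta> = ?n * ((5 * B / ?a) ^ (?n - 1) * (real m + 1)) * (96 * A * (2 * KK A) ^ (s + 1)) * (1 / (real (2 * e + 1))\<^sup>2)"
  by simp
 also have "... \<le> ?n * (2 * (5 * B) ^ ?n) * (96 * A * (2 * KK A) ^ (s + 1)) * Dd e powr (- 7 / 4)"
  using B1 KK_ge1[of A] A(1) by (intro mult_mono mult_right_mono mult_left_mono 11 inv_sq_Dd mult_nonneg_nonneg) auto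
 finally have 12: "norm (csum ?R ?z' F u - csum ?R ?z F u) \<le> ?n * (2 * (5 * B) ^ ?n) * (96 * A * (2 * KK A) ^ (s + 1)) * Dd e powr (- 7 / 4)"
  using 1 by linarith
 let ?w = "%n. B * (1 / (mx (int m) n)\<^sup>2)"
 have 2: "norm (csum ?R ?z F u - csum (%a b. b < a) ?z F u) \<le> 2 * ?n\<^sup>2 * (5 * B) ^ ?n * (B * B * 3000 * Dd e powr (- 7 / 4))"
 proof (rule csum_order_diff[OF F(1), where b = ?w])
  show "1 \<le> 5 * B" using B1 by simp
  show "norm (1 / ?z x ^ k) \<le> ?w x" if "x \<in> F" "k \<in> set u" for x k
   using inv_power_le2[OF mx_ge1 lo(1)[OF that(1)] _ k[OF that(2)]] KK_ge1[of A] by (simp add: B_def)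
  show "0 \<le> ?w x" for x using B1 by simp
  have "(\<Sum>x\<in>F. ?w x) = B * (\<Sum>x\<in>F. 1 / (mx (int m) x)\<^sup>2)" by (simp only: sum_distrib_left)
  also have "... \<le> B * (5 / max 1 (real_of_int (int m)))" using B1 by (intro mult_left_mono sum_mx_sq F) auto
  also have "... \<le> B * 5" using B1 by (intro mult_left_mono) (auto simp: field_simps)
  finally show "(\<Sum>x\<in>F. ?w x) \<le> 5 * B" by simp
  have "(\<Sum>x\<in>F. ?w x * (\<Sum>y\<in>{y\<in>F. (y < x) \<noteq> ?R x y}. ?w y))
   = B * B * (\<Sum>x\<in>F. 1 / (mx (int m) x)\<^sup>2 * (\<Sum>y\<in>{y\<in>F. (y < x) \<noteq> ?R x y}. 1 / (mx (int m) y)\<^sup>2))"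
   unfolding sum_distrib_left[symmetric, of B] unfolding sum_distrib_left[of "B * B"] by (intro sum.cong refl) simp
  also have "... \<le> B * B * (600 * ell e / (real (2 * e + 1))\<^sup>2)"
   using B1 by (intro mult_left_mono order_error F e) auto
  also have "... \<le> B * B * (600 * (5 * Dd e powr (- 7 / 4)))"
   using B1 mult_left_mono[OF ell_Dd[OF e], of 600] by (intro mult_left_mono) auto
  finally show "(\<Sum>x\<in>F. ?w x * (\<Sum>y\<in>{y\<in>F. (y < x) \<noteq> ?R x y}. ?w y)) \<le> B * B * 3000 * Dd e powr (- 7 / 4)" by simp
 qed
 have "norm (csum ?R ?z' F u - csum (%a b. b < a) ?z F u)
  \<le> ?n * (2 * (5 * B) ^ ?n) * (96 * A * (2 * KK A) ^ (s + 1)) * Dd e powr (- 7 / 4) + 2 * ?n\<^sup>2 * (5 * B) ^ ?n * (B * B * 3000 * Dd e powr (- 7 / 4))"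
  using norm_triangle_mono[OF 12 2] by simp
 also have "... = RC A u * Dd e powr (- 7 / 4)"
  unfolding RC_def B_def s_def by (simp add: distrib_right)
 finally show ?thesis .
qed

lemma RC_nonneg: "1 \<le> A ==> 0 \<le> RC A u"
 unfolding RC_def using KK_ge1[of A] by (intro add_nonneg_nonneg mult_nonneg_nonneg) auto

lemma cluster_relabel:
 assumes A: "1 \<le> A" "t \<in> KA A" and u: "u \<in> mes_indices" and e: "1 \<le> e" and c: "2 \<le> length u \<or> (m = 0 \<and> u \<noteq> [])"
 shows "norm (cl e t m u - plim {int m} u t) \<le> RC A u * Dd e powr (- 7 / 4)"
 unfolding cl_def
proof (rule cluster_limit[OF A u, where C = "length u * (6 * KK A ^ sum_list u) ^ length u * (KK A ^ sum_list u * 4)"])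
 fix N :: nat assume N: "1 \<le> N"
 let ?F = "sg e ` lab e m (N + m)"
 have 1: "norm (csum (%a b. b < a) (%n. lval t (int m, n)) ?F u - psum {int m} u N t)
   \<le> length u * (6 * KK A ^ sum_list u) ^ length u * (KK A ^ sum_list u * (4 / N))"
  by (rule line_exhaust[OF A _ sg_lab_pos lab_contains(2) N u]) auto
 have 2: "norm (csum (lx e) (zs e m t) (lab e m (N + m)) u - csum (%a b. b < a) (%n. lval t (int m, n)) ?F u) \<le> RC A u * Dd e powr (- 7 / 4)"
  unfolding csum_lab_sg by (rule relabel_compare[OF A u e c _ sg_lab_pos]) auto
 show "norm (csum (lx e) (zs e m t) (lab e m (N + m)) u - psum {int m} u N t) \<le> RC A u * Dd e powr (- 7 / 4) + length u * (6 * KK A ^ sum_list u) ^ length u * (KK A ^ sum_list u * 4) / N"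
  using norm_triangle_mono[OF 2 1] by simp
qed

lemma cluster_diff:
 assumes A: "1 \<le> A" and u: "u \<in> mes_indices"
 shows "\<exists>C\<ge>0. \<forall>e\<ge>1. \<forall>t\<in>KA A. \<forall>m. norm (cl e t m u - plim {int m} u t) \<le> C * Dd e powr (- 7 / 4)"
proof -
 define C where "C = RC A u + 16 * (real (sum_list u) * A * (2 * KK A) ^ (sum_list u + 1))"
 have C: "RC A u \<le> C" "16 * (real (sum_list u) * A * (2 * KK A) ^ (sum_list u + 1)) \<le> C" "0 \<le> C"
  using RC_nonneg[OF A, of u] KK_ge1[of A] A by (auto simp: C_def)
 have "norm (cl e t m u - plim {int m} u t) \<le> C * Dd e powr (- 7 / 4)" if e: "1 \<le> e" and t: "t \<in> KA A" for e t m
 proof (cases "2 \<le> length u \<or> (m = 0 \<and> u \<noteq> [])")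
  case True
  have "norm (cl e t m u - plim {int m} u t) \<le> RC A u * Dd e powr (- 7 / 4)" by (rule cluster_relabel[OF A t u e True])
  also have "... \<le> C * Dd e powr (- 7 / 4)" using C by (intro mult_right_mono) auto
  finally show ?thesis .
 next
  case False
  show ?thesis
  proof (cases u)
   case Nil
   then show ?thesis using C by (simp add: cl_def)
  next
   case (Cons k v)
   then have uk: "u = [k]" "1 \<le> m" "2 \<le> k" using False u by (cases v; auto)+
   have "norm (cl e t m u - plim {int m} u t) \<le> 2 * real k * A * (2 * KK A) ^ (k + 1) / real (2 * e + 1) * (8 / real (2 * e + 1))"
    unfolding uk(1) by (rule cluster_shear(1)[OF A t uk(2,3)])
   also have "... = 16 * (real (sum_list u) * A * (2 * KK A) ^ (sum_list u + 1)) * (1 / (real (2 * e + 1))\<^sup>2)"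
    by (simp add: uk(1) power2_eq_square)
   also have "... \<le> C * Dd e powr (- 7 / 4)" using C by (intro mult_mono inv_sq_Dd) auto
   finally show ?thesis .
  qed
 qed
 then show ?thesis using C(3) by blast
qed

lemma interpolate:
 fixes x a b \<theta> :: real
 assumes "0 \<le> x" "x \<le> a" "x \<le> b" "0 \<le> \<theta>" "\<theta> \<le> 1"
 shows "x \<le> a powr \<theta> * b powr (1 - \<theta>)"
proof (cases "x = 0")
 case False
 then have "x = x powr \<theta> * x powr (1 - \<theta>)" using assms by (simp add: powr_add[symmetric])
 also have "... \<le> a powr \<theta> * b powr (1 - \<theta>)"
  using assms by (intro mult_mono powr_mono2) auto
 finally show ?thesis .
qed simp

lemma inv_power_Suc_le: "1 \<le> m ==> 1 / real m ^ j \<le> 2 ^ j / (real m + 1) ^ j"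
proof -
 assume m: "1 \<le> m"
 then have "1 / real m \<le> 2 / (real m + 1)" by (simp add: field_simps)
 then have "(1 / real m) ^ j \<le> (2 / (real m + 1)) ^ j" by (intro power_mono) auto
 then show ?thesis by (simp add: power_divide)
qed

lemma cluster_diff_adm:
 assumes A: "1 \<le> A" and u: "u \<in> mes_indices" "u \<noteq> []" "3 \<le> hd u"
 shows "\<exists>C\<ge>0. \<forall>e\<ge>1. \<forall>t\<in>KA A. \<forall>m. norm (cl e t m u - plim {int m} u t) \<le> C * Dd e powr (- 21 / 20) * (real m + 1) powr (- 6 / 5)"
proof -
 obtain C1 where C1: "0 \<le> C1" "!!e t m. 1 \<le> e ==> t \<in> KA A ==> norm (cl e t m u - plim {int m} u t) \<le> C1 * Dd e powr (- 7 / 4)"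
  using cluster_diff[OF A u(1)] by blast
 define E where "E = 2 * real (sum_list u) * A * (2 * KK A) ^ (sum_list u + 1)"
 define T where "T = 8 * ((5 * (2 * KK A) ^ sum_list u) ^ length u + PK A u)"
 have E0: "0 \<le> E" unfolding E_def using A KK_ge1[of A] by simp
 have T0: "0 \<le> T" unfolding T_def using PK_nonneg[of A u] KK_ge1[of A] by simp
 define C where "C = C1 + E * (8 powr (1 / 20) * 20 powr (19 / 20)) + C1 powr (3 / 5) * T powr (2 / 5)"
 have CC: "C1 \<le> C" "E * (8 powr (1 / 20) * 20 powr (19 / 20)) \<le> C" "C1 powr (3 / 5) * T powr (2 / 5) \<le> C" "0 \<le> C"
  unfolding C_def using C1(1) E0 by auto
 have "norm (cl e t m u - plim {int m} u t) \<le> C * Dd e powr (- 21 / 20) * (real m + 1) powr (- 6 / 5)" if e: "1 \<le> e" and t: "t \<in> KA A" for e t m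
 proof -
  have D: "1 \<le> Dd e" by (rule Dd_ge1)
  consider "m = 0" | "1 \<le> m" "length u = 1" | "1 \<le> m" "2 \<le> length u" using u(2) by (cases "length u") force+
  then show ?thesis
  proof cases
   case 1
   have "norm (cl e t m u - plim {int m} u t) \<le> C1 * Dd e powr (- 7 / 4)" by (rule C1(2)[OF e t])
   also have "... \<le> C * Dd e powr (- 21 / 20)" using D CC C1(1) by (intro mult_mono powr_mono) auto
   finally show ?thesis using 1 by simp
  next
   case 2
   then obtain k where k: "u = [k]" by (cases u) auto
   then have k3: "3 \<le> k" using u by simp
   define X where "X = norm (cl e t m u - plim {int m} u t) / (E / Dd e)"
   have Epos: "0 < E" unfolding E_def using A KK_ge1[of A] k k3 by simp
   have "norm (cl e t m u - plim {int m} u t) \<le> E / Dd e * (8 / Dd e)"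
    unfolding E_def Dd_def using cluster_shear(1)[OF A t 2(1), of k e] k k3 by simp
   then have X1: "X \<le> 8 / Dd e" unfolding X_def using Epos D by (simp add: field_simps)
   have "norm (cl e t m u - plim {int m} u t) \<le> E / Dd e * (5 / (real m)\<^sup>2)"
    unfolding E_def Dd_def using cluster_shear(2)[OF A t 2(1), of k e] k k3 by simp
   also have "... \<le> E / Dd e * (20 / (real m + 1)\<^sup>2)"
    using inv_power_Suc_le[OF 2(1), of 2] E0 D by (intro mult_left_mono) auto
   finally have X2: "X \<le> 20 / (real m + 1)\<^sup>2" unfolding X_def using Epos D by (simp add: field_simps)
   have "X \<le> (8 / Dd e) powr (1 / 20) * (20 / (real m + 1)\<^sup>2) powr (1 - 1 / 20)"
    by (rule interpolate[OF _ X1 X2]) (use E0 D in \<open>auto simp: X_def\<close>)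
   also have "(8 / Dd e) powr (1 / 20) = 8 powr (1 / 20) * Dd e powr (- 1 / 20)"
    using D by (simp add: powr_divide powr_minus_divide)
   also have "(20 / (real m + 1)\<^sup>2) powr (1 - 1 / 20) = 20 powr (19 / 20) * (real m + 1) powr (- 19 / 10)"
   proof -
    have e: "20 / (real m + 1)\<^sup>2 = 20 * (real m + 1) powr (- 2)"
     by (simp add: powr_minus powr_realpow inverse_eq_divide)
    show ?thesis unfolding e by (simp add: powr_mult powr_powr)
   qed
   also have "8 powr (1 / 20) * Dd e powr (- 1 / 20) * (20 powr (19 / 20) * (real m + 1) powr (- 19 / 10))
    \<le> 8 powr (1 / 20) * Dd e powr (- 1 / 20) * (20 powr (19 / 20) * (real m + 1) powr (- 6 / 5))"
    by (intro mult_left_mono powr_mono) auto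
   finally have X3: "X \<le> 8 powr (1 / 20) * Dd e powr (- 1 / 20) * (20 powr (19 / 20) * (real m + 1) powr (- 6 / 5))" .
   have "norm (cl e t m u - plim {int m} u t) = E / Dd e * X" unfolding X_def using Epos D by simp
   also have "... \<le> E / Dd e * (8 powr (1 / 20) * Dd e powr (- 1 / 20) * (20 powr (19 / 20) * (real m + 1) powr (- 6 / 5)))"
    using X3 E0 D by (intro mult_left_mono) auto
   also have "... = E * (8 powr (1 / 20) * 20 powr (19 / 20)) * (Dd e powr (- 1 / 20) / Dd e) * (real m + 1) powr (- 6 / 5)"
    by simp
   also have "Dd e powr (- 1 / 20) / Dd e = Dd e powr (- 21 / 20)"
   proof -
    have "Dd e powr (- 1 / 20) / Dd e = Dd e powr (- 1 / 20) / Dd e powr 1" using D by simp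
    also have "... = Dd e powr (- 1 / 20 - 1)" by (simp only: powr_diff)
    finally show ?thesis by simp
   qed
   also have "E * (8 powr (1 / 20) * 20 powr (19 / 20)) * Dd e powr (- 21 / 20) * (real m + 1) powr (- 6 / 5)
    \<le> C * Dd e powr (- 21 / 20) * (real m + 1) powr (- 6 / 5)"
    using CC by (intro mult_right_mono) auto
   finally show ?thesis .
  next
   case 3
   let ?s = "\<Sum>k\<leftarrow>u. k - 1"
   obtain k v where uv: "u = k # v" "v \<noteq> []" using 3(2) by (cases u; cases "tl u") auto
   have "length v \<le> (\<Sum>k\<leftarrow>v. k - 1)" by (rule sum_pred_ge) (use u uv in auto)
   moreover have "1 \<le> length v" using uv(2) by (cases v) auto
   ultimately have s3: "3 \<le> ?s" using uv(1) u(3) by simp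
   have m: "max 1 (real m) = real m" using 3(1) by (simp add: max_def)
   have pw: "real m ^ 3 \<le> real m ^ ?s" using 3(1) s3 by (intro power_increasing) auto
   have "norm (cl e t m u - plim {int m} u t) \<le> norm (cl e t m u) + norm (plim {int m} u t)" by (rule norm_triangle_ineq4)
   also have "... \<le> (5 * (2 * KK A) ^ sum_list u) ^ length u / real m ^ ?s + PK A u / real m ^ ?s"
   proof (rule add_mono)
    show "norm (cl e t m u) \<le> (5 * (2 * KK A) ^ sum_list u) ^ length u / real m ^ ?s"
     using cluster_trivial[OF A t u(1), of e m] unfolding m .
    show "norm (plim {int m} u t) \<le> PK A u / real m ^ ?s"
     by (rule plim_bound) (use psum_line_bound[OF A t u(1), of "int m"] m KA_pos[OF A t] u(1) in auto)
   qed
   also have "... = ((5 * (2 * KK A) ^ sum_list u) ^ length u + PK A u) / real m ^ ?s" by (simp add: add_divide_distrib)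
   also have "... \<le> ((5 * (2 * KK A) ^ sum_list u) ^ length u + PK A u) / real m ^ 3"
    using pw 3(1) PK_nonneg[of A u] KK_ge1[of A] by (intro divide_left_mono) auto
   also have "... = ((5 * (2 * KK A) ^ sum_list u) ^ length u + PK A u) * (1 / real m ^ 3)" by simp
   also have "... \<le> ((5 * (2 * KK A) ^ sum_list u) ^ length u + PK A u) * (2 ^ 3 / (real m + 1) ^ 3)"
    using PK_nonneg[of A u] KK_ge1[of A] by (intro mult_left_mono inv_power_Suc_le 3(1)) auto
   also have "... = T * (real m + 1) powr (- 3)"
    unfolding T_def by (simp add: powr_minus powr_realpow inverse_eq_divide)
   finally have b2: "norm (cl e t m u - plim {int m} u t) \<le> T * (real m + 1) powr (- 3)" .
   have "norm (cl e t m u - plim {int m} u t) \<le> (C1 * Dd e powr (- 7 / 4)) powr (3 / 5) * (T * (real m + 1) powr (- 3)) powr (1 - 3 / 5)"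
    by (rule interpolate[OF _ C1(2)[OF e t] b2]) auto
   also have "... = C1 powr (3 / 5) * T powr (2 / 5) * Dd e powr (- 21 / 20) * (real m + 1) powr (- 6 / 5)"
    using C1(1) T0 by (simp add: powr_mult powr_powr)
   also have "... \<le> C * Dd e powr (- 21 / 20) * (real m + 1) powr (- 6 / 5)"
    using CC by (intro mult_right_mono) auto
   finally show ?thesis .
  qed
 qed
 then show ?thesis using CC(4) by blast
qed

lemma plim_Un:
 assumes "0 < Im t" "w \<in> mes_indices" "finite I" "finite J" "!!i j. i \<in> I ==> j \<in> J ==> i < j"
 shows "plim (J \<union> I) w t = (\<Sum>i\<le>length w. plim J (take i w) t * plim I (drop i w) t)"
proof (rule LIMSEQ_unique)
 show "(%N. psum (J \<union> I) w N t) \<longlonglongrightarrow> plim (J \<union> I) w t"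
  by (rule psum_plim') (use assms in auto)
 have e: "psum (J \<union> I) w N t = (\<Sum>i\<le>length w. psum J (take i w) N t * psum I (drop i w) N t)" for N
 proof -
  have "pset (J \<union> I) N = pset J N \<union> pset I N" by (auto simp: pset_def)
  show ?thesis unfolding psum_def \<open>pset (J \<union> I) N = _\<close>
  proof (rule lat.csum_Un)
   show "x \<succ> y" if "x \<in> pset J N" "y \<in> pset I N" for x y
    using that assms(5) by (cases x; cases y) (auto simp: pset_def)
  qed (use assms in simp_all)
 qed
 show "(%N. psum (J \<union> I) w N t) \<longlonglongrightarrow> (\<Sum>i\<le>length w. plim J (take i w) t * plim I (drop i w) t)"
  unfolding e by (intro tendsto_intros psum_plim') (use assms mes_indices_take mes_indices_drop in auto)
qed

definition II :: "nat => nat => int set" where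
 "II e M = {0..<int (M * (2 * e + 1) - e)}"

definition FS :: "nat => complex => nat => nat list => complex" where
 "FS e t M w = plim (II e M) w (1 / xx e t) / xx e t ^ sum_list w"

lemma II_Suc: "II e (Suc M) = JJ e M \<union> II e M"
proof (cases M)
 case (Suc k)
 have "int (M * (2 * e + 1) - e) = int M * (2 * int e + 1) - int e"
  by (simp add: Suc of_nat_diff algebra_simps)
 moreover have "int (Suc M * (2 * e + 1) - e) = int M * (2 * int e + 1) + int e + 1"
  by (simp add: of_nat_diff algebra_simps)
 moreover have "0 \<le> int M * (2 * int e + 1) - int e" by (simp add: Suc algebra_simps)
 ultimately show ?thesis unfolding II_def JJ_def using Suc by auto
qed (auto simp: II_def JJ_def)

lemma FS_Suc:
 assumes t: "0 < Im t" and w: "w \<in> mes_indices"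
 shows "FS e t (Suc M) w = (\<Sum>i\<le>length w. cl e t M (take i w) * FS e t M (drop i w))"
proof -
 have lt: "i < j" if "i \<in> II e M" "j \<in> JJ e M" for i j
 proof (cases M)
  case 0 then show ?thesis using that by (simp add: II_def)
 next
  case (Suc k)
  have "int (M * (2 * e + 1) - e) = int M * (2 * int e + 1) - int e"
   by (simp add: Suc of_nat_diff algebra_simps)
  then show ?thesis using that Suc by (simp add: II_def JJ_def)
 qed
 have fin: "finite (II e M)" by (simp add: II_def)
 have s: "xx e t ^ sum_list w = xx e t ^ sum_list (take i w) * xx e t ^ sum_list (drop i w)" for i
  unfolding power_add[symmetric] sum_list_append[symmetric] by simp
 have un: "plim (JJ e M \<union> II e M) w (1 / xx e t) = (\<Sum>i\<le>length w. plim (JJ e M) (take i w) (1 / xx e t) * plim (II e M) (drop i w) (1 / xx e t))"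
  by (rule plim_Un[OF xx_nz(2)[OF t] w fin finite_JJ lt])
 show ?thesis
  unfolding FS_def cl_def II_Suc un sum_divide_distrib
 proof (rule sum.cong[OF refl])
  fix i
  show "plim (JJ e M) (take i w) (1 / xx e t) * plim (II e M) (drop i w) (1 / xx e t) / xx e t ^ sum_list w
   = plim (JJ e M) (take i w) (1 / xx e t) / xx e t ^ sum_list (take i w) * (plim (II e M) (drop i w) (1 / xx e t) / xx e t ^ sum_list (drop i w))"
   unfolding s[of i] by simp
 qed
qed

lemma FS_Nil [simp]: "FS e t M [] = 1" and cl_Nil [simp]: "cl e t m [] = 1"
 by (simp_all add: FS_def cl_def)

lemma FS_0: "w \<noteq> [] ==> FS e t 0 w = 0"
 by (simp add: FS_def II_def plim_empty)

lemma composition_sum: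
 fixes F a :: "nat => nat list => complex"
 assumes "!!M. F (Suc M) w = (\<Sum>i\<le>length w. a M (take i w) * F M (drop i w))" "F 0 w = 0" "!!M. a M [] = 1"
 shows "F M w = (\<Sum>m<M. \<Sum>i=1..length w. a m (take i w) * F m (drop i w))"
proof (induction M)
 case (Suc M)
 have "{..length w} = insert 0 {1..length w}" by auto
 then have "F (Suc M) w = a M (take 0 w) * F M (drop 0 w) + (\<Sum>i=1..length w. a M (take i w) * F M (drop i w))"
  unfolding assms(1) by simp
 then show ?case using Suc assms(3) by simp
qed (use assms in simp)

lemma FS_sum:
 assumes "0 < Im t" "w \<in> mes_indices" "w \<noteq> []"
 shows "FS e t M w = (\<Sum>m<M. \<Sum>i=1..length w. cl e t m (take i w) * FS e t m (drop i w))"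
 by (rule composition_sum) (use assms FS_Suc FS_0 in auto)

lemma plim_sum:
 assumes "0 < Im t" "w \<in> mes_indices" "w \<noteq> []"
 shows "plim {0..<int M} w t = (\<Sum>m<M. \<Sum>i=1..length w. plim {int m} (take i w) t * plim {0..<int m} (drop i w) t)"
 by (rule composition_sum[where F = "%M w. plim {0..<int M} w t" and a = "%m w. plim {int m} w t"])
  (use assms plim_Suc plim_empty in auto)

lemma sum_powr_bound:
 assumes "1 < s" obtains Z :: real where "0 \<le> Z" "!!M. (\<Sum>m<M. (real m + 1) powr (- s)) \<le> Z"
proof -
 have "summable (%n. real n powr (- s))" using assms by (simp add: summable_real_powr_iff)
 then have s: "summable (%n. (real n + 1) powr (- s))"
  using summable_Suc_iff[of "%n. real n powr (- s)"] by (simp add: add.commute)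
 show ?thesis
 proof (rule that)
  show "0 \<le> (\<Sum>n. (real n + 1) powr (- s))" by (intro suminf_nonneg s) auto
  show "(\<Sum>m<M. (real m + 1) powr (- s)) \<le> (\<Sum>n. (real n + 1) powr (- s))" for M
   by (intro sum_le_suminf s) auto
 qed
qed

lemma cl_bound:
 assumes A: "1 \<le> A" "t \<in> KA A" and u: "u \<in> mes_indices" "u \<noteq> []"
 shows "norm (cl e t m u) \<le> 2 * (5 * (2 * KK A) ^ sum_list u) ^ length u / (real m + 1)"
proof -
 let ?B = "(5 * (2 * KK A) ^ sum_list u) ^ length u"
 have B: "0 \<le> ?B" using KK_ge1[of A] by simp
 have "1 \<le> (\<Sum>k\<leftarrow>u. k - 1)" using sum_pred_ge[OF u(1)] u(2) by (cases u) auto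
 then have p: "max 1 (real m) ^ 1 \<le> max 1 (real m) ^ (\<Sum>k\<leftarrow>u. k - 1)" by (intro power_increasing) auto
 have "norm (cl e t m u) \<le> ?B / max 1 (real m) ^ (\<Sum>k\<leftarrow>u. k - 1)" by (rule cluster_trivial[OF A u(1)])
 also have "... \<le> ?B / ((real m + 1) / 2)"
 proof (rule divide_left_mono)
  have "(real m + 1) / 2 \<le> max 1 (real m) ^ 1" by (simp add: max_def)
  then show "(real m + 1) / 2 \<le> max 1 (real m) ^ (\<Sum>k\<leftarrow>u. k - 1)" using p by linarith
 qed (use B in auto)
 finally show ?thesis by (simp add: mult_ac)
qed

lemma FS_bound:
 assumes A: "1 \<le> A" and "w \<in> mes_indices" "0 < \<alpha>"
 shows "\<exists>C\<ge>0. \<forall>e. \<forall>t\<in>KA A. \<forall>M. norm (FS e t M w) \<le> C * (real M + 1) powr \<alpha>"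
 using assms(2,3)
proof (induction "length w" arbitrary: w \<alpha> rule: less_induct)
 case less
 show ?case
 proof (cases "w = []")
  case True
  then show ?thesis by (intro exI[of _ 1]) (auto simp: ge_one_powr_ge_zero less.prems less_imp_le)
 next
  case False
  have "\<exists>C\<ge>0. \<forall>e. \<forall>t\<in>KA A. \<forall>M. norm (FS e t M (drop i w)) \<le> C * (real M + 1) powr (\<alpha> / 2)" if "i \<in> {1..length w}" for i
   using less.hyps[of "drop i w" "\<alpha> / 2"] that less.prems mes_indices_drop by auto
  then obtain C where C: "!!i. i \<in> {1..length w} ==> 0 \<le> C i"
   "!!i e t M. i \<in> {1..length w} ==> t \<in> KA A ==> norm (FS e t M (drop i w)) \<le> C i * (real M + 1) powr (\<alpha> / 2)"
   by metis
  obtain Z where Z: "0 \<le> Z" "!!M. (\<Sum>m<M. (real m + 1) powr (- (1 + \<alpha> / 2))) \<le> Z"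
   using sum_powr_bound[of "1 + \<alpha> / 2"] less.prems by auto
  define B where "B i = 2 * (5 * (2 * KK A) ^ sum_list (take i w)) ^ length (take i w)" for i
  have B0: "0 \<le> B i" for i using KK_ge1[of A] by (simp add: B_def)
  define K where "K = (\<Sum>i=1..length w. B i * C i)"
  have K0: "0 \<le> K" unfolding K_def by (intro sum_nonneg mult_nonneg_nonneg B0 C)
  have "norm (FS e t M w) \<le> (K * Z) * (real M + 1) powr \<alpha>" if t: "t \<in> KA A" for e t M
  proof -
   have pos: "0 < Im t" using KA_pos A t by blast
   have "norm (FS e t M w) \<le> (\<Sum>m<M. K * ((real M + 1) powr \<alpha> * (real m + 1) powr (- (1 + \<alpha> / 2))))"
    unfolding FS_sum[OF pos less.prems(1) False]
   proof (rule sum_norm_le)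
    fix m assume m: "m \<in> {..<M}"
    have "norm (\<Sum>i=1..length w. cl e t m (take i w) * FS e t m (drop i w)) \<le> (\<Sum>i=1..length w. (B i * C i) * ((real m + 1) powr (\<alpha> / 2) / (real m + 1)))"
    proof (rule sum_norm_le)
     fix i assume i: "i \<in> {1..length w}"
     have "norm (cl e t m (take i w) * FS e t m (drop i w)) \<le> (B i / (real m + 1)) * (C i * (real m + 1) powr (\<alpha> / 2))"
      unfolding norm_mult B_def
      by (intro mult_mono cl_bound A t mes_indices_take less.prems C(2) i) (use i False KK_ge1[of A] in auto)
     then show "norm (cl e t m (take i w) * FS e t m (drop i w)) \<le> (B i * C i) * ((real m + 1) powr (\<alpha> / 2) / (real m + 1))" by simp
    qed
    also have "... = K * ((real m + 1) powr (\<alpha> / 2) / (real m + 1))" by (simp only: K_def sum_distrib_right)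
    also have "(real m + 1) powr (\<alpha> / 2) / (real m + 1) = (real m + 1) powr \<alpha> * (real m + 1) powr (- (1 + \<alpha> / 2))"
    proof -
     have "(real m + 1) powr (\<alpha> / 2) / (real m + 1) = (real m + 1) powr (\<alpha> / 2) / (real m + 1) powr 1" by simp
     also have "... = (real m + 1) powr (\<alpha> / 2 - 1)" by (simp only: powr_diff)
     also have "... = (real m + 1) powr (\<alpha> + (- (1 + \<alpha> / 2)))" by (simp add: field_simps)
     also have "... = (real m + 1) powr \<alpha> * (real m + 1) powr (- (1 + \<alpha> / 2))" by (rule powr_add)
     finally show ?thesis .
    qed
    also have "K * ((real m + 1) powr \<alpha> * (real m + 1) powr (- (1 + \<alpha> / 2))) \<le> K * ((real M + 1) powr \<alpha> * (real m + 1) powr (- (1 + \<alpha> / 2)))"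
     using m K0 less.prems by (intro mult_left_mono mult_right_mono powr_mono2) auto
    finally show "norm (\<Sum>i=1..length w. cl e t m (take i w) * FS e t m (drop i w)) \<le> K * ((real M + 1) powr \<alpha> * (real m + 1) powr (- (1 + \<alpha> / 2)))" .
   qed
   also have "... = K * ((real M + 1) powr \<alpha> * (\<Sum>m<M. (real m + 1) powr (- (1 + \<alpha> / 2))))" by (simp only: sum_distrib_left)
   also have "... \<le> K * ((real M + 1) powr \<alpha> * Z)" using K0 Z by (intro mult_left_mono) auto
   finally show ?thesis by (simp add: mult_ac)
  qed
  then show ?thesis using K0 Z(1) by (intro exI[of _ "K * Z"]) auto
 qed
qed

lemma diff_sum:
 assumes "0 < Im t" "w \<in> mes_indices" "w \<noteq> []"
 shows "FS e t M w - plim {0..<int M} w t = (\<Sum>m<M. \<Sum>i=1..length w.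
  (cl e t m (take i w) - plim {int m} (take i w) t) * FS e t m (drop i w)
  + plim {int m} (take i w) t * (FS e t m (drop i w) - plim {0..<int m} (drop i w) t))"
 unfolding FS_sum[OF assms] plim_sum[OF assms] sum_subtractf[symmetric]
 by (intro sum.cong refl) (simp add: algebra_simps)

lemma FS_diff:
 assumes A: "1 \<le> A" and "w \<in> mes_indices"
 shows "\<exists>C\<ge>0. \<forall>e\<ge>1. \<forall>t\<in>KA A. \<forall>M. norm (FS e t M w - plim {0..<int M} w t) \<le> C * Dd e powr (- 7 / 4) * (real M + 1) powr (11 / 10)"
 using assms(2)
proof (induction "length w" arbitrary: w rule: less_induct)
 case less
 show ?case
 proof (cases "w = []")
  case False
  let ?I = "{1..length w}"
  have "\<exists>C\<ge>0. \<forall>e\<ge>1. \<forall>t\<in>KA A. \<forall>M. norm (FS e t M (drop i w) - plim {0..<int M} (drop i w) t) \<le> C * Dd e powr (- 7 / 4) * (real M + 1) powr (11 / 10)" if "i \<in> ?I" for i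
   using less.hyps[of "drop i w"] that less.prems mes_indices_drop by auto
  then obtain C where C: "!!i. i \<in> ?I ==> 0 \<le> C i"
   "!!i e t M. i \<in> ?I ==> 1 \<le> e ==> t \<in> KA A ==> norm (FS e t M (drop i w) - plim {0..<int M} (drop i w) t) \<le> C i * Dd e powr (- 7 / 4) * (real M + 1) powr (11 / 10)"
   by metis
  have "\<exists>C\<ge>0. \<forall>e\<ge>1. \<forall>t\<in>KA A. \<forall>m. norm (cl e t m (take i w) - plim {int m} (take i w) t) \<le> C * Dd e powr (- 7 / 4)" for i
   by (rule cluster_diff[OF A mes_indices_take[OF less.prems]])
  then obtain E where E: "!!i. 0 \<le> E i"
   "!!i e t m. 1 \<le> e ==> t \<in> KA A ==> norm (cl e t m (take i w) - plim {int m} (take i w) t) \<le> E i * Dd e powr (- 7 / 4)"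
   by metis
  have "\<exists>C\<ge>0. \<forall>e. \<forall>t\<in>KA A. \<forall>M. norm (FS e t M (drop i w)) \<le> C * (real M + 1) powr (1 / 10)" for i
   by (rule FS_bound[OF A mes_indices_drop[OF less.prems]]) simp
  then obtain H where H: "!!i. 0 \<le> H i" "!!i e t M. t \<in> KA A ==> norm (FS e t M (drop i w)) \<le> H i * (real M + 1) powr (1 / 10)"
   by metis
  define K where "K = (\<Sum>i\<in>?I. E i * H i + LB A (take i w) * C i)"
  have K0: "0 \<le> K" unfolding K_def by (intro sum_nonneg add_nonneg_nonneg mult_nonneg_nonneg E H C LB_nonneg)
  have "norm (FS e t M w - plim {0..<int M} w t) \<le> K * Dd e powr (- 7 / 4) * (real M + 1) powr (11 / 10)" if e: "1 \<le> e" and t: "t \<in> KA A" for e t M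
  proof -
   let ?P = "Dd e powr (- 7 / 4)"
   have pos: "0 < Im t" using KA_pos A t by blast
   have "norm (FS e t M w - plim {0..<int M} w t) \<le> (\<Sum>m<M. K * ?P * (real M + 1) powr (1 / 10))"
    unfolding diff_sum[OF pos less.prems False]
   proof (rule sum_norm_le)
    fix m assume m: "m \<in> {..<M}"
    have x: "1 \<le> real m + 1" by simp
    have "norm (\<Sum>i\<in>?I. (cl e t m (take i w) - plim {int m} (take i w) t) * FS e t m (drop i w)
     + plim {int m} (take i w) t * (FS e t m (drop i w) - plim {0..<int m} (drop i w) t))
     \<le> (\<Sum>i\<in>?I. (E i * H i + LB A (take i w) * C i) * (?P * (real m + 1) powr (1 / 10)))"
    proof (rule sum_norm_le)
     fix i assume i: "i \<in> ?I"
     have "norm ((cl e t m (take i w) - plim {int m} (take i w) t) * FS e t m (drop i w)) \<le> (E i * ?P) * (H i * (real m + 1) powr (1 / 10))"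
      unfolding norm_mult by (intro mult_mono E(2) H(2) e t) (use E(1) in auto)
     moreover have "norm (plim {int m} (take i w) t * (FS e t m (drop i w) - plim {0..<int m} (drop i w) t))
      \<le> LB A (take i w) * C i * (?P * (real m + 1) powr (1 / 10))"
     proof -
      have "norm (plim {int m} (take i w) t * (FS e t m (drop i w) - plim {0..<int m} (drop i w) t))
       \<le> (LB A (take i w) / (real m + 1)\<^sup>2) * (C i * ?P * (real m + 1) powr (11 / 10))"
       unfolding norm_mult
       by (intro mult_mono plim_line_bound A t C(2) i e mes_indices_take less.prems) (use i False LB_nonneg in auto)
      also have "... = LB A (take i w) * C i * (?P * ((real m + 1) powr (11 / 10) / (real m + 1)\<^sup>2))" by simp
      also have "... \<le> LB A (take i w) * C i * (?P * (real m + 1) powr (1 / 10))"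
      proof (intro mult_left_mono)
       have "(real m + 1) powr (11 / 10) / (real m + 1)\<^sup>2 = (real m + 1) powr (11 / 10) / (real m + 1) powr 2"
        by (simp add: powr_realpow)
       also have "... = (real m + 1) powr (11 / 10 - 2)" by (simp only: powr_diff)
       also have "... \<le> (real m + 1) powr (1 / 10)" using x by (intro powr_mono) auto
       finally show "(real m + 1) powr (11 / 10) / (real m + 1)\<^sup>2 \<le> (real m + 1) powr (1 / 10)" .
      qed (use LB_nonneg C(1)[OF i] in auto)
      finally show ?thesis .
     qed
     ultimately show "norm ((cl e t m (take i w) - plim {int m} (take i w) t) * FS e t m (drop i w)
      + plim {int m} (take i w) t * (FS e t m (drop i w) - plim {0..<int m} (drop i w) t))
      \<le> (E i * H i + LB A (take i w) * C i) * (?P * (real m + 1) powr (1 / 10))"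
      using norm_triangle_mono by (fastforce simp: algebra_simps)
    qed
    also have "... = K * ?P * (real m + 1) powr (1 / 10)" by (simp only: K_def sum_distrib_right[symmetric] mult.assoc)
    also have "... \<le> K * ?P * (real M + 1) powr (1 / 10)"
     using m K0 by (intro mult_left_mono powr_mono2) auto
    finally show "norm (\<Sum>i\<in>?I. (cl e t m (take i w) - plim {int m} (take i w) t) * FS e t m (drop i w)
     + plim {int m} (take i w) t * (FS e t m (drop i w) - plim {0..<int m} (drop i w) t)) \<le> K * ?P * (real M + 1) powr (1 / 10)" .
   qed
   also have "... = K * ?P * (M * (real M + 1) powr (1 / 10))" by simp
   also have "... \<le> K * ?P * ((real M + 1) powr 1 * (real M + 1) powr (1 / 10))"
    using K0 by (intro mult_left_mono mult_right_mono) auto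
   also have "(real M + 1) powr 1 * (real M + 1) powr (1 / 10) = (real M + 1) powr (11 / 10)"
    by (subst powr_add[symmetric]) simp
   finally show ?thesis .
  qed
  then show ?thesis using K0 by blast
 qed (auto intro!: exI[of _ 0])
qed

lemma plim_bounded:
 assumes "1 \<le> A" "w \<in> mes_indices"
 shows "\<exists>C\<ge>0. \<forall>t\<in>KA A. \<forall>M. norm (plim {0..<int M} w t) \<le> C"
proof -
 obtain C where "0 \<le> C" "\<forall>t\<in>KA A. \<forall>M. norm (plim {0..<int (Suc M)} w t - plim {0..<int M} w t) \<le> C / (real M + 1)\<^sup>2 \<and>
   norm (plim {0..<int M} w t) \<le> 1 + 2 * C"
  using plim_increments[OF assms] by blast
 then show ?thesis by (intro exI[of _ "1 + 2 * C"]) auto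
qed

lemma FS_diff_adm:
 assumes A: "1 \<le> A" and w: "w \<in> mes_indices" "w \<noteq> []" "3 \<le> hd w"
 shows "\<exists>C\<ge>0. \<forall>e\<ge>1. \<forall>t\<in>KA A. \<forall>M. norm (FS e t M w - plim {0..<int M} w t) \<le> C * Dd e powr (- 21 / 20)"
proof -
 let ?I = "{1..length w}"
 have "\<exists>C\<ge>0. \<forall>e\<ge>1. \<forall>t\<in>KA A. \<forall>m. norm (cl e t m (take i w) - plim {int m} (take i w) t) \<le> C * Dd e powr (- 21 / 20) * (real m + 1) powr (- 6 / 5)" if "i \<in> ?I" for i
  by (rule cluster_diff_adm[OF A mes_indices_take[OF w(1)]]) (use that w(2,3) in auto)
 then obtain E where E: "!!i. i \<in> ?I ==> 0 \<le> E i"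
  "!!i e t m. i \<in> ?I ==> 1 \<le> e ==> t \<in> KA A ==> norm (cl e t m (take i w) - plim {int m} (take i w) t) \<le> E i * Dd e powr (- 21 / 20) * (real m + 1) powr (- 6 / 5)"
  by metis
 have "\<exists>C\<ge>0. \<forall>e. \<forall>t\<in>KA A. \<forall>M. norm (FS e t M (drop i w)) \<le> C * (real M + 1) powr (1 / 10)" for i
  by (rule FS_bound[OF A mes_indices_drop[OF w(1)]]) simp
 then obtain H where H: "!!i. 0 \<le> H i" "!!i e t M. t \<in> KA A ==> norm (FS e t M (drop i w)) \<le> H i * (real M + 1) powr (1 / 10)"
  by metis
 have "\<exists>C\<ge>0. \<forall>t\<in>KA A. \<forall>M. norm (plim {0..<int M} (drop i w) t) \<le> C" for i
  by (rule plim_bounded[OF A mes_indices_drop[OF w(1)]])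
 then obtain P where P: "!!i. 0 \<le> P i" "!!i t M. t \<in> KA A ==> norm (plim {0..<int M} (drop i w) t) \<le> P i"
  by metis
 have "\<exists>C\<ge>0. \<forall>e\<ge>1. \<forall>t\<in>KA A. \<forall>M. norm (FS e t M (drop i w) - plim {0..<int M} (drop i w) t) \<le> C * Dd e powr (- 7 / 4) * (real M + 1) powr (11 / 10)" for i
  by (rule FS_diff[OF A mes_indices_drop[OF w(1)]])
 then obtain C where C: "!!i. 0 \<le> C i"
  "!!i e t M. 1 \<le> e ==> t \<in> KA A ==> norm (FS e t M (drop i w) - plim {0..<int M} (drop i w) t) \<le> C i * Dd e powr (- 7 / 4) * (real M + 1) powr (11 / 10)"
  by metis
 define Q where "Q i = C i powr (3 / 5) * (H i + P i) powr (2 / 5)" for i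
 have Q0: "0 \<le> Q i" for i by (simp add: Q_def)
 have Q: "norm (FS e t m (drop i w) - plim {0..<int m} (drop i w) t) \<le> Q i * Dd e powr (- 21 / 20) * (real m + 1) powr (7 / 10)"
  if e: "1 \<le> e" and t: "t \<in> KA A" for e t m i
 proof -
  have "norm (FS e t m (drop i w) - plim {0..<int m} (drop i w) t) \<le> H i * (real m + 1) powr (1 / 10) + P i * 1"
   using norm_triangle_ineq4[of "FS e t m (drop i w)" "plim {0..<int m} (drop i w) t"] H(2)[OF t, of e m i] P(2)[OF t, of m i] by simp
  also have "... \<le> H i * (real m + 1) powr (1 / 10) + P i * (real m + 1) powr (1 / 10)"
   using P(1) by (intro add_left_mono mult_left_mono) (auto simp: ge_one_powr_ge_zero)
  finally have 1: "norm (FS e t m (drop i w) - plim {0..<int m} (drop i w) t) \<le> (H i + P i) * (real m + 1) powr (1 / 10)"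
   by (simp add: distrib_right)
  have "norm (FS e t m (drop i w) - plim {0..<int m} (drop i w) t)
   \<le> (C i * Dd e powr (- 7 / 4) * (real m + 1) powr (11 / 10)) powr (3 / 5) * ((H i + P i) * (real m + 1) powr (1 / 10)) powr (1 - 3 / 5)"
   by (rule interpolate[OF _ C(2)[OF e t] 1]) auto
  also have "... = Q i * Dd e powr (- 21 / 20) * ((real m + 1) powr (33 / 50) * (real m + 1) powr (1 / 25))"
   using C(1)[of i] H(1)[of i] P(1)[of i] by (simp add: Q_def powr_mult powr_powr)
  also have "(real m + 1) powr (33 / 50) * (real m + 1) powr (1 / 25) = (real m + 1) powr (7 / 10)"
   by (subst powr_add[symmetric]) simp
  finally show ?thesis .
 qed
 obtain Z where Z: "0 \<le> Z" "!!M. (\<Sum>m<M. (real m + 1) powr (- (11 / 10))) \<le> Z"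
  using sum_powr_bound[of "11 / 10"] by auto
 define K where "K = (\<Sum>i\<in>?I. E i * H i + LB A (take i w) * Q i)"
 have K0: "0 \<le> K" unfolding K_def by (intro sum_nonneg add_nonneg_nonneg mult_nonneg_nonneg E H Q0 LB_nonneg)
 have "norm (FS e t M w - plim {0..<int M} w t) \<le> (K * Z) * Dd e powr (- 21 / 20)" if e: "1 \<le> e" and t: "t \<in> KA A" for e t M
 proof -
  let ?P = "Dd e powr (- 21 / 20)"
  have pos: "0 < Im t" using KA_pos A t by blast
  have "norm (FS e t M w - plim {0..<int M} w t) \<le> (\<Sum>m<M. K * ?P * (real m + 1) powr (- (11 / 10)))"
   unfolding diff_sum[OF pos w(1,2)]
  proof (rule sum_norm_le)
   fix m assume m: "m \<in> {..<M}"
   let ?x = "real m + 1"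
   have "norm (\<Sum>i\<in>?I. (cl e t m (take i w) - plim {int m} (take i w) t) * FS e t m (drop i w)
    + plim {int m} (take i w) t * (FS e t m (drop i w) - plim {0..<int m} (drop i w) t))
    \<le> (\<Sum>i\<in>?I. (E i * H i + LB A (take i w) * Q i) * (?P * ?x powr (- (11 / 10))))"
   proof (rule sum_norm_le)
    fix i assume i: "i \<in> ?I"
    have "norm ((cl e t m (take i w) - plim {int m} (take i w) t) * FS e t m (drop i w)) \<le> (E i * ?P * ?x powr (- 6 / 5)) * (H i * ?x powr (1 / 10))"
     unfolding norm_mult by (intro mult_mono E(2) H(2) e t i) (use E(1)[OF i] in auto)
    also have "... = E i * H i * (?P * (?x powr (- 6 / 5) * ?x powr (1 / 10)))" by simp
    also have "?x powr (- 6 / 5) * ?x powr (1 / 10) = ?x powr (- (11 / 10))" by (subst powr_add[symmetric]) simp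
    finally have 1: "norm ((cl e t m (take i w) - plim {int m} (take i w) t) * FS e t m (drop i w)) \<le> E i * H i * (?P * ?x powr (- (11 / 10)))" .
    have "norm (plim {int m} (take i w) t * (FS e t m (drop i w) - plim {0..<int m} (drop i w) t))
     \<le> (LB A (take i w) / ?x\<^sup>2) * (Q i * ?P * ?x powr (7 / 10))"
     unfolding norm_mult
     by (intro mult_mono plim_line_bound A t Q e mes_indices_take w) (use i w LB_nonneg in auto)
    also have "... = LB A (take i w) * Q i * (?P * (?x powr (7 / 10) / ?x\<^sup>2))" by simp
    also have "... \<le> LB A (take i w) * Q i * (?P * ?x powr (- (11 / 10)))"
    proof (intro mult_left_mono)
     have "?x powr (7 / 10) / ?x\<^sup>2 = ?x powr (7 / 10) / ?x powr 2" by (simp add: powr_realpow)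
     also have "... = ?x powr (7 / 10 - 2)" by (simp only: powr_diff)
     also have "... \<le> ?x powr (- (11 / 10))" by (intro powr_mono) auto
     finally show "?x powr (7 / 10) / ?x\<^sup>2 \<le> ?x powr (- (11 / 10))" .
    qed (use LB_nonneg Q0 in auto)
    finally have 2: "norm (plim {int m} (take i w) t * (FS e t m (drop i w) - plim {0..<int m} (drop i w) t)) \<le> LB A (take i w) * Q i * (?P * ?x powr (- (11 / 10)))" .
    show "norm ((cl e t m (take i w) - plim {int m} (take i w) t) * FS e t m (drop i w)
     + plim {int m} (take i w) t * (FS e t m (drop i w) - plim {0..<int m} (drop i w) t))
     \<le> (E i * H i + LB A (take i w) * Q i) * (?P * ?x powr (- (11 / 10)))"
     unfolding distrib_right by (rule norm_triangle_mono[OF 1 2])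
   qed
   also have "... = K * ?P * ?x powr (- (11 / 10))" by (simp only: K_def sum_distrib_right[symmetric] mult.assoc)
   finally show "norm (\<Sum>i\<in>?I. (cl e t m (take i w) - plim {int m} (take i w) t) * FS e t m (drop i w)
    + plim {int m} (take i w) t * (FS e t m (drop i w) - plim {0..<int m} (drop i w) t)) \<le> K * ?P * ?x powr (- (11 / 10))" .
  qed
  also have "... = K * ?P * (\<Sum>m<M. (real m + 1) powr (- (11 / 10)))" by (simp only: sum_distrib_left)
  also have "... \<le> K * ?P * Z" using K0 Z by (intro mult_left_mono) auto
  finally show ?thesis by (simp add: mult_ac)
 qed
 then show ?thesis using K0 Z(1) by (intro exI[of _ "K * Z"]) auto
qed

lemma FS_tendsto:
 assumes t: "0 < Im t" and w: "w \<in> mes_indices"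
 shows "(%M. FS e t M w) \<longlonglongrightarrow> GG w (1 / xx e t) / xx e t ^ sum_list w"
proof -
 have "filterlim (%M. M * (2 * e + 1) - e) at_top sequentially"
 proof (rule filterlim_at_top_mono[OF filterlim_ident])
  have "M \<le> M * (2 * e + 1) - e" if "1 \<le> M" for M
  proof -
   have "1 * e \<le> M * (2 * e)" using that by (intro mult_mono) auto
   moreover have "M * (2 * e + 1) = M + M * (2 * e)" by (simp add: algebra_simps)
   ultimately show ?thesis by linarith
  qed
  then show "\<forall>\<^sub>F M in sequentially. M \<le> M * (2 * e + 1) - e" using eventually_sequentially by blast
 qed
 from filterlim_compose[OF plim_GG_tendsto[OF xx_nz(2)[OF t] w] this]
 have "(%M. plim (II e M) w (1 / xx e t)) \<longlonglongrightarrow> GG w (1 / xx e t)" by (simp add: II_def)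
 then show ?thesis unfolding FS_def by (intro tendsto_divide tendsto_const) (use xx_nz(1)[OF t] in auto)
qed

theorem slash_adm:
 assumes A: "1 \<le> A" and w: "w \<in> mes_indices" "w \<noteq> []" "3 \<le> hd w"
 shows "\<exists>C\<ge>0. \<forall>e\<ge>1. \<forall>t\<in>KA A. norm (GG w (1 / xx e t) / xx e t ^ sum_list w - GG w t) \<le> C * Dd e powr (- 21 / 20)"
proof -
 obtain C where C: "0 \<le> C" "!!e t M. 1 \<le> e ==> t \<in> KA A ==> norm (FS e t M w - plim {0..<int M} w t) \<le> C * Dd e powr (- 21 / 20)"
  using FS_diff_adm[OF assms] by blast
 have "norm (GG w (1 / xx e t) / xx e t ^ sum_list w - GG w t) \<le> C * Dd e powr (- 21 / 20)" if e: "1 \<le> e" and t: "t \<in> KA A" for e t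
 proof -
  have pos: "0 < Im t" using KA_pos A t by blast
  have "(%M. norm (FS e t M w - plim {0..<int M} w t)) \<longlonglongrightarrow> norm (GG w (1 / xx e t) / xx e t ^ sum_list w - GG w t)"
   by (intro tendsto_norm tendsto_diff FS_tendsto plim_GG_tendsto pos w)
  then show ?thesis by (rule tendsto_upperbound) (use C(2)[OF e t] in auto)
 qed
 with C(1) show ?thesis by blast
qed

section \<open>Periodicity and the inversion formula in weight 2\<close>

lemma plim_line_shift:
 assumes t: "0 < Im t" and u: "u \<in> mes_indices"
 shows "plim {int m} u (t + 1) = plim {int m} u t"
proof -
 obtain A where A: "1 \<le> A" "t \<in> KA A" using ex_KA[OF t] by blast
 let ?F = "%N. {n. \<bar>n - int m\<bar> < int N \<and> (m = 0 \<longrightarrow> 0 < n)}"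
 let ?c = "%N. csum (%a b. b < a) (%n. lval t (int m, n)) (?F N) u"
 have fin: "finite (?F N)" for N
  by (rule finite_subset[of _ "{int m - int N..int m + int N}"]) auto
 have ps: "psum {int m} u N (t + 1) = ?c N" for N
  unfolding psum_def
 proof (rule csum_transport[symmetric])
  show "bij_betw (%p. snd p + int m) (pset {int m} N) (?F N)"
   by (rule bij_betw_byWitness[of _ "%n. (int m, n - int m)"]) (auto simp: pset_def)
 qed (auto simp: pset_def lval_def algebra_simps)
 let ?K = "length u * (6 * KK A ^ sum_list u) ^ length u * (KK A ^ sum_list u * 4)"
 have b: "norm (psum {int m} u (N + m) (t + 1) - psum {int m} u N t) \<le> ?K / N" if "1 \<le> N" for N
 proof -
  have "norm (?c (N + m) - psum {int m} u N t) \<le> length u * (6 * KK A ^ sum_list u) ^ length u * (KK A ^ sum_list u * (4 / N))"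
   by (rule line_exhaust[OF A fin]) (use that u in auto)
  then show ?thesis unfolding ps by simp
 qed
 have 1: "(%N. psum {int m} u (N + m) (t + 1)) \<longlonglongrightarrow> plim {int m} u (t + 1)"
  by (rule LIMSEQ_ignore_initial_segment[OF psum_plim']) (use t u in auto)
 have "(%N. psum {int m} u (N + m) (t + 1) - psum {int m} u N t) \<longlonglongrightarrow> plim {int m} u (t + 1) - plim {int m} u t"
  by (intro tendsto_diff 1 psum_plim' t u) auto
 moreover have "(%N. psum {int m} u (N + m) (t + 1) - psum {int m} u N t) \<longlonglongrightarrow> 0"
 proof (rule Lim_null_comparison)
  show "\<forall>\<^sub>F N in sequentially. norm (psum {int m} u (N + m) (t + 1) - psum {int m} u N t) \<le> ?K / N"
   using b eventually_sequentially by blast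
  show "(%N. ?K / real N) \<longlonglongrightarrow> 0" by (rule tendsto_divide_0[OF tendsto_const]) (rule filterlim_real_at_infinity_sequentially)
 qed
 ultimately show ?thesis using LIMSEQ_unique by fastforce
qed

lemma GG_shift:
 assumes t: "0 < Im t" and w: "w \<in> mes_indices"
 shows "GG w (t + of_nat n) = GG w t"
proof -
 have pl: "plim {0..<int M} w (t + 1) = plim {0..<int M} w t" if "0 < Im t" "w \<in> mes_indices" for M t w
  using that
 proof (induction M arbitrary: w)
  case 0
  then show ?case by (cases "w = []") (auto simp: plim_empty)
 next
  case (Suc M)
  have t1: "0 < Im (t + 1)" using Suc.prems by simp
  show ?case unfolding plim_Suc[OF t1 Suc.prems(2)] plim_Suc[OF Suc.prems]
   by (intro sum.cong refl) (simp add: plim_line_shift Suc.IH Suc.prems mes_indices_take mes_indices_drop)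
 qed
 have "GG w (t + 1) = GG w t" if "0 < Im t" for t
  unfolding GG_def pl[OF that w] ..
 from this[of "t + of_nat k" for k] show ?thesis using t by (induction n) (auto simp: add_ac)
qed

definition bx :: "nat => nat => complex => complex" where
 "bx M N y = (\<Sum>p\<in>lat_box M N - {(0, 0)}. 1 / (lval y p)\<^sup>2)"

lemma bx_eq: "bx M N y = 2 * psum {0..<int M} [2] N y"
proof -
 have u: "lat_box M N - {(0, 0)} = posbox M N \<union> uminus ` posbox M N"
 proof (intro equalityI subsetI)
  fix p assume p: "p \<in> lat_box M N - {(0, 0)}"
  show "p \<in> posbox M N \<union> uminus ` posbox M N"
  proof (cases "p \<in> posbox M N")
   case False
   then have "- p \<in> posbox M N" using p by (cases p) (auto simp: posbox_def lat_box_def)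
   then show ?thesis by (intro UnI2 image_eqI[of _ _ "- p"]) auto
  qed simp
 qed (auto simp: posbox_def lat_box_def)
 have d: "posbox M N \<inter> uminus ` posbox M N = {}" by (auto simp: posbox_def)
 have "bx M N y = (\<Sum>p\<in>posbox M N. 1 / (lval y p)\<^sup>2) + (\<Sum>p\<in>uminus ` posbox M N. 1 / (lval y p)\<^sup>2)"
  unfolding bx_def u by (rule sum.union_disjoint) (use d in auto)
 also have "(\<Sum>p\<in>uminus ` posbox M N. 1 / (lval y p)\<^sup>2) = (\<Sum>p\<in>posbox M N. 1 / (lval y p)\<^sup>2)"
  by (subst sum.reindex) (auto simp: inj_on_def lval_def power2_eq_square algebra_simps)
 finally show ?thesis by (simp add: psum_def posbox_eq_pset)
qed

lemma bx_swap:
 assumes "0 < Im y" shows "bx N M y = bx M N (- 1 / y) / y\<^sup>2"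
proof -
 have y: "y \<noteq> 0" using assms by auto
 have "bx N M y = (\<Sum>p\<in>lat_box M N - {(0, 0)}. 1 / (lval y (snd p, - fst p))\<^sup>2)"
  unfolding bx_def
  by (rule sum.reindex_bij_witness[of _ "%p. (snd p, - fst p)" "%p. (- snd p, fst p)"]) (auto simp: lat_box_def)
 also have "... = (\<Sum>p\<in>lat_box M N - {(0, 0)}. 1 / (lval (- 1 / y) p)\<^sup>2 / y\<^sup>2)"
 proof (rule sum.cong[OF refl])
  fix p
  have "lval y (snd p, - fst p) = y * lval (- 1 / y) p" using y by (simp add: lval_def field_simps)
  then show "1 / (lval y (snd p, - fst p))\<^sup>2 = 1 / (lval (- 1 / y) p)\<^sup>2 / y\<^sup>2" by (simp add: power_mult_distrib)
 qed
 finally show ?thesis by (simp add: bx_def sum_divide_distrib)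
qed

definition p0 :: "nat => nat => complex => complex" where
 "p0 M N y = (\<Sum>p\<in>{m. \<bar>m\<bar> < int M \<and> m \<noteq> 0} \<times> {n. \<bar>n\<bar> < int N}. 1 / ((lval y p)\<^sup>2 * (lval y p + 1)))
  + (\<Sum>n\<in>{n. \<bar>n\<bar> < int N \<and> n \<noteq> 0}. 1 / (of_int n)\<^sup>2)"

definition q0 :: "nat => nat => complex => complex" where
 "q0 M N y = (\<Sum>m\<in>{m. \<bar>m\<bar> < int M \<and> m \<noteq> 0}. 1 / lval y (m, 1 - int N) - 1 / lval y (m, int N))"

lemma lval_plus_1: "lval y (m, n) + 1 = lval y (m, n + 1)"
 by (simp add: lval_def)

lemma bx_split:
 assumes y: "0 < Im y" and MN: "1 \<le> M" "1 \<le> N"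
 shows "bx M N y = p0 M N y + q0 M N y"
proof -
 let ?M = "{m. \<bar>m\<bar> < int M \<and> m \<noteq> 0}" and ?N = "{n. \<bar>n\<bar> < int N}" and ?Nz = "{n. \<bar>n\<bar> < int N \<and> n \<noteq> 0}"
 have fN: "finite ?N" using finite_pset_line[of N "%_. True"] by simp
 have e: "lat_box M N - {(0, 0)} = ?M \<times> ?N \<union> {0} \<times> ?Nz"
 proof (rule set_eqI)
  fix p
  show "p \<in> lat_box M N - {(0, 0)} \<longleftrightarrow> p \<in> ?M \<times> ?N \<union> {0} \<times> ?Nz"
   using MN by (cases p) (auto simp: lat_box_def)
 qed
 have "bx M N y = (\<Sum>p\<in>?M \<times> ?N. 1 / (lval y p)\<^sup>2) + (\<Sum>p\<in>{0} \<times> ?Nz. 1 / (lval y p)\<^sup>2)"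
  unfolding bx_def e
 proof (rule sum.union_disjoint)
  show "finite (?M \<times> ?N)" by (intro finite_cartesian_product fN) simp
  show "finite ({0} \<times> ?Nz)" by (intro finite_cartesian_product) simp_all
 qed auto
 also have "(\<Sum>p\<in>{0} \<times> ?Nz. 1 / (lval y p)\<^sup>2) = (\<Sum>n\<in>?Nz. 1 / (of_int n)\<^sup>2)"
  by (rule sum.reindex_bij_witness[of _ "Pair 0" snd]) (auto simp: lval_def)
 also have "(\<Sum>p\<in>?M \<times> ?N. 1 / (lval y p)\<^sup>2)
  = (\<Sum>p\<in>?M \<times> ?N. 1 / ((lval y p)\<^sup>2 * (lval y p + 1)) + (1 / lval y p - 1 / (lval y p + 1)))"
 proof (rule sum.cong[OF refl])
  fix p assume "p \<in> ?M \<times> ?N"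
  then obtain m n where p: "p = (m, n)" "m \<noteq> 0" by (cases p) auto
  have nz: "lval y p \<noteq> 0" "lval y p + 1 \<noteq> 0" unfolding p(1) lval_plus_1 using lval_nz[OF y] p(2) by auto
  have "1 / z\<^sup>2 = 1 / (z\<^sup>2 * (z + 1)) + (1 / z - 1 / (z + 1))" if "z \<noteq> 0" "z + 1 \<noteq> 0" for z :: complex
   using that by (simp add: divide_simps) (simp add: power2_eq_square algebra_simps)
  from this[OF nz] show "1 / (lval y p)\<^sup>2 = 1 / ((lval y p)\<^sup>2 * (lval y p + 1)) + (1 / lval y p - 1 / (lval y p + 1))" .
 qed
 also have "... = (\<Sum>p\<in>?M \<times> ?N. 1 / ((lval y p)\<^sup>2 * (lval y p + 1))) + (\<Sum>p\<in>?M \<times> ?N. 1 / lval y p - 1 / (lval y p + 1))"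
  by (rule sum.distrib)
 also have "(\<Sum>p\<in>?M \<times> ?N. 1 / lval y p - 1 / (lval y p + 1)) = (\<Sum>m\<in>?M. \<Sum>n\<in>?N. 1 / lval y (m, n) - 1 / lval y (m, n + 1))"
  unfolding sum.cartesian_product lval_plus_1[symmetric] by (rule sum.cong) auto
 also have "... = q0 M N y"
 proof -
  obtain N' where N': "N = Suc N'" using MN by (cases N) auto
  have "(\<Sum>n\<in>?N. 1 / lval y (m, n) - 1 / lval y (m, n + 1)) = 1 / lval y (m, 1 - int N) - 1 / lval y (m, int N)" for m
   unfolding N' sum_telescope_int[of "%n. 1 / lval y (m, n)" N'] by simp
  then show ?thesis by (simp add: q0_def)
 qed
 finally show ?thesis by (simp add: p0_def)
qed

lemma q0_tendsto_0:
 assumes "0 < Im y" shows "(%N. q0 M N y) \<longlonglongrightarrow> 0"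
proof -
 have a: "filterlim (%N. (of_nat N :: complex)) at_infinity sequentially" by (rule tendsto_of_nat)
 have 1: "(%N. 1 / lval y (m, int N)) \<longlonglongrightarrow> 0" for m
  unfolding lval_def fst_conv snd_conv of_int_of_nat_eq
  by (rule tendsto_divide_0[OF tendsto_const tendsto_add_filterlim_at_infinity[OF tendsto_const a]])
 have "(%N. - 1 / ((- of_int m * y - 1) + of_nat N)) \<longlonglongrightarrow> 0" for m
  by (rule tendsto_divide_0[OF tendsto_const tendsto_add_filterlim_at_infinity[OF tendsto_const a]])
 moreover have "- 1 / ((- of_int m * y - 1) + of_nat N) = 1 / lval y (m, 1 - int N)" for m N
 proof -
  have "lval y (m, 1 - int N) = - ((- of_int m * y - 1) + of_nat N)" by (simp add: lval_def)
  moreover have "- 1 / X = 1 / - X" for X :: complex by simp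
  ultimately show ?thesis by (simp only:)
 qed
 ultimately have 2: "(%N. 1 / lval y (m, 1 - int N)) \<longlonglongrightarrow> 0" for m by simp
 have "(%N. q0 M N y) \<longlonglongrightarrow> (\<Sum>m\<in>{m. \<bar>m\<bar> < int M \<and> m \<noteq> 0}. 0 - 0)"
  unfolding q0_def by (intro tendsto_sum tendsto_diff 1 2)
 then show ?thesis by simp
qed

lemma q0_lsum:
 assumes y: "0 < Im y" and N: "2 \<le> N" and M: "1 \<le> M"
 shows "q0 M N y = (lsum M (- 1 / y) (int (N - 1)) + lsum M (- 1 / y) (int N)) / y + (1 / of_nat (N - 1) + 1 / of_nat N)"
proof -
 let ?M = "{m. \<bar>m\<bar> < int M \<and> m \<noteq> 0}"
 have y0: "y \<noteq> 0" using y by auto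
 have fM: "finite {m. \<bar>m\<bar> < int M}" using finite_pset_line[of M "%_. True"] by simp
 have M0: "{m. \<bar>m\<bar> < int M} = insert 0 ?M" using M by auto
 have s: "(\<Sum>m\<in>?M. 1 / lval y (m, int j)) = - lsum M (- 1 / y) (int j) / y - 1 / of_nat j" for j
 proof -
  have "(\<Sum>m\<in>{m. \<bar>m\<bar> < int M}. 1 / lval y (m, int j)) = (\<Sum>m\<in>{m. \<bar>m\<bar> < int M}. 1 / lval y (- m, int j))"
   by (rule sum.reindex_bij_witness[of _ uminus uminus]) auto
  also have "... = (\<Sum>m\<in>{m. \<bar>m\<bar> < int M}. - (1 / lval (- 1 / y) (int j, m)) / y)"
  proof (rule sum.cong[OF refl])
   fix m
   have "lval y (- m, int j) = - (y * lval (- 1 / y) (int j, m))" using y0 by (simp add: lval_def field_simps)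
   then show "1 / lval y (- m, int j) = - (1 / lval (- 1 / y) (int j, m)) / y" by simp
  qed
  also have "... = - lsum M (- 1 / y) (int j) / y"
   by (simp add: lsum_def sum_negf sum_divide_distrib)
  finally have "(\<Sum>m\<in>{m. \<bar>m\<bar> < int M}. 1 / lval y (m, int j)) = - lsum M (- 1 / y) (int j) / y" .
  moreover have "(\<Sum>m\<in>{m. \<bar>m\<bar> < int M}. 1 / lval y (m, int j)) = 1 / of_nat j + (\<Sum>m\<in>?M. 1 / lval y (m, int j))"
   using fM unfolding M0 by (subst sum.insert) (auto simp: lval_def)
  ultimately show ?thesis by (simp add: algebra_simps)
 qed
 have "(\<Sum>m\<in>?M. 1 / lval y (m, 1 - int N)) = (\<Sum>m\<in>?M. - (1 / lval y (m, int (N - 1))))"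
 proof (rule sum.reindex_bij_witness[of _ uminus uminus])
  fix m
  have "lval y (m, 1 - int N) = - lval y (- m, int (N - 1))" using N by (simp add: lval_def of_nat_diff)
  then show "- (1 / lval y (- m, int (N - 1))) = 1 / lval y (m, 1 - int N)" by simp
 qed auto
 then have "q0 M N y = - (\<Sum>m\<in>?M. 1 / lval y (m, int (N - 1))) - (\<Sum>m\<in>?M. 1 / lval y (m, int N))"
  by (simp add: q0_def sum_subtractf sum_negf)
 then show ?thesis unfolding s by (simp add: add_divide_distrib)
qed

lemma p0_cauchy:
 assumes A: "1 \<le> A" "y \<in> KA A" and L: "1 \<le> L" "L \<le> M" "L \<le> N"
 shows "norm (p0 M N y - p0 L L y) \<le> (56 * KK A ^ 3 + 4) / L"
proof -
 have pos: "0 < Im y" using KA_pos A by blast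
 let ?a = "%p. 1 / ((lval y p)\<^sup>2 * (lval y p + 1))"
 let ?X = "%M. {m. \<bar>m\<bar> < int M \<and> m \<noteq> 0}" and ?Y = "%N. {n. \<bar>n\<bar> < int N}" and ?Z = "%N. {n. \<bar>n\<bar> < int N \<and> n \<noteq> 0}"
 have fY: "finite (?Y N)" for N using finite_pset_line[of N "%_. True"] by simp
 let ?D = "?X M \<times> ?Y N - ?X L \<times> ?Y L"
 have e: "p0 M N y - p0 L L y = (\<Sum>p\<in>?D. ?a p) + (\<Sum>n\<in>?Z N - ?Z L. 1 / (of_int n)\<^sup>2)"
 proof -
  have "(\<Sum>p\<in>?X M \<times> ?Y N. ?a p) = (\<Sum>p\<in>?D. ?a p) + (\<Sum>p\<in>?X L \<times> ?Y L. ?a p)"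
   by (rule sum.subset_diff) (use L fY in auto)
  moreover have "(\<Sum>n\<in>?Z N. 1 / (of_int n)\<^sup>2 :: complex) = (\<Sum>n\<in>?Z N - ?Z L. 1 / (of_int n)\<^sup>2) + (\<Sum>n\<in>?Z L. 1 / (of_int n)\<^sup>2)"
   by (rule sum.subset_diff) (use L in auto)
  ultimately show ?thesis unfolding p0_def by simp
 qed
 let ?b = "%m n. 1 / mx \<bar>m\<bar> n ^ 3"
 have a: "norm (?a (m, n)) \<le> 2 * KK A ^ 3 * ?b m n" if "m \<noteq> 0" for m n
 proof -
  let ?y = "mx \<bar>m\<bar> n"
  have y1: "1 \<le> ?y" by (rule mx_ge1)
  have m1: "1 \<le> \<bar>real_of_int m\<bar>" using that by linarith
  have mxe: "?y = max \<bar>real_of_int m\<bar> \<bar>real_of_int n\<bar>" using m1 by (simp add: mx_def max_def)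
  have 1: "?y \<le> KK A * norm (lval y (m, n))" unfolding mxe by (rule lval_lower[OF A])
  have "\<bar>real_of_int n\<bar> \<le> \<bar>real_of_int (n + 1)\<bar> + 1" by simp
  moreover have "a \<le> 2 * c \<or> a \<le> 2 * b" if "a \<le> b + 1" "1 \<le> c" for a b c :: real using that by linarith
  ultimately have "\<bar>real_of_int n\<bar> \<le> 2 * \<bar>real_of_int m\<bar> \<or> \<bar>real_of_int n\<bar> \<le> 2 * \<bar>real_of_int (n + 1)\<bar>" using m1 by blast
  then have "\<bar>real_of_int n\<bar> \<le> 2 * max \<bar>real_of_int m\<bar> \<bar>real_of_int (n + 1)\<bar>" by (auto simp: max_def)
  moreover have "a \<le> 2 * max a b" if "0 \<le> a" for a b :: real using that by (simp add: max_def)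
  ultimately have "?y \<le> 2 * max \<bar>real_of_int m\<bar> \<bar>real_of_int (n + 1)\<bar>" unfolding mxe by (intro max.boundedI) (blast intro: abs_ge_zero)+
  also have "... \<le> 2 * (KK A * norm (lval y (m, n + 1)))" by (intro mult_left_mono lval_lower A) auto
  finally have 2: "?y \<le> (2 * KK A) * norm (lval y (m, n + 1))" by simp
  have "norm (?a (m, n)) = norm (1 / lval y (m, n) ^ 2) * norm (1 / lval y (m, n + 1) ^ 1)"
   unfolding lval_plus_1 by (simp add: norm_divide norm_mult)
  also have "... \<le> (KK A ^ 2 / ?y ^ 2) * ((2 * KK A) ^ 1 / ?y ^ 1)"
   using KK_ge1[of A] by (intro mult_mono inv_power_le y1 1 2) auto
  also have "... = 2 * KK A ^ 3 * ?b m n" by (simp add: power2_eq_square power3_eq_cube)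
  finally show ?thesis .
 qed
 let ?D1 = "(?X M - ?X L) \<times> ?Y N" and ?D2 = "?X L \<times> (?Y N - ?Y L)"
 have "(\<Sum>p\<in>?D. norm (?a p)) \<le> (\<Sum>p\<in>?D1 \<union> ?D2. norm (?a p))"
  using fY L by (intro sum_mono2) auto
 also have "... \<le> (\<Sum>p\<in>?D1. norm (?a p)) + (\<Sum>p\<in>?D2. norm (?a p))"
  using fY by (subst sum.union_disjoint) auto
 also have "(\<Sum>p\<in>?D1. norm (?a p)) \<le> 2 * KK A ^ 3 * (20 / L)"
 proof -
  have "(\<Sum>p\<in>?D1. norm (?a p)) = (\<Sum>m\<in>?X M - ?X L. \<Sum>n\<in>?Y N. norm (?a (m, n)))"
   by (simp add: sum.cartesian_product)
  also have "... \<le> (\<Sum>m\<in>?X M - ?X L. 2 * KK A ^ 3 * (5 * (1 / (mx 0 m)\<^sup>2)))"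
  proof (rule sum_mono)
   fix m assume m: "m \<in> ?X M - ?X L"
   then have m1: "1 \<le> \<bar>real_of_int m\<bar>" by auto
   have "(\<Sum>n\<in>?Y N. norm (?a (m, n))) \<le> (\<Sum>n\<in>?Y N. 2 * KK A ^ 3 * ?b m n)" by (intro sum_mono a) (use m in auto)
   also have "... = 2 * KK A ^ 3 * (\<Sum>n\<in>?Y N. ?b m n)" by (simp only: sum_distrib_left)
   also have "... \<le> 2 * KK A ^ 3 * (5 / (max 1 (real_of_int \<bar>m\<bar>)) ^ (3 - 1))"
    using KK_ge1[of A] by (intro mult_left_mono sum_mx_pow fY) auto
   also have "5 / (max 1 (real_of_int \<bar>m\<bar>)) ^ (3 - 1) = 5 * (1 / (mx 0 m)\<^sup>2)"
    using m1 by (simp add: mx_def max_def)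
   finally show "(\<Sum>n\<in>?Y N. norm (?a (m, n))) \<le> 2 * KK A ^ 3 * (5 * (1 / (mx 0 m)\<^sup>2))" .
  qed
  also have "... = 2 * KK A ^ 3 * (5 * (\<Sum>m\<in>?X M - ?X L. 1 / (mx 0 m)\<^sup>2))" by (simp only: sum_distrib_left)
  also have "... \<le> 2 * KK A ^ 3 * (5 * (4 / L))"
   using KK_ge1[of A] L(1) by (intro mult_left_mono sum_tail) auto
  finally show ?thesis by simp
 qed
 also have "(\<Sum>p\<in>?D2. norm (?a p)) \<le> 2 * KK A ^ 3 * (8 / L)"
 proof -
  have "(\<Sum>p\<in>?D2. norm (?a p)) = (\<Sum>m\<in>?X L. \<Sum>n\<in>?Y N - ?Y L. norm (?a (m, n)))"
   by (simp add: sum.cartesian_product)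
  also have "... \<le> (\<Sum>m\<in>?X L. 2 * KK A ^ 3 * (1 / L * (4 / L)))"
  proof (rule sum_mono)
   fix m assume m: "m \<in> ?X L"
   have "(\<Sum>n\<in>?Y N - ?Y L. norm (?a (m, n))) \<le> (\<Sum>n\<in>?Y N - ?Y L. 2 * KK A ^ 3 * (1 / L * (1 / (mx \<bar>m\<bar> n)\<^sup>2)))"
   proof (rule sum_mono)
    fix n assume n: "n \<in> ?Y N - ?Y L"
    then have "real L \<le> mx \<bar>m\<bar> n" by (auto simp: mx_def)
    then have "1 / mx \<bar>m\<bar> n \<le> 1 / L" using L(1) by (simp add: frac_le)
    then have "1 / mx \<bar>m\<bar> n * (1 / (mx \<bar>m\<bar> n)\<^sup>2) \<le> 1 / L * (1 / (mx \<bar>m\<bar> n)\<^sup>2)" by (intro mult_right_mono) auto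
    then have "?b m n \<le> 1 / L * (1 / (mx \<bar>m\<bar> n)\<^sup>2)" by (simp add: power2_eq_square power3_eq_cube mult.assoc)
    then show "norm (?a (m, n)) \<le> 2 * KK A ^ 3 * (1 / L * (1 / (mx \<bar>m\<bar> n)\<^sup>2))"
     using KK_ge1[of A] m by (intro order_trans[OF a] mult_left_mono) auto
   qed
   also have "... = 2 * KK A ^ 3 * (1 / L * (\<Sum>n\<in>?Y N - ?Y L. 1 / (mx \<bar>m\<bar> n)\<^sup>2))" by (simp only: sum_distrib_left)
   also have "... \<le> 2 * KK A ^ 3 * (1 / L * (4 / L))"
    using KK_ge1[of A] L(1) fY by (intro mult_left_mono sum_tail) auto
   finally show "(\<Sum>n\<in>?Y N - ?Y L. norm (?a (m, n))) \<le> 2 * KK A ^ 3 * (1 / L * (4 / L))" .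
  qed
  also have "... = card (?X L) * (2 * KK A ^ 3 * (1 / L * (4 / L)))" by simp
  also have "... \<le> (2 * real L) * (2 * KK A ^ 3 * (1 / L * (4 / L)))"
  proof (rule mult_right_mono)
   have "card (?X L) \<le> card {- int L + 1..int L - 1}" by (rule card_mono) auto
   then show "real (card (?X L)) \<le> 2 * real L" using L(1) by simp
  qed (use KK_ge1[of A] in auto)
  also have "... = 2 * KK A ^ 3 * (8 / L)" using L(1) by simp
  finally show ?thesis .
 qed
 finally have 1: "norm (\<Sum>p\<in>?D. ?a p) \<le> 2 * KK A ^ 3 * (20 / L) + 2 * KK A ^ 3 * (8 / L)"
  using norm_sum[of ?a ?D] by linarith
 have "norm (\<Sum>n\<in>?Z N - ?Z L. 1 / (of_int n)\<^sup>2 :: complex) \<le> (\<Sum>n\<in>?Z N - ?Z L. 1 / (mx 0 n)\<^sup>2)"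
 proof (rule sum_norm_le)
  fix n assume "n \<in> ?Z N - ?Z L"
  then have "mx 0 n = \<bar>real_of_int n\<bar>" by (auto simp: mx_def max_def)
  then show "norm (1 / (of_int n)\<^sup>2 :: complex) \<le> 1 / (mx 0 n)\<^sup>2" by (simp add: norm_divide norm_power)
 qed
 also have "... \<le> 4 / L" by (rule sum_tail) (use L in auto)
 finally have 2: "norm (\<Sum>n\<in>?Z N - ?Z L. 1 / (of_int n)\<^sup>2 :: complex) \<le> 4 / L" .
 show ?thesis unfolding e using norm_triangle_mono[OF 1 2] by (simp add: add_divide_distrib)
qed

lemma G2_inversion_S:
 assumes y: "0 < Im y"
 shows "GG [2] (- 1 / y) / y\<^sup>2 = GG [2] y - of_real pi * \<i> / y"
proof -
 obtain A where A: "1 \<le> A" "y \<in> KA A" using ex_KA[OF y] by blast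
 have t': "0 < Im (- 1 / y)" using y by (auto simp: Im_divide intro!: divide_pos_pos add_nonneg_pos)
 obtain A' where A': "1 \<le> A'" "- 1 / y \<in> KA A'" using ex_KA[OF t'] by blast
 have y0: "y \<noteq> 0" using y by auto
 define \<eta> where "\<eta> L = (56 * KK A ^ 3 + 4) / real L" for L
 define \<alpha> where "\<alpha> M = 2 * plim {0..<int M} [2] y" for M
 define \<beta> where "\<beta> N = 2 * plim {0..<int N} [2] (- 1 / y) / y\<^sup>2" for N
 define c where "c = 2 * of_real pi * \<i> / y"
 have lN: "(%N. bx M N y) \<longlonglongrightarrow> \<alpha> M" for M
  unfolding bx_eq \<alpha>_def by (intro tendsto_mult_left psum_plim' y) auto
 have lM: "(%M. bx M N y) \<longlonglongrightarrow> \<beta> N" for N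
  unfolding bx_swap[OF y, where N = M and M = N for M] unfolding bx_eq \<beta>_def by (intro tendsto_divide tendsto_mult_left psum_plim' t' tendsto_const) (use y0 in auto)
 have \<alpha>: "\<alpha> \<longlonglongrightarrow> 2 * GG [2] y"
  unfolding \<alpha>_def by (intro tendsto_mult_left plim_GG_tendsto y) auto
 have \<beta>: "\<beta> \<longlonglongrightarrow> 2 * GG [2] (- 1 / y) / y\<^sup>2"
  unfolding \<beta>_def by (intro tendsto_divide tendsto_mult_left plim_GG_tendsto t' tendsto_const) (use y0 in auto)
 have pc: "norm (bx M N y - q0 M N y - p0 L L y) \<le> \<eta> L" if "1 \<le> L" "L \<le> M" "L \<le> N" for L M N
  using p0_cauchy[OF A that] bx_split[OF y, of M N] that by (simp add: \<eta>_def)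
 have a1: "norm (2 * GG [2] y - p0 L L y) \<le> \<eta> L" if L: "1 \<le> L" for L
 proof (rule tendsto_upperbound)
  have "norm (\<alpha> M - p0 L L y) \<le> \<eta> L" if "L \<le> M" for M
  proof (rule tendsto_upperbound)
   show "(%N. norm (bx M N y - q0 M N y - p0 L L y)) \<longlonglongrightarrow> norm (\<alpha> M - p0 L L y)"
    using tendsto_norm[OF tendsto_diff[OF tendsto_diff[OF lN q0_tendsto_0[OF y]] tendsto_const]] by simp
   show "\<forall>\<^sub>F N in sequentially. norm (bx M N y - q0 M N y - p0 L L y) \<le> \<eta> L"
    using pc[OF L that] eventually_sequentially by blast
  qed simp
  then show "\<forall>\<^sub>F M in sequentially. norm (\<alpha> M - p0 L L y) \<le> \<eta> L" using eventually_sequentially by blast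
  show "(%M. norm (\<alpha> M - p0 L L y)) \<longlonglongrightarrow> norm (2 * GG [2] y - p0 L L y)"
   by (intro tendsto_norm tendsto_diff \<alpha> tendsto_const)
 qed simp
 define r where "r N = (80 * KK A' ^ 3 / (real (N - 1))\<^sup>2 + 2 / real (N - 1)) / norm y + 2 / real (N - 1)" for N
 have q: "\<forall>\<^sub>F M in sequentially. norm (q0 M N y + c) \<le> r N" if N: "2 \<le> N" for N
 proof -
  let ?K = "40 * KK A' ^ 3"
  have e: "0 < 1 / real (N - 1)" using N by simp
  have "\<forall>\<^sub>F M in sequentially. norm (lsum M (- 1 / y) (int (N - 1)) + of_real pi * \<i>) \<le> ?K / (real_of_int (int (N - 1)))\<^sup>2 + 1 / real (N - 1)"
   by (rule lsum_bound[OF A' _ e]) (use N in auto)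
  moreover have "\<forall>\<^sub>F M in sequentially. norm (lsum M (- 1 / y) (int N) + of_real pi * \<i>) \<le> ?K / (real_of_int (int N))\<^sup>2 + 1 / real (N - 1)"
   by (rule lsum_bound[OF A' _ e]) (use N in auto)
  ultimately show ?thesis using eventually_ge_at_top[of 1]
  proof eventually_elim
   case (elim M)
   let ?l1 = "lsum M (- 1 / y) (int (N - 1)) + of_real pi * \<i>" and ?l2 = "lsum M (- 1 / y) (int N) + of_real pi * \<i>"
   have q: "q0 M N y + c = (?l1 + ?l2) / y + (1 / of_nat (N - 1) + 1 / of_nat N)"
    unfolding q0_lsum[OF y N elim(3)] c_def by (simp add: add_divide_distrib)
   have K0: "0 \<le> ?K" using KK_ge1[of A'] by simp
   have "?K / (real_of_int (int N))\<^sup>2 \<le> ?K / (real (N - 1))\<^sup>2"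
    using N K0 by (intro divide_left_mono power_mono) auto
   then have "norm (?l1 + ?l2) \<le> 80 * KK A' ^ 3 / (real (N - 1))\<^sup>2 + 2 / real (N - 1)"
    using norm_triangle_ineq[of ?l1 ?l2] elim(1,2) by simp
   then have 1: "norm ((?l1 + ?l2) / y) \<le> (80 * KK A' ^ 3 / (real (N - 1))\<^sup>2 + 2 / real (N - 1)) / norm y"
    by (simp add: norm_divide divide_right_mono)
   have "norm (1 / of_nat (N - 1) + 1 / of_nat N :: complex) \<le> 1 / real (N - 1) + 1 / real N"
    by (rule norm_triangle_le) (simp add: norm_divide)
   also have "1 / real N \<le> 1 / real (N - 1)" using N by (intro divide_left_mono) auto
   finally have 2: "norm (1 / of_nat (N - 1) + 1 / of_nat N :: complex) \<le> 2 / real (N - 1)" by simp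
   show ?case unfolding q r_def by (rule norm_triangle_mono[OF 1 2])
  qed
 qed
 have r0: "r \<longlonglongrightarrow> 0"
 proof -
  have "(%N. (K / (real (N - 1))\<^sup>2 + 2 / real (N - 1)) / z + 2 / real (N - 1)) \<longlonglongrightarrow> 0" for K z :: real
  proof -
   have "filterlim (%N. real (N - 1)) at_top sequentially"
    by (rule filterlim_compose[OF filterlim_real_sequentially]) (rule filterlim_minus_const_nat_at_top)
   then have f: "filterlim (%N. real (N - 1)) at_infinity sequentially" by (rule filterlim_at_top_imp_at_infinity)
   have i: "(%N. a / real (N - 1)) \<longlonglongrightarrow> 0" for a by (rule tendsto_divide_0[OF tendsto_const f])
   have "(%N. (K / real (N - 1) * (1 / real (N - 1)) + 2 / real (N - 1)) * (1 / z) + 2 / real (N - 1)) \<longlonglongrightarrow> (0 * 0 + 0) * (1 / z) + 0"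
    by (intro tendsto_add tendsto_mult i tendsto_const)
   then show ?thesis by (simp add: power2_eq_square)
  qed
  then show ?thesis unfolding r_def .
 qed
 have b1: "norm (2 * GG [2] (- 1 / y) / y\<^sup>2 + c - p0 L L y) \<le> \<eta> L" if L: "1 \<le> L" for L
 proof (rule tendsto_le[of sequentially "%N. \<eta> L + r N" _ "%N. norm (\<beta> N + c - p0 L L y)"])
  show "(%N. \<eta> L + r N) \<longlonglongrightarrow> \<eta> L" using tendsto_add[OF tendsto_const r0, of "\<eta> L"] by simp
  show "(%N. norm (\<beta> N + c - p0 L L y)) \<longlonglongrightarrow> norm (2 * GG [2] (- 1 / y) / y\<^sup>2 + c - p0 L L y)"
   by (intro tendsto_norm tendsto_diff tendsto_add \<beta> tendsto_const)
  have "norm (\<beta> N + c - p0 L L y) \<le> \<eta> L + r N" if N: "max L 2 \<le> N" for N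
  proof (rule tendsto_upperbound)
   show "(%M. norm (bx M N y + c - p0 L L y)) \<longlonglongrightarrow> norm (\<beta> N + c - p0 L L y)"
    by (intro tendsto_norm tendsto_diff tendsto_add lM tendsto_const)
   have "\<forall>\<^sub>F M in sequentially. norm (q0 M N y + c) \<le> r N" by (rule q) (use N in auto)
   then show "\<forall>\<^sub>F M in sequentially. norm (bx M N y + c - p0 L L y) \<le> \<eta> L + r N"
    using eventually_ge_at_top[of L]
   proof eventually_elim
    case (elim M)
    have eq: "bx M N y + c - p0 L L y = (bx M N y - q0 M N y - p0 L L y) + (q0 M N y + c)" by simp
    have "L \<le> N" using N by simp
    show ?case unfolding eq by (rule norm_triangle_mono[OF pc[OF L elim(2) \<open>L \<le> N\<close>] elim(1)])
   qed
  qed simp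
  then show "\<forall>\<^sub>F N in sequentially. norm (\<beta> N + c - p0 L L y) \<le> \<eta> L + r N" using eventually_sequentially by blast
 qed simp
 have "norm (2 * GG [2] (- 1 / y) / y\<^sup>2 + c - 2 * GG [2] y) \<le> 2 * \<eta> L" if "1 \<le> L" for L
 proof -
  have "norm (p0 L L y - 2 * GG [2] y) \<le> \<eta> L" using a1[OF \<open>1 \<le> L\<close>] by (simp only: norm_minus_commute)
  from norm_diff_triangle_le[OF b1[OF \<open>1 \<le> L\<close>] this] show ?thesis by (simp only: mult_2)
 qed
 moreover have "(%L. 2 * \<eta> L) \<longlonglongrightarrow> 0" unfolding \<eta>_def by real_asymp
 ultimately have "norm (2 * GG [2] (- 1 / y) / y\<^sup>2 + c - 2 * GG [2] y) \<le> 0"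
  by (intro tendsto_lowerbound[of "%L. 2 * \<eta> L" 0 sequentially]) (auto simp: eventually_sequentially)
 then have "2 * GG [2] (- 1 / y) / y\<^sup>2 + c = 2 * GG [2] y" by simp
 then have "2 * (GG [2] (- 1 / y) / y\<^sup>2) = 2 * (GG [2] y - of_real pi * \<i> / y)"
  unfolding c_def by (simp add: algebra_simps)
 then show ?thesis by (simp only: mult_cancel_left) simp
qed

theorem G2_inversion:
 assumes t: "0 < Im t"
 shows "GG [2] (1 / xx e t) / (xx e t)\<^sup>2 = GG [2] t + of_real pi * \<i> / xx e t"
proof -
 have i: "0 < Im (- xx e t)" using t by (simp add: xx_def)
 have "- xx e t + of_nat (2 * e + 1) = t" by (simp add: xx_def)
 then have "GG [2] (- xx e t) = GG [2] t" using GG_shift[OF i, of "[2]" "2 * e + 1"] by simp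
 then show ?thesis using G2_inversion_S[OF i] by simp
qed

section \<open>The action of inversion on the weight graded pieces\<close>

definition dh :: "nat list => complex => complex" where
 "dh w t = (case w of [] => 0 | k # u => if k = 2 then - (1 / 2) * GG u t else 0)"

lemma dh_simps [simp]: "dh [] t = 0" "dh (2 # u) t = - (1 / 2) * GG u t" "k \<noteq> 2 ==> dh (k # u) t = 0"
 by (simp_all add: dh_def)

lemma sum_list_map_append3: "(\<Sum>w\<leftarrow>map f us @ map g vs @ map h ws. F w) = (\<Sum>w\<leftarrow>us. F (f w)) + (\<Sum>w\<leftarrow>vs. F (g w)) + (\<Sum>w\<leftarrow>ws. (F (h w) :: complex))"
 by (simp add: comp_def)

lemma dh_qsh:
 assumes "0 < Im t" "u \<in> mes_indices" "v \<in> mes_indices"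
 shows "(\<Sum>w\<leftarrow>qsh u v. dh w t) = dh u t * GG v t + GG u t * dh v t"
proof (cases u)
 case (Cons a u')
 show ?thesis
 proof (cases v)
  case v: (Cons b v')
  have ab: "2 \<le> a" "2 \<le> b" "u' \<in> mes_indices" "v' \<in> mes_indices" using assms by (auto simp: Cons v)
  have q: "(\<Sum>w\<leftarrow>qsh u v. dh w t) = (\<Sum>w\<leftarrow>qsh u' v. dh (a # w) t) + (\<Sum>w\<leftarrow>qsh u v'. dh (b # w) t) + (\<Sum>w\<leftarrow>qsh u' v'. dh ((a + b) # w) t)"
   unfolding Cons v qsh.simps by (rule sum_list_map_append3)
  have s: "(\<Sum>w\<leftarrow>ws. dh (c # w) t) = (if c = 2 then - (1 / 2) * (\<Sum>w\<leftarrow>ws. GG w t) else 0)" for c ws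
   by (induction ws) (auto simp: algebra_simps add_divide_distrib)
  show ?thesis
   unfolding q s GG_mult[OF assms(1) ab(3) assms(3), symmetric] GG_mult[OF assms(1,2) ab(4), symmetric]
   using ab by (auto simp: Cons v dh_def)
 qed simp
qed simp

definition QQ :: "nat => (complex => complex) => (complex => complex) => bool" where
 "QQ k f g \<longleftrightarrow> (\<forall>A\<ge>1. uniform_limit (KA A) (%e t. xx e t * (f (1 / xx e t) / xx e t ^ k - f t)) (%t. - 2 * of_real pi * \<i> * g t) sequentially
  \<and> bounded (f ` KA A) \<and> bounded (g ` KA A))"

lemma QQD:
 assumes "QQ k f g" "1 \<le> A"
 shows "uniform_limit (KA A) (%e t. xx e t * (f (1 / xx e t) / xx e t ^ k - f t)) (%t. - 2 * of_real pi * \<i> * g t) sequentially"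
  "bounded (f ` KA A)" "bounded (g ` KA A)"
 using assms unfolding QQ_def by blast+

lemma QQ_cong:
 assumes "QQ k f g" "!!t. 0 < Im t ==> f' t = f t" "!!t. 0 < Im t ==> g' t = g t"
 shows "QQ k f' g'"
 unfolding QQ_def
proof (intro allI impI)
 fix A :: real assume A: "1 \<le> A"
 have p: "0 < Im t" if "t \<in> KA A" for t using KA_pos[OF A that] .
 have u: "uniform_limit (KA A) (%e t. xx e t * (f (1 / xx e t) / xx e t ^ k - f t)) (%t. - 2 * of_real pi * \<i> * g t) sequentially"
  by (rule QQD(1)[OF assms(1) A])
 have "uniform_limit (KA A) (%e t. xx e t * (f' (1 / xx e t) / xx e t ^ k - f' t)) (%t. - 2 * of_real pi * \<i> * g' t) sequentially"
  using u by (rule uniform_limit_cong'[THEN iffD2, rotated 2]) (use p xx_nz(2) assms(2,3) in auto)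
 moreover have "f' ` KA A = f ` KA A" "g' ` KA A = g ` KA A" using p assms(2,3) by (auto intro!: image_cong)
 ultimately show "uniform_limit (KA A) (%e t. xx e t * (f' (1 / xx e t) / xx e t ^ k - f' t)) (%t. - 2 * of_real pi * \<i> * g' t) sequentially
  \<and> bounded (f' ` KA A) \<and> bounded (g' ` KA A)"
  using QQD(2,3)[OF assms(1) A] by auto
qed

lemma bounded_imageI: "(!!t. t \<in> S ==> norm (f t) \<le> C) ==> bounded (f ` S)"
 unfolding bounded_iff by blast

lemma bounded_imageE:
 assumes "bounded (f ` S)" obtains C where "0 \<le> C" "!!t. t \<in> S ==> norm (f t) \<le> C"
 using assms unfolding bounded_pos by (metis image_eqI less_imp_le)

lemma bounded_image_add: "bounded (f ` S) ==> bounded (g ` S) ==> bounded ((%t. f t + g t :: complex) ` S)"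
proof -
 assume "bounded (f ` S)" "bounded (g ` S)"
 then obtain C D where "!!t. t \<in> S ==> norm (f t) \<le> C" "!!t. t \<in> S ==> norm (g t) \<le> D"
  by (metis bounded_imageE)
 then show ?thesis by (intro bounded_imageI[of S _ "C + D"] norm_triangle_mono)
qed

lemma bounded_image_mult: "bounded (f ` S) ==> bounded (g ` S) ==> bounded ((%t. f t * g t :: complex) ` S)"
proof -
 assume "bounded (f ` S)" "bounded (g ` S)"
 then obtain C D where "0 \<le> C" "!!t. t \<in> S ==> norm (f t) \<le> C" "!!t. t \<in> S ==> norm (g t) \<le> D"
  by (metis bounded_imageE)
 then show ?thesis by (intro bounded_imageI[of S _ "C * D"]) (simp add: norm_mult mult_mono)
qed

lemma bounded_image_const: "bounded ((%t. c :: complex) ` S)"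
 by (rule bounded_imageI[of _ _ "norm c"]) simp

lemma QQD_bounded:
 assumes "QQ k f g" "1 \<le> A" shows "bounded ((%t. - 2 * of_real pi * \<i> * g t) ` KA A)"
 by (rule bounded_image_mult[OF bounded_image_const QQD(3)[OF assms]])

lemma QQ_add:
 assumes "QQ k f f'" "QQ k g g'" shows "QQ k (%t. f t + g t) (%t. f' t + g' t)"
 unfolding QQ_def
proof (intro allI impI conjI)
 fix A :: real assume A: "1 \<le> A"
 have "uniform_limit (KA A) (%e t. xx e t * (f (1 / xx e t) / xx e t ^ k - f t) + xx e t * (g (1 / xx e t) / xx e t ^ k - g t))
  (%t. - 2 * of_real pi * \<i> * f' t + - 2 * of_real pi * \<i> * g' t) sequentially"
  by (rule uniform_limit_add[OF QQD(1)[OF assms(1) A] QQD(1)[OF assms(2) A]])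
 moreover have "x * ((a + b) / X - (c + d)) = x * (a / X - c) + x * (b / X - d)" for x X a b c d :: complex
  by (simp add: algebra_simps add_divide_distrib)
 ultimately show "uniform_limit (KA A) (%e t. xx e t * ((f (1 / xx e t) + g (1 / xx e t)) / xx e t ^ k - (f t + g t)))
  (%t. - 2 * of_real pi * \<i> * (f' t + g' t)) sequentially"
  by (simp only: distrib_left)
qed (use QQD[OF assms(1)] QQD[OF assms(2)] in \<open>auto intro: bounded_image_add\<close>)

lemma QQ_scale:
 assumes "QQ k f f'" shows "QQ k (%t. c * f t) (%t. c * f' t)"
 unfolding QQ_def
proof (intro allI impI conjI)
 fix A :: real assume A: "1 \<le> A"
 have "uniform_limit (KA A) (%e t. c * (xx e t * (f (1 / xx e t) / xx e t ^ k - f t))) (%t. c * (- 2 * of_real pi * \<i> * f' t)) sequentially"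
  by (rule uniform_lim_mult[OF uniform_limit_const QQD(1)[OF assms A] bounded_image_const QQD_bounded[OF assms A]])
 moreover have "x * (c * a / X - c * b) = c * (x * (a / X - b))" for x X a b :: complex
  by (simp add: algebra_simps)
 ultimately show "uniform_limit (KA A) (%e t. xx e t * (c * f (1 / xx e t) / xx e t ^ k - c * f t)) (%t. - 2 * of_real pi * \<i> * (c * f' t)) sequentially"
  by (simp only: mult.left_commute[of "- 2 * of_real pi * \<i>"])
qed (use QQD[OF assms] in \<open>auto intro: bounded_image_mult bounded_image_const\<close>)

lemma QQ_zero: "QQ k (%t. 0) (%t. 0)"
 by (auto simp: QQ_def intro: bounded_image_const uniform_limit_const)

lemma norm_xx_ge:
 assumes "t \<in> KA A" shows "real (2 * e + 1) - A \<le> norm (xx e t)"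
proof -
 have "norm t < A" using assms by (simp add: KA_def)
 moreover have "norm (of_nat (2 * e + 1) :: complex) - norm t \<le> norm (xx e t)"
  unfolding xx_def by (rule norm_triangle_ineq2)
 ultimately show ?thesis by (simp only: norm_of_nat)
qed

lemma uniform_inv_xx:
 assumes "1 \<le> A" shows "uniform_limit (KA A) (%e t. 1 / xx e t) (%t. 0) sequentially"
proof (rule uniform_limitI)
 fix \<epsilon> :: real assume e: "0 < \<epsilon>"
 have "filterlim (%e. real (2 * e + 1)) at_top sequentially" by real_asymp
 then have "\<forall>\<^sub>F e in sequentially. A + 1 / \<epsilon> < real (2 * e + 1)" by (simp add: filterlim_at_top_dense)
 then show "\<forall>\<^sub>F n in sequentially. \<forall>t\<in>KA A. dist (1 / xx n t) 0 < \<epsilon>"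
 proof eventually_elim
  case (elim n)
  show ?case
  proof
   fix t assume t: "t \<in> KA A"
   have "1 / \<epsilon> < norm (xx n t)" using norm_xx_ge[OF t, of n] elim by linarith
   then have "1 < \<epsilon> * norm (xx n t)" using e by (simp add: field_simps)
   moreover have "0 < norm (xx n t)" using xx_nz(1) KA_pos[OF assms t] by simp
   ultimately show "dist (1 / xx n t) 0 < \<epsilon>" by (simp add: norm_divide field_simps)
  qed
 qed
qed

lemma QQ_slash:
 assumes "QQ k f g" "1 \<le> A"
 shows "uniform_limit (KA A) (%e t. f (1 / xx e t) / xx e t ^ k) f sequentially"
proof -
 have "uniform_limit (KA A) (%e t. 1 / xx e t * (xx e t * (f (1 / xx e t) / xx e t ^ k - f t))) (%t. 0 * (- 2 * of_real pi * \<i> * g t)) sequentially"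
  by (rule uniform_lim_mult[OF uniform_inv_xx[OF assms(2)] QQD(1)[OF assms] bounded_image_const QQD_bounded[OF assms]])
 moreover have "uniform_limit (KA A) (%e t. f t) f sequentially" by (rule uniform_limit_const)
 ultimately have "uniform_limit (KA A) (%e t. 1 / xx e t * (xx e t * (f (1 / xx e t) / xx e t ^ k - f t)) + f t) (%t. 0 * (- 2 * of_real pi * \<i> * g t) + f t) sequentially"
  by (rule uniform_limit_add)
 then show ?thesis
  by (rule uniform_limit_cong'[THEN iffD2, rotated 2]) (use xx_nz(1) KA_pos[OF assms(2)] in auto)
qed

lemma QQ_mult:
 assumes f: "QQ k f f'" and g: "QQ l g g'"
 shows "QQ (k + l) (%t. f t * g t) (%t. f' t * g t + f t * g' t)"
 unfolding QQ_def
proof (intro allI impI conjI)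
 fix A :: real assume A: "1 \<le> A"
 let ?c = "- 2 * of_real pi * \<i> :: complex"
 have bf: "bounded (f ` KA A)" "bounded (f' ` KA A)" "bounded (g ` KA A)" "bounded (g' ` KA A)"
  using QQD[OF f A] QQD[OF g A] by auto
 have u: "uniform_limit (KA A) (%e t. xx e t * (f (1 / xx e t) / xx e t ^ k - f t)) (%t. ?c * f' t) sequentially"
  "uniform_limit (KA A) (%e t. xx e t * (g (1 / xx e t) / xx e t ^ l - g t)) (%t. ?c * g' t) sequentially"
  using QQD[OF f A] QQD[OF g A] by auto
 have "uniform_limit (KA A) (%e t. xx e t * (f (1 / xx e t) / xx e t ^ k - f t) * (g (1 / xx e t) / xx e t ^ l)
   + f t * (xx e t * (g (1 / xx e t) / xx e t ^ l - g t))) (%t. ?c * f' t * g t + f t * (?c * g' t)) sequentially"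
  by (rule uniform_limit_add[OF uniform_lim_mult[OF u(1) QQ_slash[OF g A] QQD_bounded[OF f A] bf(3)]
     uniform_lim_mult[OF uniform_limit_const u(2) bf(1) QQD_bounded[OF g A]]])
 then show "uniform_limit (KA A) (%e t. xx e t * (f (1 / xx e t) * g (1 / xx e t) / xx e t ^ (k + l) - f t * g t))
  (%t. ?c * (f' t * g t + f t * g' t)) sequentially"
 proof (rule uniform_limit_cong'[THEN iffD2, rotated 2])
  have alg: "x * (a * b / (X * Y) - c * d) = x * (a / X - c) * (b / Y) + c * (x * (b / Y - d))" for x a b X Y c d :: complex
   by (simp add: algebra_simps)
  show "xx e t * (f (1 / xx e t) * g (1 / xx e t) / xx e t ^ (k + l) - f t * g t)
   = xx e t * (f (1 / xx e t) / xx e t ^ k - f t) * (g (1 / xx e t) / xx e t ^ l) + f t * (xx e t * (g (1 / xx e t) / xx e t ^ l - g t))" for e t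
   unfolding power_add by (rule alg)
  have "p * (a * b + c * d) = p * a * b + c * (p * d)" for p a b c d :: complex by (simp add: algebra_simps)
  then show "?c * (f' t * g t + f t * g' t) = ?c * f' t * g t + f t * (?c * g' t)" for t .
 qed
 show "bounded ((%t. f t * g t) ` KA A)" "bounded ((%t. f' t * g t + f t * g' t) ` KA A)"
  using bf by (auto intro: bounded_image_mult bounded_image_add)
qed

lemma QQ_unique:
 assumes "QQ k f g" "QQ k f g'" "0 < Im t" shows "g t = g' t"
proof -
 obtain A where A: "1 \<le> A" "t \<in> KA A" using ex_KA[OF assms(3)] by blast
 have "(%e. xx e t * (f (1 / xx e t) / xx e t ^ k - f t)) \<longlonglongrightarrow> - 2 * of_real pi * \<i> * g t"
  "(%e. xx e t * (f (1 / xx e t) / xx e t ^ k - f t)) \<longlonglongrightarrow> - 2 * of_real pi * \<i> * g' t"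
  by (rule tendsto_uniform_limitI[OF QQD(1)[OF assms(1) A(1)] A(2)], rule tendsto_uniform_limitI[OF QQD(1)[OF assms(2) A(1)] A(2)])
 then have "- 2 * of_real pi * \<i> * g t = - 2 * of_real pi * \<i> * g' t" by (rule LIMSEQ_unique)
 then show ?thesis by simp
qed

lemma bounded_GG:
 assumes "1 \<le> A" "w \<in> mes_indices" shows "bounded (GG w ` KA A)"
proof -
 obtain C where C: "!!t M. t \<in> KA A ==> norm (plim {0..<int M} w t) \<le> C" using plim_bounded[OF assms] by blast
 show ?thesis
 proof (rule bounded_imageI)
  fix t assume t: "t \<in> KA A"
  show "norm (GG w t) \<le> C"
   by (rule tendsto_upperbound[OF tendsto_norm[OF plim_GG_tendsto[OF KA_pos[OF assms(1) t] assms(2)]]]) (use C[OF t] in auto)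
 qed
qed

lemma QQ_Nil: "QQ 0 (GG []) (dh [])"
 by (auto simp: QQ_def fun_eq_iff intro: bounded_image_const uniform_limit_const)

lemma QQ_adm:
 assumes w: "w \<in> mes_indices" "w \<noteq> []" "3 \<le> hd w"
 shows "QQ (sum_list w) (GG w) (dh w)"
 unfolding QQ_def
proof (intro allI impI conjI)
 fix A :: real assume A: "1 \<le> A"
 have d0: "dh w = (%t. 0)" using w by (cases w) (auto simp: fun_eq_iff dh_def)
 show "bounded (GG w ` KA A)" by (rule bounded_GG[OF A w(1)])
 show "bounded (dh w ` KA A)" unfolding d0 by (rule bounded_image_const)
 obtain C where C: "0 \<le> C" "!!e t. 1 \<le> e ==> t \<in> KA A ==> norm (GG w (1 / xx e t) / xx e t ^ sum_list w - GG w t) \<le> C * Dd e powr (- 21 / 20)"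
  using slash_adm[OF A w] by blast
 have l: "(%e. (1 + A) * C * Dd e powr (- 1 / 20)) \<longlonglongrightarrow> 0"
 proof -
  have "(%e. real (2 * e + 1) powr (- 1 / 20)) \<longlonglongrightarrow> 0" by real_asymp
  then show ?thesis unfolding Dd_def by (rule tendsto_mult_right_zero)
 qed
 show "uniform_limit (KA A) (%e t. xx e t * (GG w (1 / xx e t) / xx e t ^ sum_list w - GG w t)) (%t. - 2 * of_real pi * \<i> * dh w t) sequentially"
 proof (rule uniform_limitI)
  fix \<epsilon> :: real assume "0 < \<epsilon>"
  with l have "\<forall>\<^sub>F e in sequentially. (1 + A) * C * Dd e powr (- 1 / 20) < \<epsilon>" by (rule order_tendstoD)
  then show "\<forall>\<^sub>F e in sequentially. \<forall>t\<in>KA A. dist (xx e t * (GG w (1 / xx e t) / xx e t ^ sum_list w - GG w t)) (- 2 * of_real pi * \<i> * dh w t) < \<epsilon>"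
   using eventually_ge_at_top[of 1]
  proof eventually_elim
   case (elim e)
   show ?case
   proof
    fix t assume t: "t \<in> KA A"
    have D: "1 \<le> Dd e" by (rule Dd_ge1)
    have "norm (xx e t) \<le> norm (of_nat (2 * e + 1) :: complex) + norm t" unfolding xx_def by (rule norm_triangle_ineq4)
    also have "... \<le> Dd e + A" using t by (simp only: norm_of_nat Dd_def) (simp add: KA_def)
    also have "... \<le> (1 + A) * Dd e" using D A by (simp add: algebra_simps)
    finally have x: "norm (xx e t) \<le> (1 + A) * Dd e" .
    have "norm (xx e t * (GG w (1 / xx e t) / xx e t ^ sum_list w - GG w t)) \<le> ((1 + A) * Dd e) * (C * Dd e powr (- 21 / 20))"
     unfolding norm_mult using x C(2)[OF elim(2) t] A D by (intro mult_mono) auto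
    also have "... = (1 + A) * C * (Dd e powr 1 * Dd e powr (- 21 / 20))" using D by simp
    also have "Dd e powr 1 * Dd e powr (- 21 / 20) = Dd e powr (- 1 / 20)" by (subst powr_add[symmetric]) simp
    finally show "dist (xx e t * (GG w (1 / xx e t) / xx e t ^ sum_list w - GG w t)) (- 2 * of_real pi * \<i> * dh w t) < \<epsilon>"
     using elim(1) by (simp add: d0 dist_norm)
   qed
  qed
 qed
qed

lemma QQ_two: "QQ 2 (GG [2]) (dh [2])"
 unfolding QQ_def
proof (intro allI impI conjI)
 fix A :: real assume A: "1 \<le> A"
 show "bounded (GG [2] ` KA A)" by (rule bounded_GG[OF A]) simp
 show "bounded (dh [2] ` KA A)" by (rule bounded_imageI[of _ _ 1]) (simp add: norm_divide)
 have "uniform_limit (KA A) (%e t. of_real pi * \<i>) (%t. of_real pi * \<i>) sequentially" by (rule uniform_limit_const)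
 then show "uniform_limit (KA A) (%e t. xx e t * (GG [2] (1 / xx e t) / (xx e t)\<^sup>2 - GG [2] t)) (%t. - 2 * of_real pi * \<i> * dh [2] t) sequentially"
  by (rule uniform_limit_cong'[THEN iffD2, rotated 2]) (use G2_inversion KA_pos[OF A] xx_nz(1) in auto)
qed

definition lead :: "nat list => nat" where
 "lead w = length (takeWhile (%k. k = 2) w)"

lemma lead_simps [simp]: "lead [] = 0" "lead (2 # w) = Suc (lead w)" "k \<noteq> 2 ==> lead (k # w) = 0"
 by (simp_all add: lead_def)

lemma qsh_two:
 assumes "v \<in> mes_indices"
 shows "\<exists>rest. (\<forall>w\<in>set rest. lead w \<le> lead v \<and> w \<in> mes_indices \<and> sum_list w = 2 + sum_list v) \<and>
  (\<forall>F :: nat list => complex. (\<Sum>w\<leftarrow>qsh [2] v. F w) = (of_nat (lead v) + 1) * F (2 # v) + (\<Sum>w\<leftarrow>rest. F w))"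
 using assms
proof (induction v)
 case Nil
 show ?case by (intro exI[of _ "[]"]) simp
next
 case (Cons k v)
 then have k: "2 \<le> k" "v \<in> mes_indices" by auto
 obtain rest where r: "!!w. w \<in> set rest ==> lead w \<le> lead v \<and> w \<in> mes_indices \<and> sum_list w = 2 + sum_list v"
  "!!F :: nat list => complex. (\<Sum>w\<leftarrow>qsh [2] v. F w) = (of_nat (lead v) + 1) * F (2 # v) + (\<Sum>w\<leftarrow>rest. F w)"
  using Cons.IH[OF k(2)] by blast
 have q: "(\<Sum>w\<leftarrow>qsh [2] (k # v). F w) = F (2 # k # v) + (\<Sum>w\<leftarrow>qsh [2] v. F (k # w)) + F ((2 + k) # v)" for F :: "nat list => complex"
  by (simp add: comp_def)
 show ?case
 proof (cases "k = 2")
  case True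
  show ?thesis
  proof (intro exI[of _ "map ((#) 2) rest @ [4 # v]"] conjI ballI allI)
   fix w assume "w \<in> set (map ((#) 2) rest @ [4 # v])"
   then show "lead w \<le> lead (k # v)" "w \<in> mes_indices" "sum_list w = 2 + sum_list (k # v)"
    using r(1) k True by auto
  next
   fix F :: "nat list => complex"
   show "(\<Sum>w\<leftarrow>qsh [2] (k # v). F w) = (of_nat (lead (k # v)) + 1) * F (2 # k # v) + (\<Sum>w\<leftarrow>map ((#) 2) rest @ [4 # v]. F w)"
    unfolding q using True r(2)[of "%w. F (2 # w)"] by (simp add: comp_def algebra_simps)
  qed
 next
  case False
  show ?thesis
  proof (intro exI[of _ "map ((#) k) (qsh [2] v) @ [(2 + k) # v]"] conjI ballI allI)
   fix w assume w: "w \<in> set (map ((#) k) (qsh [2] v) @ [(2 + k) # v])"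
   then show "lead w \<le> lead (k # v)" using k False by auto
   show "w \<in> mes_indices" using w k mes_indices_qsh[of _ "[2]" v] by auto
   show "sum_list w = 2 + sum_list (k # v)" using w sum_list_qsh[of _ "[2]" v] by auto
  next
   fix F :: "nat list => complex"
   show "(\<Sum>w\<leftarrow>qsh [2] (k # v). F w) = (of_nat (lead (k # v)) + 1) * F (2 # k # v) + (\<Sum>w\<leftarrow>map ((#) k) (qsh [2] v) @ [(2 + k) # v]. F w)"
    unfolding q using False by (simp add: comp_def)
  qed
 qed
qed

lemma QQ_sum_list:
 assumes "!!w. w \<in> set ws ==> QQ k (f w) (g w)"
 shows "QQ k (%t. \<Sum>w\<leftarrow>ws. f w t) (%t. \<Sum>w\<leftarrow>ws. g w t)"
 using assms by (induction ws) (auto intro: QQ_zero QQ_add)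

theorem QQ_word:
 assumes "w \<in> mes_indices" shows "QQ (sum_list w) (GG w) (dh w)"
 using assms
proof (induction "lead w" arbitrary: w rule: less_induct)
 case less
 show ?case
 proof (cases w)
  case Nil
  then show ?thesis using QQ_Nil by simp
 next
  case (Cons k v)
  show ?thesis
  proof (cases "k = 2")
   case False
   then show ?thesis using less.prems Cons by (intro QQ_adm) auto
  next
   case True
   have v: "v \<in> mes_indices" using less.prems Cons by simp
   obtain rest where r: "!!w. w \<in> set rest ==> lead w \<le> lead v \<and> w \<in> mes_indices \<and> sum_list w = 2 + sum_list v"
    "!!F :: nat list => complex. (\<Sum>w\<leftarrow>qsh [2] v. F w) = (of_nat (lead v) + 1) * F (2 # v) + (\<Sum>w\<leftarrow>rest. F w)"
    using qsh_two[OF v] by blast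
   let ?n = "of_nat (lead v) + 1 :: complex"
   have n0: "?n \<noteq> 0" by (metis of_nat_Suc of_nat_neq_0 add.commute)
   have "QQ (2 + sum_list v) (%t. GG [2] t * GG v t) (%t. dh [2] t * GG v t + GG [2] t * dh v t)"
    by (rule QQ_mult[OF QQ_two less.hyps]) (use v in \<open>auto simp: Cons True\<close>)
   moreover have "QQ (2 + sum_list v) (%t. \<Sum>w\<leftarrow>rest. GG w t) (%t. \<Sum>w\<leftarrow>rest. dh w t)"
   proof (rule QQ_sum_list)
    fix x assume x: "x \<in> set rest"
    have "QQ (sum_list x) (GG x) (dh x)"
     by (rule less.hyps) (use r(1)[OF x] in \<open>auto simp: Cons True\<close>)
    then show "QQ (2 + sum_list v) (GG x) (dh x)" using r(1)[OF x] by simp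
   qed
   ultimately have "QQ (2 + sum_list v) (%t. 1 / ?n * (GG [2] t * GG v t + - 1 * (\<Sum>w\<leftarrow>rest. GG w t)))
    (%t. 1 / ?n * (dh [2] t * GG v t + GG [2] t * dh v t + - 1 * (\<Sum>w\<leftarrow>rest. dh w t)))"
    by (intro QQ_scale QQ_add)
   then have "QQ (2 + sum_list v) (GG w) (dh w)"
   proof (rule QQ_cong)
    fix t :: complex assume t: "0 < Im t"
    show "GG w t = 1 / ?n * (GG [2] t * GG v t + - 1 * (\<Sum>w\<leftarrow>rest. GG w t))"
     unfolding GG_mult[OF t _ v, of "[2]", simplified] using r(2)[of "%w. GG w t"] n0 by (simp add: Cons True)
    show "dh w t = 1 / ?n * (dh [2] t * GG v t + GG [2] t * dh v t + - 1 * (\<Sum>w\<leftarrow>rest. dh w t))"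
     using r(2)[of "%w. dh w t"] dh_qsh[OF t _ v, of "[2]"] n0 by (simp add: Cons True)
   qed
   then show ?thesis by (simp add: Cons True)
  qed
 qed
qed

lemma QQ_pointwise:
 assumes "QQ k f g" "0 < Im t"
 shows "(%e. f (1 / xx e t) / xx e t ^ k) \<longlonglongrightarrow> f t"
  "(%e. xx e t * (f (1 / xx e t) / xx e t ^ k - f t)) \<longlonglongrightarrow> - 2 * of_real pi * \<i> * g t"
proof -
 obtain A where A: "1 \<le> A" "t \<in> KA A" using ex_KA[OF assms(2)] by blast
 show "(%e. f (1 / xx e t) / xx e t ^ k) \<longlonglongrightarrow> f t"
  by (rule tendsto_uniform_limitI[OF QQ_slash[OF assms(1) A(1)] A(2)])
 show "(%e. xx e t * (f (1 / xx e t) / xx e t ^ k - f t)) \<longlonglongrightarrow> - 2 * of_real pi * \<i> * g t"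
  by (rule tendsto_uniform_limitI[OF QQD(1)[OF assms(1) A(1)] A(2)])
qed

definition part :: "nat => (rat \<times> nat list) list => (rat \<times> nat list) list" where
 "part k ps = filter (%p. sum_list (snd p) = k) ps"

lemma part_Nil [simp]: "part k [] = []"
 and part_Cons [simp]: "part k (p # ps) = (if sum_list (snd p) = k then p # part k ps else part k ps)"
 by (simp_all add: part_def)

lemma set_part: "set (part k ps) = {p \<in> set ps. sum_list (snd p) = k}"
 by (simp add: part_def)

lemma ex_weight_bound:
 fixes ps :: "('a \<times> nat list) list"
 shows "\<exists>K. \<forall>p\<in>set ps. sum_list (snd p) < K"
proof (induction ps)
 case (Cons p ps)
 then obtain K where "\<forall>p\<in>set ps. sum_list (snd p) < K" by blast
 then show ?case by (intro exI[of _ "max K (Suc (sum_list (snd p)))"]) auto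
qed simp

lemma lcw_parts:
 assumes "\<forall>p\<in>set ps. sum_list (snd p) < K"
 shows "lcw f ps = (\<Sum>k<K. lcw f (part k ps))"
 using assms
proof (induction ps)
 case (Cons p ps)
 obtain q w where p: "p = (q, w)" by (cases p)
 have "lcw f (part k (p # ps)) = (if k = sum_list w then of_rat q * f w else 0) + lcw f (part k ps)" for k
  by (simp add: p)
 then have "(\<Sum>k<K. lcw f (part k (p # ps))) = of_rat q * f w + (\<Sum>k<K. lcw f (part k ps))"
  using Cons.prems by (simp only: sum.distrib) (simp add: p sum.delta)
 then show ?case using Cons by (simp add: p)
qed simp

lemma lcw_QQ:
 assumes "snd ` set ps \<subseteq> mes_indices"
 shows "QQ k (%t. lcw (%w. GG w t) (part k ps)) (%t. lcw (%w. dh w t) (part k ps))"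
 using assms
proof (induction ps)
 case (Cons p ps)
 obtain q w where p: "p = (q, w)" by (cases p)
 have IH: "QQ k (%t. lcw (%w. GG w t) (part k ps)) (%t. lcw (%w. dh w t) (part k ps))" using Cons by simp
 have w: "w \<in> mes_indices" using Cons.prems by (simp add: p)
 show ?case
 proof (cases "sum_list w = k")
  case True
  have "QQ k (GG w) (dh w)" using QQ_word[OF w] True by simp
  then show ?thesis using QQ_add[OF QQ_scale[of k "GG w" "dh w" "of_rat q"] IH] True by (simp add: p)
 qed (use IH in \<open>simp add: p\<close>)
qed (simp add: QQ_zero)

lemma xx_at_infinity: "filterlim (%e. xx e t) at_infinity sequentially"
proof -
 have "filterlim (%e. 2 * e + 1 :: nat) at_top sequentially"
  by (rule filterlim_at_top_mono[OF filterlim_ident]) (auto intro!: always_eventually)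
 from filterlim_compose[OF tendsto_of_nat this]
 have "filterlim (%e. (of_nat (2 * e + 1) :: complex)) at_infinity sequentially" .
 from tendsto_add_filterlim_at_infinity[OF tendsto_const this, of "- t"]
 show ?thesis unfolding xx_def by simp
qed

lemma inv_xx_tendsto: "0 < n ==> (%e. (1 / xx e t) ^ n) \<longlonglongrightarrow> 0"
 using tendsto_power[OF tendsto_divide_0[OF tendsto_const xx_at_infinity], of 1 t n] by (simp add: power_0_left)

lemma slash_shift:
 assumes "(%e. F e / xx e t ^ i) \<longlonglongrightarrow> l" "i < j" "0 < Im t"
 shows "(%e. F e / xx e t ^ j) \<longlonglongrightarrow> 0"
proof -
 have "(%e. F e / xx e t ^ i * (1 / xx e t) ^ (j - i)) \<longlonglongrightarrow> l * 0"
  by (intro tendsto_mult assms inv_xx_tendsto) (use assms in simp)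
 moreover have "F e / xx e t ^ i * (1 / xx e t) ^ (j - i) = F e / xx e t ^ j" for e
 proof -
  have "xx e t ^ j = xx e t ^ i * xx e t ^ (j - i)" using assms(2) by (simp add: power_add[symmetric])
  then show ?thesis by (simp add: power_divide)
 qed
 ultimately show ?thesis by simp
qed

lemma top_part:
 assumes ps: "snd ` set ps \<subseteq> mes_indices" and t: "0 < Im t"
  and z: "!!i t. j < i ==> 0 < Im t ==> lcw (%w. GG w t) (part i ps) = 0"
 shows "(%e. lcw (%w. GG w (1 / xx e t)) ps / xx e t ^ j) \<longlonglongrightarrow> lcw (%w. GG w t) (part j ps)"
proof -
 obtain K0 where "\<forall>p\<in>set ps. sum_list (snd p) < K0" using ex_weight_bound by blast
 then have K: "\<forall>p\<in>set ps. sum_list (snd p) < max K0 (Suc j)" by auto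
 let ?P = "%i t. lcw (%w. GG w t) (part i ps)"
 have l: "(%e. ?P i (1 / xx e t) / xx e t ^ j) \<longlonglongrightarrow> (if i = j then ?P j t else 0)" for i
 proof -
  consider "i = j" | "i < j" | "j < i" by linarith
  then show ?thesis
  proof cases
   case 1
   then show ?thesis using QQ_pointwise(1)[OF lcw_QQ[OF ps] t, of j] by simp
  next
   case 2
   then show ?thesis using slash_shift[OF QQ_pointwise(1)[OF lcw_QQ[OF ps] t, of i] 2 t] by simp
  next
   case 3
   then show ?thesis using z[OF 3 xx_nz(2)[OF t]] by simp
  qed
 qed
 have "(%e. \<Sum>i<max K0 (Suc j). ?P i (1 / xx e t) / xx e t ^ j) \<longlonglongrightarrow> (\<Sum>i<max K0 (Suc j). if i = j then ?P j t else 0)"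
  by (intro tendsto_sum l)
 then show ?thesis
  unfolding sum_divide_distrib[symmetric] lcw_parts[OF K, symmetric] by (simp add: sum.delta less_max_iff_disj)
qed

lemma lead_parts:
 assumes ps: "snd ` set ps \<subseteq> mes_indices"
  and L: "!!t. 0 < Im t ==> (%e. lcw (%w. GG w (1 / xx e t)) ps / xx e t ^ n) \<longlonglongrightarrow> L t"
  and t: "0 < Im t"
 shows "L t = lcw (%w. GG w t) (part n ps)"
proof -
 obtain K where K: "\<forall>p\<in>set ps. sum_list (snd p) < K" using ex_weight_bound by blast
 have z: "lcw (%w. GG w t) (part j ps) = 0" if "n < j" "K \<le> j + m" "0 < Im t" for m j t
  using that
 proof (induction m arbitrary: j t)
  case 0
  then have "part j ps = []" using K by (auto simp: part_def filter_empty_conv)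
  then show ?case by simp
 next
  case (Suc m)
  have "(%e. lcw (%w. GG w (1 / xx e t)) ps / xx e t ^ j) \<longlonglongrightarrow> lcw (%w. GG w t) (part j ps)"
   by (rule top_part[OF ps Suc.prems(3)]) (use Suc in auto)
  moreover have "(%e. lcw (%w. GG w (1 / xx e t)) ps / xx e t ^ j) \<longlonglongrightarrow> 0"
   by (rule slash_shift[OF L Suc.prems(1)]) (use Suc.prems in auto)
  ultimately show ?case by (rule LIMSEQ_unique)
 qed
 have "(%e. lcw (%w. GG w (1 / xx e t)) ps / xx e t ^ n) \<longlonglongrightarrow> lcw (%w. GG w t) (part n ps)"
  by (rule top_part[OF ps t]) (use z[of _ K] in auto)
 then show ?thesis using L[OF t] LIMSEQ_unique by blast
qed

lemma relation_parts:
 assumes ps: "snd ` set ps \<subseteq> mes_indices" and z: "!!t. 0 < Im t ==> lcw (%w. GG w t) ps = 0" and t: "0 < Im t"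
 shows "lcw (%w. GG w t) (part k ps) = 0" "lcw (%w. dh w t) (part k ps) = 0"
proof -
 have g: "lcw (%w. GG w t) (part k ps) = 0" if "0 < Im t" for t
  by (rule lead_parts[OF ps _ that, of k "%_. 0", symmetric]) (use z xx_nz(2) in auto)
 then show "lcw (%w. GG w t) (part k ps) = 0" using t .
 have "QQ k (%t. 0) (%t. lcw (%w. dh w t) (part k ps))"
  by (rule QQ_cong[OF lcw_QQ[OF ps]]) (use g in auto)
 then show "lcw (%w. dh w t) (part k ps) = 0" by (rule QQ_unique[OF _ QQ_zero t])
qed

lemma open_upper: "open {t. 0 < Im t}"
 by (rule open_halfspace_Im_gt)

lemma holomorphic_dh:
 assumes "w \<in> mes_indices" shows "dh w holomorphic_on {t. 0 < Im t}"
proof (cases w)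
 case Nil
 then have "dh w = (%_. 0)" by (simp add: fun_eq_iff)
 then show ?thesis by simp
next
 case (Cons k u)
 then have "dh w = (if k = 2 then (%t. - (1 / 2) * GG u t) else (%_. 0))" by (auto simp: fun_eq_iff dh_def)
 then show ?thesis using assms Cons by (auto intro!: holomorphic_intros holomorphic_GG)
qed

lemma has_derivative_GG:
 assumes "w \<in> mes_indices" "0 < Im t" shows "(GG w has_field_derivative deriv (GG w) t) (at t)"
 using holomorphic_derivI[OF holomorphic_GG[OF assms(1)] open_upper, of t] assms(2) by simp

lemma slash_derivative:
 assumes w: "w \<in> mes_indices" and t: "0 < Im t"
 defines "k \<equiv> sum_list w"
 shows "((%t. xx e t * (GG w (1 / xx e t) / xx e t ^ k - GG w t)) has_field_derivative
  xx e t * (deriv (GG w) (1 / xx e t) / xx e t ^ (k + 2) - deriv (GG w) t)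
  - (GG w (1 / xx e t) / xx e t ^ k - GG w t) + of_nat k * (GG w (1 / xx e t) / xx e t ^ k)) (at t)"
proof -
 have nz: "xx e t \<noteq> 0" using xx_nz(1)[OF t] .
 have dx: "((%t. xx e t) has_field_derivative - 1) (at t)"
  unfolding xx_def by (auto intro!: derivative_eq_intros)
 have di: "((%t. 1 / xx e t) has_field_derivative 1 / (xx e t)\<^sup>2) (at t)"
  using DERIV_divide[OF DERIV_const dx nz, of 1] by (simp add: power2_eq_square)
 have dG: "((%t. GG w (1 / xx e t)) has_field_derivative deriv (GG w) (1 / xx e t) * (1 / (xx e t)\<^sup>2)) (at t)"
  by (rule DERIV_chain2[OF has_derivative_GG[OF w xx_nz(2)[OF t]] di])
 have du: "((%t. GG w (1 / xx e t) / xx e t ^ k) has_field_derivative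
  (deriv (GG w) (1 / xx e t) * (1 / (xx e t)\<^sup>2) * xx e t ^ k - GG w (1 / xx e t) * (of_nat k * (- 1 * xx e t ^ (k - Suc 0)))) / (xx e t ^ k * xx e t ^ k)) (at t)"
  by (rule DERIV_divide[OF dG DERIV_power[OF dx]]) (use nz in simp)
 note D = DERIV_mult[OF dx DERIV_diff[OF du has_derivative_GG[OF w t]]]
 have alg: "- 1 * (g / x ^ k - h) + ((a * (1 / x\<^sup>2) * x ^ k - g * (of_nat k * (- 1 * x ^ (k - Suc 0)))) / (x ^ k * x ^ k) - b) * x
  = x * (a / x ^ (k + 2) - b) - (g / x ^ k - h) + of_nat k * (g / x ^ k)" if "x \<noteq> 0" for x g h a b :: complex
  using that by (cases k) (simp_all add: field_simps power2_eq_square)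
 show ?thesis using D unfolding alg[OF nz] .
qed

theorem deriv_GG_weight:
 assumes w: "w \<in> mes_indices"
 shows "\<exists>ps. (\<forall>v\<in>snd ` set ps. v \<in> mes_indices \<and> sum_list v = sum_list w + 2) \<and>
  (\<forall>t. 0 < Im t \<longrightarrow> 2 * of_real pi * \<i> * deriv (GG w) t = lcw (%v. GG v t) ps \<and>
   lcw (%v. dh v t) ps = 2 * of_real pi * \<i> * deriv (dh w) t + of_nat (sum_list w) * GG w t)"
proof -
 let ?k = "sum_list w" and ?c = "2 * of_real pi * \<i> :: complex"
 obtain ps where ps: "snd ` set ps \<subseteq> mes_indices" "!!t. 0 < Im t ==> ?c * deriv (GG w) t = lcw (%v. GG v t) ps"
  using deriv_GG_span[OF w] by blast
 let ?\<phi> = "%e t. xx e t * (GG w (1 / xx e t) / xx e t ^ ?k - GG w t)"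
 have hol: "?\<phi> e holomorphic_on {t. 0 < Im t}" for e
  unfolding holomorphic_on_open[OF open_upper] using slash_derivative[OF w] by blast
 have lim: "(%e. xx e t * ((?c * deriv (GG w) (1 / xx e t)) / xx e t ^ (?k + 2) - ?c * deriv (GG w) t))
   \<longlonglongrightarrow> - ?c * (?c * deriv (dh w) t + of_nat ?k * GG w t)" if t: "0 < Im t" for t
 proof -
  have "(%e. deriv (?\<phi> e) t) \<longlonglongrightarrow> deriv (%t. - 2 * of_real pi * \<i> * dh w t) t"
   by (rule deriv_upper_limit[OF hol t]) (rule QQD(1)[OF QQ_word[OF w]])
  also have "deriv (%t. - 2 * of_real pi * \<i> * dh w t) t = - 2 * of_real pi * \<i> * deriv (dh w) t"
   by (rule deriv_cmult) (use holomorphic_dh[OF w] t open_upper in \<open>auto simp: holomorphic_on_imp_differentiable_at\<close>)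
  finally have 1: "(%e. deriv (?\<phi> e) t) \<longlonglongrightarrow> - 2 * of_real pi * \<i> * deriv (dh w) t" .
  note 2 = QQ_pointwise(1)[OF QQ_word[OF w] t]
  have "(%e. ?c * (deriv (?\<phi> e) t + (GG w (1 / xx e t) / xx e t ^ ?k - GG w t) - of_nat ?k * (GG w (1 / xx e t) / xx e t ^ ?k)))
   \<longlonglongrightarrow> ?c * (- 2 * of_real pi * \<i> * deriv (dh w) t + (GG w t - GG w t) - of_nat ?k * GG w t)"
   by (intro tendsto_mult_left tendsto_diff tendsto_add 1 2 tendsto_const)
  moreover have "?c * (deriv (?\<phi> e) t + (GG w (1 / xx e t) / xx e t ^ ?k - GG w t) - of_nat ?k * (GG w (1 / xx e t) / xx e t ^ ?k))
   = xx e t * ((?c * deriv (GG w) (1 / xx e t)) / xx e t ^ (?k + 2) - ?c * deriv (GG w) t)" for e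
   unfolding DERIV_imp_deriv[OF slash_derivative[OF w t]] by (simp add: algebra_simps)
  moreover have "?c * (- 2 * of_real pi * \<i> * deriv (dh w) t + (GG w t - GG w t) - of_nat ?k * GG w t)
   = - ?c * (?c * deriv (dh w) t + of_nat ?k * GG w t)" by (simp add: algebra_simps)
  ultimately show ?thesis by (simp only:)
 qed
 have sl: "(%e. lcw (%v. GG v (1 / xx e t)) ps / xx e t ^ (?k + 2)) \<longlonglongrightarrow> ?c * deriv (GG w) t" if t: "0 < Im t" for t
 proof -
  have "(%e. (1 / xx e t) ^ 1 * (xx e t * ((?c * deriv (GG w) (1 / xx e t)) / xx e t ^ (?k + 2) - ?c * deriv (GG w) t)) + ?c * deriv (GG w) t)
   \<longlonglongrightarrow> 0 * (- ?c * (?c * deriv (dh w) t + of_nat ?k * GG w t)) + ?c * deriv (GG w) t"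
   by (intro tendsto_add tendsto_mult inv_xx_tendsto lim t tendsto_const) simp
  moreover have "(1 / x) ^ 1 * (x * (a / X - b)) + b = a / X" if "x \<noteq> 0" for x a X b :: complex using that by simp
  ultimately show ?thesis unfolding ps(2)[OF xx_nz(2)[OF t], symmetric] using xx_nz(1)[OF t] by simp
 qed
 have eq: "?c * deriv (GG w) t = lcw (%v. GG v t) (part (?k + 2) ps)" if "0 < Im t" for t
  by (rule lead_parts[OF ps(1) sl that])
 have "lcw (%v. dh v t) (part (?k + 2) ps) = ?c * deriv (dh w) t + of_nat ?k * GG w t" if t: "0 < Im t" for t
 proof -
  have "(%e. xx e t * (lcw (%v. GG v (1 / xx e t)) (part (?k + 2) ps) / xx e t ^ (?k + 2) - lcw (%v. GG v t) (part (?k + 2) ps)))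
   \<longlonglongrightarrow> - 2 * of_real pi * \<i> * lcw (%v. dh v t) (part (?k + 2) ps)"
   by (rule QQ_pointwise(2)[OF lcw_QQ[OF ps(1)] t])
  then have "- 2 * of_real pi * \<i> * lcw (%v. dh v t) (part (?k + 2) ps) = - ?c * (?c * deriv (dh w) t + of_nat ?k * GG w t)"
   unfolding eq[OF t, symmetric] eq[OF xx_nz(2)[OF t], symmetric] using lim[OF t] by (rule LIMSEQ_unique)
  then show ?thesis by simp
 qed
 then show ?thesis using eq ps(1) by (intro exI[of _ "part (?k + 2) ps"]) (auto simp: set_part)
qed

section \<open>Derivations on the span\<close>

definition uh :: "(nat list => complex => complex) => nat list => uhp => complex" where
 "uh h w = (%\<tau>. h w (of_uhp \<tau>))"

definition ev :: "(nat list => complex => complex) => (rat \<times> nat list) list => uhp => complex" where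
 "ev h ps = (%\<tau>. lcw (%w. h w (of_uhp \<tau>)) ps)"

lemma ev_simps [simp]:
 "ev h [] = 0" "ev h ((q, w) # ps) = scaleQ q (uh h w) + ev h ps" "ev h (ps @ qs) = ev h ps + ev h qs"
 "ev h (map (%(q, w). (c * q, w)) ps) = scaleQ c (ev h ps)"
 by (simp_all add: ev_def uh_def scaleQ_def fun_eq_iff lcw_scale)

lemma ev_single: "ev h [(1, w)] = uh h w"
 by (simp add: ev_def uh_def fun_eq_iff)

lemma ev_one: "ev h (map (Pair 1) ws) = (%\<tau>. \<Sum>w\<leftarrow>ws. h w (of_uhp \<tau>))"
 by (induction ws) (simp_all add: uh_def scaleQ_def fun_eq_iff)

lemma uh_GG: "w \<in> mes_indices ==> uh GG w = G w"
 by (simp add: uh_def G_eq_GG fun_eq_iff)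

lemma ex_of_uhp: "0 < Im t ==> \<exists>\<tau>. t = of_uhp \<tau>"
 using Uhp_inverse[of t] by (metis mem_Collect_eq)

lemma G_Nil: "G [] = 1"
 using G_eq_GG[of "[]"] by (simp add: fun_eq_iff)

lemma Q_span_induct:
 assumes "f \<in> Q.span B" "P 0"
  and "!!c x y. x \<in> B ==> y \<in> Q.span B ==> P y ==> P (scaleQ c x + y)"
 shows "P f"
proof -
 have "f \<in> Q.span B \<and> P f"
 proof (rule Q.span_induct_alt[OF assms(1), where h = "%f. f \<in> Q.span B \<and> P f"])
  show "0 \<in> Q.span B \<and> P 0" using Q.span_zero assms(2) by (rule conjI)
  show "scaleQ c x + y \<in> Q.span B \<and> P (scaleQ c x + y)" if "x \<in> B" "y \<in> Q.span B \<and> P y" for c x y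
   using Q.span_add[OF Q.span_scale[OF Q.span_base[OF that(1)]]] assms(3)[OF that(1)] that(2) by blast
 qed
 then show ?thesis ..
qed

lemma span_iff_ev:
 assumes "S \<subseteq> mes_indices"
 shows "f \<in> Q.span (G ` S) \<longleftrightarrow> (\<exists>ps. snd ` set ps \<subseteq> S \<and> f = ev GG ps)"
proof
 assume "f \<in> Q.span (G ` S)"
 then show "\<exists>ps. snd ` set ps \<subseteq> S \<and> f = ev GG ps"
 proof (rule Q_span_induct[where P = "%f. \<exists>ps. snd ` set ps \<subseteq> S \<and> f = ev GG ps"])
  show "\<exists>ps. snd ` set ps \<subseteq> S \<and> 0 = ev GG ps" by (intro exI[of _ "[]"]) simp
  fix c x y assume "x \<in> G ` S" "\<exists>ps. snd ` set ps \<subseteq> S \<and> y = ev GG ps"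
  then obtain w ps where "w \<in> S" "x = G w" "snd ` set ps \<subseteq> S" "y = ev GG ps" by blast
  then show "\<exists>ps. snd ` set ps \<subseteq> S \<and> scaleQ c x + y = ev GG ps"
   using assms by (intro exI[of _ "(c, w) # ps"]) (simp add: uh_GG subset_iff)
 qed
next
 have "snd ` set ps \<subseteq> S ==> ev GG ps \<in> Q.span (G ` S)" for ps
 proof (induction ps)
  case (Cons p ps)
  obtain q w where p: "p = (q, w)" by (cases p)
  have w: "w \<in> S" using Cons.prems p by auto
  have e: "ev GG (p # ps) = scaleQ q (G w) + ev GG ps" using w assms by (simp add: p uh_GG subset_iff)
  have "ev GG ps \<in> Q.span (G ` S)" using Cons by simp
  then show ?case unfolding e by (rule Q.span_add[OF Q.span_scale[OF Q.span_base[OF imageI[OF w]]]])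
 qed (simp add: Q.span_zero)
 then show "\<exists>ps. snd ` set ps \<subseteq> S \<and> f = ev GG ps ==> f \<in> Q.span (G ` S)" by blast
qed

lemma MES_iff: "f \<in> MES \<longleftrightarrow> (\<exists>ps. snd ` set ps \<subseteq> mes_indices \<and> f = ev GG ps)"
 unfolding MES_def by (rule span_iff_ev) simp

lemma subspace_MES: "Q.subspace MES"
 unfolding MES_def by (rule Q.subspace_span)

lemmas MES_closed = Q.subspace_0[OF subspace_MES] Q.subspace_add[OF subspace_MES] Q.subspace_scale[OF subspace_MES]

lemma G_in_MES: "w \<in> mes_indices ==> G w \<in> MES"
 unfolding MES_def by (auto intro: Q.span_base)

lemma G_mult:
 assumes "u \<in> mes_indices" "v \<in> mes_indices"
 shows "G u * G v = ev GG (map (Pair 1) (qsh u v))"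
 by (simp add: ev_one fun_eq_iff G_eq_GG assms GG_mult of_uhp_pos)

lemma scaleQ_mult: "scaleQ c f * g = scaleQ c (f * g)" "f * scaleQ c g = scaleQ c (f * g)"
 by (simp_all add: scaleQ_def fun_eq_iff)

lemma span_mult_closed:
 assumes "!!x y. x \<in> S ==> y \<in> S ==> x * y \<in> Q.span S" "f \<in> Q.span S" "g \<in> Q.span S"
 shows "f * g \<in> Q.span S"
proof -
 have *: "x * g \<in> Q.span S" if x: "x \<in> S" for x
 proof (rule Q_span_induct[OF assms(3), where P = "%g. x * g \<in> Q.span S"])
  show "x * (scaleQ c y + z) \<in> Q.span S" if "y \<in> S" "x * z \<in> Q.span S" for c y z
   unfolding distrib_left scaleQ_mult by (rule Q.span_add[OF Q.span_scale[OF assms(1)[OF x that(1)]] that(2)])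
 qed (simp add: Q.span_zero)
 show ?thesis
 proof (rule Q_span_induct[OF assms(2), where P = "%f. f * g \<in> Q.span S"])
  show "(scaleQ c y + z) * g \<in> Q.span S" if "y \<in> S" "z * g \<in> Q.span S" for c y z
   unfolding distrib_right scaleQ_mult by (rule Q.span_add[OF Q.span_scale[OF *[OF that(1)]] that(2)])
 qed (simp add: Q.span_zero)
qed

lemma subalgebra_span:
 assumes "S \<subseteq> mes_indices" "[] \<in> S" "!!u v w. u \<in> S ==> v \<in> S ==> w \<in> set (qsh u v) ==> w \<in> S"
 shows "rat_subalgebra (Q.span (G ` S))"
 unfolding rat_subalgebra_def
proof (intro conjI ballI)
 show "1 \<in> Q.span (G ` S)" using assms(2) by (intro Q.span_base) (force simp: G_Nil)
 fix f g assume fg: "f \<in> Q.span (G ` S)" "g \<in> Q.span (G ` S)"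
 show "f * g \<in> Q.span (G ` S)"
 proof (rule span_mult_closed[OF _ fg])
  fix x y assume "x \<in> G ` S" "y \<in> G ` S"
  then obtain u v where uv: "u \<in> S" "v \<in> S" "x = G u" "y = G v" by blast
  have "x * y = ev GG (map (Pair 1) (qsh u v))" unfolding uv(3,4) by (rule G_mult) (use uv(1,2) assms(1) in blast)+
  then show "x * y \<in> Q.span (G ` S)"
   unfolding span_iff_ev[OF assms(1)] using assms(3)[OF uv(1,2)] by (intro exI[of _ "map (Pair 1) (qsh u v)"]) auto
 qed
qed (rule Q.subspace_span)

lemma subalgebra_MES: "rat_subalgebra MES"
 unfolding MES_def by (rule subalgebra_span) (auto intro: mes_indices_qsh)

lemma MES_mult: "f \<in> MES ==> g \<in> MES ==> f * g \<in> MES"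
 using subalgebra_MES by (simp add: rat_subalgebra_def)

lemma holomorphic_MES:
 assumes "f \<in> MES" shows "holomorphic_uhp f"
proof -
 have "f \<in> Q.span (G ` mes_indices)" using assms by (simp add: MES_def)
 then show ?thesis
 proof (rule Q_span_induct[where P = holomorphic_uhp])
  have "(0 :: uhp => complex) \<circ> Uhp = (%_. 0)" by (simp add: fun_eq_iff)
  then show "holomorphic_uhp 0" by (simp add: holomorphic_uhp_def)
  fix c x y assume xy: "x \<in> G ` mes_indices" "holomorphic_uhp y"
  then obtain w where w: "w \<in> mes_indices" "x = G w" by blast
  have e: "(scaleQ c x + y) \<circ> Uhp = (%t. of_rat c * (x \<circ> Uhp) t + (y \<circ> Uhp) t)"
   by (simp add: fun_eq_iff scaleQ_def)
  have x: "x \<circ> Uhp holomorphic_on {t. 0 < Im t}"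
   by (rule holomorphic_transform[OF holomorphic_GG[OF w(1)]]) (simp add: w G_eq_GG Uhp_inverse)
  show "holomorphic_uhp (scaleQ c x + y)"
   unfolding holomorphic_uhp_def e
   by (rule holomorphic_on_add[OF holomorphic_on_mult[OF holomorphic_on_const x] xy(2)[unfolded holomorphic_uhp_def]])
 qed
qed

definition ext :: "(nat list => complex => complex) => operator" where
 "ext h f = ev h (SOME ps. snd ` set ps \<subseteq> mes_indices \<and> f = ev GG ps)"

lemma ext_ev:
 assumes ker: "!!ps. snd ` set ps \<subseteq> mes_indices ==> ev GG ps = 0 ==> ev h ps = 0"
  and ps: "snd ` set ps \<subseteq> mes_indices"
 shows "ext h (ev GG ps) = ev h ps"
proof -
 define qs where "qs = (SOME qs. snd ` set qs \<subseteq> mes_indices \<and> ev GG ps = ev GG qs)"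
 have qs: "snd ` set qs \<subseteq> mes_indices \<and> ev GG ps = ev GG qs"
  unfolding qs_def by (rule someI[of _ ps]) (use ps in simp)
 have "ev h (ps @ map (%(q, w). (- 1 * q, w)) qs) = 0"
 proof (rule ker)
  show "snd ` set (ps @ map (%(q, w). (- 1 * q, w)) qs) \<subseteq> mes_indices" using ps qs by force
  show "ev GG (ps @ map (%(q, w). (- 1 * q, w)) qs) = 0"
   unfolding ev_simps using qs by (simp add: scaleQ_def fun_eq_iff)
 qed
 then have "ev h ps = ev h qs" unfolding ev_simps by (simp add: scaleQ_def fun_eq_iff)
 then show ?thesis by (simp add: ext_def qs_def)
qed

lemma derivation_extension:
 assumes T: "!!ps. snd ` set ps \<subseteq> mes_indices ==> T (ev GG ps) = ev h ps"
  and im: "!!w. w \<in> mes_indices ==> uh h w \<in> MES"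
  and leibniz: "!!u v t. u \<in> mes_indices ==> v \<in> mes_indices ==> 0 < Im t ==>
   (\<Sum>w\<leftarrow>qsh u v. h w t) = h u t * GG v t + GG u t * h v t"
 shows "derivation_on MES T"
proof -
 have TG: "T (G w) = uh h w" if "w \<in> mes_indices" for w
  using T[of "[(1, w)]"] that unfolding ev_single by (simp add: uh_GG)
 have add: "T (f + g) = T f + T g" if "f \<in> MES" "g \<in> MES" for f g
 proof -
  obtain ps qs where ps: "snd ` set ps \<subseteq> mes_indices" "f = ev GG ps"
   and qs: "snd ` set qs \<subseteq> mes_indices" "g = ev GG qs"
   using \<open>f \<in> MES\<close>[unfolded MES_iff] \<open>g \<in> MES\<close>[unfolded MES_iff] by blast
  have "T (ev GG (ps @ qs)) = ev h (ps @ qs)" by (rule T) (use ps(1) qs(1) in auto)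
  then show ?thesis unfolding ps(2) qs(2) T[OF ps(1)] T[OF qs(1)] ev_simps .
 qed
 have scale: "T (scaleQ c f) = scaleQ c (T f)" if "f \<in> MES" for c f
 proof -
  obtain ps where ps: "snd ` set ps \<subseteq> mes_indices" "f = ev GG ps" using \<open>f \<in> MES\<close>[unfolded MES_iff] by blast
  have "T (ev GG (map (%(q, w). (c * q, w)) ps)) = ev h (map (%(q, w). (c * q, w)) ps)"
   by (rule T) (use ps(1) in force)
  then show ?thesis unfolding ps(2) T[OF ps(1)] ev_simps .
 qed
 have closed: "T f \<in> MES" if "f \<in> MES" for f
 proof -
  obtain ps where ps: "snd ` set ps \<subseteq> mes_indices" "f = ev GG ps" using \<open>f \<in> MES\<close>[unfolded MES_iff] by blast
  have "ev h ps \<in> MES" using ps(1)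
  proof (induction ps)
   case (Cons p ps)
   then show ?case by (cases p) (simp only: ev_simps MES_closed im insert_subset snd_conv list.set image_insert)
  qed (simp add: MES_closed)
  then show ?thesis unfolding ps(2) T[OF ps(1)] .
 qed
 have gen: "T (G u * G v) = T (G u) * G v + G u * T (G v)" if "u \<in> mes_indices" "v \<in> mes_indices" for u v
 proof -
  have "T (G u * G v) = ev h (map (Pair 1) (qsh u v))"
   unfolding G_mult[OF that] by (rule T) (use mes_indices_qsh that in auto)
  then show ?thesis
   unfolding TG[OF that(1)] TG[OF that(2)] ev_one
   by (simp add: leibniz that of_uhp_pos uh_def G_eq_GG fun_eq_iff)
 qed
 have "T (ev GG []) = ev h []" by (rule T) simp
 then have zero: "T 0 = 0" unfolding ev_simps .
 have one: "T (G u * g) = T (G u) * g + G u * T g" if u: "u \<in> mes_indices" and g: "g \<in> MES" for u g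
 proof -
  have "g \<in> Q.span (G ` mes_indices)" using g by (simp add: MES_def)
  then show ?thesis
  proof (rule Q_span_induct[where P = "%g. T (G u * g) = T (G u) * g + G u * T g"])
   fix c x y assume step: "x \<in> G ` mes_indices" "y \<in> Q.span (G ` mes_indices)" "T (G u * y) = T (G u) * y + G u * T y"
   then obtain v where v: "v \<in> mes_indices" "x = G v" by blast
   have y: "y \<in> MES" using step(2) by (simp add: MES_def)
   have e1: "T (G u * (scaleQ c x + y)) = scaleQ c (T (G u * G v)) + T (G u * y)"
    unfolding distrib_left scaleQ_mult v(2)
    using y v u by (simp only: add scale MES_closed MES_mult G_in_MES)
   have e2: "T (scaleQ c x + y) = scaleQ c (T (G v)) + T y"
    unfolding v(2) using y v by (simp only: add scale MES_closed G_in_MES)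
   show "T (G u * (scaleQ c x + y)) = T (G u) * (scaleQ c x + y) + G u * T (scaleQ c x + y)"
    unfolding e1 e2 gen[OF u v(1)] step(3) by (simp add: v(2) scaleQ_def fun_eq_iff algebra_simps)
  qed (simp add: zero)
 qed
 have "T (f * g) = T f * g + f * T g" if f: "f \<in> MES" and g: "g \<in> MES" for f g
 proof -
  have "f \<in> Q.span (G ` mes_indices)" using f by (simp add: MES_def)
  then show ?thesis
  proof (rule Q_span_induct[where P = "%f. T (f * g) = T f * g + f * T g"])
   fix c x y assume step: "x \<in> G ` mes_indices" "y \<in> Q.span (G ` mes_indices)" "T (y * g) = T y * g + y * T g"
   then obtain v where v: "v \<in> mes_indices" "x = G v" by blast
   have y: "y \<in> MES" using step(2) by (simp add: MES_def)
   have e1: "T ((scaleQ c x + y) * g) = scaleQ c (T (G v * g)) + T (y * g)"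
    unfolding distrib_right scaleQ_mult v(2)
    using y v g by (simp only: add scale MES_closed MES_mult G_in_MES)
   have e2: "T (scaleQ c x + y) = scaleQ c (T (G v)) + T y"
    unfolding v(2) using y v by (simp only: add scale MES_closed G_in_MES)
   show "T ((scaleQ c x + y) * g) = T (scaleQ c x + y) * g + (scaleQ c x + y) * T g"
    unfolding e1 e2 one[OF v(1) g] step(3) by (simp add: v(2) scaleQ_def fun_eq_iff algebra_simps)
  qed (simp add: zero)
 qed
 then show ?thesis unfolding derivation_on_def using closed add scale by blast
qed

definition wht :: "nat list => complex => complex" where
 "wht w t = of_nat (sum_list w) * GG w t"

lemma kernel_parts:
 assumes ps: "snd ` set ps \<subseteq> mes_indices" and z: "ev GG ps = 0"
 shows "ev wht ps = 0" "ev dh ps = 0"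
  "0 < Im t ==> lcw (%w. GG w t) (part k ps) = 0"
proof -
 have *: "lcw (%w. GG w t) ps = 0" if t: "0 < Im t" for t
  using ex_of_uhp[OF t] fun_cong[OF z] by (auto simp: ev_def)
 note r = relation_parts[OF ps *]
 show "lcw (%w. GG w t) (part k ps) = 0" if "0 < Im t" using r that by blast
 obtain K where K: "\<forall>p\<in>set ps. sum_list (snd p) < K" using ex_weight_bound by blast
 show "ev dh ps = 0" by (simp add: fun_eq_iff ev_def lcw_parts[OF K] r of_uhp_pos)
 have "lcw (%w. wht w t) (part k ps) = of_nat k * lcw (%w. GG w t) (part k ps)" for k t
  by (induction ps) (auto simp: wht_def algebra_simps)
 then show "ev wht ps = 0" by (simp add: fun_eq_iff ev_def lcw_parts[OF K] r of_uhp_pos)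
qed

lemma ev_wt_homogeneous:
 assumes "!!v. v \<in> snd ` set ps ==> sum_list v = n"
 shows "ev wht ps = scaleQ (of_nat n) (ev GG ps)"
 using assms
proof (induction ps)
 case (Cons p ps)
 obtain q v where p: "p = (q, v)" by (cases p)
 have 1: "ev wht ps = scaleQ (of_nat n) (ev GG ps)" using Cons by simp
 have "sum_list v = n" using Cons.prems by (simp add: p)
 then have 2: "uh wht v = scaleQ (of_nat n) (uh GG v)" by (simp add: uh_def wht_def scaleQ_def fun_eq_iff)
 show ?case unfolding p ev_simps 1 2 by (simp add: scaleQ_def fun_eq_iff algebra_simps)
qed (simp add: scaleQ_def fun_eq_iff)

lemma uh_wt: "w \<in> mes_indices ==> uh wht w = scaleQ (of_nat (sum_list w)) (G w)"
 by (simp add: uh_def wht_def scaleQ_def fun_eq_iff G_eq_GG)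

lemma uh_dh: "k # w \<in> mes_indices ==> uh dh (k # w) = (if k = 2 then scaleQ (- 1 / 2) (G w) else 0)" "uh dh [] = 0"
 by (simp_all add: uh_def scaleQ_def fun_eq_iff G_eq_GG dh_def of_rat_divide of_rat_minus)

lemma derivation_wt: "derivation_on MES (ext wht)"
proof (rule derivation_extension[OF ext_ev])
 fix u v t assume uv: "u \<in> mes_indices" "v \<in> mes_indices" "0 < Im t"
 have "(\<Sum>w\<leftarrow>qsh u v. wht w t) = (\<Sum>w\<leftarrow>qsh u v. of_nat (sum_list u + sum_list v) * GG w t)"
  by (intro arg_cong[of _ _ sum_list] map_cong refl) (simp add: wht_def sum_list_qsh)
 also have "... = of_nat (sum_list u + sum_list v) * (GG u t * GG v t)"
  by (simp only: sum_list_const_mult GG_mult[OF uv(3,1,2)])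
 finally show "(\<Sum>w\<leftarrow>qsh u v. wht w t) = wht u t * GG v t + GG u t * wht v t"
  by (simp add: wht_def algebra_simps)
qed (simp_all only: kernel_parts uh_wt MES_closed G_in_MES)

lemma derivation_dh: "derivation_on MES (ext dh)"
proof (rule derivation_extension[OF ext_ev])
 fix w assume "w \<in> mes_indices"
 then show "uh dh w \<in> MES"
  by (cases w) (auto simp only: uh_dh MES_closed G_in_MES mes_indices_Cons split: if_split)
qed (auto simp: kernel_parts dh_qsh)

lemma ext_G:
 assumes "w \<in> mes_indices"
 shows "ext wht (G w) = scaleQ (of_nat (sum_list w)) (G w)" "ext dh (G w) = uh dh w"
proof -
 have "ext wht (ev GG [(1, w)]) = ev wht [(1, w)]" "ext dh (ev GG [(1, w)]) = ev dh [(1, w)]"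
  by (rule ext_ev; use kernel_parts assms in simp)+
 then show "ext wht (G w) = scaleQ (of_nat (sum_list w)) (G w)" "ext dh (G w) = uh dh w"
  unfolding ev_single using assms by (simp_all add: uh_wt uh_GG)
qed

definition Dop :: operator where
 "Dop f = (%\<tau>. 2 * of_real pi * \<i> * ddtau f \<tau>)"

lemma ddtau_of_uhp: "ddtau (%\<tau>. F (of_uhp \<tau>)) \<tau> = deriv F (of_uhp \<tau>)"
proof -
 have "eventually (%t. t \<in> {t. 0 < Im t}) (nhds (of_uhp \<tau>))"
  by (rule eventually_nhds_in_open[OF open_upper]) (simp add: of_uhp_pos)
 then have "\<forall>\<^sub>F t in nhds (of_uhp \<tau>). ((%\<tau>. F (of_uhp \<tau>)) \<circ> Uhp) t = F t"
  by eventually_elim (simp add: Uhp_inverse)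
 then show ?thesis unfolding ddtau_def by (rule deriv_cong_ev) simp
qed

lemma Dop_uh: "Dop (uh h w) = (%\<tau>. 2 * of_real pi * \<i> * deriv (h w) (of_uhp \<tau>))"
 by (simp add: Dop_def uh_def ddtau_of_uhp)

lemma Dop_G:
 assumes "w \<in> mes_indices"
 shows "\<exists>ps. (\<forall>v\<in>snd ` set ps. v \<in> mes_indices \<and> sum_list v = sum_list w + 2) \<and>
  Dop (G w) = ev GG ps \<and> ev dh ps = Dop (uh dh w) + scaleQ (of_nat (sum_list w)) (G w)"
proof -
 obtain ps where ps: "\<forall>v\<in>snd ` set ps. v \<in> mes_indices \<and> sum_list v = sum_list w + 2"
  "!!t. 0 < Im t ==> 2 * of_real pi * \<i> * deriv (GG w) t = lcw (%v. GG v t) ps"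
  "!!t. 0 < Im t ==> lcw (%v. dh v t) ps = 2 * of_real pi * \<i> * deriv (dh w) t + of_nat (sum_list w) * GG w t"
  using deriv_GG_weight[OF assms] by blast
 have "Dop (G w) = ev GG ps"
  unfolding uh_GG[OF assms, symmetric] Dop_uh by (simp add: fun_eq_iff ev_def ps(2) of_uhp_pos)
 moreover have "ev dh ps = Dop (uh dh w) + scaleQ (of_nat (sum_list w)) (G w)"
  unfolding Dop_uh by (simp add: fun_eq_iff ev_def ps(3) of_uhp_pos scaleQ_def G_eq_GG assms)
 ultimately show ?thesis using ps(1) by blast
qed

lemma derivation_Dop: "derivation_on MES Dop"
proof -
 have d: "(f \<circ> Uhp) field_differentiable at (of_uhp \<tau>)" if "f \<in> MES" for f \<tau>
  using holomorphic_on_imp_differentiable_at[OF holomorphic_MES[OF that, unfolded holomorphic_uhp_def] open_upper]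
  by (simp add: of_uhp_pos)
 have add: "Dop (f + g) = Dop f + Dop g" if "f \<in> MES" "g \<in> MES" for f g
 proof -
  have e: "(f + g) \<circ> Uhp = (%t. (f \<circ> Uhp) t + (g \<circ> Uhp) t)" by (simp add: fun_eq_iff)
  show ?thesis
   unfolding Dop_def ddtau_def e deriv_add[OF d[OF that(1)] d[OF that(2)]] by (simp add: fun_eq_iff algebra_simps)
 qed
 have scale: "Dop (scaleQ c f) = scaleQ c (Dop f)" if "f \<in> MES" for c f
 proof -
  have e: "scaleQ c f \<circ> Uhp = (%t. of_rat c * (f \<circ> Uhp) t)" by (simp add: fun_eq_iff scaleQ_def)
  show ?thesis
   unfolding Dop_def ddtau_def e deriv_cmult[OF d[OF that]] by (simp add: scaleQ_def fun_eq_iff algebra_simps)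
 qed
 have mult: "Dop (f * g) = Dop f * g + f * Dop g" if "f \<in> MES" "g \<in> MES" for f g
 proof -
  have e: "(f * g) \<circ> Uhp = (%t. (f \<circ> Uhp) t * (g \<circ> Uhp) t)" by (simp add: fun_eq_iff)
  show ?thesis
   unfolding Dop_def ddtau_def e deriv_mult[OF d[OF that(1)] d[OF that(2)]]
   by (simp add: fun_eq_iff algebra_simps of_uhp_inverse)
 qed
 have "Dop f \<in> MES" if "f \<in> MES" for f
 proof -
  obtain ps where ps: "snd ` set ps \<subseteq> mes_indices" "f = ev GG ps" using \<open>f \<in> MES\<close>[unfolded MES_iff] by blast
  have "ev GG ps \<in> MES \<and> Dop (ev GG ps) \<in> MES" using ps(1)
  proof (induction ps)
   case Nil
   have "Dop 0 = 0" using scale[OF MES_closed(1), of 0] by simp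
   then show "ev GG [] \<in> MES \<and> Dop (ev GG []) \<in> MES" unfolding ev_simps using MES_closed(1) by simp
  next
   case (Cons p ps)
   obtain q w where p: "p = (q, w)" by (cases p)
   have w: "w \<in> mes_indices" and IH: "ev GG ps \<in> MES" "Dop (ev GG ps) \<in> MES" using Cons p by auto
   have "Dop (G w) \<in> MES" using Dop_G[OF w] by (auto simp: MES_iff)
   then show ?case using w IH by (simp only: p ev_simps uh_GG add scale MES_closed G_in_MES simp_thms)
  qed
  then show ?thesis using ps by simp
 qed
 then show ?thesis unfolding derivation_on_def using add scale mult by blast
qed

lemma bracket_span:
 assumes X: "derivation_on MES X" and Y: "derivation_on MES Y" and Z: "derivation_on MES Z"
  and gen: "!!w. w \<in> mes_indices ==> bracket X Y (G w) = scaleQ c (Z (G w))" and f: "f \<in> MES"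
 shows "bracket X Y f = scaleQ c (Z f)"
proof -
 have lin: "T (scaleQ q g + h) = scaleQ q (T g) + T h" if "derivation_on MES T" "g \<in> MES" "h \<in> MES" for T q g h
  using that MES_closed unfolding derivation_on_def by metis
 have zero: "T 0 = 0" if "derivation_on MES T" for T
 proof -
  have "T (scaleQ 0 0) = scaleQ 0 (T 0)" using that MES_closed(1) unfolding derivation_on_def by blast
  then show ?thesis by simp
 qed
 note closed = X[unfolded derivation_on_def, THEN conjunct1, rule_format] Y[unfolded derivation_on_def, THEN conjunct1, rule_format]
 have "f \<in> Q.span (G ` mes_indices)" using f by (simp add: MES_def)
 then show ?thesis
 proof (rule Q_span_induct[where P = "%f. bracket X Y f = scaleQ c (Z f)"])
  show "bracket X Y 0 = scaleQ c (Z 0)" unfolding bracket_def zero[OF X] zero[OF Y] zero[OF Z] by (simp add: fun_eq_iff scaleQ_def)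
  fix q x y assume xy: "x \<in> G ` mes_indices" "y \<in> Q.span (G ` mes_indices)" "bracket X Y y = scaleQ c (Z y)"
  then obtain w where w: "w \<in> mes_indices" "x = G w" by blast
  have x: "x \<in> MES" and y: "y \<in> MES" using xy w by (simp_all add: MES_def G_in_MES[unfolded MES_def])
  have 1: "X (Y x) - Y (X x) = scaleQ c (Z x)" "X (Y y) - Y (X y) = scaleQ c (Z y)"
   using gen[OF w(1)] xy(3) by (simp_all add: bracket_def w(2))
  have "bracket X Y (scaleQ q x + y) = scaleQ q (X (Y x) - Y (X x)) + (X (Y y) - Y (X y))"
   unfolding bracket_def lin[OF X x y] lin[OF Y x y] lin[OF X closed(2)[OF x] closed(2)[OF y]] lin[OF Y closed(1)[OF x] closed(1)[OF y]]
   by (simp add: scaleQ_def fun_eq_iff algebra_simps)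
  then show "bracket X Y (scaleQ q x + y) = scaleQ c (Z (scaleQ q x + y))"
   unfolding 1 lin[OF Z x y] by (simp add: scaleQ_def fun_eq_iff algebra_simps)
 qed
qed

lemma derivation_scale: "derivation_on MES T ==> f \<in> MES ==> T (scaleQ q f) = scaleQ q (T f)"
 and derivation_zero: "derivation_on MES T ==> T 0 = 0"
proof -
 show *: "derivation_on MES T ==> f \<in> MES ==> T (scaleQ q f) = scaleQ q (T f)" for f q
  unfolding derivation_on_def by blast
 show "derivation_on MES T ==> T 0 = 0"
  using *[OF _ MES_closed(1), of 0] by simp
qed

lemma bracket_wt_D:
 assumes "f \<in> MES" shows "bracket (ext wht) Dop f = scaleQ 2 (Dop f)"
proof (rule bracket_span[OF derivation_wt derivation_Dop derivation_Dop _ assms])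
 fix w assume w: "w \<in> mes_indices"
 obtain ps where ps: "!!v. v \<in> snd ` set ps ==> v \<in> mes_indices \<and> sum_list v = sum_list w + 2" "Dop (G w) = ev GG ps"
  using Dop_G[OF w] by blast
 have "ext wht (Dop (G w)) = ev wht ps"
  unfolding ps(2) by (rule ext_ev) (use ps kernel_parts in auto)
 also have "... = scaleQ (of_nat (sum_list w + 2)) (Dop (G w))"
  unfolding ps(2) by (rule ev_wt_homogeneous) (use ps in blast)
 finally have 1: "ext wht (Dop (G w)) = scaleQ (of_nat (sum_list w + 2)) (Dop (G w))" .
 have 2: "Dop (ext wht (G w)) = scaleQ (of_nat (sum_list w)) (Dop (G w))"
  unfolding ext_G[OF w] by (rule derivation_scale[OF derivation_Dop G_in_MES[OF w]])
 show "bracket (ext wht) Dop (G w) = scaleQ 2 (Dop (G w))"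
  unfolding bracket_def 1 2 by (simp add: scaleQ_def fun_eq_iff algebra_simps of_rat_add)
qed

lemma bracket_wt_dh:
 assumes "f \<in> MES" shows "bracket (ext wht) (ext dh) f = scaleQ (- 2) (ext dh f)"
proof (rule bracket_span[OF derivation_wt derivation_dh derivation_dh _ assms])
 fix w assume w: "w \<in> mes_indices"
 have 2: "ext dh (ext wht (G w)) = scaleQ (of_nat (sum_list w)) (ext dh (G w))"
  unfolding ext_G(1)[OF w] by (rule derivation_scale[OF derivation_dh G_in_MES[OF w]])
 show "bracket (ext wht) (ext dh) (G w) = scaleQ (- 2) (ext dh (G w))"
 proof (cases "\<exists>u. w = 2 # u")
  case True
  then obtain u where u: "w = 2 # u" by blast
  have uM: "u \<in> mes_indices" using w u by simp
  have 3: "ext dh (G w) = scaleQ (- 1 / 2) (G u)" using w unfolding ext_G(2)[OF w] unfolding u uh_dh(1)[OF w[unfolded u]] by simp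
  have 1: "ext wht (ext dh (G w)) = scaleQ (- 1 / 2) (scaleQ (of_nat (sum_list u)) (G u))"
   unfolding 3 derivation_scale[OF derivation_wt G_in_MES[OF uM]] ext_G(1)[OF uM] ..
  have "(of_rat (of_nat (sum_list w)) :: complex) = of_rat (of_nat (sum_list u)) + 2" by (simp add: u of_rat_add)
  then show ?thesis
   unfolding bracket_def 2 1 unfolding 3 by (simp add: scaleQ_def fun_eq_iff algebra_simps of_rat_add)
 next
  case False
  then have "ext dh (G w) = 0" using w by (cases w) (simp_all add: ext_G(2) uh_dh)
  then show ?thesis unfolding bracket_def 2 by (simp add: derivation_zero[OF derivation_wt])
 qed
qed

lemma bracket_dh_D:
 assumes "f \<in> MES" shows "bracket (ext dh) Dop f = ext wht f"
proof -
 have "bracket (ext dh) Dop f = scaleQ 1 (ext wht f)"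
 proof (rule bracket_span[OF derivation_dh derivation_Dop derivation_wt _ assms])
  fix w assume w: "w \<in> mes_indices"
  obtain ps where ps: "!!v. v \<in> snd ` set ps ==> v \<in> mes_indices" "Dop (G w) = ev GG ps"
    "ev dh ps = Dop (uh dh w) + scaleQ (of_nat (sum_list w)) (G w)"
   using Dop_G[OF w] by blast
  have "ext dh (Dop (G w)) = ev dh ps"
   unfolding ps(2) by (rule ext_ev) (use ps kernel_parts in auto)
  then show "bracket (ext dh) Dop (G w) = scaleQ 1 (ext wht (G w))"
   by (simp add: bracket_def ps(3) ext_G w)
 qed
 then show ?thesis by simp
qed

section \<open>Polynomials over the admissible part\<close>

definition adm0 :: "nat list set" where
 "adm0 = insert [] adm_indices"

lemma adm0_mes: "adm0 \<subseteq> mes_indices"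
 by (auto simp: adm0_def adm_indices_def)

lemma adm0_iff: "w \<in> adm0 \<longleftrightarrow> w \<in> mes_indices \<and> lead w = 0"
 by (cases w) (auto simp: adm0_def adm_indices_def lead_def)

lemma MES_adm_span: "MES_adm = Q.span (G ` adm0)"
proof -
 have e: "G ` adm0 = {1} \<union> G ` adm_indices" by (simp add: adm0_def G_Nil)
 show ?thesis unfolding MES_adm_def e Q.span_Un ..
qed

lemma MES_adm_iff: "f \<in> MES_adm \<longleftrightarrow> (\<exists>ps. snd ` set ps \<subseteq> adm0 \<and> f = ev GG ps)"
 unfolding MES_adm_span by (rule span_iff_ev[OF adm0_mes])

lemma subalgebra_MES_adm: "rat_subalgebra MES_adm"
 unfolding MES_adm_span
proof (rule subalgebra_span[OF adm0_mes])
 fix u v w assume uv: "u \<in> adm0" "v \<in> adm0" "w \<in> set (qsh u v)"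
 have "w \<in> mes_indices" using uv mes_indices_qsh adm0_mes by blast
 moreover have "lead w = 0"
 proof (cases "u = [] \<or> v = []")
  case True
  then show ?thesis using uv by (cases u; cases v) (auto simp: adm0_iff)
 next
  case False
  then obtain a u' b v' where ab: "u = a # u'" "v = b # v'" by (meson neq_Nil_conv)
  then have "a \<ge> 3" "b \<ge> 3" using uv by (auto simp: adm0_def adm_indices_def)
  then show ?thesis using uv ab by auto
 qed
 ultimately show "w \<in> adm0" by (simp add: adm0_iff)
qed (simp add: adm0_def)

lemma MES_adm_subset: "MES_adm \<subseteq> MES"
 unfolding MES_adm_span MES_def by (intro Q.span_mono image_mono adm0_mes)

lemma dh_MES_adm:
 assumes "a \<in> MES_adm" shows "ext dh a = 0"
proof -
 obtain ps where ps: "snd ` set ps \<subseteq> adm0" "a = ev GG ps" using assms[unfolded MES_adm_iff] by blast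
 have "uh dh w = 0" if "w \<in> adm0" for w
 proof (cases w)
  case (Cons k u)
  then have "k \<noteq> 2" using that by (auto simp: adm0_iff)
  then show ?thesis using uh_dh(1)[of k u] that Cons by (simp add: adm0_iff)
 qed (simp add: uh_dh(2))
 then have "ev dh ps = 0"
  using ps(1) by (induction ps) auto
 moreover have "ext dh a = ev dh ps"
  unfolding ps(2) by (rule ext_ev) (use kernel_parts ps(1) adm0_mes in auto)
 ultimately show ?thesis by simp
qed

lemma adm_direct: "Q.span {1} \<inter> Q.span (G ` adm_indices) = {0}"
proof -
 have "f = 0" if f: "f \<in> Q.span {1}" "f \<in> Q.span (G ` adm_indices)" for f
 proof -
  obtain c where c: "f = scaleQ c 1" using f(1) by (auto simp: Q.span_singleton)
  have adm: "adm_indices \<subseteq> mes_indices" by (auto simp: adm_indices_def)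
  obtain ps where ps: "snd ` set ps \<subseteq> adm_indices" "f = ev GG ps" using f(2)[unfolded span_iff_ev[OF adm]] by blast
  let ?qs = "(- c, []) # ps"
  have "ev GG ?qs = 0"
   using c ps(2) by (simp add: uh_GG G_Nil scaleQ_def fun_eq_iff of_rat_minus)
  moreover have "snd ` set ?qs \<subseteq> mes_indices" using ps(1) adm by auto
  ultimately have "lcw (%w. GG w \<i>) (part 0 ?qs) = 0" by (intro kernel_parts) simp_all
  moreover have "sum_list (snd p) \<noteq> 0" if "p \<in> set ps" for p
  proof -
   have "snd p \<in> adm_indices" using that ps(1) by auto
   then show ?thesis by (cases "snd p") (auto simp: adm_indices_def)
  qed
  then have "part 0 ps = []" by (simp add: part_def filter_empty_conv)
  ultimately have "c = 0" by (simp add: GG_Nil)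
  then show ?thesis using c by simp
 qed
 then show ?thesis using Q.span_zero by blast
qed

lemma polys_over_pCons [simp]: "pCons a p \<in> polys_over A \<longleftrightarrow> a \<in> A \<and> p \<in> polys_over A"
proof -
 have "(\<forall>i. P i) \<longleftrightarrow> P 0 \<and> (\<forall>i. P (Suc i))" for P :: "nat => bool" by (metis not0_implies_Suc)
 from this[of "%i. coeff (pCons a p) i \<in> A"] show ?thesis by (simp add: polys_over_def)
qed

lemma coeff_formal_deriv: "coeff (formal_deriv p) j = of_nat (Suc j) * coeff p (Suc j)"
proof -
 have "coeff (formal_deriv p) j = (\<Sum>i\<le>degree p. if i = Suc j then of_nat i * coeff p i else 0)"
 proof -
  have "coeff (monom (of_nat i * coeff p i) (i - 1)) j = (if i = Suc j then of_nat i * coeff p i else 0)" for i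
   by (cases i) (auto simp: coeff_monom)
  then show ?thesis unfolding formal_deriv_def coeff_sum by simp
 qed
 then show ?thesis by (simp add: sum.delta coeff_eq_0)
qed

lemma formal_deriv_0 [simp]: "formal_deriv 0 = 0"
 by (simp add: formal_deriv_def)

lemma formal_deriv_pCons: "formal_deriv (pCons a p) = p + pCons 0 (formal_deriv p)"
 by (rule poly_eqI) (simp add: coeff_formal_deriv coeff_pCons algebra_simps split: nat.split)

lemma poly_in_MES:
 assumes "p \<in> polys_over MES_adm" shows "poly p (G [2]) \<in> MES"
 using assms
proof (induction p)
 case (pCons a p)
 have "a \<in> MES" "poly p (G [2]) \<in> MES" using pCons MES_adm_subset by auto
 moreover have "G [2] \<in> MES" by (rule G_in_MES) simp
 ultimately show "poly (pCons a p) (G [2]) \<in> MES" unfolding poly_pCons by (intro MES_closed(2) MES_mult)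
qed (simp add: MES_closed)

lemma dh_poly:
 assumes "p \<in> polys_over MES_adm"
 shows "ext dh (poly p (G [2])) = scaleQ (- 1 / 2) (poly (formal_deriv p) (G [2]))"
 using assms
proof (induction p)
 case 0
 show "ext dh (poly 0 (G [2])) = scaleQ (- 1 / 2) (poly (formal_deriv 0) (G [2]))"
  unfolding poly_0 formal_deriv_0 derivation_zero[OF derivation_dh] by (simp add: fun_eq_iff scaleQ_def)
next
 case (pCons a p)
 let ?x = "G [2]" let ?p = "poly p ?x"
 have a: "a \<in> MES_adm" and p: "p \<in> polys_over MES_adm" using pCons.prems by simp_all
 have x: "?x \<in> MES" by (rule G_in_MES) simp
 have dx: "ext dh ?x = scaleQ (- 1 / 2) 1" using ext_G(2)[of "[2]"] by (simp add: uh_dh G_Nil)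
 have "ext dh (a + ?x * ?p) = ext dh a + (ext dh ?x * ?p + ?x * ext dh ?p)"
  using derivation_dh MES_adm_subset a x poly_in_MES[OF p] MES_mult[OF x poly_in_MES[OF p]]
  unfolding derivation_on_def by (metis subsetD)
 then have "ext dh (poly (pCons a p) ?x) = scaleQ (- 1 / 2) 1 * ?p + ?x * scaleQ (- 1 / 2) (poly (formal_deriv p) ?x)"
  unfolding dh_MES_adm[OF a] dx pCons.IH[OF p] poly_pCons by simp
 also have "... = scaleQ (- 1 / 2) (poly (formal_deriv (pCons a p)) ?x)"
  unfolding formal_deriv_pCons poly_add poly_pCons by (simp add: scaleQ_def fun_eq_iff algebra_simps)
 finally show ?case .
qed

lemma of_nat_fun_apply: "(of_nat n :: uhp => complex) \<tau> = of_nat n"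
 by (induction n) simp_all

lemma of_nat_mult_fun_eq_0: "of_nat (Suc n) * f = 0 \<longleftrightarrow> f = 0" for f :: "uhp => complex"
 unfolding fun_eq_iff by (simp add: of_nat_fun_apply del: of_nat_Suc)

lemma subspace_MES_adm: "Q.subspace MES_adm"
 unfolding MES_adm_span by (rule Q.subspace_span)

lemma formal_deriv_polys_over:
 assumes "p \<in> polys_over MES_adm" shows "formal_deriv p \<in> polys_over MES_adm"
proof -
 have "of_nat n * f = scaleQ (of_nat n) f" for n and f :: "uhp => complex"
  by (simp add: scaleQ_def fun_eq_iff of_nat_fun_apply)
 then show ?thesis
  using assms Q.subspace_scale[OF subspace_MES_adm] by (simp add: polys_over_def coeff_formal_deriv del: of_nat_Suc)
qed

lemma poly_zero_coeffs:
 assumes "p \<in> polys_over MES_adm" "poly p (G [2]) = 0" "!!i. n \<le> i ==> coeff p i = 0"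
 shows "p = 0"
 using assms
proof (induction n arbitrary: p)
 case 0
 have "coeff p i = 0" for i by (rule 0(3)) simp
 then show "p = 0" by (simp add: poly_eq_iff)
next
 case (Suc n)
 have "scaleQ (- 1 / 2) (poly (formal_deriv p) (G [2])) = 0"
  using dh_poly[OF Suc.prems(1)] unfolding Suc.prems(2) derivation_zero[OF derivation_dh] by simp
 then have "poly (formal_deriv p) (G [2]) = 0" by (simp add: scaleQ_def fun_eq_iff)
 then have "formal_deriv p = 0"
  by (rule Suc.IH[OF formal_deriv_polys_over[OF Suc.prems(1)]]) (simp add: coeff_formal_deriv Suc.prems(3))
 then have "coeff p (Suc j) = 0" for j
  using coeff_formal_deriv[of p j] of_nat_mult_fun_eq_0[of j "coeff p (Suc j)"] by simp
 then have p: "p = [:coeff p 0:]" by (intro poly_eqI) (simp add: coeff_pCons split: nat.split)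
 then have e: "poly p (G [2]) = coeff p 0" by (metis mult_zero_right poly_0 poly_pCons add.right_neutral)
 have c: "coeff p 0 = 0" using trans[OF e[symmetric] Suc.prems(2)] .
 have "p = [:0:]" using p unfolding c .
 then show "p = 0" by simp
qed

lemma MES_in_range:
 assumes "f \<in> MES"
 shows "f \<in> (%p. poly p (G [2])) ` polys_over MES_adm" (is "_ \<in> ?R")
proof -
 have add: "f + g \<in> ?R" if "f \<in> ?R" "g \<in> ?R" for f g
 proof -
  obtain p q where "p \<in> polys_over MES_adm" "q \<in> polys_over MES_adm" "f = poly p (G [2])" "g = poly q (G [2])"
   using \<open>f \<in> ?R\<close> \<open>g \<in> ?R\<close> by blast
  then show ?thesis using Q.subspace_add[OF subspace_MES_adm]
   by (intro image_eqI[of _ _ "p + q"]) (simp_all add: polys_over_def)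
 qed
 have scale: "scaleQ c f \<in> ?R" if "f \<in> ?R" for c f
 proof -
  obtain p where p: "p \<in> polys_over MES_adm" "f = poly p (G [2])" using \<open>f \<in> ?R\<close> by blast
  have e: "scaleQ c 1 * g = scaleQ c g" for g by (simp add: scaleQ_mult)
  show ?thesis using p Q.subspace_scale[OF subspace_MES_adm]
   by (intro image_eqI[of _ _ "smult (scaleQ c 1) p"]) (simp_all add: polys_over_def e)
 qed
 have times: "G [2] * f \<in> ?R" if "f \<in> ?R" for f
 proof -
  obtain p where "p \<in> polys_over MES_adm" "f = poly p (G [2])" using \<open>f \<in> ?R\<close> by blast
  then show ?thesis using Q.subspace_0[OF subspace_MES_adm]
   by (intro image_eqI[of _ _ "pCons 0 p"]) simp_all
 qed
 have const: "a \<in> ?R" if "a \<in> MES_adm" for a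
 proof (rule image_eqI[of _ _ "[:a:]"])
  have "0 \<in> polys_over MES_adm" using Q.subspace_0[OF subspace_MES_adm] by (simp add: polys_over_def)
  then show "[:a:] \<in> polys_over MES_adm" using that by simp
 qed simp
 have G: "G w \<in> ?R" if "w \<in> mes_indices" for w
  using that
 proof (induction "lead w" arbitrary: w rule: less_induct)
  case less
  show ?case
  proof (cases "lead w = 0")
   case True
   then have "G w \<in> MES_adm"
    unfolding MES_adm_span using less.prems by (intro Q.span_base imageI) (simp add: adm0_iff)
   then show ?thesis by (rule const)
  next
   case False
   then obtain v where w: "w = 2 # v" by (cases w) (auto simp: lead_def split: if_splits)
   have v: "v \<in> mes_indices" using less.prems w by simp
   obtain rest where r: "!!u. u \<in> set rest ==> lead u \<le> lead v \<and> u \<in> mes_indices"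
    "!!F :: nat list => complex. (\<Sum>u\<leftarrow>qsh [2] v. F u) = (of_nat (lead v) + 1) * F (2 # v) + (\<Sum>u\<leftarrow>rest. F u)"
    using qsh_two[OF v] by blast
   have rest: "ev GG (map (Pair 1) us) \<in> ?R" if "set us \<subseteq> set rest" for us
    using that
   proof (induction us)
    case Nil
    show "ev GG (map (Pair 1) []) \<in> ?R"
     unfolding list.map ev_simps by (rule const[OF Q.subspace_0[OF subspace_MES_adm]])
   next
    case (Cons u us)
    have u: "u \<in> mes_indices" "lead u < lead w" using Cons.prems r(1)[of u] by (auto simp: w)
    have "G u \<in> ?R" by (rule less.hyps[OF u(2,1)])
    moreover have "ev GG (map (Pair 1) us) \<in> ?R" using Cons by simp
    ultimately have "G u + ev GG (map (Pair 1) us) \<in> ?R" by (rule add)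
    then show "ev GG (map (Pair 1) (u # us)) \<in> ?R"
     unfolding list.map ev_simps uh_GG[OF u(1)] Q.scale_one .
   qed
   let ?n = "of_nat (lead v) + 1 :: rat"
   have n: "of_rat ?n \<noteq> (0 :: complex)" by (simp only: of_rat_eq_0_iff)
   have "G [2] * G v = scaleQ ?n (G w) + ev GG (map (Pair 1) rest)"
    by (simp add: G_mult v r(2) ev_one fun_eq_iff scaleQ_def of_rat_add G_eq_GG less.prems w)
   then have "G w = scaleQ (1 / ?n) (G [2] * G v + scaleQ (- 1) (ev GG (map (Pair 1) rest)))"
    using n by (simp add: scaleQ_def fun_eq_iff of_rat_divide field_simps of_rat_minus)
   moreover have "... \<in> ?R"
    by (intro scale add times rest less.hyps v) (simp_all add: w)
   ultimately show ?thesis by simp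
  qed
 qed
 have "f \<in> Q.span (G ` mes_indices)" using assms by (simp add: MES_def)
 then show ?thesis
 proof (rule Q_span_induct[where P = "%f. f \<in> ?R"])
  show "scaleQ c x + y \<in> ?R" if "x \<in> G ` mes_indices" "y \<in> ?R" for c x y
   by (rule add[OF scale that(2)]) (use G that(1) in blast)
 qed (rule const[OF Q.subspace_0[OF subspace_MES_adm]])
qed

lemma free_MES: "free_poly_algebra MES MES_adm (G [2])"
 unfolding free_poly_algebra_def bij_betw_def
proof (intro conjI subalgebra_MES_adm)
 show "inj_on (%p. poly p (G [2])) (polys_over MES_adm)"
 proof (rule inj_onI)
  fix p q assume pq: "p \<in> polys_over MES_adm" "q \<in> polys_over MES_adm" "poly p (G [2]) = poly q (G [2])"
  have "p - q = 0"
  proof (rule poly_zero_coeffs[where n = "Suc (degree (p - q))"])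
   show "p - q \<in> polys_over MES_adm"
    using pq Q.subspace_diff[OF subspace_MES_adm] by (simp add: polys_over_def)
   show "poly (p - q) (G [2]) = 0" using pq by simp
   show "coeff (p - q) i = 0" if "Suc (degree (p - q)) \<le> i" for i
    by (rule coeff_eq_0) (use that in simp)
  qed
  then show "p = q" by simp
 qed
 show "(%p. poly p (G [2])) ` polys_over MES_adm = MES"
  using MES_in_range poly_in_MES by blast
qed

theorem theorem1:
  shows "(\<forall>f\<in>MES. holomorphic_uhp f) \<and>
    (\<exists>W D \<delta> :: operator.
      derivation_on MES W \<and> derivation_on MES D \<and> derivation_on MES \<delta> \<and>
      (\<forall>ks\<in>mes_indices. ks \<noteq> [] \<longrightarrow> W (G ks) = scaleQ (of_nat (sum_list ks)) (G ks)) \<and>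
      (\<forall>ks\<in>mes_indices. ks \<noteq> [] \<longrightarrow>
         D (G ks) = (\<lambda>\<tau>. 2 * of_real pi * \<i> * ddtau (G ks) \<tau>)) \<and>
      (\<forall>k ks. k # ks \<in> mes_indices \<longrightarrow>
         \<delta> (G (k # ks)) = (if k = 2 then scaleQ (-1/2) (G ks) else 0)) \<and>
      (\<forall>f\<in>MES. bracket W D f = scaleQ 2 (D f)) \<and>
      (\<forall>f\<in>MES. bracket W \<delta> f = scaleQ (-2) (\<delta> f)) \<and>
      (\<forall>f\<in>MES. bracket \<delta> D f = W f) \<and>
      sl2_algebra MES W D \<delta> \<and>
      Q.span {1} \<inter> Q.span (G ` adm_indices) = {0} \<and>
      free_poly_algebra MES MES_adm (G [2]) \<and>
      (\<forall>p\<in>polys_over MES_adm.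
         \<delta> (poly p (G [2])) = scaleQ (-1/2) (poly (formal_deriv p) (G [2]))))"
proof (rule conjI, blast intro: holomorphic_MES, rule exI[of _ "ext wht"], rule exI[of _ Dop], rule exI[of _ "ext dh"],
  intro conjI)
 have dG: "ext dh (G (k # ks)) = (if k = 2 then scaleQ (- 1 / 2) (G ks) else 0)" if "k # ks \<in> mes_indices" for k ks
  using ext_G(2)[OF that] uh_dh(1)[OF that] by (rule trans)
 show "\<forall>ks\<in>mes_indices. ks \<noteq> [] \<longrightarrow> ext wht (G ks) = scaleQ (of_nat (sum_list ks)) (G ks)"
  using ext_G(1) by blast
 show "\<forall>ks\<in>mes_indices. ks \<noteq> [] \<longrightarrow> Dop (G ks) = (%\<tau>. 2 * of_real pi * \<i> * ddtau (G ks) \<tau>)"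
  by (simp add: Dop_def)
 show "\<forall>k ks. k # ks \<in> mes_indices \<longrightarrow> ext dh (G (k # ks)) = (if k = 2 then scaleQ (- 1 / 2) (G ks) else 0)"
  using dG by blast
 show "sl2_algebra MES (ext wht) Dop (ext dh)"
  unfolding sl2_algebra_def
  using subalgebra_MES derivation_wt derivation_Dop derivation_dh bracket_wt_D bracket_wt_dh bracket_dh_D by blast
 show "\<forall>p\<in>polys_over MES_adm. ext dh (poly p (G [2])) = scaleQ (- 1 / 2) (poly (formal_deriv p) (G [2]))"
  using dh_poly by blast
qed (use derivation_wt derivation_Dop derivation_dh bracket_wt_D bracket_wt_dh bracket_dh_D adm_direct free_MES in blast)+

end
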